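(* If $Z\subset\mathbb{R}^3$ is a great ring cyclide, then $Z=\mu(A\star B)$ for some great circles $A,B\subset S^3$. Great Perseus cyclides are not Cliffordian.
   Context: A surface means a real irreducible algebraic surface. $S^3\subset\mathbb{R}^4$ is the unit sphere, identified with the unit quaternions with Hamiltonian product $\star$, and $A\star B=\{a\star b\mid a\in A,b\in B\}$ for curves $A,B\subset S^3$. $\mu\colon S^3\dashrightarrow\mathbb{R}^3$, $\mu(y)=(y_1,y_2,y_3)/(1-y_4)$, is stereographic projection from $(0,0,0,1)$. For a surface $Z\subset\mathbb{R}^3$ let $X_Z$ be the Zariski closure of $\mu^{-1}(Z)$ in $\mathbb{P}^4$ (via $(y_1,\dots,y_4)\mapsto(1:y_1:\dots:y_4)$). A surface $Z\subset\mathbb{R}^3$ is great if $\mu^{-1}(Z)$ is covered by arcs of great circles. It is Cliffordian if there exist circles $A,B\subset S^3$ such that $Z$ is the Zariski closure of $\mu(A\star B)$. It is $\lambda$-circled if $X_Z$ contains at least $\lambda$ circles through a general point and, for $\lambda<\infty$, $Z$ is not $(\lambda+1)$-circled. A Darboux cyclide is a surface in $\mathbb{R}^3$ with $\deg X_Z=4$. A ring cyclide (resp. Perseus cyclide) is a Darboux cyclide without real singularities (that is, $X_Z$ has no real singular points) that is $4$-circled (resp. $5$-circled). *)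

theory Defs
  imports "HOL-Analysis.Analysis" "HOL-Library.Extended_Nat"
begin

section \<open>Polynomial functions and the Zariski topology on affine space\<close>

text \<open>
  Only infinite fields occur below, so polynomials are identified with polynomial functions.
  The library's \<^const>\<open>real_polynomial_function\<close> is not used because the same notion
  is needed over the complex numbers. An exponent vector is a map from the index type to
  the natural numbers.
\<close>

definition polynomial_fn :: "('a::comm_semiring_1 ^ 'n \<Rightarrow> 'a) \<Rightarrow> bool" where
  "polynomial_fn f \<longleftrightarrow>
     (\<exists>M c. finite M \<and> f = (\<lambda>x. \<Sum>m\<in>M. c m * (\<Prod>i\<in>UNIV. (x $ i) ^ (m i :: nat))))"

definition homogeneous_fn :: "nat \<Rightarrow> ('a::comm_semiring_1 ^ 'n \<Rightarrow> 'a) \<Rightarrow> bool" where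
  "homogeneous_fn d f \<longleftrightarrow>
     (\<exists>M c. finite M \<and> (\<forall>m\<in>M. (\<Sum>i\<in>UNIV. m i) = d) \<and>
            f = (\<lambda>x. \<Sum>m\<in>M. c m * (\<Prod>i\<in>UNIV. (x $ i) ^ (m i :: nat))))"

definition zariski_closed :: "('a::field ^ 'n) set \<Rightarrow> bool" where
  "zariski_closed S \<longleftrightarrow> (\<exists>F. (\<forall>f\<in>F. polynomial_fn f) \<and> S = {x. \<forall>f\<in>F. f x = 0})"

abbreviation zariski_closure :: "('a::field ^ 'n) set \<Rightarrow> ('a ^ 'n) set" where
  "zariski_closure S \<equiv> zariski_closed hull S"

definition zariski_irreducible :: "('a::field ^ 'n) set \<Rightarrow> bool" where
  "zariski_irreducible S \<longleftrightarrow> zariski_closed S \<and> S \<noteq> {} \<and>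
     \<not> (\<exists>S1 S2. zariski_closed S1 \<and> zariski_closed S2 \<and> S1 \<subset> S \<and> S2 \<subset> S \<and> S = S1 \<union> S2)"

definition krull_dim :: "('a::field ^ 'n) set \<Rightarrow> enat" where
  "krull_dim S = Sup {enat n | n. \<exists>c. (\<forall>i\<le>n. zariski_irreducible (c i) \<and> c i \<subseteq> S) \<and>
                                      (\<forall>i<n. c i \<subset> c (Suc i))}"

text \<open>Real surfaces are identified with their sets of real points.\<close>

definition surface :: "(real ^ 'n) set \<Rightarrow> bool" where
  "surface Z \<longleftrightarrow> zariski_irreducible Z \<and> krull_dim Z = 2"

section \<open>Complex projective closure\<close>

text \<open>
  Homogeneous coordinates on projective \<open>n\<close>-space are indexed by \<^typ>\<open>'n option\<close>, where
  \<^const>\<open>None\<close> is the index of the coordinate that is written first in \<open>(1 : y)\<close>. A subset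
  of projective space is represented by the set of all its nonzero coordinate vectors.
\<close>

definition hom_coords :: "real ^ 'n \<Rightarrow> complex ^ 'n option" where
  "hom_coords y = (\<chi> i. case i of None \<Rightarrow> 1 | Some j \<Rightarrow> complex_of_real (y $ j))"

definition proj_closure :: "(real ^ 'n) set \<Rightarrow> (complex ^ 'n option) set" where
  "proj_closure S = {v. v \<noteq> 0 \<and>
     (\<forall>d f. homogeneous_fn d f \<longrightarrow> (\<forall>y\<in>S. f (hom_coords y) = 0) \<longrightarrow> f v = 0)}"

text \<open>
  The degree of a projective surface is the number of points in which it meets a general
  linear subspace of codimension 2, that is, the common zero set of a general pair of linear
  forms. The coefficients of the forms are the entries of \<open>L\<close>; a projective point is counted
  as the line through the origin that it is.
\<close>

definition proj_surface_degree :: "(complex ^ 'n) set \<Rightarrow> nat \<Rightarrow> bool" where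
  "proj_surface_degree X d \<longleftrightarrow>
     (\<exists>g :: complex ^ (2 \<times> 'n) \<Rightarrow> complex. polynomial_fn g \<and> (\<exists>L. g L \<noteq> 0) \<and>
       (\<forall>L. g L \<noteq> 0 \<longrightarrow>
          (let P = (\<lambda>v. vec.span {v}) `
                     {v\<in>X. \<forall>r. (\<Sum>i\<in>UNIV. L $ (r, i) * v $ i) = 0}
           in finite P \<and> card P = d)))"

text \<open>
  The Zariski tangent space at \<open>v\<close> of the affine cone over \<open>X\<close>. For a surface the cone has
  dimension 3, so a point is singular iff this space has dimension greater than 3.
\<close>

definition cone_tangent_space :: "(complex ^ 'n) set \<Rightarrow> complex ^ 'n \<Rightarrow> (complex ^ 'n) set" where
  "cone_tangent_space X v = {w. \<forall>d f. homogeneous_fn d f \<longrightarrow> (\<forall>u\<in>X. f u = 0) \<longrightarrow>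
     deriv (\<lambda>t. f (v + t *s w)) 0 = 0}"

definition singular_point :: "(complex ^ 'n) set \<Rightarrow> complex ^ 'n \<Rightarrow> bool" where
  "singular_point X v \<longleftrightarrow> v \<in> X \<and> vec.dim (cone_tangent_space X v) > 3"

definition without_real_singularities :: "(complex ^ 'n) set \<Rightarrow> bool" where
  "without_real_singularities X \<longleftrightarrow> (\<forall>v. (\<forall>i. v $ i \<in> \<real>) \<longrightarrow> \<not> singular_point X v)"

section \<open>Circles, unit quaternions and stereographic projection\<close>

abbreviation S3 :: "(real ^ 4) set" where
  "S3 \<equiv> sphere 0 1"

definition circle_in_S3 :: "(real ^ 4) set \<Rightarrow> bool" where
  "circle_in_S3 C \<longleftrightarrow> C \<subseteq> S3 \<and>
     (\<exists>P c r. affine P \<and> aff_dim P = 2 \<and> c \<in> P \<and> r > 0 \<and> C = P \<inter> sphere c r)"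

definition great_circle :: "(real ^ 4) set \<Rightarrow> bool" where
  "great_circle C \<longleftrightarrow> (\<exists>P. subspace P \<and> dim P = 2 \<and> C = P \<inter> S3)"

text \<open>The vector \<open>(a\<^sub>1, a\<^sub>2, a\<^sub>3, a\<^sub>4)\<close> is the quaternion \<open>a\<^sub>1 + a\<^sub>2 i + a\<^sub>3 j + a\<^sub>4 k\<close>.\<close>

definition quat_mult :: "real ^ 4 \<Rightarrow> real ^ 4 \<Rightarrow> real ^ 4" (infixl "\<star>" 70) where
  "a \<star> b = vector
    [a$1 * b$1 - a$2 * b$2 - a$3 * b$3 - a$4 * b$4,
     a$1 * b$2 + a$2 * b$1 + a$3 * b$4 - a$4 * b$3,
     a$1 * b$3 - a$2 * b$4 + a$3 * b$1 + a$4 * b$2,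
     a$1 * b$4 + a$2 * b$3 - a$3 * b$2 + a$4 * b$1]"

definition quat_set_mult :: "(real ^ 4) set \<Rightarrow> (real ^ 4) set \<Rightarrow> (real ^ 4) set"
    (infixl "\<star>\<star>" 70) where
  "A \<star>\<star> B = {a \<star> b | a b. a \<in> A \<and> b \<in> B}"

definition north_pole :: "real ^ 4" where
  "north_pole = vector [0, 0, 0, 1]"

definition stereo :: "real ^ 4 \<Rightarrow> real ^ 3" where
  "stereo y = vector [y$1 / (1 - y$4), y$2 / (1 - y$4), y$3 / (1 - y$4)]"

text \<open>
  Stereographic projection is undefined at the pole, where \<^const>\<open>stereo\<close> returns a junk
  value; images and preimages therefore leave the pole out.
\<close>

definition stereo_image :: "(real ^ 4) set \<Rightarrow> (real ^ 3) set" where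
  "stereo_image S = stereo ` (S - {north_pole})"

definition stereo_preimage :: "(real ^ 3) set \<Rightarrow> (real ^ 4) set" where
  "stereo_preimage Z = {y \<in> S3 - {north_pole}. stereo y \<in> Z}"

definition X_of :: "(real ^ 3) set \<Rightarrow> (complex ^ 4 option) set" where
  "X_of Z = proj_closure (stereo_preimage Z)"

section \<open>Great, Cliffordian and circled surfaces; cyclides\<close>

definition great :: "(real ^ 3) set \<Rightarrow> bool" where
  "great Z \<longleftrightarrow> (\<forall>p \<in> stereo_preimage Z. \<exists>G g. great_circle G \<and> arc g \<and>
     p \<in> path_image g \<and> path_image g \<subseteq> G \<inter> stereo_preimage Z)"

definition cliffordian :: "(real ^ 3) set \<Rightarrow> bool" where
  "cliffordian Z \<longleftrightarrow> (\<exists>A B. circle_in_S3 A \<and> circle_in_S3 B \<and>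
     Z = zariski_closure (stereo_image (A \<star>\<star> B)))"

definition has_at_least :: "enat \<Rightarrow> 'a set \<Rightarrow> bool" where
  "has_at_least l S \<longleftrightarrow> (\<forall>n. enat n \<le> l \<longrightarrow> (\<exists>T\<subseteq>S. finite T \<and> card T = n))"

text \<open>
  The surface \<open>X_of Z\<close> lies in the projective closure of the unit sphere, which has no real
  points at infinity; so every real point of it is \<open>hom_coords p\<close> for some \<open>p\<close>. It contains
  a circle (a conic) iff it contains the real points of that circle.
\<close>

definition real_points :: "(complex ^ 'n option) set \<Rightarrow> (real ^ 'n) set" where
  "real_points X = {p. hom_coords p \<in> X}"

definition circles_through_general_point :: "enat \<Rightarrow> (real ^ 3) set \<Rightarrow> bool" where
  "circles_through_general_point l Z \<longleftrightarrow>
     (\<exists>W. zariski_closed W \<and> \<not> real_points (X_of Z) \<subseteq> W \<and>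
       (\<forall>p \<in> real_points (X_of Z) - W.
          has_at_least l {C. circle_in_S3 C \<and> p \<in> C \<and> C \<subseteq> real_points (X_of Z)}))"

definition circled :: "enat \<Rightarrow> (real ^ 3) set \<Rightarrow> bool" where
  "circled l Z \<longleftrightarrow> circles_through_general_point l Z \<and>
     (l < \<infinity> \<longrightarrow> \<not> circles_through_general_point (l + 1) Z)"

definition darboux_cyclide :: "(real ^ 3) set \<Rightarrow> bool" where
  "darboux_cyclide Z \<longleftrightarrow> surface Z \<and> proj_surface_degree (X_of Z) 4"

definition ring_cyclide :: "(real ^ 3) set \<Rightarrow> bool" where
  "ring_cyclide Z \<longleftrightarrow> darboux_cyclide Z \<and> without_real_singularities (X_of Z) \<and> circled 4 Z"

definition perseus_cyclide :: "(real ^ 3) set \<Rightarrow> bool" where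
  "perseus_cyclide Z \<longleftrightarrow> darboux_cyclide Z \<and> without_real_singularities (X_of Z) \<and> circled 5 Z"

end

theory Submission imports Defs "HOL-Complex_Analysis.Conformal_Mappings" begin

text \<open>
  Let \<open>Z\<close> be a great cyclide without real singularities whose surface \<open>X\<^sub>Z\<close> has degree 4. A great
  circle is the intersection of the sphere with a plane through the origin. Projection from the
  centre of the sphere therefore maps the great circles on \<open>X\<^sub>Z\<close> to lines in projective 3-space,
  and it identifies antipodal points. A plane through the origin meets \<open>X\<^sub>Z\<close> in four points
  counted properly, which come in antipodal pairs; so a line in projective 3-space that has three
  points on the projected surface lies on it (\<open>three_zeros_imp_plane_zero\<close>, where the general
  sections that define the degree are moved close to the given plane). The surface is irreducible
  and is neither contained in a hyperplane nor a cone, as the vertex of a cone would be singular.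
  So three of its lines are skew (\<open>dense_planes_skew_triple\<close>), the transversals of these lie on
  the surface, and the projected surface is the quadric that the transversals fill
  (\<open>preimage_is_quadric_section\<close>).

  In principal axes, \<open>X\<^sub>Z\<close> thus has the real points
  \<open>|x| = 1, d\<^sub>1 x\<^sub>1\<^sup>2 + d\<^sub>2 x\<^sub>2\<^sup>2 + d\<^sub>3 x\<^sub>3\<^sup>2 + d\<^sub>4 x\<^sub>4\<^sup>2 = 0\<close>
  with \<open>d\<^sub>1 \<ge> d\<^sub>2 > 0 > d\<^sub>3 \<ge> d\<^sub>4\<close> (\<open>real_points_principal_axes\<close>). The circles through a general
  point can be written down. Two of them are great, from the two rulings of the quadric. The
  combinations of the form with the sphere equation that belong to \<open>d\<^sub>2\<close> and \<open>d\<^sub>3\<close> are degenerate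
  and give two more each, which coincide if \<open>d\<^sub>1 = d\<^sub>2\<close> or \<open>d\<^sub>3 = d\<^sub>4\<close>, respectively. Hence there
  are at least 4 circles, plus one for each of the two strict inequalities
  (\<open>circles_through_general_point_lower\<close>), and exactly 4 if both are equalities
  (\<open>circles_through_general_point_upper\<close>). A ring cyclide therefore has two equalities, and a
  Perseus cyclide exactly one.

  With two equalities the section is a Clifford torus, the orbit of a point under left and right
  multiplication by two great circles through 1 (\<open>clifford_torus_product\<close>).

  With one equality, suppose that the quadratic form vanishes on \<open>a \<star> b\<close> for all \<open>a\<close> and \<open>b\<close> in
  two circles \<open>A\<close> and \<open>B\<close>. The form has a double and two simple eigenvalues. This determines
  the position of small circles on the section so precisely that a one-parameter family of them of
  the form \<open>a \<star> B\<close> is impossible; so \<open>A\<close> and \<open>B\<close> are great circles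
  (\<open>small_right_circle_centre\<close>). The product of two great circles lies in a hyperplane or makes
  the form a sum of two multiples of squared lengths on orthogonal planes, with two double
  eigenvalues (\<open>great_circle_product_not_spanning\<close>). The latter contradicts the simple
  eigenvalues, the former the degree (\<open>preimage_not_in_hyperplane\<close>).
\<close>

section \<open>Polynomial functions\<close>

text \<open>
  Exponent vectors may repeat in \<open>e\<close>; collecting equal ones gives a normal form. Sums and
  products of polynomials are therefore written over disjoint unions and products of index
  sets.
\<close>

lemma homogeneous_fn_indexed_sum:
  fixes e :: "'j \<Rightarrow> 'n::finite \<Rightarrow> nat" and c :: "'j \<Rightarrow> 'a::comm_semiring_1"
  assumes "finite J" and "\<And>j. j \<in> J \<Longrightarrow> (\<Sum>i\<in>UNIV. e j i) = d"
  shows "homogeneous_fn d (\<lambda>x. \<Sum>j\<in>J. c j * (\<Prod>i\<in>UNIV. (x $ i) ^ e j i))"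
proof -
  let ?c = "\<lambda>m. \<Sum>j\<in>{j\<in>J. e j = m}. c j"
  have "(\<Sum>j\<in>J. c j * (\<Prod>i\<in>UNIV. (x $ i) ^ e j i)) =
        (\<Sum>m\<in>e ` J. ?c m * (\<Prod>i\<in>UNIV. (x $ i) ^ m i))" for x :: "'a ^ 'n"
    unfolding sum_distrib_right
    by (subst sum.image_gen[OF assms(1), of _ e]) (auto intro!: sum.cong)
  then show ?thesis
    unfolding homogeneous_fn_def using assms
    by (intro exI[of _ "e ` J"] exI[of _ ?c]) auto
qed

lemma homogeneous_fn_const: "homogeneous_fn 0 (\<lambda>x. c)"
  using homogeneous_fn_indexed_sum[of "{()}" "\<lambda>_ _. 0" 0 "\<lambda>_. c"] by simp

lemma homogeneous_fn_zero: "homogeneous_fn d (\<lambda>x. 0)"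
  using homogeneous_fn_indexed_sum[of "{}" "\<lambda>_ _. 0" d] by simp

lemma homogeneous_fn_coord:
  "homogeneous_fn 1 (\<lambda>x :: 'a::comm_semiring_1 ^ 'n::finite. x $ i)"
proof -
  have "(\<Prod>j\<in>UNIV. (x $ j) ^ (if j = i then 1 else 0)) = x $ i" for x :: "'a ^ 'n"
    using prod.delta[of UNIV i "\<lambda>j. x $ j"]
    by (simp add: if_distrib[of "\<lambda>n. _ ^ n"] cong: if_cong)
  moreover have "homogeneous_fn 1
     (\<lambda>x. \<Sum>u\<in>{()}. 1 * (\<Prod>j\<in>UNIV. (x $ j :: 'a) ^ (if j = i then 1 else 0)))"
    by (rule homogeneous_fn_indexed_sum) simp_all
  ultimately show ?thesis by simp
qed

lemma homogeneous_fn_add: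
  assumes "homogeneous_fn d f" "homogeneous_fn d g"
  shows "homogeneous_fn d (\<lambda>x. f x + g x)"
proof -
  obtain M c where M: "finite M" "\<And>m. m \<in> M \<Longrightarrow> (\<Sum>i\<in>UNIV. m i) = d"
      "f = (\<lambda>x. \<Sum>m\<in>M. c m * (\<Prod>i\<in>UNIV. (x $ i) ^ m i))"
    using assms(1) unfolding homogeneous_fn_def by blast
  obtain N b where N: "finite N" "\<And>m. m \<in> N \<Longrightarrow> (\<Sum>i\<in>UNIV. m i) = d"
      "g = (\<lambda>x. \<Sum>m\<in>N. b m * (\<Prod>i\<in>UNIV. (x $ i) ^ m i))"
    using assms(2) unfolding homogeneous_fn_def by blast
  have "homogeneous_fn d (\<lambda>x. \<Sum>j\<in>M <+> N. case_sum c b j *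
          (\<Prod>i\<in>UNIV. (x $ i) ^ case_sum (\<lambda>m. m) (\<lambda>m. m) j i))"
    using M N by (intro homogeneous_fn_indexed_sum) (auto split: sum.splits)
  then show ?thesis
    using M N by (simp add: sum.Plus)
qed

lemma homogeneous_fn_mult:
  assumes "homogeneous_fn d f" "homogeneous_fn e g"
  shows "homogeneous_fn (d + e) (\<lambda>x. f x * g x)"
proof -
  obtain M c where M: "finite M" "\<And>m. m \<in> M \<Longrightarrow> (\<Sum>i\<in>UNIV. m i) = d"
      "f = (\<lambda>x. \<Sum>m\<in>M. c m * (\<Prod>i\<in>UNIV. (x $ i) ^ m i))"
    using assms(1) unfolding homogeneous_fn_def by blast
  obtain N b where N: "finite N" "\<And>m. m \<in> N \<Longrightarrow> (\<Sum>i\<in>UNIV. m i) = e"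
      "g = (\<lambda>x. \<Sum>m\<in>N. b m * (\<Prod>i\<in>UNIV. (x $ i) ^ m i))"
    using assms(2) unfolding homogeneous_fn_def by blast
  have "homogeneous_fn (d + e) (\<lambda>x. \<Sum>j\<in>M \<times> N. (c (fst j) * b (snd j)) *
          (\<Prod>i\<in>UNIV. (x $ i) ^ (fst j i + snd j i)))"
    using M N by (intro homogeneous_fn_indexed_sum) (auto simp: sum.distrib)
  moreover have "(\<Sum>j\<in>M \<times> N. (c (fst j) * b (snd j)) *
          (\<Prod>i\<in>UNIV. (x $ i) ^ (fst j i + snd j i))) = f x * g x" for x
    unfolding M(3) N(3) sum_product sum.cartesian_product
    by (intro sum.cong) (auto simp: power_add prod.distrib mult_ac)
  ultimately show ?thesis by simp
qed

lemma homogeneous_fn_cmult: "homogeneous_fn d f \<Longrightarrow> homogeneous_fn d (\<lambda>x. c * f x)"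
  using homogeneous_fn_mult[OF homogeneous_fn_const, of d f c] by simp

lemma homogeneous_fn_sum:
  "(\<And>j. j \<in> J \<Longrightarrow> homogeneous_fn d (f j)) \<Longrightarrow> homogeneous_fn d (\<lambda>x. \<Sum>j\<in>J. f j x)"
  by (induction J rule: infinite_finite_induct)
     (auto intro!: homogeneous_fn_zero homogeneous_fn_add)

lemma homogeneous_fn_power: "homogeneous_fn d f \<Longrightarrow> homogeneous_fn (n * d) (\<lambda>x. f x ^ n)"
proof (induction n)
  case 0 then show ?case using homogeneous_fn_const[of 1] by simp
next
  case (Suc n) then show ?case using homogeneous_fn_mult[of d f "n * d"] by simp
qed

lemma homogeneous_fn_prod:
  "finite J \<Longrightarrow> (\<And>j. j \<in> J \<Longrightarrow> homogeneous_fn (d j) (f j)) \<Longrightarrow>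
   homogeneous_fn (\<Sum>j\<in>J. d j) (\<lambda>x. \<Prod>j\<in>J. f j x)"
proof (induction J rule: finite_induct)
  case empty then show ?case using homogeneous_fn_const[of 1] by simp
next
  case (insert a J) then show ?case
    using homogeneous_fn_mult[of "d a" "f a" "\<Sum>j\<in>J. d j"] by simp
qed

lemma homogeneous_fn_scale:
  assumes "homogeneous_fn d f" shows "f (k *s x) = k ^ d * f x"
proof -
  obtain M c where M: "finite M" "\<And>m. m \<in> M \<Longrightarrow> (\<Sum>i\<in>UNIV. m i) = d"
      "f = (\<lambda>x. \<Sum>m\<in>M. c m * (\<Prod>i\<in>UNIV. (x $ i) ^ m i))"
    using assms unfolding homogeneous_fn_def by blast
  have "(\<Prod>i\<in>UNIV. ((k *s x) $ i) ^ m i) = k ^ d * (\<Prod>i\<in>UNIV. (x $ i) ^ m i)"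
    if "m \<in> M" for m
    using M(2)[OF that]
    by (simp add: power_mult_distrib prod.distrib power_sum[symmetric])
  then show ?thesis
    unfolding M(3) sum_distrib_left by (intro sum.cong) (auto simp: mult_ac)
qed

lemma homogeneous_fn_substitute:
  assumes "homogeneous_fn d f" and "\<And>i. homogeneous_fn k (\<lambda>x. h x $ i)"
  shows "homogeneous_fn (d * k) (\<lambda>x. f (h x))"
proof -
  obtain M c where M: "finite M" "\<And>m. m \<in> M \<Longrightarrow> (\<Sum>i\<in>UNIV. m i) = d"
      "f = (\<lambda>x. \<Sum>m\<in>M. c m * (\<Prod>i\<in>UNIV. (x $ i) ^ m i))"
    using assms(1) unfolding homogeneous_fn_def by blast
  have "homogeneous_fn (d * k) (\<lambda>x. \<Prod>i\<in>UNIV. (h x $ i) ^ m i)" if "m \<in> M" for m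
    using homogeneous_fn_prod[of UNIV "\<lambda>i. m i * k" "\<lambda>i x. (h x $ i) ^ m i"]
      homogeneous_fn_power[OF assms(2)] M(2)[OF that]
    by (simp add: sum_distrib_right[symmetric])
  then show ?thesis
    unfolding M(3) by (intro homogeneous_fn_sum homogeneous_fn_cmult)
qed

lemma homogeneous_imp_polynomial_fn: "homogeneous_fn d f \<Longrightarrow> polynomial_fn f"
  unfolding homogeneous_fn_def polynomial_fn_def by blast

lemma polynomial_fn_homogeneous_parts:
  assumes "polynomial_fn f"
  shows "\<exists>(N::nat) h. (\<forall>d. homogeneous_fn d (h d)) \<and> (\<forall>x. f x = (\<Sum>d\<le>N. h d x))"
proof -
  obtain M c where M: "finite M" "f = (\<lambda>x. \<Sum>m\<in>M. c m * (\<Prod>i\<in>UNIV. (x $ i) ^ m i))"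
    using assms unfolding polynomial_fn_def by blast
  define h where "h = (\<lambda>d x. \<Sum>m\<in>{m\<in>M. (\<Sum>i\<in>UNIV. m i) = d}. c m * (\<Prod>i\<in>UNIV. (x $ i) ^ m i))"
  define N where "N = Max (insert 0 ((\<lambda>m. \<Sum>i\<in>UNIV. m i) ` M))"
  have "homogeneous_fn d (h d)" for d
    unfolding h_def using M(1) by (intro homogeneous_fn_indexed_sum) auto
  moreover have "f x = (\<Sum>d\<le>N. h d x)" for x
    unfolding h_def M(2)
    by (subst sum.group) (auto simp: N_def M(1))
  ultimately show ?thesis by blast
qed

lemma polynomial_fn_const: "polynomial_fn (\<lambda>x. c)"
  by (rule homogeneous_imp_polynomial_fn[OF homogeneous_fn_const])

lemma polynomial_fn_coord: "polynomial_fn (\<lambda>x. x $ i)"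
  by (rule homogeneous_imp_polynomial_fn[OF homogeneous_fn_coord])

lemma polynomial_fn_indexed_sum:
  fixes e :: "'j \<Rightarrow> 'n::finite \<Rightarrow> nat" and c :: "'j \<Rightarrow> 'a::comm_semiring_1"
  assumes "finite J"
  shows "polynomial_fn (\<lambda>x. \<Sum>j\<in>J. c j * (\<Prod>i\<in>UNIV. (x $ i) ^ e j i))"
proof -
  let ?c = "\<lambda>m. \<Sum>j\<in>{j\<in>J. e j = m}. c j"
  have "(\<Sum>j\<in>J. c j * (\<Prod>i\<in>UNIV. (x $ i) ^ e j i)) =
        (\<Sum>m\<in>e ` J. ?c m * (\<Prod>i\<in>UNIV. (x $ i) ^ m i))" for x :: "'a ^ 'n"
    unfolding sum_distrib_right
    by (subst sum.image_gen[OF assms(1), of _ e]) (auto intro!: sum.cong)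
  then show ?thesis
    unfolding polynomial_fn_def using assms
    by (intro exI[of _ "e ` J"] exI[of _ ?c]) auto
qed

lemma polynomial_fn_add:
  assumes "polynomial_fn f" "polynomial_fn g"
  shows "polynomial_fn (\<lambda>x. f x + g x)"
proof -
  obtain M c where M: "finite M" "f = (\<lambda>x. \<Sum>m\<in>M. c m * (\<Prod>i\<in>UNIV. (x $ i) ^ m i))"
    using assms(1) unfolding polynomial_fn_def by blast
  obtain N b where N: "finite N" "g = (\<lambda>x. \<Sum>m\<in>N. b m * (\<Prod>i\<in>UNIV. (x $ i) ^ m i))"
    using assms(2) unfolding polynomial_fn_def by blast
  have "polynomial_fn (\<lambda>x. \<Sum>j\<in>M <+> N. case_sum c b j *
          (\<Prod>i\<in>UNIV. (x $ i) ^ case_sum (\<lambda>m. m) (\<lambda>m. m) j i))"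
    using M N by (intro polynomial_fn_indexed_sum) auto
  then show ?thesis
    using M N by (simp add: sum.Plus)
qed

lemma polynomial_fn_mult:
  assumes "polynomial_fn f" "polynomial_fn g"
  shows "polynomial_fn (\<lambda>x. f x * g x)"
proof -
  obtain M c where M: "finite M" "f = (\<lambda>x. \<Sum>m\<in>M. c m * (\<Prod>i\<in>UNIV. (x $ i) ^ m i))"
    using assms(1) unfolding polynomial_fn_def by blast
  obtain N b where N: "finite N" "g = (\<lambda>x. \<Sum>m\<in>N. b m * (\<Prod>i\<in>UNIV. (x $ i) ^ m i))"
    using assms(2) unfolding polynomial_fn_def by blast
  have "polynomial_fn (\<lambda>x. \<Sum>j\<in>M \<times> N. (c (fst j) * b (snd j)) *
          (\<Prod>i\<in>UNIV. (x $ i) ^ (fst j i + snd j i)))"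
    using M N by (intro polynomial_fn_indexed_sum) auto
  moreover have "(\<Sum>j\<in>M \<times> N. (c (fst j) * b (snd j)) *
          (\<Prod>i\<in>UNIV. (x $ i) ^ (fst j i + snd j i))) = f x * g x" for x
    unfolding M(2) N(2) sum_product sum.cartesian_product
    by (intro sum.cong) (auto simp: power_add prod.distrib mult_ac)
  ultimately show ?thesis by simp
qed

lemma polynomial_fn_sum:
  "(\<And>j. j \<in> J \<Longrightarrow> polynomial_fn (f j)) \<Longrightarrow> polynomial_fn (\<lambda>x. \<Sum>j\<in>J. f j x)"
  by (induction J rule: infinite_finite_induct)
     (auto intro!: polynomial_fn_const polynomial_fn_add)

lemma polynomial_fn_power: "polynomial_fn f \<Longrightarrow> polynomial_fn (\<lambda>x. f x ^ n)"
  by (induction n) (auto intro!: polynomial_fn_const polynomial_fn_mult)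

lemma polynomial_fn_diff:
  fixes f :: "'a::comm_ring_1 ^ 'n \<Rightarrow> 'a"
  assumes "polynomial_fn f" "polynomial_fn g"
  shows "polynomial_fn (\<lambda>x. f x - g x)"
  using polynomial_fn_add[OF assms(1) polynomial_fn_mult[OF polynomial_fn_const[of "-1"] assms(2)]]
  by simp

lemmas polynomial_fn_intros = polynomial_fn_const polynomial_fn_coord polynomial_fn_add
  polynomial_fn_mult polynomial_fn_sum polynomial_fn_power polynomial_fn_diff

lemma polynomial_fn_induct [consumes 1, case_names const coord add mult]:
  assumes "polynomial_fn f"
    and const: "\<And>c. P (\<lambda>x. c)" and coord: "\<And>i. P (\<lambda>x. x $ i)"
    and add: "\<And>f g. P f \<Longrightarrow> P g \<Longrightarrow> P (\<lambda>x. f x + g x)"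
    and mult: "\<And>f g. P f \<Longrightarrow> P g \<Longrightarrow> P (\<lambda>x. f x * g x)"
  shows "P f"
proof -
  obtain M c where M: "finite M" "f = (\<lambda>x. \<Sum>m\<in>M. c m * (\<Prod>i\<in>UNIV. (x $ i) ^ m i))"
    using assms(1) unfolding polynomial_fn_def by blast
  have pow: "P (\<lambda>x. (x $ i) ^ n)" for i n
    by (induction n) (auto intro: const mult coord)
  have prd: "P (\<lambda>x. \<Prod>i\<in>I. (x $ i) ^ m i)" if "finite I" for I :: "'b set" and m
    using that by (induction I rule: finite_induct) (auto intro: const mult pow)
  have "P (\<lambda>x. \<Sum>m\<in>M. c m * (\<Prod>i\<in>UNIV. (x $ i) ^ m i))"
    using M(1)
  proof (induction M rule: finite_induct)
    case (insert m F)
    show ?case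
      using insert add[OF mult[OF const[of "c m"] prd[of UNIV m]] insert.IH] by simp
  qed (simp add: const)
  then show ?thesis using M(2) by simp
qed

lemma polynomial_fn_compose:
  assumes "polynomial_fn f" "\<And>i. polynomial_fn (\<lambda>x. h x $ i)"
  shows "polynomial_fn (\<lambda>x. f (h x))"
  using assms(1) by (induction rule: polynomial_fn_induct) (auto intro: polynomial_fn_intros assms(2))

lemma polynomial_fn_continuous:
  fixes f :: "complex ^ 'n \<Rightarrow> complex"
  assumes "polynomial_fn f" "continuous_on S h"
  shows "continuous_on S (\<lambda>x. f (h x))"
  using assms(1)
  by (induction rule: polynomial_fn_induct) (auto intro!: continuous_intros assms(2))

lemma polynomial_fn_holomorphic:
  fixes f :: "complex ^ 'n \<Rightarrow> complex"
  assumes "polynomial_fn f" "\<And>i. (\<lambda>t. h t $ i) holomorphic_on S"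
  shows "(\<lambda>t. f (h t)) holomorphic_on S"
  using assms(1)
  by (induction rule: polynomial_fn_induct) (auto intro!: holomorphic_intros assms(2))

lemma polynomial_fn_along_polynomial_curve:
  fixes f :: "complex ^ 'n \<Rightarrow> complex"
  assumes "polynomial_fn f" "\<And>i. \<exists>p. \<forall>t. h t $ i = poly p t"
  shows "\<exists>p. \<forall>t. f (h t) = poly p t"
  using assms(1)
proof (induction rule: polynomial_fn_induct)
  case (const c) show ?case by (rule exI[of _ "[:c:]"]) simp
next
  case (coord i) show ?case by (rule assms(2))
next
  case (add f g)
  then obtain p q where "\<forall>t. f (h t) = poly p t" "\<forall>t. g (h t) = poly q t" by blast
  then show ?case by (intro exI[of _ "p + q"]) simp
next
  case (mult f g)
  then obtain p q where "\<forall>t. f (h t) = poly p t" "\<forall>t. g (h t) = poly q t" by blast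
  then show ?case by (intro exI[of _ "p * q"]) simp
qed

text \<open>
  A gradient that computes derivatives along arbitrary curves through \<open>v\<close>. The tangent
  space is defined by derivatives along lines, whereas the surface is known to contain
  certain curves; the gradient links the two.
\<close>

definition curve_gradient :: "(complex ^ 'n \<Rightarrow> complex) \<Rightarrow> complex ^ 'n \<Rightarrow> complex ^ 'n \<Rightarrow> bool" where
  "curve_gradient f v G \<longleftrightarrow> (\<forall>\<gamma> w. \<gamma> 0 = v \<longrightarrow>
     (\<forall>i. ((\<lambda>t. \<gamma> t $ i) has_field_derivative w $ i) (at 0)) \<longrightarrow>
     ((\<lambda>t. f (\<gamma> t)) has_field_derivative (\<Sum>i\<in>UNIV. G $ i * w $ i)) (at 0))"

lemma polynomial_fn_has_curve_gradient:
  fixes f :: "complex ^ 'n \<Rightarrow> complex"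
  assumes "polynomial_fn f"
  shows "\<exists>G. curve_gradient f v G"
proof -
  have "\<exists>G::complex^'n. \<forall>\<gamma> w. \<gamma> 0 = v \<longrightarrow>
     (\<forall>i. ((\<lambda>t. \<gamma> t $ i) has_field_derivative w $ i) (at 0)) \<longrightarrow>
     ((\<lambda>t. f (\<gamma> t)) has_field_derivative (\<Sum>i\<in>UNIV. G $ i * w $ i)) (at 0)"
    using assms
  proof (induction rule: polynomial_fn_induct)
    case (const c) show ?case by (rule exI[of _ 0]) simp
  next
    case (coord i) show ?case
      by (rule exI[of _ "axis i 1"]) (simp add: axis_def if_distrib[of "\<lambda>x. x * _"] cong: if_cong)
  next
    case (add f g)
    then obtain G H :: "complex ^ 'n" where
      GH: "\<And>\<gamma> w. \<gamma> 0 = v \<Longrightarrow> (\<forall>i. ((\<lambda>t. \<gamma> t $ i) has_field_derivative w $ i) (at 0)) \<Longrightarrow>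
       ((\<lambda>t. f (\<gamma> t)) has_field_derivative (\<Sum>i\<in>UNIV. G $ i * w $ i)) (at 0)"
       "\<And>\<gamma> w. \<gamma> 0 = v \<Longrightarrow> (\<forall>i. ((\<lambda>t. \<gamma> t $ i) has_field_derivative w $ i) (at 0)) \<Longrightarrow>
       ((\<lambda>t. g (\<gamma> t)) has_field_derivative (\<Sum>i\<in>UNIV. H $ i * w $ i)) (at 0)" by blast
    show ?case
    proof (intro exI[of _ "G + H"] allI impI)
      fix \<gamma> w assume *: "\<gamma> 0 = v" "\<forall>i. ((\<lambda>t. \<gamma> t $ i) has_field_derivative w $ i) (at 0)"
      show "((\<lambda>t. f (\<gamma> t) + g (\<gamma> t)) has_field_derivative
           (\<Sum>i\<in>UNIV. (G + H) $ i * w $ i)) (at 0)"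
        using DERIV_add[OF GH(1)[OF *] GH(2)[OF *]]
        by (simp add: distrib_right sum.distrib)
    qed
  next
    case (mult f g)
    then obtain G H :: "complex ^ 'n" where
      GH: "\<And>\<gamma> w. \<gamma> 0 = v \<Longrightarrow> (\<forall>i. ((\<lambda>t. \<gamma> t $ i) has_field_derivative w $ i) (at 0)) \<Longrightarrow>
       ((\<lambda>t. f (\<gamma> t)) has_field_derivative (\<Sum>i\<in>UNIV. G $ i * w $ i)) (at 0)"
       "\<And>\<gamma> w. \<gamma> 0 = v \<Longrightarrow> (\<forall>i. ((\<lambda>t. \<gamma> t $ i) has_field_derivative w $ i) (at 0)) \<Longrightarrow>
       ((\<lambda>t. g (\<gamma> t)) has_field_derivative (\<Sum>i\<in>UNIV. H $ i * w $ i)) (at 0)" by blast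
    show ?case
    proof (intro exI[of _ "g v *s G + f v *s H"] allI impI)
      fix \<gamma> w assume *: "\<gamma> 0 = v" "\<forall>i. ((\<lambda>t. \<gamma> t $ i) has_field_derivative w $ i) (at 0)"
      have "(\<Sum>i\<in>UNIV. (g v *s G + f v *s H) $ i * w $ i) =
        (\<Sum>i\<in>UNIV. G $ i * w $ i) * g (\<gamma> 0) + (\<Sum>i\<in>UNIV. H $ i * w $ i) * f (\<gamma> 0)"
        by (simp add: * algebra_simps sum.distrib sum_distrib_left)
      then show "((\<lambda>t. f (\<gamma> t) * g (\<gamma> t)) has_field_derivative
           (\<Sum>i\<in>UNIV. (g v *s G + f v *s H) $ i * w $ i)) (at 0)"
        using DERIV_mult[OF GH(1)[OF *] GH(2)[OF *]] by simp
    qed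
  qed
  then show ?thesis unfolding curve_gradient_def .
qed

subsection \<open>Polynomials along real lines\<close>

text \<open>
  Functions on a real vector space that are polynomial on each real line. This covers
  polynomials in any kind of parameters, and lines suffice for the two facts used later:
  there are no zero divisors, and a function that vanishes near a point vanishes
  everywhere.
\<close>

definition line_polynomial :: "('v::real_vector \<Rightarrow> complex) \<Rightarrow> bool" where
  "line_polynomial f \<longleftrightarrow> (\<forall>a b. \<exists>p. \<forall>t::real. f (a + t *\<^sub>R b) = poly p (of_real t))"

lemma line_polynomial_const: "line_polynomial (\<lambda>x. c)"
  unfolding line_polynomial_def by (intro allI exI[of _ "[:c:]"]) simp

lemma line_polynomial_linear:
  assumes "linear l" shows "line_polynomial (\<lambda>x. of_real (l x))"
  unfolding line_polynomial_def
proof (intro allI)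
  fix a b show "\<exists>p. \<forall>t. of_real (l (a + t *\<^sub>R b)) = poly p (of_real t)"
    by (rule exI[of _ "[:of_real (l a), of_real (l b):]"])
       (simp add: linear_add[OF assms] linear_cmul[OF assms])
qed

lemma line_polynomial_add:
  "line_polynomial f \<Longrightarrow> line_polynomial g \<Longrightarrow> line_polynomial (\<lambda>x. f x + g x)"
  unfolding line_polynomial_def
proof (intro allI)
  fix a b
  assume "\<forall>a b. \<exists>p. \<forall>t::real. f (a + t *\<^sub>R b) = poly p (of_real t)"
    "\<forall>a b. \<exists>p. \<forall>t::real. g (a + t *\<^sub>R b) = poly p (of_real t)"
  then obtain p q where "\<forall>t::real. f (a + t *\<^sub>R b) = poly p (of_real t)"
    "\<forall>t::real. g (a + t *\<^sub>R b) = poly q (of_real t)" by blast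
  then show "\<exists>p. \<forall>t::real. f (a + t *\<^sub>R b) + g (a + t *\<^sub>R b) = poly p (of_real t)"
    by (intro exI[of _ "p + q"]) simp
qed

lemma line_polynomial_mult:
  "line_polynomial f \<Longrightarrow> line_polynomial g \<Longrightarrow> line_polynomial (\<lambda>x. f x * g x)"
  unfolding line_polynomial_def
proof (intro allI)
  fix a b
  assume "\<forall>a b. \<exists>p. \<forall>t::real. f (a + t *\<^sub>R b) = poly p (of_real t)"
    "\<forall>a b. \<exists>p. \<forall>t::real. g (a + t *\<^sub>R b) = poly p (of_real t)"
  then obtain p q where "\<forall>t::real. f (a + t *\<^sub>R b) = poly p (of_real t)"
    "\<forall>t::real. g (a + t *\<^sub>R b) = poly q (of_real t)" by blast
  then show "\<exists>p. \<forall>t::real. f (a + t *\<^sub>R b) * g (a + t *\<^sub>R b) = poly p (of_real t)"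
    by (intro exI[of _ "p * q"]) simp
qed

lemma line_polynomial_compose:
  fixes f :: "complex ^ 'n \<Rightarrow> complex"
  assumes "polynomial_fn f" "\<And>i. line_polynomial (\<lambda>x. h x $ i)"
  shows "line_polynomial (\<lambda>x. f (h x))"
  using assms(1) by (induction rule: polynomial_fn_induct)
    (auto intro: line_polynomial_const line_polynomial_add line_polynomial_mult assms(2))

lemma poly_zero_on_infinite:
  fixes p :: "complex poly"
  assumes "infinite {t::real. poly p (of_real t) = 0}" shows "p = 0"
proof (rule ccontr)
  assume "p \<noteq> 0"
  then have "finite {z. poly p z = 0}" by (rule poly_roots_finite)
  then have "finite (of_real -` {z. poly p z = 0} :: real set)"
    by (rule finite_vimageI) (simp add: inj_of_real)
  then show False using assms by (simp add: vimage_def)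
qed

lemma poly_zero_on_reals:
  fixes p :: "complex poly"
  assumes "\<And>t::real. poly p (of_real t) = 0" shows "p = 0"
proof (rule poly_zero_on_infinite)
  have "{t::real. poly p (of_real t) = 0} = UNIV" using assms by auto
  then show "infinite {t::real. poly p (of_real t) = 0}"
    using infinite_UNIV_char_0 by metis
qed

lemma line_polynomial_no_zero_divisors:
  assumes "line_polynomial f" "line_polynomial g" "\<And>x. f x * g x = 0" "g a \<noteq> 0"
  shows "f b = 0"
proof -
  obtain p where p: "\<And>t::real. f (b + t *\<^sub>R (a - b)) = poly p (of_real t)"
    using assms(1) unfolding line_polynomial_def by blast
  obtain q where q: "\<And>t::real. g (b + t *\<^sub>R (a - b)) = poly q (of_real t)"
    using assms(2) unfolding line_polynomial_def by blast
  have "poly (p * q) (of_real t) = 0" for t :: real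
    using assms(3)[of "b + t *\<^sub>R (a - b)"] p[of t] q[of t] by simp
  then have "p * q = 0" by (rule poly_zero_on_reals)
  moreover have "q \<noteq> 0" using q[of 1] assms(4) by auto
  ultimately have "p = 0" by simp
  then show ?thesis using p[of 0] by simp
qed

lemma line_polynomial_zero_near:
  fixes f :: "'v::real_normed_vector \<Rightarrow> complex"
  assumes "line_polynomial f" "open U" "a \<in> U" "\<And>x. x \<in> U \<Longrightarrow> f x = 0"
  shows "f b = 0"
proof -
  obtain p where p: "\<And>t::real. f (a + t *\<^sub>R (b - a)) = poly p (of_real t)"
    using assms(1) unfolding line_polynomial_def by blast
  have "((\<lambda>t::real. a + t *\<^sub>R (b - a)) \<longlongrightarrow> a + 0 *\<^sub>R (b - a)) (at 0)"
    by (intro tendsto_intros)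
  then have "eventually (\<lambda>t::real. a + t *\<^sub>R (b - a) \<in> U) (at 0)"
    using topological_tendstoD[OF _ assms(2)] assms(3) by (metis add.right_neutral scale_zero_left)
  then obtain d where d: "d > 0" "\<And>t::real. t \<noteq> 0 \<Longrightarrow> \<bar>t\<bar> < d \<Longrightarrow> a + t *\<^sub>R (b - a) \<in> U"
    unfolding eventually_at dist_real_def by auto
  have "{0<..<d} \<subseteq> {t::real. poly p (of_real t) = 0}"
  proof
    fix t assume "t \<in> {0<..<d}"
    then show "t \<in> {t::real. poly p (of_real t) = 0}"
      using d(2)[of t] assms(4)[of "a + t *\<^sub>R (b - a)"] p[of t] by simp
  qed
  then have "infinite {t::real. poly p (of_real t) = 0}"
    using infinite_super[OF _ infinite_Ioo[OF d(1)]] by blast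
  then have "p = 0" by (rule poly_zero_on_infinite)
  then show ?thesis using p[of 1] by simp
qed

subsection \<open>Complexified real vectors\<close>

definition cvec :: "real ^ 'n \<Rightarrow> complex ^ 'n" where
  "cvec y = (\<chi> i. complex_of_real (y $ i))"

lemma cvec_nth [simp]: "cvec y $ i = of_real (y $ i)"
  by (simp add: cvec_def)

lemma cvec_add: "cvec (x + y) = cvec x + cvec y"
  and cvec_scaleR: "cvec (c *\<^sub>R x) = of_real c *s cvec x"
  and cvec_0 [simp]: "cvec 0 = 0"
  by (simp_all add: vec_eq_iff)

lemma cvec_real_imag: "\<exists>x y. z = cvec x + \<i> *s cvec y"
proof (intro exI)
  show "z = cvec (\<chi> i. Re (z $ i)) + \<i> *s cvec (\<chi> i. Im (z $ i))"
    by (subst vec_eq_iff) (simp only: vector_add_component vector_smult_component cvec_nth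
      vec_lambda_beta complex_eq[symmetric] simp_thms)
qed

lemma cvec_eq_0_iff [simp]: "cvec x = 0 \<longleftrightarrow> x = 0"
  by (simp add: vec_eq_iff)

lemma line_polynomial_cvec: "polynomial_fn f \<Longrightarrow> line_polynomial (\<lambda>y. f (cvec y))"
  by (rule line_polynomial_compose)
     (simp_all add: line_polynomial_linear bounded_linear.linear[OF bounded_linear_vec_nth])

text \<open>
  The two real parameters are made complex one after the other, by the identity theorem
  for polynomials in one variable.
\<close>

lemma polynomial_fn_zero_on_real_span:
  assumes f: "polynomial_fn f" and z: "\<And>s t::real. f (cvec (s *\<^sub>R a + t *\<^sub>R b)) = 0"
  shows "f (s *s cvec a + t *s cvec b) = 0"
proof -
  have 1: "f (s *s cvec a + of_real t *s cvec b) = 0" for s and t :: real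
  proof -
    have "\<exists>p. \<forall>s. f (s *s cvec a + of_real t *s cvec b) = poly p s"
    proof (rule polynomial_fn_along_polynomial_curve[OF f])
      fix i show "\<exists>p. \<forall>s. (s *s cvec a + of_real t *s cvec b) $ i = poly p s"
        by (rule exI[of _ "[:of_real t * cvec b $ i, cvec a $ i:]"]) simp
    qed
    then obtain p where p: "\<And>s. f (s *s cvec a + of_real t *s cvec b) = poly p s" by blast
    have "poly p (of_real s) = 0" for s :: real
      using p[of "of_real s"] z[of s t] by (simp add: cvec_add cvec_scaleR)
    then have "p = 0" by (rule poly_zero_on_reals)
    then show ?thesis using p by simp
  qed
  have "\<exists>p. \<forall>t. f (s *s cvec a + t *s cvec b) = poly p t"
  proof (rule polynomial_fn_along_polynomial_curve[OF f])
    fix i show "\<exists>p. \<forall>t. (s *s cvec a + t *s cvec b) $ i = poly p t"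
      by (rule exI[of _ "[:s * cvec a $ i, cvec b $ i:]"]) simp
  qed
  then obtain p where p: "\<And>t. f (s *s cvec a + t *s cvec b) = poly p t" by blast
  have "poly p (of_real t) = 0" for t :: real
    using p[of "of_real t"] 1[of s t] by simp
  then have "p = 0" by (rule poly_zero_on_reals)
  then show ?thesis using p by simp
qed

lemma polynomial_fn_zero_on_reals:
  assumes "polynomial_fn f" "\<And>y. f (cvec y) = 0" shows "f z = 0"
proof -
  obtain x y where "z = cvec x + \<i> *s cvec y" using cvec_real_imag by blast
  then show ?thesis using polynomial_fn_zero_on_real_span[of f x y 1 \<i>] assms by simp
qed

section \<open>Great circles and the functions vanishing on their planes\<close>

lemma entire_zero_from_infinite_real_zeros:
  assumes "h holomorphic_on UNIV" "infinite S" "S \<subseteq> {0..2*pi}" "\<And>t. t \<in> S \<Longrightarrow> h (of_real t) = 0"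
  shows "h z = 0"
proof -
  let ?U = "(of_real :: real \<Rightarrow> complex) ` S"
  have inf: "infinite ?U" using assms(2) by (simp add: finite_image_iff inj_on_def)
  have "?U \<subseteq> cball 0 (2*pi)" using assms(3) by auto
  then obtain x where "x islimpt ?U"
    using compact_eq_Bolzano_Weierstrass[of "cball (0::complex) (2*pi)"] inf by auto
  then show ?thesis
    using analytic_continuation[OF assms(1) open_UNIV connected_UNIV, of ?U x z] assms(4) by auto
qed

lemma plane_orthonormal_basis:
  fixes P :: "(real ^ 'n) set"
  assumes "subspace P" "dim P = 2"
  obtains k1 k2 where "norm k1 = 1" "norm k2 = 1" "k1 \<bullet> k2 = 0"
    "P = {s *\<^sub>R k1 + t *\<^sub>R k2 | s t. True}"
proof -
  obtain B where B: "B \<subseteq> P" "pairwise orthogonal B" "\<And>x. x \<in> B \<Longrightarrow> norm x = 1"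
     "independent B" "card B = dim P" "span B = P"
    using orthonormal_basis_subspace[OF assms(1)] by metis
  obtain k1 k2 where k: "B = {k1, k2}" "k1 \<noteq> k2"
    using B(5) assms(2) by (auto simp: card_2_iff)
  have "k1 \<bullet> k2 = 0" using B(2) k unfolding pairwise_def orthogonal_def by auto
  moreover have "P = {s *\<^sub>R k1 + t *\<^sub>R k2 | s t. True}"
    unfolding B(6)[symmetric] k(1)
    by (auto simp: span_breakdown_eq algebra_simps) (metis add.commute diff_add_cancel)+
  ultimately show ?thesis using that[of k1 k2] B(3) k by auto
qed

lemma norm_combination_orthonormal:
  assumes "norm k1 = 1" "norm k2 = 1" "k1 \<bullet> k2 = 0"
  shows "(norm (s *\<^sub>R k1 + t *\<^sub>R k2))\<^sup>2 = s\<^sup>2 + t\<^sup>2"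
  using assms unfolding power2_norm_eq_inner
  by (simp add: inner_add_left inner_add_right inner_commute power2_eq_square norm_eq_1)

definition hcons :: "complex \<Rightarrow> complex ^ 'n \<Rightarrow> complex ^ 'n option" where
  "hcons y0 y = (\<chi> i. case i of None \<Rightarrow> y0 | Some j \<Rightarrow> y $ j)"

lemma hcons_nth [simp]: "hcons y0 y $ None = y0" "hcons y0 y $ Some j = y $ j"
  by (simp_all add: hcons_def)

lemma vec_option_eq_iff: "v = w \<longleftrightarrow> v $ None = w $ None \<and> (\<forall>j. v $ Some j = w $ Some j)"
  by (metis (no_types) option.exhaust vec_eq_iff)

lemma hom_coords_eq_hcons: "hom_coords y = hcons 1 (cvec y)"
  by (simp add: vec_option_eq_iff hom_coords_def)

lemma hcons_cases: obtains y0 y where "v = hcons y0 y"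
proof
  show "v = hcons (v $ None) (\<chi> j. v $ Some j)" by (simp add: vec_option_eq_iff)
qed

lemma hcons_smult: "c *s hcons y0 y = hcons (c * y0) (c *s y)"
  by (simp add: vec_option_eq_iff)

lemma hcons_eq_0_iff: "hcons y0 y = 0 \<longleftrightarrow> y0 = 0 \<and> y = 0"
  by (simp add: vec_option_eq_iff vec_eq_iff)

lemma hom_coords_nonzero: "hom_coords y \<noteq> 0"
  by (simp add: hom_coords_eq_hcons hcons_eq_0_iff)

lemma sum_squares_cvec: "(\<Sum>i\<in>UNIV. (cvec y $ i)\<^sup>2) = of_real ((norm y)\<^sup>2)"
  unfolding power2_norm_eq_inner inner_vec_def by (simp add: power2_eq_square)

text \<open>The identity theorem on the parametrization \<open>t \<mapsto> cos t k\<^sub>1 + sin t k\<^sub>2\<close>.\<close>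

lemma polynomial_fn_zero_on_great_circle:
  fixes f :: "complex ^ ('n::finite) option \<Rightarrow> complex" and P :: "(real ^ 'n) set"
  assumes f: "polynomial_fn f" and P: "subspace P" "dim P = 2"
    and inf: "infinite {y \<in> P \<inter> sphere 0 1. f (hom_coords y) = 0}" and y: "y \<in> P" "norm y = 1"
  shows "f (hom_coords y) = 0"
proof -
  obtain k1 k2 where k: "norm k1 = 1" "norm k2 = 1" "k1 \<bullet> k2 = 0"
      "P = {s *\<^sub>R k1 + t *\<^sub>R k2 | s t. True}"
    using plane_orthonormal_basis[OF P] .
  have par: "\<exists>t\<in>{0..2*pi}. x = cos t *\<^sub>R k1 + sin t *\<^sub>R k2" if x: "x \<in> P" "norm x = 1" for x
  proof -
    obtain s t where st: "x = s *\<^sub>R k1 + t *\<^sub>R k2" using k(4) x(1) by auto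
    then have "s\<^sup>2 + t\<^sup>2 = 1"
      using norm_combination_orthonormal[OF k(1-3), of s t] x(2) by simp
    then obtain a where "0 \<le> a" "a < 2*pi" "s = cos a" "t = sin a"
      using sincos_total_2pi by metis
    then show ?thesis using st by (intro bexI[of _ a]) auto
  qed
  define h where "h = (\<lambda>z::complex. f (hcons 1 (cos z *s cvec k1 + sin z *s cvec k2)))"
  have hol: "h holomorphic_on UNIV"
    unfolding h_def
  proof (rule polynomial_fn_holomorphic[OF f])
    fix i :: "'n option"
    show "(\<lambda>t. hcons 1 (cos t *s cvec k1 + sin t *s cvec k2) $ i) holomorphic_on UNIV"
      by (cases i) (auto intro!: holomorphic_intros)
  qed
  have hr: "h (of_real t) = f (hom_coords (cos t *\<^sub>R k1 + sin t *\<^sub>R k2))" for t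
    by (simp add: h_def hom_coords_eq_hcons cvec_add cvec_scaleR cos_of_real sin_of_real)
  define S where "S = {t\<in>{0..2*pi}. h (of_real t) = 0}"
  have "{y \<in> P \<inter> sphere 0 1. f (hom_coords y) = 0} \<subseteq> (\<lambda>t. cos t *\<^sub>R k1 + sin t *\<^sub>R k2) ` S"
    using par hr unfolding S_def by fastforce
  then have "infinite S" using inf finite_surj by blast
  then have "h z = 0" for z
    by (rule entire_zero_from_infinite_real_zeros[OF hol]) (auto simp: S_def)
  then show ?thesis using par[OF y] hr by metis
qed

text \<open>
  Great circles are encoded by their planes through the origin. A plane is admitted as
  soon as the surface contains infinitely many points of its circle; by the identity
  theorem it then contains the circle.
\<close>

definition circle_planes :: "(real ^ 3) set \<Rightarrow> (real ^ 4) set set" where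
  "circle_planes Z = {P. subspace P \<and> dim P = 2 \<and> infinite (P \<inter> stereo_preimage Z)}"

text \<open>
  Only the four affine coordinates enter, not the homogenizing one: these functions cut
  out the projection of the surface from the centre of the sphere to projective 3-space,
  where the planes become lines.
\<close>

definition vanishing :: "(real ^ 'n) set set \<Rightarrow> (complex ^ 'n \<Rightarrow> complex) set" where
  "vanishing D = {f. polynomial_fn f \<and> (\<forall>P\<in>D. \<forall>y\<in>P. f (cvec y) = 0)}"

lemma stereo_preimage_norm: "p \<in> stereo_preimage Z \<Longrightarrow> norm p = 1"
  by (simp add: stereo_preimage_def)

lemma circle_planesD:
  assumes "P \<in> circle_planes Z"
  shows "subspace P" "dim P = 2" "infinite (P \<inter> stereo_preimage Z)"
  using assms by (auto simp: circle_planes_def)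

lemma infinite_path_image_arc: "arc g \<Longrightarrow> infinite (path_image g)"
  unfolding path_image_def arc_def
  by (simp add: finite_image_iff)

lemma great_imp_circle_plane:
  assumes "great Z" "p \<in> stereo_preimage Z" shows "\<exists>P\<in>circle_planes Z. p \<in> P"
proof -
  obtain G g where *: "great_circle G" "arc g" "p \<in> path_image g"
      "path_image g \<subseteq> G \<inter> stereo_preimage Z"
    using assms unfolding great_def by blast
  obtain P where P: "subspace P" "dim P = 2" "G = P \<inter> S3"
    using *(1) unfolding great_circle_def by blast
  have "path_image g \<subseteq> P \<inter> stereo_preimage Z" using *(4) P(3) by auto
  then have "infinite (P \<inter> stereo_preimage Z)"
    using infinite_path_image_arc[OF *(2)] finite_subset by blast
  then show ?thesis using P * unfolding circle_planes_def by auto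
qed

text \<open>
  On the cone \<open>y\<^sub>0\<^sup>2 = \<Sum>y\<^sub>i\<^sup>2\<close> every power of \<open>y\<^sub>0\<close> reduces to \<open>1\<close> or \<open>y\<^sub>0\<close>.
\<close>

lemma polynomial_fn_split_on_sphere:
  fixes f :: "complex ^ ('n::finite) option \<Rightarrow> complex"
  assumes "polynomial_fn f"
  obtains fe fo where "polynomial_fn fe" "polynomial_fn fo"
    "\<And>y0 y. y0\<^sup>2 = (\<Sum>i\<in>UNIV. (y $ i)\<^sup>2) \<Longrightarrow> f (hcons y0 y) = fe y + y0 * fo y"
proof -
  have "\<exists>fe fo. polynomial_fn fe \<and> polynomial_fn fo \<and>
     (\<forall>y0 y. y0\<^sup>2 = (\<Sum>i\<in>UNIV. (y $ i)\<^sup>2) \<longrightarrow> f (hcons y0 y) = fe y + y0 * fo y)"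
    using assms
  proof (induction rule: polynomial_fn_induct)
    case (const c)
    show ?case by (rule exI[of _ "\<lambda>_. c"], rule exI[of _ "\<lambda>_. 0"]) (simp add: polynomial_fn_const)
  next
    case (coord i)
    show ?case
    proof (cases i)
      case None
      show ?thesis unfolding None
        by (rule exI[of _ "\<lambda>_. 0"], rule exI[of _ "\<lambda>_. 1"]) (simp add: polynomial_fn_const)
    next
      case (Some j)
      show ?thesis unfolding Some
        by (rule exI[of _ "\<lambda>y. y $ j"], rule exI[of _ "\<lambda>_. 0"])
           (simp add: polynomial_fn_const polynomial_fn_coord)
    qed
  next
    case (add f g)
    then obtain fe fo ge go where *: "polynomial_fn fe" "polynomial_fn fo" "polynomial_fn ge"
      "polynomial_fn go"
      "\<forall>y0 y. y0\<^sup>2 = (\<Sum>i\<in>UNIV. (y $ i)\<^sup>2) \<longrightarrow> f (hcons y0 y) = fe y + y0 * fo y"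
      "\<forall>y0 y. y0\<^sup>2 = (\<Sum>i\<in>UNIV. (y $ i)\<^sup>2) \<longrightarrow> g (hcons y0 y) = ge y + y0 * go y" by blast
    show ?case
      by (rule exI[of _ "\<lambda>y. fe y + ge y"], rule exI[of _ "\<lambda>y. fo y + go y"])
         (auto intro!: polynomial_fn_intros * simp: *(5,6) algebra_simps)
  next
    case (mult f g)
    then obtain fe fo ge go where *: "polynomial_fn fe" "polynomial_fn fo" "polynomial_fn ge"
      "polynomial_fn go"
      "\<forall>y0 y. y0\<^sup>2 = (\<Sum>i\<in>UNIV. (y $ i)\<^sup>2) \<longrightarrow> f (hcons y0 y) = fe y + y0 * fo y"
      "\<forall>y0 y. y0\<^sup>2 = (\<Sum>i\<in>UNIV. (y $ i)\<^sup>2) \<longrightarrow> g (hcons y0 y) = ge y + y0 * go y" by blast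
    show ?case
    proof (rule exI[of _ "\<lambda>y. fe y * ge y + (\<Sum>i\<in>UNIV. (y $ i)\<^sup>2) * (fo y * go y)"],
        rule exI[of _ "\<lambda>y. fe y * go y + fo y * ge y"], intro conjI allI impI)
      fix y0 :: complex and y :: "complex ^ 'n"
      assume y: "y0\<^sup>2 = (\<Sum>i\<in>UNIV. (y $ i)\<^sup>2)"
      show "f (hcons y0 y) * g (hcons y0 y) = fe y * ge y + (\<Sum>i\<in>UNIV. (y $ i)\<^sup>2) * (fo y * go y) +
          y0 * (fe y * go y + fo y * ge y)"
        using *(5,6)[rule_format, OF y] y by algebra
    qed (auto intro!: polynomial_fn_intros *)
  qed
  then show ?thesis using that by blast
qed

lemma vanishing_on_punctured_plane:
  assumes f: "polynomial_fn f" and P: "subspace P" "y \<in> P" "y \<noteq> 0"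
    and z: "\<And>x. x \<in> P \<Longrightarrow> x \<noteq> 0 \<Longrightarrow> f (cvec x) = 0"
  shows "f (cvec 0) = 0"
proof -
  obtain p where p: "\<And>t::real. f (cvec (0 + t *\<^sub>R y)) = poly p (of_real t)"
    using line_polynomial_cvec[OF f] unfolding line_polynomial_def by blast
  have "poly p (of_real t) = 0" if "t \<in> {0<..<1}" for t
    using p[of t] z[of "t *\<^sub>R y"] that P by (simp add: subspace_scale)
  then have "{0<..<1} \<subseteq> {t::real. poly p (of_real t) = 0}" by blast
  then have "p = 0" using poly_zero_on_infinite infinite_super infinite_Ioo[of 0 "1::real"]
    by (metis zero_less_one)
  then show ?thesis using p[of 0] by simp
qed

text \<open>
  The form vanishes on the whole great circle; the points \<open>(\<plusminus> |y| : y)\<close> are a point of it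
  and its antipode.
\<close>

lemma homogeneous_vanishing_on_circle_plane:
  fixes f :: "complex ^ 4 option \<Rightarrow> complex"
  assumes f: "homogeneous_fn d f" "\<forall>y\<in>stereo_preimage Z. f (hom_coords y) = 0"
    and P: "P \<in> circle_planes Z" and y: "y \<in> P" "y \<noteq> 0"
  shows "f (hcons (of_real (norm y)) (cvec y)) = 0" "f (hcons (- of_real (norm y)) (cvec y)) = 0"
proof -
  note P' = circle_planesD[OF P]
  have unit: "f (hom_coords x) = 0" if "x \<in> P" "norm x = 1" for x
  proof (rule polynomial_fn_zero_on_great_circle[OF homogeneous_imp_polynomial_fn[OF f(1)] P'(1,2) _ that])
    have "P \<inter> stereo_preimage Z \<subseteq> {y \<in> P \<inter> S3. f (hom_coords y) = 0}"
      using f(2) stereo_preimage_norm by auto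
    then show "infinite {y \<in> P \<inter> S3. f (hom_coords y) = 0}"
      using P'(3) infinite_super by blast
  qed
  let ?r = "norm y"
  have r: "?r \<noteq> 0" using y by simp
  have scaled: "f (hcons (of_real c) (cvec y)) = 0" if c: "c \<noteq> 0" "\<bar>c\<bar> = norm y" for c
  proof -
    have "hcons (of_real c) (cvec y) = of_real c *s hom_coords ((1/c) *\<^sub>R y)"
      using c by (auto simp: vec_option_eq_iff hom_coords_eq_hcons cvec_scaleR)
    moreover have "f (hom_coords ((1/c) *\<^sub>R y)) = 0"
      using c y(1) P'(1) r by (intro unit) (auto simp: subspace_scale)
    ultimately show ?thesis using homogeneous_fn_scale[OF f(1)] by simp
  qed
  show "f (hcons (of_real (norm y)) (cvec y)) = 0" using scaled[of ?r] r by simp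
  show "f (hcons (- of_real (norm y)) (cvec y)) = 0" using scaled[of "- ?r"] r by simp
qed

lemma plane_nonzero_vector:
  fixes P :: "(real^'n) set"
  assumes "dim P = 2" shows "\<exists>y\<in>P. y \<noteq> 0"
proof (rule ccontr)
  assume "\<not> ?thesis"
  then have "P \<subseteq> {0}" by auto
  then show False using assms dim_eq_0[of P] by auto
qed

text \<open>
  Above each point of the projected surface both points of the sphere belong to \<open>X_of Z\<close>:
  a form that vanishes on a great circle vanishes at antipodal points, so the parts \<open>fe\<close>
  and \<open>fo\<close> vanish separately on the plane of the circle.
\<close>

lemma X_of_memI:
  assumes v: "y0\<^sup>2 = (\<Sum>i\<in>UNIV. (y $ i)\<^sup>2)" "hcons y0 y \<noteq> 0"
    and van: "\<And>f. f \<in> vanishing (circle_planes Z) \<Longrightarrow> f y = 0"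
  shows "hcons y0 y \<in> X_of Z"
  unfolding X_of_def proj_closure_def
proof (intro CollectI conjI allI impI v(2))
  fix d f
  assume f: "homogeneous_fn d f" "\<forall>y\<in>stereo_preimage Z. f (hom_coords y) = 0"
  obtain fe fo where s: "polynomial_fn fe" "polynomial_fn fo"
    "\<And>y0 y. y0\<^sup>2 = (\<Sum>i\<in>UNIV. (y $ i)\<^sup>2) \<Longrightarrow> f (hcons y0 y) = fe y + y0 * fo y"
    using polynomial_fn_split_on_sphere[OF homogeneous_imp_polynomial_fn[OF f(1)]] by blast
  have nz: "fe (cvec x) = 0 \<and> fo (cvec x) = 0"
    if P: "P \<in> circle_planes Z" and x: "x \<in> P" "x \<noteq> 0" for P x
  proof -
    have "(of_real (norm x))\<^sup>2 = (\<Sum>i\<in>UNIV. (cvec x $ i)\<^sup>2)"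
      "(- of_real (norm x))\<^sup>2 = (\<Sum>i\<in>UNIV. (cvec x $ i)\<^sup>2)"
      by (simp_all only: sum_squares_cvec power2_minus of_real_power)
    then have "fe (cvec x) + of_real (norm x) * fo (cvec x) = 0"
      "fe (cvec x) + (- of_real (norm x)) * fo (cvec x) = 0"
      using s(3) homogeneous_vanishing_on_circle_plane[OF f P x] by metis+
    then show ?thesis using x by (simp add: add_eq_0_iff)
  qed
  have "fe (cvec x) = 0 \<and> fo (cvec x) = 0" if P: "P \<in> circle_planes Z" and x: "x \<in> P" for P x
  proof (cases "x = 0")
    case True
    obtain w where "w \<in> P" "w \<noteq> 0" using plane_nonzero_vector circle_planesD[OF P] by blast
    then show ?thesis
      using vanishing_on_punctured_plane[OF s(1) circle_planesD(1)[OF P], of w]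
        vanishing_on_punctured_plane[OF s(2) circle_planesD(1)[OF P], of w] nz[OF P] True by metis
  qed (use nz[OF P x] in auto)
  then have "fe \<in> vanishing (circle_planes Z)" "fo \<in> vanishing (circle_planes Z)"
    using s(1,2) by (auto simp: vanishing_def)
  then show "f (hcons y0 y) = 0" using s(3)[OF v(1)] van[of fe] van[of fo] by simp
qed

lemma homogeneous_fn_forget_coordinate:
  fixes f :: "complex ^ 'n \<Rightarrow> complex"
  assumes "homogeneous_fn d f" shows "homogeneous_fn d (\<lambda>v. f (\<chi> j. v $ Some j))"
proof -
  have "homogeneous_fn 1 (\<lambda>v :: complex ^ 'n option. (\<chi> j. v $ Some j) $ i)" for i
    using homogeneous_fn_coord[of "Some i"] by simp
  from homogeneous_fn_substitute[OF assms this] show ?thesis by simp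
qed

lemma X_ofD:
  assumes "hcons y0 y \<in> X_of Z"
  shows "hcons y0 y \<noteq> 0" "y0\<^sup>2 = (\<Sum>i\<in>UNIV. (y $ i)\<^sup>2)"
    "\<And>d f. homogeneous_fn d f \<Longrightarrow> (\<forall>p\<in>stereo_preimage Z. f (cvec p) = 0) \<Longrightarrow> f y = 0"
proof -
  have *: "hcons y0 y \<noteq> 0"
    "\<And>d f. homogeneous_fn d f \<Longrightarrow> (\<forall>y\<in>stereo_preimage Z. f (hom_coords y) = 0) \<Longrightarrow> f (hcons y0 y) = 0"
    using assms unfolding X_of_def proj_closure_def by auto
  show "hcons y0 y \<noteq> 0" by (rule *)
  have "homogeneous_fn 2 (\<lambda>v :: complex ^ 4 option. (\<Sum>i\<in>UNIV. (v $ Some i)\<^sup>2) + (- 1) * (v $ None)\<^sup>2)"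
    using homogeneous_fn_power[OF homogeneous_fn_coord, of 2]
    by (intro homogeneous_fn_add homogeneous_fn_sum homogeneous_fn_cmult) simp_all
  from *(2)[OF this] show "y0\<^sup>2 = (\<Sum>i\<in>UNIV. (y $ i)\<^sup>2)"
    using sum_squares_cvec[of "_ :: real ^ 4"]
    by (auto simp: hom_coords_eq_hcons stereo_preimage_norm simp del: cvec_nth)
  show "f y = 0" if "homogeneous_fn d f" "\<forall>p\<in>stereo_preimage Z. f (cvec p) = 0" for d f
    using *(2)[OF homogeneous_fn_forget_coordinate[OF that(1)]] that(2)
    by (simp add: hom_coords_eq_hcons cvec_def)
qed

lemma homogeneous_parts_vanish:
  fixes h :: "nat \<Rightarrow> complex ^ 'n \<Rightarrow> complex"
  assumes "\<And>d. homogeneous_fn d (h d)" "\<And>t::real. (\<Sum>d\<le>N. h d (of_real t *s x)) = 0" "d \<le> N"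
  shows "h d x = 0"
proof -
  define p where "p = (\<Sum>d\<le>N. monom (h d x) d)"
  have "poly p (of_real t) = 0" for t :: real
    using assms(2)[of t] unfolding homogeneous_fn_scale[OF assms(1)]
    by (simp add: p_def poly_sum poly_monom mult.commute)
  then have "p = 0" by (rule poly_zero_on_reals)
  moreover have "coeff p d = h d x"
    using assms(3) by (simp add: p_def coeff_sum coeff_monom)
  ultimately show ?thesis by simp
qed

text \<open>
  A plane through the origin contains with a vector its multiples.
\<close>

lemma vanishing_homogeneous_parts:
  assumes h: "\<And>d. homogeneous_fn d (h d)" and f: "\<And>x. f x = (\<Sum>d\<le>N. h d x)"
    "f \<in> vanishing D" and D: "\<And>P. P \<in> D \<Longrightarrow> subspace P" and d: "d \<le> N"
  shows "h d \<in> vanishing D"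
  unfolding vanishing_def
proof (intro CollectI conjI ballI homogeneous_imp_polynomial_fn[OF h])
  fix P y assume P: "P \<in> D" "y \<in> P"
  show "h d (cvec y) = 0"
  proof (rule homogeneous_parts_vanish[OF h _ d])
    fix t :: real
    have "t *\<^sub>R y \<in> P" using P D subspace_scale by blast
    then have "f (cvec (t *\<^sub>R y)) = 0" using f(2) P(1) unfolding vanishing_def by blast
    then show "(\<Sum>d\<le>N. h d (of_real t *s cvec y)) = 0" by (simp add: f(1) cvec_scaleR)
  qed
qed

lemma vanishing_on_preimage:
  assumes "great Z" "f \<in> vanishing (circle_planes Z)" "p \<in> stereo_preimage Z"
  shows "f (cvec p) = 0"
  using great_imp_circle_plane[OF assms(1,3)] assms(2) unfolding vanishing_def by blast

lemma X_of_vanishing: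
  assumes "great Z" "hcons y0 y \<in> X_of Z" "f \<in> vanishing (circle_planes Z)"
  shows "f y = 0"
proof -
  have pf: "polynomial_fn f" using assms(3) by (simp add: vanishing_def)
  obtain N h where "(\<forall>d. homogeneous_fn d (h d)) \<and> (\<forall>x. f x = (\<Sum>d\<le>(N::nat). h d x))"
    using polynomial_fn_homogeneous_parts[OF pf] by auto
  then have h: "\<And>d. homogeneous_fn d (h d)" "\<And>x. f x = (\<Sum>d\<le>N. h d x)" by auto
  have "h d y = 0" if "d \<le> N" for d
  proof (rule X_ofD(3)[OF assms(2) h(1)], rule ballI)
    fix p assume "p \<in> stereo_preimage Z"
    moreover have "h d \<in> vanishing (circle_planes Z)"
      using vanishing_homogeneous_parts[OF h assms(3) _ that] circle_planesD(1) by blast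
    ultimately show "h d (cvec p) = 0" using vanishing_on_preimage[OF assms(1)] by blast
  qed
  then show ?thesis by (simp add: h(2))
qed

section \<open>Irreducibility and dense families of planes\<close>

text \<open>
  Inverse stereographic projection up to a positive factor, which homogeneous functions do
  not see; this avoids the denominator.
\<close>

definition stereo_lift :: "real ^ 3 \<Rightarrow> real ^ 4" where
  "stereo_lift x = vector [2 * x$1, 2 * x$2, 2 * x$3, (x$1)\<^sup>2 + (x$2)\<^sup>2 + (x$3)\<^sup>2 - 1]"

lemma vector_4 [simp]:
  "(vector [x, y, z, w] :: 'a::zero ^ 4) $ 1 = x" "(vector [x, y, z, w] :: 'a ^ 4) $ 2 = y"
  "(vector [x, y, z, w] :: 'a ^ 4) $ 3 = z" "(vector [x, y, z, w] :: 'a ^ 4) $ 4 = w"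
  by (simp_all add: vector_def)

lemma vector_eq_4: "(x :: real ^ 4) = y \<longleftrightarrow> x$1 = y$1 \<and> x$2 = y$2 \<and> x$3 = y$3 \<and> x$4 = y$4"
  by (simp add: vec_eq_iff forall_4)

lemma north_pole_iff: "norm p = 1 \<Longrightarrow> p = north_pole \<longleftrightarrow> p $ 4 = 1"
proof
  assume n: "norm p = 1" and p: "p $ 4 = 1"
  have "(p$1)\<^sup>2 + (p$2)\<^sup>2 + (p$3)\<^sup>2 + (p$4)\<^sup>2 = 1"
    using n by (simp add: norm_eq_1 inner_vec_def sum_4 power2_eq_square)
  then have "(p$1)\<^sup>2 + (p$2)\<^sup>2 + (p$3)\<^sup>2 = 0" using p by simp
  then have "p$1 = 0" "p$2 = 0" "p$3 = 0"
    using zero_le_power2[of "p$1"] zero_le_power2[of "p$2"] zero_le_power2[of "p$3"]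
    by (smt (verit) power_eq_0_iff)+
  then show "p = north_pole" using p by (simp add: north_pole_def vec_eq_iff forall_4)
qed (simp add: north_pole_def)

lemma sphere_4_eq: "norm (p :: real ^ 4) = 1 \<Longrightarrow> (p$1)\<^sup>2 + (p$2)\<^sup>2 + (p$3)\<^sup>2 + (p$4)\<^sup>2 = 1"
  by (simp add: norm_eq_1 inner_vec_def sum_4 power2_eq_square)

lemma stereo_lift_stereo:
  assumes "norm p = 1" "p \<noteq> north_pole"
  shows "stereo_lift (stereo p) = (2 / (1 - p $ 4)) *\<^sub>R p"
proof -
  have n: "1 - p$4 \<noteq> 0" using north_pole_iff assms by auto
  have "(p$1)\<^sup>2 + (p$2)\<^sup>2 + (p$3)\<^sup>2 = (1 - p$4) * (1 + p$4)"
    using sphere_4_eq[OF assms(1)] by (simp add: algebra_simps power2_eq_square)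
  then have "((p$1)\<^sup>2 + (p$2)\<^sup>2 + (p$3)\<^sup>2) / (1 - p$4)\<^sup>2 = (1 + p$4) / (1 - p$4)"
    using n by (simp add: power2_eq_square)
  then have "((p$1)\<^sup>2 + (p$2)\<^sup>2 + (p$3)\<^sup>2) / (1 - p$4)\<^sup>2 - 1 = 2 * p$4 / (1 - p$4)"
    using n by (simp only:) (simp add: field_simps)
  then show ?thesis
    by (simp add: stereo_lift_def stereo_def vec_eq_iff forall_4 power_divide add_divide_distrib)
qed

lemma stereo_surj: "\<exists>p. norm p = 1 \<and> p \<noteq> north_pole \<and> stereo p = x"
proof -
  define r where "r = (x$1)\<^sup>2 + (x$2)\<^sup>2 + (x$3)\<^sup>2"
  have r: "r + 1 > 0" by (simp add: r_def add_nonneg_pos)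
  define p where "p = (1 / (r + 1)) *\<^sub>R stereo_lift x"
  have p: "p$1 = 2 * x$1 / (r+1)" "p$2 = 2 * x$2 / (r+1)" "p$3 = 2 * x$3 / (r+1)"
     "p$4 = (r - 1) / (r+1)"
    by (simp_all add: p_def stereo_lift_def r_def)
  have "(p$1)\<^sup>2 + (p$2)\<^sup>2 + (p$3)\<^sup>2 + (p$4)\<^sup>2 = (4 * r + (r - 1)\<^sup>2) / (r+1)\<^sup>2"
    unfolding p by (simp add: power_divide add_divide_distrib power_mult_distrib r_def)
  also have "4 * r + (r - 1)\<^sup>2 = (r + 1)\<^sup>2" by (simp add: power2_eq_square algebra_simps)
  finally have "norm p = 1" using r by (simp add: norm_eq_1 inner_vec_def sum_4 power2_eq_square)
  moreover have d: "1 - p$4 = 2 / (r+1)" using r by (simp add: p field_simps)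
  then have "p \<noteq> north_pole" using r by (auto simp: north_pole_def)
  moreover have "stereo p = x" using r d by (simp add: stereo_def vec_eq_iff forall_3 p)
  ultimately show ?thesis by blast
qed

lemma stereo_image_preimage: "stereo ` stereo_preimage Z = Z"
proof
  show "stereo ` stereo_preimage Z \<subseteq> Z" by (auto simp: stereo_preimage_def)
  show "Z \<subseteq> stereo ` stereo_preimage Z"
  proof
    fix x assume "x \<in> Z"
    obtain p where "norm p = 1" "p \<noteq> north_pole" "stereo p = x" using stereo_surj by blast
    then show "x \<in> stereo ` stereo_preimage Z"
      using \<open>x \<in> Z\<close> by (intro image_eqI[of _ _ p]) (auto simp: stereo_preimage_def)
  qed
qed

lemma stereo_lift_polynomial_fn:
  "polynomial_fn (\<lambda>x. stereo_lift x $ i)"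
proof -
  have "i = 1 \<or> i = 2 \<or> i = 3 \<or> i = 4" using exhaust_4 by blast
  then show ?thesis
    by (elim disjE) (auto simp: stereo_lift_def intro!: polynomial_fn_intros)
qed

text \<open>
  Zariski closed subsets of real space are defined by real polynomials, whereas the
  vanishing functions are complex.
\<close>

lemma polynomial_fn_real_imag_parts:
  fixes f :: "complex ^ 'n \<Rightarrow> complex" and h :: "real ^ 'm \<Rightarrow> real ^ 'n"
  assumes "polynomial_fn f" "\<And>i. polynomial_fn (\<lambda>x. h x $ i)"
  shows "\<exists>r s. polynomial_fn r \<and> polynomial_fn s \<and> (\<forall>x. f (cvec (h x)) = Complex (r x) (s x))"
  using assms(1)
proof (induction rule: polynomial_fn_induct)
  case (const c)
  show ?case
    by (rule exI[of _ "\<lambda>_. Re c"], rule exI[of _ "\<lambda>_. Im c"]) (simp add: polynomial_fn_const)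
next
  case (coord i)
  show ?case
    by (rule exI[of _ "\<lambda>x. h x $ i"], rule exI[of _ "\<lambda>_. 0"])
       (simp add: polynomial_fn_const assms(2) complex_of_real_def)
next
  case (add f g)
  then obtain r s r' s' where *: "polynomial_fn r" "polynomial_fn s" "polynomial_fn r'" "polynomial_fn s'"
    "\<forall>x. f (cvec (h x)) = Complex (r x) (s x)" "\<forall>x. g (cvec (h x)) = Complex (r' x) (s' x)" by blast
  show ?case
    by (rule exI[of _ "\<lambda>x. r x + r' x"], rule exI[of _ "\<lambda>x. s x + s' x"])
       (simp add: * polynomial_fn_add complex_add)
next
  case (mult f g)
  then obtain r s r' s' where *: "polynomial_fn r" "polynomial_fn s" "polynomial_fn r'" "polynomial_fn s'"
    "\<forall>x. f (cvec (h x)) = Complex (r x) (s x)" "\<forall>x. g (cvec (h x)) = Complex (r' x) (s' x)" by blast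
  show ?case
    by (rule exI[of _ "\<lambda>x. r x * r' x - s x * s' x"], rule exI[of _ "\<lambda>x. r x * s' x + s x * r' x"])
       (simp add: * polynomial_fn_add polynomial_fn_mult polynomial_fn_diff complex_mult)
qed

lemma vanishing_homogeneousI:
  assumes f: "homogeneous_fn d f" and T: "\<And>p. p \<in> stereo_preimage Z \<Longrightarrow> f (cvec p) = 0"
  shows "f \<in> vanishing (circle_planes Z)"
  unfolding vanishing_def
proof (intro CollectI conjI ballI homogeneous_imp_polynomial_fn[OF f])
  fix P y assume P: "P \<in> circle_planes Z" and y: "y \<in> P"
  let ?f = "\<lambda>v :: complex ^ 4 option. f (\<chi> j. v $ Some j)"
  have f': "homogeneous_fn d ?f" by (rule homogeneous_fn_forget_coordinate[OF f])
  have on: "\<forall>p\<in>stereo_preimage Z. ?f (hom_coords p) = 0"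
    using T by (simp add: hom_coords_eq_hcons) (simp add: cvec_def)
  have nz: "f (cvec x) = 0" if "x \<in> P" "x \<noteq> 0" for x
    using homogeneous_vanishing_on_circle_plane(1)[OF f' on P that] by (simp add: cvec_def)
  obtain w where "w \<in> P" "w \<noteq> 0" using plane_nonzero_vector circle_planesD[OF P] by blast
  then have "f (cvec 0) = 0"
    using vanishing_on_punctured_plane[OF homogeneous_imp_polynomial_fn[OF f] circle_planesD(1)[OF P]]
      nz by blast
  then show "f (cvec y) = 0" using nz y by (cases "y = 0") auto
qed

text \<open>
  The planes in \<open>D\<close> suffice to recognize the vanishing functions: their union is Zariski
  dense in the cone over the surface.
\<close>

definition dense_planes :: "(real ^ 3) set \<Rightarrow> (real ^ 4) set set \<Rightarrow> bool" where
  "dense_planes Z D \<longleftrightarrow> D \<subseteq> circle_planes Z \<and> vanishing D \<subseteq> vanishing (circle_planes Z)"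

lemma dense_planes_circle_planes: "dense_planes Z (circle_planes Z)"
  by (simp add: dense_planes_def)

lemma zariski_closed_subset_lift_zeros:
  assumes Z: "zariski_closed Z" and f: "polynomial_fn f"
  shows "zariski_closed {x\<in>Z. f (cvec (stereo_lift x)) = 0}"
proof -
  obtain F where F: "\<forall>f\<in>F. polynomial_fn f" "Z = {x. \<forall>f\<in>F. f x = 0}"
    using Z unfolding zariski_closed_def by blast
  obtain r s where rs: "polynomial_fn r" "polynomial_fn s"
      "\<And>x. f (cvec (stereo_lift x)) = Complex (r x) (s x)"
    using polynomial_fn_real_imag_parts[OF f stereo_lift_polynomial_fn] by blast
  show ?thesis unfolding zariski_closed_def
    by (rule exI[of _ "F \<union> {r, s}"]) (use F rs in \<open>auto simp: complex_eq_iff\<close>)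
qed

text \<open>
  Homogeneous functions are needed because only they can be evaluated at \<open>stereo_lift\<close>
  instead of the point of the sphere.
\<close>

lemma not_vanishing_homogeneous_part:
  assumes "f \<in> vanishing D" "f \<notin> vanishing E" "\<And>P. P \<in> D \<Longrightarrow> subspace P"
  shows "\<exists>d h. homogeneous_fn d h \<and> h \<in> vanishing D \<and> h \<notin> vanishing E"
proof -
  have pf: "polynomial_fn f" using assms(1) by (simp add: vanishing_def)
  obtain N h where "(\<forall>d. homogeneous_fn d (h d)) \<and> (\<forall>x. f x = (\<Sum>d\<le>(N::nat). h d x))"
    using polynomial_fn_homogeneous_parts[OF pf] by auto
  then have h: "\<And>d. homogeneous_fn d (h d)" "\<And>x. f x = (\<Sum>d\<le>N. h d x)" by auto
  obtain P y where P: "P \<in> E" "y \<in> P" "f (cvec y) \<noteq> 0"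
    using assms(2) pf unfolding vanishing_def by auto
  then obtain d where d: "d \<le> N" "h d (cvec y) \<noteq> 0"
    unfolding h(2) using sum.neutral[of "{..N}" "\<lambda>d. h d (cvec y)"] by (metis atMost_iff)
  have "h d \<notin> vanishing E" using P d unfolding vanishing_def by blast
  then show ?thesis using h(1)[of d] vanishing_homogeneous_parts[OF h assms(1,3) d(1)] by blast
qed

text \<open>
  Homogeneous functions \<open>f1\<close> and \<open>f2\<close> that vanish on the two parts of \<open>D\<close>, but not on all
  circle planes, would split \<open>Z\<close> into two proper closed subsets.
\<close>

lemma dense_planes_union:
  assumes Z: "zariski_irreducible Z" "great Z" and D: "dense_planes Z D" "D \<subseteq> D1 \<union> D2"
  shows "dense_planes Z (D \<inter> D1) \<or> dense_planes Z (D \<inter> D2)"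
proof (rule ccontr)
  assume *: "\<not> ?thesis"
  have sub: "D \<subseteq> circle_planes Z" using D(1) by (simp add: dense_planes_def)
  have ss: "subspace P" if "P \<in> D" for P using that sub circle_planesD(1) by blast
  obtain d1 f1 where f1: "homogeneous_fn d1 f1" "f1 \<in> vanishing (D \<inter> D1)" "f1 \<notin> vanishing (circle_planes Z)"
    using * sub not_vanishing_homogeneous_part[of _ "D \<inter> D1" "circle_planes Z"] ss
    unfolding dense_planes_def by blast
  obtain d2 f2 where f2: "homogeneous_fn d2 f2" "f2 \<in> vanishing (D \<inter> D2)" "f2 \<notin> vanishing (circle_planes Z)"
    using * sub not_vanishing_homogeneous_part[of _ "D \<inter> D2" "circle_planes Z"] ss
    unfolding dense_planes_def by blast
  note pf = homogeneous_imp_polynomial_fn[OF f1(1)] homogeneous_imp_polynomial_fn[OF f2(1)]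
  have "(\<lambda>x. f1 x * f2 x) \<in> vanishing D"
    using f1(2) f2(2) D(2) pf unfolding vanishing_def by (auto intro: polynomial_fn_mult)
  then have prod: "f1 (cvec p) * f2 (cvec p) = 0" if "p \<in> stereo_preimage Z" for p
    using D(1) vanishing_on_preimage[OF Z(2) _ that] unfolding dense_planes_def by blast
  have lift: "f (cvec (stereo_lift (stereo p))) = 0 \<longleftrightarrow> f (cvec p) = 0"
    if "homogeneous_fn d f" "p \<in> stereo_preimage Z" for d f p
  proof -
    have p: "norm p = 1" "p \<noteq> north_pole" using that(2) by (auto simp: stereo_preimage_def)
    then have "p $ 4 \<noteq> 1" using north_pole_iff by blast
    moreover have "f (cvec (stereo_lift (stereo p))) = (of_real (2 / (1 - p $ 4))) ^ d * f (cvec p)"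
      unfolding stereo_lift_stereo[OF p] cvec_scaleR homogeneous_fn_scale[OF that(1)] ..
    ultimately show ?thesis by (simp del: of_real_divide)
  qed
  define Z1 where "Z1 = {x\<in>Z. f1 (cvec (stereo_lift x)) = 0}"
  define Z2 where "Z2 = {x\<in>Z. f2 (cvec (stereo_lift x)) = 0}"
  have cl: "zariski_closed Z" using Z(1) by (simp add: zariski_irreducible_def)
  have "Z = Z1 \<union> Z2"
  proof -
    have "x \<in> Z1 \<union> Z2" if x: "x \<in> Z" for x
    proof -
      obtain p where p: "p \<in> stereo_preimage Z" "x = stereo p"
        using x stereo_image_preimage[of Z] by blast
      then show ?thesis
        using prod[OF p(1)] lift[OF f1(1) p(1)] lift[OF f2(1) p(1)] x unfolding Z1_def Z2_def by auto
    qed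
    then show ?thesis unfolding Z1_def Z2_def by auto
  qed
  moreover have "zariski_closed Z1" "zariski_closed Z2"
    unfolding Z1_def Z2_def by (intro zariski_closed_subset_lift_zeros cl pf)+
  ultimately have "Z1 = Z \<or> Z2 = Z"
    using Z(1) unfolding zariski_irreducible_def by blast
  moreover have False if "homogeneous_fn d f" "f \<notin> vanishing (circle_planes Z)"
    "{x\<in>Z. f (cvec (stereo_lift x)) = 0} = Z" for d f
  proof -
    have "f (cvec p) = 0" if p: "p \<in> stereo_preimage Z" for p
    proof -
      have "stereo p \<in> Z" using p by (simp add: stereo_preimage_def)
      then show ?thesis using that lift \<open>homogeneous_fn d f\<close> \<open>{x\<in>Z. f (cvec (stereo_lift x)) = 0} = Z\<close>
        by blast
    qed
    then show False using vanishing_homogeneousI that by blast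
  qed
  ultimately show False using f1 f2 unfolding Z1_def Z2_def by blast
qed

text \<open>
  A power of \<open>1 - p\<^sub>4\<close> clears the denominators of stereographic projection.
\<close>

lemma homogeneous_fn_of_stereo_pullback:
  fixes h :: "real ^ 3 \<Rightarrow> real"
  assumes "polynomial_fn h"
  shows "\<exists>d f. homogeneous_fn d f \<and>
    (\<forall>p. p $ 4 \<noteq> 1 \<longrightarrow> f (hom_coords p) = of_real ((1 - p $ 4) ^ d * h (stereo p)))"
  using assms
proof (induction rule: polynomial_fn_induct)
  case (const c)
  show ?case
    by (rule exI[of _ 0], rule exI[of _ "\<lambda>_. of_real c"]) (simp add: homogeneous_fn_const)
next
  case (coord i)
  obtain j :: 4 where j: "\<And>p. p $ 4 \<noteq> 1 \<Longrightarrow> p $ j = (1 - p $ 4) * stereo p $ i"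
  proof -
    have "i = 1 \<or> i = 2 \<or> i = 3" using exhaust_3 by blast
    then show ?thesis
      using that[of 1] that[of 2] that[of 3] by (auto simp: stereo_def)
  qed
  show ?case
    by (rule exI[of _ 1], rule exI[of _ "\<lambda>v. v $ Some j"])
       (use j in \<open>simp add: homogeneous_fn_coord[of "Some j", simplified] hom_coords_eq_hcons flip: of_real_mult of_real_diff\<close>)
next
  case (add g h)
  then obtain d f e k where *: "homogeneous_fn d f" "homogeneous_fn e k"
    "\<forall>p. p $ 4 \<noteq> 1 \<longrightarrow> f (hom_coords p) = of_real ((1 - p $ 4) ^ d * g (stereo p))"
    "\<forall>p. p $ 4 \<noteq> 1 \<longrightarrow> k (hom_coords p) = of_real ((1 - p $ 4) ^ e * h (stereo p))" by blast
  define u where "u = (\<lambda>v :: complex ^ 4 option. v $ None + (-1) * v $ Some 4)"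
  have u: "homogeneous_fn 1 u"
    unfolding u_def by (intro homogeneous_fn_add homogeneous_fn_cmult homogeneous_fn_coord)
  have up: "u (hom_coords p) = of_real (1 - p $ 4)" for p by (simp add: u_def hom_coords_eq_hcons)
  have pw: "homogeneous_fn n (\<lambda>v. u v ^ n)" for n
    using homogeneous_fn_power[OF u, of n] by simp
  show ?case
  proof (rule exI[of _ "d + e"], rule exI[of _ "\<lambda>v. u v ^ e * f v + u v ^ d * k v"], intro conjI allI impI)
    show "homogeneous_fn (d + e) (\<lambda>v. u v ^ e * f v + u v ^ d * k v)"
      using homogeneous_fn_mult[OF pw *(1), of e] homogeneous_fn_mult[OF pw *(2), of d]
      by (intro homogeneous_fn_add) (simp_all add: add.commute)
    fix p :: "real ^ 4" assume "p $ 4 \<noteq> 1"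
    then show "u (hom_coords p) ^ e * f (hom_coords p) + u (hom_coords p) ^ d * k (hom_coords p) =
        of_real ((1 - p $ 4) ^ (d + e) * (g (stereo p) + h (stereo p)))"
      by (simp add: up *(3,4) power_add algebra_simps)
  qed
next
  case (mult g h)
  then obtain d f e k where *: "homogeneous_fn d f" "homogeneous_fn e k"
    "\<forall>p. p $ 4 \<noteq> 1 \<longrightarrow> f (hom_coords p) = of_real ((1 - p $ 4) ^ d * g (stereo p))"
    "\<forall>p. p $ 4 \<noteq> 1 \<longrightarrow> k (hom_coords p) = of_real ((1 - p $ 4) ^ e * h (stereo p))" by blast
  show ?case
    by (rule exI[of _ "d + e"], rule exI[of _ "\<lambda>v. f v * k v"])
       (simp add: * homogeneous_fn_mult power_add)
qed

text \<open>
  The equations of \<open>Z\<close>, pulled back to the sphere, hold on the projective closure. So the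
  closure adds at most the pole to the real points.
\<close>

lemma X_of_real_point_in_preimage:
  assumes Z: "zariski_closed Z" and p: "hom_coords p \<in> X_of Z" "norm p = 1" "p \<noteq> north_pole"
  shows "p \<in> stereo_preimage Z"
proof -
  obtain F where F: "\<forall>f\<in>F. polynomial_fn f" "Z = {x. \<forall>f\<in>F. f x = 0}"
    using Z unfolding zariski_closed_def by blast
  have p4: "p $ 4 \<noteq> 1" using north_pole_iff p by blast
  have "h (stereo p) = 0" if h: "h \<in> F" for h
  proof -
    obtain d f where f: "homogeneous_fn d f"
      "\<And>p. p $ 4 \<noteq> 1 \<Longrightarrow> f (hom_coords p) = of_real ((1 - p $ 4) ^ d * h (stereo p))"
      using homogeneous_fn_of_stereo_pullback[of h] F(1) h by blast
    have "f (hom_coords y) = 0" if y: "y \<in> stereo_preimage Z" for y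
    proof -
      have "norm y = 1" "y \<noteq> north_pole" "stereo y \<in> Z" using y by (auto simp: stereo_preimage_def)
      then have "y $ 4 \<noteq> 1" "h (stereo y) = 0" using north_pole_iff F(2) \<open>h \<in> F\<close> by blast+
      then show ?thesis using f(2) by simp
    qed
    then have "f (hom_coords p) = 0"
      using p(1) f(1) unfolding X_of_def proj_closure_def by blast
    then show ?thesis using f(2)[OF p4] p4 by simp
  qed
  then show ?thesis using p F(2) by (simp add: stereo_preimage_def)
qed

section \<open>Sections by planes near a real plane\<close>

text \<open>
  A basis \<open>k1, k2\<close> of the plane of interest, completed by an orthonormal basis \<open>k3, k4\<close> of
  its orthogonal complement.
\<close>

definition frame :: "real ^ 4 \<Rightarrow> real ^ 4 \<Rightarrow> real ^ 4 \<Rightarrow> real ^ 4 \<Rightarrow> bool" where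
  "frame k1 k2 k3 k4 \<longleftrightarrow> norm k3 = 1 \<and> norm k4 = 1 \<and> k3 \<bullet> k4 = 0 \<and>
     k1 \<bullet> k3 = 0 \<and> k1 \<bullet> k4 = 0 \<and> k2 \<bullet> k3 = 0 \<and> k2 \<bullet> k4 = 0 \<and>
     (\<forall>s t. s *\<^sub>R k1 + t *\<^sub>R k2 = 0 \<longrightarrow> s = 0 \<and> t = 0) \<and>
     (\<forall>y. \<exists>s t u w. y = s *\<^sub>R k1 + t *\<^sub>R k2 + u *\<^sub>R k3 + w *\<^sub>R k4)"

lemma frame_exists:
  fixes k1 k2 :: "real ^ 4"
  assumes ind: "\<And>s t. s *\<^sub>R k1 + t *\<^sub>R k2 = 0 \<Longrightarrow> s = 0 \<and> t = 0"
  obtains k3 k4 where "frame k1 k2 k3 k4"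
proof -
  have nz: "k1 \<noteq> 0" "k2 \<noteq> 0" using ind[of 1 0] ind[of 0 1] by auto
  have neq: "k1 \<noteq> k2" using ind[of 1 "-1"] by auto
  have "k1 \<notin> span {k2}" using ind[of 1] by (auto simp: span_singleton) (metis add.right_inverse scaleR_minus_left scaleR_one zero_neq_one)
  then have "independent {k1, k2}" using nz by (simp add: independent_insert neq)
  then have d2: "dim {k1, k2} = 2" using neq by (simp add: dim_eq_card_independent)
  define V where "V = {y :: real ^ 4. \<forall>x\<in>span {k1, k2}. orthogonal x y}"
  have sV: "subspace V" unfolding V_def by (auto simp: subspace_def orthogonal_def inner_right_distrib)
  have "dim V + dim {k1, k2} = dim (UNIV :: (real ^ 4) set)"
    using dim_subspace_orthogonal_to_vectors[of "span {k1, k2}" UNIV] by (simp add: V_def)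
  then have dV: "dim V = 2" using d2 by simp
  obtain k3 k4 where k: "norm k3 = 1" "norm k4 = 1" "k3 \<bullet> k4 = 0" "V = {s *\<^sub>R k3 + t *\<^sub>R k4 | s t. True}"
    using plane_orthonormal_basis[OF sV dV] .
  have "1 *\<^sub>R k3 + 0 *\<^sub>R k4 \<in> V" "0 *\<^sub>R k3 + 1 *\<^sub>R k4 \<in> V" unfolding k(4) by blast+
  then have "k1 \<bullet> k3 = 0" "k1 \<bullet> k4 = 0" "k2 \<bullet> k3 = 0" "k2 \<bullet> k4 = 0"
    unfolding V_def orthogonal_def by (auto simp: span_base)
  moreover have "\<exists>s t u w. y = s *\<^sub>R k1 + t *\<^sub>R k2 + u *\<^sub>R k3 + w *\<^sub>R k4" for y
  proof -
    obtain x z where xz: "x \<in> span {k1, k2}" "\<And>w. w \<in> span {k1, k2} \<Longrightarrow> orthogonal z w" "y = x + z"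
      using orthogonal_subspace_decomp_exists[of "{k1, k2}" y] by metis
    obtain s t where x: "x = s *\<^sub>R k1 + t *\<^sub>R k2"
      using xz(1) by (auto simp: span_breakdown_eq algebra_simps)
    have "z \<in> V" using xz(2) unfolding V_def by (auto simp: orthogonal_commute)
    then obtain u w where "z = u *\<^sub>R k3 + w *\<^sub>R k4" unfolding k(4) by blast
    then show ?thesis using xz(3) x by (metis add.assoc)
  qed
  ultimately have "frame k1 k2 k3 k4" using k ind unfolding frame_def by blast
  then show ?thesis using that by blast
qed

lemma frame_complex_independent:
  assumes fr: "frame k1 k2 k3 k4"
    and z: "s *s cvec k1 + t *s cvec k2 + u *s cvec k3 + w *s cvec k4 = 0"
  shows "s = 0" "t = 0" "u = 0" "w = 0"
proof -
  have real_case: "a = 0 \<and> b = 0 \<and> c = 0 \<and> d = 0"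
    if *: "a *\<^sub>R k1 + b *\<^sub>R k2 + c *\<^sub>R k3 + d *\<^sub>R k4 = 0" for a b c d
  proof -
    have "(a *\<^sub>R k1 + b *\<^sub>R k2 + c *\<^sub>R k3 + d *\<^sub>R k4) \<bullet> k3 = 0"
      "(a *\<^sub>R k1 + b *\<^sub>R k2 + c *\<^sub>R k3 + d *\<^sub>R k4) \<bullet> k4 = 0" using * by simp_all
    then have "c = 0" "d = 0"
      using fr unfolding frame_def
      by (auto simp: inner_add_left inner_commute[of k4 k3] norm_eq_1)
    then show ?thesis using * fr unfolding frame_def by auto
  qed
  have c: "s * k1 $ i + t * k2 $ i + u * k3 $ i + w * k4 $ i = 0" for i
    using arg_cong[OF z, of "\<lambda>v. v $ i"] by simp
  have "Re s *\<^sub>R k1 + Re t *\<^sub>R k2 + Re u *\<^sub>R k3 + Re w *\<^sub>R k4 = 0"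
    using arg_cong[OF c, of Re] by (simp add: vec_eq_iff)
  moreover have "Im s *\<^sub>R k1 + Im t *\<^sub>R k2 + Im u *\<^sub>R k3 + Im w *\<^sub>R k4 = 0"
    using arg_cong[OF c, of Im] by (simp add: vec_eq_iff)
  ultimately show "s = 0" "t = 0" "u = 0" "w = 0"
    using real_case by (auto simp: complex_eq_iff)
qed

lemma frame_complex_spanning:
  assumes fr: "frame k1 k2 k3 k4"
  shows "\<exists>s t u w. y = s *s cvec k1 + t *s cvec k2 + u *s cvec k3 + w *s cvec k4"
proof -
  obtain a b where y: "y = cvec a + \<i> *s cvec b" using cvec_real_imag by blast
  obtain s t u w where a: "a = s *\<^sub>R k1 + t *\<^sub>R k2 + u *\<^sub>R k3 + w *\<^sub>R k4"
    using fr unfolding frame_def by blast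
  obtain s' t' u' w' where b: "b = s' *\<^sub>R k1 + t' *\<^sub>R k2 + u' *\<^sub>R k3 + w' *\<^sub>R k4"
    using fr unfolding frame_def by blast
  show ?thesis
    by (rule exI[of _ "of_real s + \<i> * of_real s'"], rule exI[of _ "of_real t + \<i> * of_real t'"],
        rule exI[of _ "of_real u + \<i> * of_real u'"], rule exI[of _ "of_real w + \<i> * of_real w'"])
       (simp add: y a b vec_eq_iff algebra_simps)
qed

text \<open>
  The points of the plane with equations \<open>u\<^sub>r = U\<^sub>r\<^sub>1 y\<^sub>0 + U\<^sub>r\<^sub>2 s + U\<^sub>r\<^sub>3 t\<close>, where
  \<open>s, t, u\<^sub>1, u\<^sub>2\<close> are the coordinates with respect to the frame.
\<close>

definition frame_pt :: "real ^ 4 \<Rightarrow> real ^ 4 \<Rightarrow> real ^ 4 \<Rightarrow> real ^ 4 \<Rightarrow> complex ^ 3 ^ 2 \<Rightarrow>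
    complex \<Rightarrow> complex \<Rightarrow> complex \<Rightarrow> complex ^ 4" where
  "frame_pt k1 k2 k3 k4 U y0 s t = s *s cvec k1 + t *s cvec k2 +
     (U $ 1 $ 1 * y0 + U $ 1 $ 2 * s + U $ 1 $ 3 * t) *s cvec k3 +
     (U $ 2 $ 1 * y0 + U $ 2 $ 2 * s + U $ 2 $ 3 * t) *s cvec k4"

definition section_points :: "(complex ^ 4 option) set \<Rightarrow> real ^ 4 \<Rightarrow> real ^ 4 \<Rightarrow> real ^ 4 \<Rightarrow>
    real ^ 4 \<Rightarrow> complex ^ 3 ^ 2 \<Rightarrow> (complex ^ 4 option) set set" where
  "section_points X k1 k2 k3 k4 U = (\<lambda>v. vec.span {v}) `
     {v\<in>X. \<exists>y0 s t. v = hcons y0 (frame_pt k1 k2 k3 k4 U y0 s t)}"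

lemma sum_UNIV_option:
  "(\<Sum>i\<in>UNIV. f i) = f None + (\<Sum>j\<in>UNIV. f (Some j))" for f :: "'n::finite option \<Rightarrow> 'a::comm_monoid_add"
  unfolding UNIV_option_conv by (subst sum.insert) (auto simp: sum.reindex)

text \<open>
  Cramer's rule for the two coordinates that the linear forms of a section determine.
\<close>

lemma cramer_2:
  fixes N13 :: complex
  assumes "N13 * N24 - N14 * N23 \<noteq> 0"
  shows "w1 + u1 * N13 + u2 * N14 = 0 \<and> w2 + u1 * N23 + u2 * N24 = 0 \<longleftrightarrow>
    u1 = (w2 * N14 - w1 * N24) / (N13 * N24 - N14 * N23) \<and>
    u2 = (w1 * N23 - w2 * N13) / (N13 * N24 - N14 * N23)"
proof -
  have "u1 * (N13 * N24 - N14 * N23) = N24 * (w1 + u1 * N13 + u2 * N14) -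
      N14 * (w2 + u1 * N23 + u2 * N24) + (w2 * N14 - w1 * N24)"
    "u2 * (N13 * N24 - N14 * N23) = N13 * (w2 + u1 * N23 + u2 * N24) -
      N23 * (w1 + u1 * N13 + u2 * N14) + (w1 * N23 - w2 * N13)"
    "(w1 + u1 * N13 + u2 * N14) * (N13 * N24 - N14 * N23) =
      (u1 * (N13 * N24 - N14 * N23) - (w2 * N14 - w1 * N24)) * N13 +
      (u2 * (N13 * N24 - N14 * N23) - (w1 * N23 - w2 * N13)) * N14"
    "(w2 + u1 * N23 + u2 * N24) * (N13 * N24 - N14 * N23) =
      (u1 * (N13 * N24 - N14 * N23) - (w2 * N14 - w1 * N24)) * N23 +
      (u2 * (N13 * N24 - N14 * N23) - (w1 * N23 - w2 * N13)) * N24"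
    by algebra+
  then show ?thesis using assms by (auto simp: eq_divide_eq)
qed

text \<open>
  The degree is known only for general sections, but those come arbitrarily close to the
  plane of a real frame: on the line from its pair of linear forms to a general pair, the
  polynomial that describes the exceptional sections has finitely many zeros. Near the
  frame the two equations can be solved for the coordinates along \<open>k3\<close> and \<open>k4\<close>.
\<close>

lemma degree_near_frame:
  assumes fr: "frame k1 k2 k3 k4" and deg: "proj_surface_degree X d"
  shows "\<exists>U. U \<longlonglongrightarrow> 0 \<and> (\<forall>n::nat. finite (section_points X k1 k2 k3 k4 (U n)) \<and>
            card (section_points X k1 k2 k3 k4 (U n)) = d)"
proof -
  obtain g :: "complex ^ (2 \<times> 4 option) \<Rightarrow> complex" and Ls where g: "polynomial_fn g" "g Ls \<noteq> 0"
    and cnt: "\<And>L. g L \<noteq> 0 \<Longrightarrow>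
      finite ((\<lambda>v. vec.span {v}) ` {v\<in>X. \<forall>r. (\<Sum>i\<in>UNIV. L $ (r, i) * v $ i) = 0}) \<and>
      card ((\<lambda>v. vec.span {v}) ` {v\<in>X. \<forall>r. (\<Sum>i\<in>UNIV. L $ (r, i) * v $ i) = 0}) = d"
    using deg unfolding proj_surface_degree_def Let_def by blast
  define L0 :: "complex ^ (2 \<times> 4 option)" where
    "L0 = (\<chi> p. case snd p of None \<Rightarrow> 0 | Some j \<Rightarrow> of_real ((if fst p = 1 then k3 else k4) $ j))"
  \<comment> \<open>At \<open>e = 0\<close> the section is the plane of the frame, at \<open>e = 1\<close> a general one.\<close>
  define L where "L = (\<lambda>e::complex. L0 + e *s (Ls - L0))"
  obtain q where q: "\<And>e. g (L e) = poly q e"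
  proof -
    have "\<exists>p. \<forall>e. L e $ i = poly p e" for i
      by (rule exI[of _ "[:L0 $ i, (Ls - L0) $ i:]"]) (simp add: L_def algebra_simps)
    then show ?thesis using polynomial_fn_along_polynomial_curve[OF g(1), of L] that by blast
  qed
  have "poly q 1 \<noteq> 0" using q[of 1] g(2) by (simp add: L_def)
  then have "finite {e. poly q e = 0}" by (intro poly_roots_finite) auto
  define c where "c = (\<lambda>r e. L e $ (r, None))"
  define N where "N = (\<lambda>r k e. \<Sum>j\<in>UNIV. L e $ (r, Some j) * cvec k $ j)"
  \<comment> \<open>The determinant of the equations in the coordinates along \<open>k3\<close> and \<open>k4\<close>.\<close>
  define \<Delta> where "\<Delta> = (\<lambda>e. N 1 k3 e * N 2 k4 e - N 1 k4 e * N 2 k3 e)"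
  have two: "(2::2) \<noteq> 1" by simp
  have L0c: "c r 0 = 0" for r by (simp add: c_def L_def L0_def)
  have N0: "N r k 0 = of_real ((if r = 1 then k3 else k4) \<bullet> k)" for r k
    unfolding N_def L_def L0_def inner_vec_def by (simp add: vector_add_component)
  have fr': "k3 \<bullet> k3 = 1" "k4 \<bullet> k4 = 1" "k3 \<bullet> k4 = 0" "k4 \<bullet> k3 = 0" "k3 \<bullet> k1 = 0" "k4 \<bullet> k1 = 0"
     "k3 \<bullet> k2 = 0" "k4 \<bullet> k2 = 0"
    using fr unfolding frame_def by (simp_all add: norm_eq_1 inner_commute)
  define W where "W = (\<lambda>w1 w2 e :: complex. (\<chi> r. if r = (1::2)
     then (w2 e * N 1 k4 e - w1 e * N 2 k4 e) / \<Delta> e else (w1 e * N 2 k3 e - w2 e * N 1 k3 e) / \<Delta> e))"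
  define V :: "complex \<Rightarrow> complex ^ 3 ^ 2" where "V = (\<lambda>e. \<chi> r. vector
     [W (c 1) (c 2) e $ r, W (N 1 k1) (N 2 k1) e $ r, W (N 1 k2) (N 2 k2) e $ r])"
  have conts: "isCont (c r) 0" "isCont (N r k) 0" for r k
    unfolding c_def N_def L_def by (simp_all add: vector_add_component)
  have D0: "\<Delta> 0 = 1" by (simp add: \<Delta>_def N0 fr')
  have contD: "isCont \<Delta> 0" unfolding \<Delta>_def by (intro continuous_intros conts)
  have Wlim: "((\<lambda>e. W w1 w2 e $ r) \<longlongrightarrow> 0) (at 0)" if "isCont w1 0" "isCont w2 0" "w1 0 = 0" "w2 0 = 0"
    for w1 w2 :: "complex \<Rightarrow> complex" and r
  proof -
    have "isCont (\<lambda>e. (w2 e * N 1 k4 e - w1 e * N 2 k4 e) / \<Delta> e) 0"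
      "isCont (\<lambda>e. (w1 e * N 2 k3 e - w2 e * N 1 k3 e) / \<Delta> e) 0"
      by (intro continuous_intros conts contD that; simp add: D0)+
    then show ?thesis unfolding W_def isCont_def by (cases "r = 1") (simp_all add: that)
  qed
  have V_lim: "(V \<longlongrightarrow> 0) (at 0)"
  proof (rule vec_tendstoI, rule vec_tendstoI)
    fix r :: 2 and i :: 3
    have "i = 1 \<or> i = 2 \<or> i = 3" using exhaust_3 by blast
    then show "((\<lambda>e. V e $ r $ i) \<longlongrightarrow> 0 $ r $ i) (at 0)"
      by (elim disjE) (simp_all add: V_def Wlim conts L0c N0 fr')
  qed
  have sec: "section_points X k1 k2 k3 k4 (V e) =
      (\<lambda>v. vec.span {v}) ` {v\<in>X. \<forall>r. (\<Sum>i\<in>UNIV. L e $ (r, i) * v $ i) = 0}" if "\<Delta> e \<noteq> 0" for e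
  proof -
    have lin: "(\<Sum>i\<in>UNIV. L e $ (r, i) * hcons y0 (s *s cvec k1 + t *s cvec k2 + u *s cvec k3 + w *s cvec k4) $ i) =
       (c r e * y0 + N r k1 e * s + N r k2 e * t) + u * N r k3 e + w * N r k4 e" for r y0 s t u w
      unfolding sum_UNIV_option c_def N_def
      by (simp add: sum.distrib sum_distrib_left sum_distrib_right algebra_simps)
    have iff: "(\<forall>r. (\<Sum>i\<in>UNIV. L e $ (r, i) *
          hcons y0 (s *s cvec k1 + t *s cvec k2 + u *s cvec k3 + w *s cvec k4) $ i) = 0) \<longleftrightarrow>
        u = V e $ 1 $ 1 * y0 + V e $ 1 $ 2 * s + V e $ 1 $ 3 * t \<and>
        w = V e $ 2 $ 1 * y0 + V e $ 2 $ 2 * s + V e $ 2 $ 3 * t" for y0 s t u w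
      unfolding lin forall_2
      by (subst cramer_2) (use that in \<open>simp_all add: \<Delta>_def V_def W_def add_divide_distrib
            diff_divide_distrib algebra_simps\<close>)
    have "(\<forall>r. (\<Sum>i\<in>UNIV. L e $ (r, i) * v $ i) = 0) \<longleftrightarrow>
        (\<exists>y0 s t. v = hcons y0 (frame_pt k1 k2 k3 k4 (V e) y0 s t))" for v
    proof -
      obtain y0 y where v: "v = hcons y0 y" using hcons_cases by blast
      obtain s t u w where y: "y = s *s cvec k1 + t *s cvec k2 + u *s cvec k3 + w *s cvec k4"
        using frame_complex_spanning[OF fr] by blast
      show ?thesis
      proof
        assume "\<forall>r. (\<Sum>i\<in>UNIV. L e $ (r, i) * v $ i) = 0"
        then show "\<exists>y0 s t. v = hcons y0 (frame_pt k1 k2 k3 k4 (V e) y0 s t)"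
          unfolding v y iff frame_pt_def by blast
      next
        assume "\<exists>y0 s t. v = hcons y0 (frame_pt k1 k2 k3 k4 (V e) y0 s t)"
        then obtain y0 s t where v': "v = hcons y0 (frame_pt k1 k2 k3 k4 (V e) y0 s t)" by blast
        show "\<forall>r. (\<Sum>i\<in>UNIV. L e $ (r, i) * v $ i) = 0"
          unfolding v' frame_pt_def iff by (intro conjI refl)
      qed
    qed
    then show ?thesis unfolding section_points_def by simp
  qed
  have ev: "eventually (\<lambda>e. poly q e \<noteq> 0 \<and> \<Delta> e \<noteq> 0) (at 0)"
  proof (intro eventually_conj)
    have "eventually (\<lambda>e. e \<notin> {e. poly q e = 0}) (at 0)"
      using islimpt_finite[OF \<open>finite {e. poly q e = 0}\<close>, of 0] by (simp add: islimpt_iff_eventually)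
    then show "eventually (\<lambda>e. poly q e \<noteq> 0) (at 0)" by simp
    show "eventually (\<lambda>e. \<Delta> e \<noteq> 0) (at 0)"
      using contD D0 unfolding isCont_def by (intro tendsto_imp_eventually_ne[of _ "\<Delta> 0"]) auto
  qed
  define en where "en = (\<lambda>n::nat. 1 / of_nat (Suc n) :: complex)"
  have en: "filterlim en (at 0) sequentially"
    unfolding filterlim_at en_def
    by (auto simp del: of_nat_Suc intro!: LIMSEQ_Suc[OF lim_1_over_n])
  from eventually_compose_filterlim[OF ev en] obtain n0 where
    n0: "\<And>n. n \<ge> n0 \<Longrightarrow> poly q (en n) \<noteq> 0 \<and> \<Delta> (en n) \<noteq> 0"
    unfolding eventually_sequentially by blast
  have lim: "(\<lambda>n. V (en (n + n0))) \<longlonglongrightarrow> 0"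
    using LIMSEQ_ignore_initial_segment[OF filterlim_compose[OF V_lim en]] .
  show ?thesis
    by (rule exI[of _ "\<lambda>n. V (en (n + n0))"])
       (use lim n0 sec cnt q in \<open>simp add: le_add2\<close>)
qed

text \<open>
  If \<open>\<Phi> u\<close> had no zero near \<open>t0\<close>, the maximum modulus principle for \<open>1 / \<Phi> u\<close> would bound
  \<open>|\<Phi> u t0|\<close> from below by the values on a small circle, where \<open>\<Phi> 0\<close> is bounded away from
  zero.
\<close>

lemma zero_persists:
  fixes \<Phi> :: "'u::euclidean_space \<Rightarrow> complex \<Rightarrow> complex"
  assumes O: "open Q" "(0, t0) \<in> Q" and cont: "continuous_on Q (\<lambda>(U, t). \<Phi> U t)"
    and hol: "\<And>U. \<Phi> U holomorphic_on {t. (U, t) \<in> Q}"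
    and z: "\<Phi> 0 t0 = 0" and iso: "eventually (\<lambda>t. \<Phi> 0 t \<noteq> 0) (at t0)"
    and U: "U \<longlonglongrightarrow> 0"
  shows "eventually (\<lambda>n. \<exists>t. (U n, t) \<in> Q \<and> \<Phi> (U n) t = 0) sequentially"
proof -
  obtain A B where AB: "open A" "open B" "0 \<in> A" "t0 \<in> B" "A \<times> B \<subseteq> Q"
    using open_prod_elim[OF O] by (metis mem_Sigma_iff)
  obtain d where d: "d > 0" "cball 0 d \<subseteq> A" using AB(1,3) open_contains_cball by blast
  obtain r1 where r1: "r1 > 0" "cball t0 r1 \<subseteq> B" using AB(2,4) open_contains_cball by blast
  obtain r2 where r2: "r2 > 0" "\<And>t. t \<noteq> t0 \<Longrightarrow> dist t t0 < r2 \<Longrightarrow> \<Phi> 0 t \<noteq> 0"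
    using iso unfolding eventually_at by auto
  define r where "r = min r1 (r2 / 2)"
  have r: "r > 0" "r \<le> r1" "r < r2" using r1 r2 by (auto simp: r_def)
  have sub: "cball 0 d \<times> cball t0 r \<subseteq> Q" using d r1 r AB(5) by fastforce
  have cont': "continuous_on (cball 0 d \<times> cball t0 r) (\<lambda>(U, t). \<Phi> U t)"
    using cont sub continuous_on_subset by blast
  have uc: "uniformly_continuous_on (cball 0 d \<times> cball t0 r) (\<lambda>(U, t). \<Phi> U t)"
    by (intro compact_uniformly_continuous cont' compact_Times) auto
  have cont_t: "continuous_on (cball t0 r) (\<Phi> u)" if "u \<in> cball 0 d" for u
  proof -
    have "continuous_on (cball t0 r) ((\<lambda>(U, t). \<Phi> U t) \<circ> (\<lambda>t. (u, t)))"
      by (intro continuous_on_compose continuous_intros continuous_on_subset[OF cont']) (use that in auto)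
    then show ?thesis by (simp add: o_def)
  qed
  have ne: "sphere t0 r \<noteq> {}" using r by simp
  have "continuous_on (sphere t0 r) (\<lambda>t. norm (\<Phi> 0 t))"
    using continuous_on_subset[OF cont_t[of 0]] d(1) by (intro continuous_intros) (auto simp: sphere_cball)
  then obtain w where w: "w \<in> sphere t0 r" "\<And>t. t \<in> sphere t0 r \<Longrightarrow> norm (\<Phi> 0 w) \<le> norm (\<Phi> 0 t)"
    using continuous_attains_inf[OF compact_sphere ne] by blast
  define m where "m = norm (\<Phi> 0 w)"
  have m: "m > 0" using w(1) r2(2)[of w] r by (auto simp: m_def dist_commute)
  obtain e where e: "e > 0" "\<And>x y. x \<in> cball 0 d \<times> cball t0 r \<Longrightarrow> y \<in> cball 0 d \<times> cball t0 r \<Longrightarrow>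
      dist y x < e \<Longrightarrow> dist ((\<lambda>(U, t). \<Phi> U t) y) ((\<lambda>(U, t). \<Phi> U t) x) < m / 2"
    using uc m unfolding uniformly_continuous_on_def by (metis half_gt_zero)
  have close: "dist (\<Phi> u t) (\<Phi> 0 t) < m / 2" if "u \<in> cball 0 d" "norm u < e" "t \<in> cball t0 r" for u t
    using e(2)[of "(0, t)" "(u, t)"] that d(1) by (simp add: dist_Pair_Pair)
  have zero: "\<exists>t\<in>cball t0 r. \<Phi> u t = 0" if u: "u \<in> cball 0 d" "norm u < e" for u
  proof (rule ccontr)
    assume "\<not> ?thesis"
    then have nz: "\<Phi> u t \<noteq> 0" if "t \<in> cball t0 r" for t using that by blast
    have hol': "(\<lambda>t. 1 / \<Phi> u t) holomorphic_on ball t0 r"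
    proof (intro holomorphic_intros holomorphic_on_subset[OF hol])
      show "ball t0 r \<subseteq> {t. (u, t) \<in> Q}" using sub u(1) by auto
      show "\<Phi> u t \<noteq> 0" if "t \<in> ball t0 r" for t using nz that by auto
    qed
    have "norm (1 / \<Phi> u t0) \<le> 2 / m"
    proof (rule maximum_modulus_frontier[where S = "ball t0 r" and f = "\<lambda>t. 1 / \<Phi> u t"])
      show "(\<lambda>t. 1 / \<Phi> u t) holomorphic_on interior (ball t0 r)" using hol' by simp
      show "continuous_on (closure (ball t0 r)) (\<lambda>t. 1 / \<Phi> u t)"
        using r nz cont_t[OF u(1)] by (auto intro!: continuous_intros)
      show "norm (1 / \<Phi> u t) \<le> 2 / m" if "t \<in> frontier (ball t0 r)" for t
      proof -
        have t: "t \<in> sphere t0 r" using that r by simp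
        then have "norm (\<Phi> u t) \<ge> m / 2"
          using close[OF u, of t] w(2)[OF t] norm_triangle_ineq2[of "\<Phi> 0 t" "\<Phi> u t"]
          by (auto simp: m_def dist_norm norm_minus_commute)
        then have "m / norm (\<Phi> u t) \<le> 2"
          using m by (intro mult_imp_div_pos_le) auto
        then show ?thesis using m by (simp add: norm_divide field_simps)
      qed
    qed (use r in auto)
    moreover have "norm (\<Phi> u t0) < m / 2" using close[OF u, of t0] z r by (simp add: dist_norm)
    ultimately show False using nz[of t0] r m by (simp add: norm_divide field_simps)
  qed
  have "eventually (\<lambda>n. dist (U n) 0 < min d e) sequentially"
    by (rule tendstoD[OF U]) (use d(1) e(1) in simp)
  then show ?thesis
  proof eventually_elim
    case (elim n)
    then obtain t where "t \<in> cball t0 r" "\<Phi> (U n) t = 0" using zero[of "U n"] by auto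
    then show ?case using sub elim by (intro exI[of _ t]) auto
  qed
qed

lemma sum_squares_combination:
  fixes a b c d :: "complex ^ 4"
  shows "(\<Sum>i\<in>UNIV. ((s *s a + t *s b + u *s c + w *s d) $ i)\<^sup>2) =
    s\<^sup>2 * (\<Sum>i\<in>UNIV. a $ i * a $ i) + t\<^sup>2 * (\<Sum>i\<in>UNIV. b $ i * b $ i) + u\<^sup>2 * (\<Sum>i\<in>UNIV. c $ i * c $ i) +
    w\<^sup>2 * (\<Sum>i\<in>UNIV. d $ i * d $ i) + 2 * s * t * (\<Sum>i\<in>UNIV. a $ i * b $ i) + 2 * s * u * (\<Sum>i\<in>UNIV. a $ i * c $ i) +
    2 * s * w * (\<Sum>i\<in>UNIV. a $ i * d $ i) + 2 * t * u * (\<Sum>i\<in>UNIV. b $ i * c $ i) +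
    2 * t * w * (\<Sum>i\<in>UNIV. b $ i * d $ i) + 2 * u * w * (\<Sum>i\<in>UNIV. c $ i * d $ i)"
  unfolding sum_distrib_left sum.distrib[symmetric]
  by (rule sum.cong) (auto simp: power2_eq_square algebra_simps)

text \<open>
  Since \<open>k3\<close> and \<open>k4\<close> are orthonormal and orthogonal to the plane, only the terms within
  the plane are mixed.
\<close>

lemma frame_sum_squares:
  assumes fr: "frame k1 k2 k3 k4"
  shows "(\<Sum>i\<in>UNIV. ((s *s cvec k1 + t *s cvec k2 + u *s cvec k3 + w *s cvec k4) $ i)\<^sup>2) =
    s\<^sup>2 * of_real (k1 \<bullet> k1) + 2 * s * t * of_real (k1 \<bullet> k2) + t\<^sup>2 * of_real (k2 \<bullet> k2) + u\<^sup>2 + w\<^sup>2"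
proof -
  have in_c: "(\<Sum>i\<in>UNIV. cvec a $ i * cvec b $ i) = of_real (a \<bullet> b)" for a b :: "real ^ 4"
    by (simp add: inner_vec_def)
  show ?thesis unfolding sum_squares_combination in_c
    using fr by (simp add: frame_def norm_eq_1)
qed

text \<open>
  Points of the section are equal in projective space only if their parameters agree, as
  the coordinate along \<open>k1\<close> is normalized to 1.
\<close>

lemma frame_hcons_eq:
  assumes fr: "frame k1 k2 k3 k4"
    and eq: "hcons y0 (frame_pt k1 k2 k3 k4 U y0 1 t) = c *s hcons z0 (frame_pt k1 k2 k3 k4 U z0 1 t')"
  shows "y0 = z0 \<and> t = t'"
proof -
  let ?u = "U $ 1 $ 1 * y0 + U $ 1 $ 2 * 1 + U $ 1 $ 3 * t"
  let ?w = "U $ 2 $ 1 * y0 + U $ 2 $ 2 * 1 + U $ 2 $ 3 * t"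
  let ?u' = "U $ 1 $ 1 * z0 + U $ 1 $ 2 * 1 + U $ 1 $ 3 * t'"
  let ?w' = "U $ 2 $ 1 * z0 + U $ 2 $ 2 * 1 + U $ 2 $ 3 * t'"
  have y0: "y0 = c * z0" using eq unfolding hcons_smult vec_option_eq_iff hcons_nth by simp
  have y: "frame_pt k1 k2 k3 k4 U y0 1 t = c *s frame_pt k1 k2 k3 k4 U z0 1 t'"
    using eq unfolding hcons_smult vec_option_eq_iff hcons_nth vec_eq_iff by blast
  have "(1 - c) *s cvec k1 + (t - c * t') *s cvec k2 + (?u - c * ?u') *s cvec k3 + (?w - c * ?w') *s cvec k4
     = frame_pt k1 k2 k3 k4 U y0 1 t - c *s frame_pt k1 k2 k3 k4 U z0 1 t'"
    by (simp add: frame_pt_def vec_eq_iff algebra_simps)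
  also have "\<dots> = 0" using y by simp
  finally have "1 - c = 0" "t - c * t' = 0" using frame_complex_independent[OF fr] by blast+
  then show ?thesis using y0 by simp
qed

lemma complete_square:
  fixes A :: complex
  assumes "A * Y = B + \<sigma> * S"
  shows "A * (A * Y\<^sup>2 - 2 * B * Y - C) = \<sigma>\<^sup>2 * S\<^sup>2 - B\<^sup>2 - A * C"
proof -
  have "(A * Y - B)\<^sup>2 = \<sigma>\<^sup>2 * S\<^sup>2" using assms by (simp add: power_mult_distrib)
  then show ?thesis by (simp add: power2_eq_square algebra_simps)
qed

lemma finite_reals_separated:
  assumes "finite (A :: real set)"
  shows "\<exists>e>0. \<forall>x\<in>A. \<forall>y\<in>A. x \<noteq> y \<longrightarrow> 2 * e \<le> \<bar>x - y\<bar>"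
proof -
  let ?S = "insert 1 ((\<lambda>(x, y). \<bar>x - y\<bar>) ` {(x, y) \<in> A \<times> A. x \<noteq> y})"
  have fin: "finite ?S"
    using assms by (auto intro!: finite_imageI intro: finite_subset[of _ "A \<times> A"])
  have "Min ?S > 0" using fin by (subst Min_gr_iff) auto
  moreover have "Min ?S \<le> \<bar>x - y\<bar>" if "x \<in> A" "y \<in> A" "x \<noteq> y" for x y
    using that by (intro Min_le[OF fin]) force
  ultimately show ?thesis by (intro exI[of _ "Min ?S / 2"]) auto
qed

text \<open>
  The degree bounds the zeros on a line of projective 3-space. On the section with
  parameter \<open>U\<close>, the sphere equation at \<open>s = 1\<close> is a quadratic equation for \<open>y\<^sub>0\<close>, whose
  two solutions depend holomorphically on \<open>t\<close> near real values of \<open>t\<close>. So each real zero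
  of \<open>F\<close> on the unperturbed plane persists twice, once on each sheet, and three zeros
  would give six points of a section of degree 4. The function \<open>l\<close> delimits where \<open>F\<close>
  describes the surface.
\<close>

lemma three_zeros_imp_plane_zero:
  assumes fr: "frame k1 k2 k3 k4" and deg: "proj_surface_degree (X_of Z) 4"
    and pF: "polynomial_fn F" and pl: "polynomial_fn l"
    and V: "\<And>x f. F x = 0 \<Longrightarrow> l x \<noteq> 0 \<Longrightarrow> f \<in> vanishing (circle_planes Z) \<Longrightarrow> f x = 0"
    and A: "card (A :: real set) = 3" "\<And>t. t \<in> A \<Longrightarrow> F (cvec k1 + of_real t *s cvec k2) = 0"
      "\<And>t. t \<in> A \<Longrightarrow> l (cvec k1 + of_real t *s cvec k2) \<noteq> 0"
  shows "F (cvec k1 + z *s cvec k2) = 0"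
proof (rule ccontr)
  assume nz: "F (cvec k1 + z *s cvec k2) \<noteq> 0"
  obtain U where U: "U \<longlonglongrightarrow> 0"
    "\<And>n::nat. finite (section_points (X_of Z) k1 k2 k3 k4 (U n))"
    "\<And>n::nat. card (section_points (X_of Z) k1 k2 k3 k4 (U n)) = 4"
    using degree_near_frame[OF fr deg] by blast
  have finA: "finite A" using A(1) card.infinite by fastforce
  obtain e where e: "e > 0" "\<And>x y. x \<in> A \<Longrightarrow> y \<in> A \<Longrightarrow> x \<noteq> y \<Longrightarrow> 2 * e \<le> \<bar>x - y\<bar>"
    using finite_reals_separated[OF finA] by blast
  \<comment> \<open>On the section the sphere equation reads \<open>a y\<^sub>0\<^sup>2 - 2 b y\<^sub>0 - c = 0\<close>; \<open>Y 1\<close> and \<open>Y (- 1)\<close> are its roots.\<close>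
  define a where "a = (\<lambda>(U :: complex ^ 3 ^ 2, t :: complex). 1 - (U$1$1)\<^sup>2 - (U$2$1)\<^sup>2)"
  define b where "b = (\<lambda>(U :: complex ^ 3 ^ 2, t). U$1$1 * (U$1$2 + U$1$3 * t) + U$2$1 * (U$2$2 + U$2$3 * t))"
  define c where "c = (\<lambda>(U :: complex ^ 3 ^ 2, t). of_real (k1 \<bullet> k1) + 2 * t * of_real (k1 \<bullet> k2) +
     t\<^sup>2 * of_real (k2 \<bullet> k2) + (U$1$2 + U$1$3 * t)\<^sup>2 + (U$2$2 + U$2$3 * t)\<^sup>2)"
  define D where "D = (\<lambda>x. (b x)\<^sup>2 + a x * c x)"
  define Y where "Y = (\<lambda>\<sigma> x. (b x + \<sigma> * csqrt (D x)) / a x)"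
  define P where "P = (\<lambda>\<sigma> x. frame_pt k1 k2 k3 k4 (fst x) (Y \<sigma> x) 1 (snd x))"
  have cont: "continuous_on UNIV a" "continuous_on UNIV b" "continuous_on UNIV c"
    unfolding a_def b_def c_def case_prod_unfold by (intro continuous_intros)+
  then have contD: "continuous_on UNIV D" unfolding D_def by (intro continuous_intros)
  define Q0 where "Q0 = {x. a x \<noteq> 0} \<inter> {x. D x \<notin> \<real>\<^sub>\<le>\<^sub>0}"
  have oQ0: "open Q0"
  proof -
    have "open (a -` (- {0}))" "open (D -` (- \<real>\<^sub>\<le>\<^sub>0))"
      using cont(1) contD by (auto intro!: open_vimage)
    moreover have "Q0 = a -` (- {0}) \<inter> D -` (- \<real>\<^sub>\<le>\<^sub>0)" unfolding Q0_def by auto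
    ultimately show ?thesis by auto
  qed
  have contY: "continuous_on Q0 (Y \<sigma>)" for \<sigma>
    unfolding Y_def
    by (intro continuous_intros continuous_on_compose2[OF continuous_on_csqrt, of Q0 D]
         continuous_on_subset[OF cont(1)] continuous_on_subset[OF cont(2)] continuous_on_subset[OF contD])
       (auto simp: Q0_def)
  have contP: "continuous_on Q0 (P \<sigma>)" for \<sigma>
    unfolding P_def frame_pt_def vector_smult_lid
    by (rule continuous_on_vec_lambda[where f = "\<lambda>i x. _ x $ i", simplified]) 
       (auto intro!: continuous_intros contY)
  define G where "G = (\<lambda>t. k1 \<bullet> k1 + 2 * t * (k1 \<bullet> k2) + t\<^sup>2 * (k2 \<bullet> k2))"
  have Gpos: "G t > 0" for t
  proof -
    have "G t = (k1 + t *\<^sub>R k2) \<bullet> (k1 + t *\<^sub>R k2)"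
      by (simp add: G_def inner_add_left inner_add_right inner_commute power2_eq_square algebra_simps)
    moreover have "k1 + t *\<^sub>R k2 \<noteq> 0" using fr unfolding frame_def by (metis scaleR_one zero_neq_one)
    ultimately show ?thesis by simp
  qed
  have zero_pt: "P \<sigma> (0, t) = cvec k1 + t *s cvec k2" for \<sigma> t
    unfolding P_def frame_pt_def by (simp add: vec_eq_iff)
  have at0: "a (0, of_real t) = 1" "D (0, of_real t) = of_real (G t)" for t
    by (simp_all add: a_def D_def b_def c_def G_def)
  have mem0: "(0, of_real t) \<in> Q0" for t
    using Gpos[of t] by (auto simp: Q0_def at0 complex_nonpos_Reals_iff)
  \<comment> \<open>The bound \<open>e\<close> keeps the zeros that persist from different \<open>t0\<close> apart.\<close>
  define R where "R = (\<lambda>\<sigma> t0. {x\<in>Q0. l (P \<sigma> x) \<noteq> 0 \<and> dist (snd x) (of_real t0) < e})"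
  have oR: "open (R \<sigma> t0)" for \<sigma> t0
  proof -
    have c1: "continuous_on Q0 (\<lambda>x. l (P \<sigma> x))" by (rule polynomial_fn_continuous[OF pl contP])
    have "open (Q0 \<inter> (\<lambda>x. l (P \<sigma> x)) -` (- {0}))"
      by (rule continuous_open_preimage[OF c1 oQ0]) auto
    moreover have "open ((\<lambda>x :: (complex ^ 3 ^ 2) \<times> complex. snd x) -` ball (of_real t0) e)"
      by (intro open_vimage continuous_intros) auto
    moreover have "R \<sigma> t0 = (Q0 \<inter> (\<lambda>x. l (P \<sigma> x)) -` (- {0})) \<inter> ((\<lambda>x. snd x) -` ball (of_real t0) e)"
      unfolding R_def by (auto simp: dist_commute)
    ultimately show ?thesis by (metis open_Int)
  qed
  have ev: "eventually (\<lambda>n. \<exists>t. (U n, t) \<in> R \<sigma> t0 \<and> F (P \<sigma> (U n, t)) = 0) sequentially"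
    if t0: "t0 \<in> A" for \<sigma> t0
  proof (rule zero_persists[OF oR _ _ _ _ _ U(1), where \<Phi> = "\<lambda>u t. F (P \<sigma> (u, t))"])
    show "(0, of_real t0) \<in> R \<sigma> t0"
      unfolding R_def using mem0 A(3)[OF t0] e(1) by (simp add: zero_pt)
    show "continuous_on (R \<sigma> t0) (\<lambda>(u, t). F (P \<sigma> (u, t)))"
      unfolding case_prod_unfold prod.collapse
      by (intro polynomial_fn_continuous[OF pF] continuous_on_subset[OF contP]) (auto simp: R_def)
    show "(\<lambda>t. F (P \<sigma> (u, t))) holomorphic_on {t. (u, t) \<in> R \<sigma> t0}" for u
    proof (rule polynomial_fn_holomorphic[OF pF])
      fix i
      have sq: "(\<lambda>t. csqrt (D (u, t))) holomorphic_on {t. (u, t) \<in> R \<sigma> t0}"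
        unfolding D_def a_def b_def c_def case_prod_conv
        by (intro holomorphic_intros) (auto simp: R_def Q0_def D_def a_def b_def c_def)
      have "(\<lambda>t. Y \<sigma> (u, t)) holomorphic_on {t. (u, t) \<in> R \<sigma> t0}"
        unfolding Y_def a_def b_def case_prod_conv
        by (intro holomorphic_intros sq) (auto simp: R_def Q0_def a_def)
      then show "(\<lambda>t. P \<sigma> (u, t) $ i) holomorphic_on {t. (u, t) \<in> R \<sigma> t0}"
        unfolding P_def frame_pt_def by (auto intro!: holomorphic_intros)
    qed
    show "F (P \<sigma> (0, of_real t0)) = 0" using A(2)[OF t0] by (simp add: zero_pt)
    have "\<exists>p. \<forall>t. F (cvec k1 + t *s cvec k2) = poly p t"
    proof (rule polynomial_fn_along_polynomial_curve[OF pF])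
      fix i show "\<exists>p. \<forall>t. (cvec k1 + t *s cvec k2) $ i = poly p t"
        by (rule exI[of _ "[:cvec k1 $ i, cvec k2 $ i:]"]) simp
    qed
    then obtain p where p: "\<And>t. F (cvec k1 + t *s cvec k2) = poly p t" by blast
    have "p \<noteq> 0" using nz p by auto
    then have "finite {t. poly p t = 0}" by (rule poly_roots_finite)
    then have "eventually (\<lambda>t. t \<notin> {t. poly p t = 0}) (at (of_real t0))"
      by (metis islimpt_finite islimpt_iff_eventually)
    then show "eventually (\<lambda>t. F (P \<sigma> (0, t)) \<noteq> 0) (at (of_real t0))" by (simp add: zero_pt p)
  qed
  have "eventually (\<lambda>n. \<forall>i\<in>A \<times> {1, - 1}. \<exists>t. (U n, t) \<in> R (snd i) (fst i) \<and> F (P (snd i) (U n, t)) = 0) sequentially"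
    using finA ev by (intro eventually_ball_finite) auto
  then obtain n where n: "\<forall>i\<in>A \<times> {1, - 1}. \<exists>t. (U n, t) \<in> R (snd i) (fst i) \<and> F (P (snd i) (U n, t)) = 0"
    using eventually_happens' sequentially_bot by blast
  then obtain \<tau> where \<tau>: "\<And>i. i \<in> A \<times> {1, - 1} \<Longrightarrow> (U n, \<tau> i) \<in> R (snd i) (fst i)"
     "\<And>i. i \<in> A \<times> {1, - 1} \<Longrightarrow> F (P (snd i) (U n, \<tau> i)) = 0" by metis
  define v where "v = (\<lambda>i. hcons (Y (snd i) (U n, \<tau> i)) (P (snd i) (U n, \<tau> i)))"
  have ind: "frame_pt k1 k2 k3 k4 u y0 1 t \<noteq> 0" for u y0 t
    using frame_complex_independent(1)[OF fr, of 1 t] zero_neq_one unfolding frame_pt_def by metis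
  have vX: "v i \<in> X_of Z" if i: "i \<in> A \<times> {1, - 1}" for i
    unfolding v_def
  proof (rule X_of_memI)
    let ?x = "(U n, \<tau> i)" and ?\<sigma> = "snd i"
    show "hcons (Y ?\<sigma> ?x) (P ?\<sigma> ?x) \<noteq> 0" using ind by (simp add: P_def hcons_eq_0_iff)
    show "f (P ?\<sigma> ?x) = 0" if "f \<in> vanishing (circle_planes Z)" for f
      using V[OF \<tau>(2)[OF i] _ that] \<tau>(1)[OF i] by (simp add: R_def)
    have an: "a ?x \<noteq> 0" using \<tau>(1)[OF i] by (simp add: R_def Q0_def)
    have s2: "?\<sigma>\<^sup>2 = 1" using i by auto
    have "a ?x * Y ?\<sigma> ?x = b ?x + ?\<sigma> * csqrt (D ?x)" using an by (simp add: Y_def)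
    then have "a ?x * (a ?x * (Y ?\<sigma> ?x)\<^sup>2 - 2 * b ?x * Y ?\<sigma> ?x - c ?x) = ?\<sigma>\<^sup>2 * (csqrt (D ?x))\<^sup>2 - (b ?x)\<^sup>2 - a ?x * c ?x"
      by (rule complete_square)
    also have "\<dots> = 0" unfolding s2 by (simp add: D_def)
    finally have "a ?x * (Y ?\<sigma> ?x)\<^sup>2 - 2 * b ?x * Y ?\<sigma> ?x - c ?x = 0" using an by simp
    moreover have "(\<Sum>i\<in>UNIV. (P ?\<sigma> ?x $ i)\<^sup>2) - (Y ?\<sigma> ?x)\<^sup>2 = - (a ?x * (Y ?\<sigma> ?x)\<^sup>2 - 2 * b ?x * Y ?\<sigma> ?x - c ?x)"
      unfolding P_def frame_pt_def frame_sum_squares[OF fr]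
      unfolding a_def b_def c_def fst_conv snd_conv case_prod_conv
      by (simp add: power2_eq_square algebra_simps)
    ultimately show "(Y ?\<sigma> ?x)\<^sup>2 = (\<Sum>i\<in>UNIV. (P ?\<sigma> ?x $ i)\<^sup>2)" by simp
  qed
  have inj: "inj_on (\<lambda>i. vec.span {v i}) (A \<times> {1, - 1})"
  proof (rule inj_onI)
    fix i j assume ij: "i \<in> A \<times> {1, - 1}" "j \<in> A \<times> {1, - 1}" and eq: "vec.span {v i} = vec.span {v j}"
    have "v i \<in> vec.span {v j}" using eq by (metis insertI1 vec.span_base)
    then obtain k where "v i = k *s v j" by (auto simp: vec.span_singleton)
    then have yt: "Y (snd i) (U n, \<tau> i) = Y (snd j) (U n, \<tau> j) \<and> \<tau> i = \<tau> j"
      unfolding v_def P_def fst_conv snd_conv by (rule frame_hcons_eq[OF fr])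
    have "dist (\<tau> i) (of_real (fst i)) < e" "dist (\<tau> i) (of_real (fst j)) < e"
      using \<tau>(1)[OF ij(1)] \<tau>(1)[OF ij(2)] yt by (auto simp: R_def)
    then have "dist (of_real (fst i) :: complex) (of_real (fst j)) < 2 * e"
      using dist_triangle_half_r[of "\<tau> i" "of_real (fst i)" "2 * e" "of_real (fst j)"] by (simp add: dist_commute)
    then have "\<bar>fst i - fst j\<bar> < 2 * e" unfolding dist_of_real by (simp add: dist_real_def)
    then have f: "fst i = fst j" using e(2)[of "fst i" "fst j"] ij by force
    have "a (U n, \<tau> i) \<noteq> 0" "D (U n, \<tau> i) \<noteq> 0" using \<tau>(1)[OF ij(1)] by (auto simp: R_def Q0_def)
    moreover have "Y (snd i) (U n, \<tau> i) = Y (snd j) (U n, \<tau> i)" using yt by metis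
    ultimately have "snd i = snd j" by (simp add: Y_def)
    then show "i = j" using f by (simp add: prod_eq_iff)
  qed
  have "(\<lambda>i. vec.span {v i}) ` (A \<times> {1, - 1}) \<subseteq> section_points (X_of Z) k1 k2 k3 k4 (U n)"
    using vX unfolding section_points_def v_def P_def by auto
  then have "card (A \<times> {1, - 1 :: complex}) \<le> 4"
    using card_mono[OF U(2)] card_image[OF inj] U(3) by metis
  then show False using A(1) by (simp add: card_cartesian_product)
qed

text \<open>
  Every section near the frame meets the surface. By compactness of projective space the
  points found for \<open>U \<longlonglongrightarrow> 0\<close> accumulate at a point of the limiting plane, where the
  vanishing functions are zero by continuity.
\<close>

lemma plane_meets_vanishing_forms:
  assumes fr: "frame k1 k2 k3 k4" and deg: "proj_surface_degree (X_of Z) 4" and Z: "great Z"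
    and F: "F \<in> vanishing (circle_planes Z)" and h: "h \<in> vanishing (circle_planes Z)"
  shows "\<exists>s t. (s, t) \<noteq> (0, 0) \<and> F (s *s cvec k1 + t *s cvec k2) = 0 \<and> h (s *s cvec k1 + t *s cvec k2) = 0"
proof -
  obtain U where U: "U \<longlonglongrightarrow> 0"
    "\<And>n::nat. card (section_points (X_of Z) k1 k2 k3 k4 (U n)) = 4"
    using degree_near_frame[OF fr deg] by blast
  define pt where "pt = (\<lambda>u (x :: complex ^ 3). frame_pt k1 k2 k3 k4 u (x $ 1) (x $ 2) (x $ 3))"
  have pt_scale: "pt u (c *s x) = c *s pt u x" for u c x
    by (simp add: pt_def frame_pt_def vec_eq_iff algebra_simps)
  have ex: "\<exists>x. norm x = 1 \<and> hcons (x $ 1) (pt (U n) x) \<in> X_of Z" for n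
  proof -
    have "section_points (X_of Z) k1 k2 k3 k4 (U n) \<noteq> {}" using U(2)[of n] by auto
    then obtain y0 s t where X: "hcons y0 (frame_pt k1 k2 k3 k4 (U n) y0 s t) \<in> X_of Z"
      unfolding section_points_def by auto
    define x :: "complex ^ 3" where "x = vector [y0, s, t]"
    have x: "hcons (x $ 1) (pt (U n) x) \<in> X_of Z" using X by (simp add: x_def pt_def)
    have "x \<noteq> 0"
    proof
      assume "x = 0"
      then have "hcons (x $ 1) (pt (U n) x) = 0" by (simp add: pt_def frame_pt_def hcons_eq_0_iff)
      then show False using X_ofD(1)[OF x] by simp
    qed
    define c :: complex where "c = of_real (1 / norm x)"
    have c: "c \<noteq> 0" using \<open>x \<noteq> 0\<close> by (simp add: c_def)
    have "c *s x = (1 / norm x) *\<^sub>R x" 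
      unfolding vec_eq_iff vector_smult_component vector_scaleR_component c_def
      by (simp only: scaleR_conv_of_real simp_thms)
    then have "norm (c *s x) = 1" using \<open>x \<noteq> 0\<close> by simp
    moreover have "hcons ((c *s x) $ 1) (pt (U n) (c *s x)) = c *s hcons (x $ 1) (pt (U n) x)"
      by (simp add: pt_scale hcons_smult)
    moreover have "c *s v \<in> X_of Z" if "v \<in> X_of Z" for v
      using that c unfolding X_of_def proj_closure_def by (auto simp: homogeneous_fn_scale)
    ultimately show ?thesis using x by metis
  qed
  then obtain x where x: "\<And>n. norm (x n) = 1" "\<And>n. hcons (x n $ 1) (pt (U n) (x n)) \<in> X_of Z"
    by metis
  have "compact (sphere (0 :: complex ^ 3) 1)" by simp
  then obtain x0 r where r: "x0 \<in> sphere 0 1" "strict_mono (r :: nat \<Rightarrow> nat)" "(x \<circ> r) \<longlonglongrightarrow> x0"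
    unfolding compact_def using x(1) by (metis mem_sphere_0)
  have lim: "(\<lambda>n. pt (U (r n)) (x (r n))) \<longlonglongrightarrow> pt 0 x0"
  proof (rule vec_tendstoI)
    fix i
    have "(\<lambda>n. U (r n)) \<longlonglongrightarrow> 0" using LIMSEQ_subseq_LIMSEQ[OF U(1) r(2)] by (simp add: o_def)
    moreover have "(\<lambda>n. x (r n)) \<longlonglongrightarrow> x0" using r(3) by (simp add: o_def)
    ultimately show "(\<lambda>n. pt (U (r n)) (x (r n)) $ i) \<longlonglongrightarrow> pt 0 x0 $ i"
      unfolding pt_def frame_pt_def vector_add_component vector_smult_component
      by (intro tendsto_intros)
  qed
  have zero_lim: "f (pt 0 x0) = 0" if f: "f \<in> vanishing (circle_planes Z)" for f
  proof -
    have "continuous_on UNIV f"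
      using f polynomial_fn_continuous[of f UNIV "\<lambda>x. x"] by (simp add: vanishing_def)
    then have "(\<lambda>n. f (pt (U (r n)) (x (r n)))) \<longlonglongrightarrow> f (pt 0 x0)"
      using lim continuous_on_tendsto_compose[of UNIV f] by auto
    moreover have "f (pt (U (r n)) (x (r n))) = 0" for n
      using X_of_vanishing[OF Z x(2) f] .
    ultimately show ?thesis by (simp add: LIMSEQ_const_iff)
  qed
  have "(\<lambda>n. (x (r n) $ 1)\<^sup>2) \<longlonglongrightarrow> (x0 $ 1)\<^sup>2"
    using r(3) by (intro tendsto_intros) (simp add: o_def)
  moreover have "(\<lambda>n. \<Sum>i\<in>UNIV. (pt (U (r n)) (x (r n)) $ i)\<^sup>2) \<longlonglongrightarrow> (\<Sum>i\<in>UNIV. (pt 0 x0 $ i)\<^sup>2)"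
    using lim by (intro tendsto_intros)
  ultimately have sph: "(x0 $ 1)\<^sup>2 = (\<Sum>i\<in>UNIV. (pt 0 x0 $ i)\<^sup>2)"
    using X_ofD(2)[OF x(2)] LIMSEQ_unique by simp
  have pt0: "pt 0 x0 = (x0 $ 2) *s cvec k1 + (x0 $ 3) *s cvec k2"
    by (simp add: pt_def frame_pt_def vec_eq_iff)
  have "(x0 $ 2, x0 $ 3) \<noteq> (0, 0)"
  proof
    assume *: "(x0 $ 2, x0 $ 3) = (0, 0)"
    then have "x0 $ 1 = 0" using sph pt0 by simp
    then have "x0 = 0" using * by (simp add: vec_eq_iff forall_3)
    then show False using r(1) by simp
  qed
  then show ?thesis using zero_lim[OF F] zero_lim[OF h] pt0 by metis
qed

lemma quadratic_roots_card:
  fixes a b c :: complex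
  assumes "a \<noteq> 0" shows "finite {t. a * t\<^sup>2 + b * t + c = 0} \<and> card {t. a * t\<^sup>2 + b * t + c = 0} \<le> 2"
proof -
  have p: "[:c, b, a:] \<noteq> 0" using assms by simp
  have "{t. a * t\<^sup>2 + b * t + c = 0} = {t. poly [:c, b, a:] t = 0}"
    by (auto simp: power2_eq_square algebra_simps)
  then show ?thesis
    using poly_roots_finite[OF p] card_poly_roots_bound[OF p] assms by simp
qed

text \<open>
  A section of a two-dimensional sphere by two further linear equations has at most two
  points.
\<close>

lemma preimage_not_in_hyperplane:
  assumes deg: "proj_surface_degree (X_of Z) 4" and w: "w \<noteq> 0"
    and T: "\<And>y. y \<in> stereo_preimage Z \<Longrightarrow> w \<bullet> y = 0"
  shows False
proof -
  have "dim {y. w \<bullet> y = 0} = 3" using dim_hyperplane[OF w] by simp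
  then have "\<not> {y. w \<bullet> y = 0} \<subseteq> {0}" using dim_eq_0[of "{y. w \<bullet> y = 0}"] by auto
  then obtain k2 where k2: "w \<bullet> k2 = 0" "k2 \<noteq> 0" by blast
  have ind: "s = 0 \<and> t = 0" if "s *\<^sub>R w + t *\<^sub>R k2 = 0" for s t
  proof -
    have "w \<bullet> (s *\<^sub>R w + t *\<^sub>R k2) = 0" using that by simp
    then have "s = 0" using k2 w by (simp add: inner_add_right)
    then show ?thesis using that k2 by simp
  qed
  obtain k3 k4 where fr: "frame w k2 k3 k4" using frame_exists[of w k2] ind by blast
  obtain U where U: "U \<longlonglongrightarrow> 0"
    "\<And>n::nat. card (section_points (X_of Z) w k2 k3 k4 (U n)) = 4"
    using degree_near_frame[OF fr deg] by blast
  have "(\<lambda>n. of_real (k2 \<bullet> k2) + (U n $ 1 $ 3)\<^sup>2 + (U n $ 2 $ 3)\<^sup>2) \<longlonglongrightarrow>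
      of_real (k2 \<bullet> k2) + ((0 :: complex ^ 3 ^ 2) $ 1 $ 3)\<^sup>2 + ((0 :: complex ^ 3 ^ 2) $ 2 $ 3)\<^sup>2"
    by (intro tendsto_intros U(1))
  then have "eventually (\<lambda>n. of_real (k2 \<bullet> k2) + (U n $ 1 $ 3)\<^sup>2 + (U n $ 2 $ 3)\<^sup>2 \<noteq> 0) sequentially"
    by (rule tendsto_imp_eventually_ne) (use k2 in simp)
  then obtain n where n: "of_real (k2 \<bullet> k2) + (U n $ 1 $ 3)\<^sup>2 + (U n $ 2 $ 3)\<^sup>2 \<noteq> 0"
    using eventually_happens' sequentially_bot by blast
  define u where "u = U n"
  define a where "a = of_real (k2 \<bullet> k2) + (u $ 1 $ 3)\<^sup>2 + (u $ 2 $ 3)\<^sup>2"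
  define b where "b = 2 * (u $ 1 $ 1 * u $ 1 $ 3 + u $ 2 $ 1 * u $ 2 $ 3)"
  define c where "c = (u $ 1 $ 1)\<^sup>2 + (u $ 2 $ 1)\<^sup>2 - 1"
  have a: "a \<noteq> 0" using n by (simp add: a_def u_def)
  let ?R = "{t. a * t\<^sup>2 + b * t + c = 0}"
  have lin: "homogeneous_fn 1 (\<lambda>y :: complex ^ 4. \<Sum>i\<in>UNIV. cvec w $ i * y $ i)"
    by (intro homogeneous_fn_sum homogeneous_fn_cmult homogeneous_fn_coord)
  have in_c: "(\<Sum>i\<in>UNIV. cvec a $ i * cvec b $ i) = of_real (a \<bullet> b)" for a b :: "real ^ 4"
    by (simp add: inner_vec_def)
  have "section_points (X_of Z) w k2 k3 k4 u \<subseteq>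
      (\<lambda>t. vec.span {hcons 1 (frame_pt w k2 k3 k4 u 1 0 t)}) ` ?R"
  proof
    fix S assume "S \<in> section_points (X_of Z) w k2 k3 k4 u"
    then obtain y0 s t where S: "S = vec.span {hcons y0 (frame_pt w k2 k3 k4 u y0 s t)}"
      "hcons y0 (frame_pt w k2 k3 k4 u y0 s t) \<in> X_of Z" unfolding section_points_def by auto
    have "(\<Sum>i\<in>UNIV. cvec w $ i * frame_pt w k2 k3 k4 u y0 s t $ i) = 0"
      by (rule X_ofD(3)[OF S(2) lin]) (use T in \<open>simp add: in_c del: cvec_nth\<close>)
    moreover have "(\<Sum>i\<in>UNIV. cvec w $ i * (s *s cvec w + t *s cvec k2 + p *s cvec k3 + q *s cvec k4) $ i)
       = s * of_real (w \<bullet> w)" for p q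
    proof -
      have "(\<Sum>i\<in>UNIV. cvec w $ i * (s *s cvec w + t *s cvec k2 + p *s cvec k3 + q *s cvec k4) $ i) =
        s * (\<Sum>i\<in>UNIV. cvec w $ i * cvec w $ i) + t * (\<Sum>i\<in>UNIV. cvec w $ i * cvec k2 $ i) +
        p * (\<Sum>i\<in>UNIV. cvec w $ i * cvec k3 $ i) + q * (\<Sum>i\<in>UNIV. cvec w $ i * cvec k4 $ i)"
        unfolding sum_distrib_left sum.distrib[symmetric]
        by (rule sum.cong) (auto simp: algebra_simps)
      then show ?thesis unfolding in_c using fr k2 by (simp add: frame_def)
    qed
    ultimately have "s * of_real (w \<bullet> w) = 0" unfolding frame_pt_def by metis
    then have s: "s = 0" using w by simp
    have sph: "y0\<^sup>2 = t\<^sup>2 * of_real (k2 \<bullet> k2) + (u $ 1 $ 1 * y0 + u $ 1 $ 3 * t)\<^sup>2 + (u $ 2 $ 1 * y0 + u $ 2 $ 3 * t)\<^sup>2"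
      using X_ofD(2)[OF S(2)] unfolding frame_pt_def frame_sum_squares[OF fr] by (simp add: s)
    then have q: "a * t\<^sup>2 + b * (t * y0) + c * y0\<^sup>2 = 0" unfolding a_def b_def c_def by algebra
    have y0: "y0 \<noteq> 0"
    proof
      assume "y0 = 0"
      moreover then have "t = 0" using q a by simp
      ultimately have "hcons y0 (frame_pt w k2 k3 k4 u y0 s t) = 0"
        using s by (simp add: frame_pt_def hcons_eq_0_iff)
      then show False using X_ofD(1)[OF S(2)] by simp
    qed
    have "a * (t / y0)\<^sup>2 + b * (t / y0) + c = (a * t\<^sup>2 + b * (t * y0) + c * y0\<^sup>2) / y0\<^sup>2"
      using y0 by (simp add: power2_eq_square field_simps)
    then have "t / y0 \<in> ?R" using q by simp
    moreover have "hcons y0 (frame_pt w k2 k3 k4 u y0 s t) = y0 *s hcons 1 (frame_pt w k2 k3 k4 u 1 0 (t / y0))"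
      using y0 by (simp add: s hcons_smult vec_option_eq_iff frame_pt_def algebra_simps)
    moreover have "vec.span {y0 *s v} = vec.span {v}" for v :: "complex ^ 4 option"
      using vec.span_image_scale[of "{v}" "\<lambda>_. y0"] y0 by simp
    ultimately show "S \<in> (\<lambda>t. vec.span {hcons 1 (frame_pt w k2 k3 k4 u 1 0 t)}) ` ?R"
      using S(1) by (metis (no_types, lifting) image_eqI)
  qed
  then have "card (section_points (X_of Z) w k2 k3 k4 u) \<le> card ?R"
    using quadratic_roots_card[OF a] by (meson card_image_le card_mono finite_imageI le_trans)
  then show False using quadratic_roots_card[OF a, of b c] U(2)[of n] unfolding u_def by simp
qed

section \<open>A vanishing form of minimal degree in one direction\<close>

lemma homogeneous_fn_induct [consumes 1, case_names zero const coord add mult]: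
  assumes "homogeneous_fn d f"
    and zero: "\<And>d. P d (\<lambda>x. 0)" and const: "\<And>c. P 0 (\<lambda>x. c)" and coord: "\<And>i. P 1 (\<lambda>x. x $ i)"
    and add: "\<And>d f g. P d f \<Longrightarrow> P d g \<Longrightarrow> P d (\<lambda>x. f x + g x)"
    and mult: "\<And>d e f g. P d f \<Longrightarrow> P e g \<Longrightarrow> P (d + e) (\<lambda>x. f x * g x)"
  shows "P d f"
proof -
  obtain M c where M: "finite M" "\<And>m. m \<in> M \<Longrightarrow> (\<Sum>i\<in>UNIV. m i) = d"
      "f = (\<lambda>x. \<Sum>m\<in>M. c m * (\<Prod>i\<in>UNIV. (x $ i) ^ m i))"
    using assms(1) unfolding homogeneous_fn_def by blast
  have pow: "P n (\<lambda>x. (x $ i) ^ n)" for i n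
  proof (induction n)
    case (Suc n) then show ?case using mult[OF coord Suc, of i] by simp
  qed (simp add: const)
  have prd: "P (\<Sum>i\<in>I. m i) (\<lambda>x. \<Prod>i\<in>I. (x $ i) ^ m i)" if "finite I" for I :: "'b set" and m
    using that
  proof (induction I rule: finite_induct)
    case (insert i I) then show ?case using mult[OF pow insert.IH] by simp
  qed (simp add: const)
  have mono: "P d (\<lambda>x. c m * (\<Prod>i\<in>UNIV. (x $ i) ^ m i))" if "m \<in> M" for m
    using mult[OF const[of "c m"] prd[OF finite[of UNIV], of m]] M(2)[OF that] by simp
  have "P d (\<lambda>x. \<Sum>m\<in>N. c m * (\<Prod>i\<in>UNIV. (x $ i) ^ m i))" if "N \<subseteq> M" for N
    using finite_subset[OF that M(1)] that
  proof (induction N rule: finite_induct)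
    case (insert m N)
    then show ?case using add[OF mono[of m] insert.IH] by simp
  qed (simp add: zero)
  then show ?thesis using M(3) by simp
qed

text \<open>
  A form that is nonzero at the origin is constant, so every nonzero vector serves.
\<close>

lemma homogeneous_fn_nonzero_at_nonzero_real:
  fixes f :: "complex ^ 'n \<Rightarrow> complex"
  assumes f: "homogeneous_fn d f" "f x \<noteq> 0"
  shows "\<exists>v. v \<noteq> 0 \<and> f (cvec v) \<noteq> 0"
proof -
  obtain v where v: "f (cvec v) \<noteq> 0"
    using polynomial_fn_zero_on_reals[OF homogeneous_imp_polynomial_fn[OF f(1)]] f(2) by blast
  show ?thesis
  proof (cases "v = 0")
    case True
    have c: "f 0 = 0 ^ d * f y" for y using homogeneous_fn_scale[OF f(1), of 0 y] by simp
    have "f 0 \<noteq> 0" using v True by simp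
    then have "0 ^ d \<noteq> (0 :: complex)" using c[of 0] by (metis mult_zero_left)
    then have d: "d = 0" by (cases d) auto
    have "f (cvec (axis undefined 1)) = f 0" using c[of "cvec (axis undefined 1)"] d by simp
    then show ?thesis using v True by (intro exI[of _ "axis undefined 1"]) (auto simp: axis_eq_0_iff)
  qed (use v in blast)
qed

text \<open>
  If \<open>f\<close> vanished on \<open>x + z y\<close> for all \<open>z\<close>, then by homogeneity on \<open>w x + y\<close> for \<open>w \<noteq> 0\<close>,
  and in the limit at \<open>y\<close>.
\<close>

lemma homogeneous_fn_along_line:
  fixes f :: "complex ^ 'n \<Rightarrow> complex"
  assumes f: "homogeneous_fn d f" and y: "f y \<noteq> 0"
  shows "\<exists>q. q \<noteq> 0 \<and> (\<forall>z. f (x + z *s y) = poly q z)"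
proof -
  have line: "\<exists>q. \<forall>z. f (a + z *s b) = poly q z" for a b
  proof (rule polynomial_fn_along_polynomial_curve[OF homogeneous_imp_polynomial_fn[OF f(1)]])
    fix i show "\<exists>p. \<forall>z. (a + z *s b) $ i = poly p z"
      by (rule exI[of _ "[:a $ i, b $ i:]"]) simp
  qed
  obtain q where q: "\<And>z. f (x + z *s y) = poly q z" using line by blast
  obtain r where r: "\<And>z. f (y + z *s x) = poly r z" using line by blast
  have "q \<noteq> 0"
  proof
    assume "q = 0"
    then have z: "f (x + z *s y) = 0" for z using q by simp
    have "poly r w = 0" if "w \<noteq> 0" for w
    proof -
      have "y + w *s x = w *s (x + (1 / w) *s y)" using that by (simp add: vec_eq_iff field_simps)
      then have "f (y + w *s x) = w ^ d * f (x + (1 / w) *s y)"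
        using homogeneous_fn_scale[OF f(1)] by metis
      then show ?thesis using z r[of w] by simp
    qed
    then have "{0<..<1} \<subseteq> {t::real. poly r (of_real t) = 0}" by auto
    then have "infinite {t::real. poly r (of_real t) = 0}"
      using infinite_super[OF _ infinite_Ioo[of 0 "1::real"]] by simp
    then have "r = 0" by (rule poly_zero_on_infinite)
    then show False using r[of 0] y by simp
  qed
  then show ?thesis using q by blast
qed

definition invariant_along :: "complex ^ 'n \<Rightarrow> (complex ^ 'n \<Rightarrow> complex) \<Rightarrow> bool" where
  "invariant_along v h \<longleftrightarrow> (\<forall>x c. h (x + c *s v) = h x)"

text \<open>
  On the plane spanned by \<open>a + c v\<close> and \<open>b\<close> with \<open>h b \<noteq> 0\<close>, the zeros of \<open>h\<close> do not depend
  on \<open>c\<close>. Up to scaling there are finitely many, and only finitely many \<open>c\<close> put a zero of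
  \<open>F\<close> on one of them. For any other \<open>c\<close> the two functions have no common zero on that
  plane, against \<open>plane_meets_vanishing_forms\<close>.
\<close>

lemma no_invariant_vanishing_form:
  assumes deg: "proj_surface_degree (X_of Z) 4" and Z: "great Z"
    and F: "F \<in> vanishing (circle_planes Z)" "homogeneous_fn dF F" "F (cvec v) \<noteq> 0"
    and h: "h \<in> vanishing (circle_planes Z)" "homogeneous_fn dh h" "invariant_along (cvec v) h"
  shows "h x = 0"
proof (rule ccontr)
  assume "h x \<noteq> 0"
  then obtain b where b: "b \<noteq> 0" "h (cvec b) \<noteq> 0"
    using homogeneous_fn_nonzero_at_nonzero_real[OF h(2)] by blast
  have "dim {v, b} \<le> card {v, b}" by (rule dim_le_card') simp
  also have "card {v, b} \<le> 2" by (simp add: card_insert_if)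
  finally have "dim (span {v, b}) \<noteq> dim (UNIV :: (real ^ 4) set)" by simp
  then have "span {v, b} \<noteq> UNIV" by metis
  then obtain a where a: "a \<notin> span {v, b}" by blast
  obtain q where q: "q \<noteq> 0" "\<And>z. h (cvec a + z *s cvec b) = poly q z"
    using homogeneous_fn_along_line[OF h(2) b(2)] by blast
  have finq: "finite {z. poly q z = 0}" using q(1) by (rule poly_roots_finite)
  have "\<exists>p. p \<noteq> 0 \<and> (\<forall>c. F ((cvec a + z *s cvec b) + c *s cvec v) = poly p c)" for z
    using homogeneous_fn_along_line[OF F(2,3)] by blast
  then obtain p where p: "\<And>z. p z \<noteq> 0" "\<And>z c. F ((cvec a + z *s cvec b) + c *s cvec v) = poly (p z) c"
    by metis
  have "finite (\<Union>z\<in>{z. poly q z = 0}. {c. poly (p z) c = 0})"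
    using finq poly_roots_finite p(1) by blast
  then have "finite ((of_real :: real \<Rightarrow> complex) -` (\<Union>z\<in>{z. poly q z = 0}. {c. poly (p z) c = 0}))"
    by (rule finite_vimageI) (simp add: inj_of_real)
  then obtain c :: real where "c \<notin> of_real -` (\<Union>z\<in>{z. poly q z = 0}. {c. poly (p z) c = 0})"
    using ex_new_if_finite[OF infinite_UNIV_char_0] by blast
  then have c: "poly (p z) (of_real c) \<noteq> 0" if "poly q z = 0" for z using that by auto
  have ind: "s = 0 \<and> t = 0" if st: "s *\<^sub>R (a + c *\<^sub>R v) + t *\<^sub>R b = 0" for s t
  proof -
    have "s = 0"
    proof (rule ccontr)
      assume s: "s \<noteq> 0"
      have "s *\<^sub>R a = - (s * c) *\<^sub>R v - t *\<^sub>R b" using st by (simp add: algebra_simps eq_neg_iff_add_eq_0)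
      then have "s *\<^sub>R a \<in> span {v, b}" by (simp add: span_diff span_scale span_base span_neg)
      then have "(1 / s) *\<^sub>R (s *\<^sub>R a) \<in> span {v, b}" by (rule span_scale)
      then show False using a s by simp
    qed
    then show ?thesis using st b(1) by simp
  qed
  obtain k3 k4 where fr: "frame (a + c *\<^sub>R v) b k3 k4" using frame_exists[of "a + c *\<^sub>R v" b] ind by blast
  obtain s t where st: "(s, t) \<noteq> (0, 0)" "F (s *s cvec (a + c *\<^sub>R v) + t *s cvec b) = 0"
     "h (s *s cvec (a + c *\<^sub>R v) + t *s cvec b) = 0"
    using plane_meets_vanishing_forms[OF fr deg Z F(1) h(1)] by blast
  have "s *s cvec (a + c *\<^sub>R v) + t *s cvec b = (s *s cvec a + t *s cvec b) + (s * of_real c) *s cvec v"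
    by (simp add: vec_eq_iff algebra_simps)
  then have h0: "h (s *s cvec a + t *s cvec b) = 0"
    using st(3) h(3) unfolding invariant_along_def by metis
  show False
  proof (cases "s = 0")
    case True
    then show ?thesis using h0 st(1) b(2) homogeneous_fn_scale[OF h(2)] by simp
  next
    case False
    have "s *s cvec a + t *s cvec b = s *s (cvec a + (t / s) *s cvec b)"
      using False by (simp add: vec_eq_iff field_simps)
    then have "h (s *s cvec a + t *s cvec b) = s ^ dh * h (cvec a + (t / s) *s cvec b)"
      using homogeneous_fn_scale[OF h(2)] by metis
    then have "poly q (t / s) = 0" using h0 False q(2) by simp
    then have n: "F ((cvec a + (t / s) *s cvec b) + of_real c *s cvec v) \<noteq> 0" using c p(2) by simp
    have "s *s cvec (a + c *\<^sub>R v) + t *s cvec b = s *s ((cvec a + (t / s) *s cvec b) + of_real c *s cvec v)"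
      using False by (simp add: vec_eq_iff field_simps)
    then have "F (s *s cvec (a + c *\<^sub>R v) + t *s cvec b) =
        s ^ dF * F ((cvec a + (t / s) *s cvec b) + of_real c *s cvec v)"
      using homogeneous_fn_scale[OF F(2)] by metis
    then show ?thesis using n st(2) False by (metis mult_eq_0_iff power_not_zero)
  qed
qed

text \<open>
  If nothing but zero vanished on the circle planes, the hypotheses of
  \<open>three_zeros_imp_plane_zero\<close> would hold for every cubic with three real zeros on a line.
\<close>

lemma exists_nonzero_vanishing:
  assumes deg: "proj_surface_degree (X_of Z) 4"
  shows "\<exists>f\<in>vanishing (circle_planes Z). \<exists>x. f x \<noteq> 0"
proof (rule ccontr)
  assume no: "\<not> ?thesis"
  let ?k1 = "axis 1 1 :: real ^ 4" and ?k2 = "axis 2 1 - axis 1 1 :: real ^ 4"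
  have ind: "s = 0 \<and> t = 0" if "s *\<^sub>R ?k1 + t *\<^sub>R ?k2 = 0" for s t
  proof -
    have "(s *\<^sub>R ?k1 + t *\<^sub>R ?k2) $ 1 = 0" "(s *\<^sub>R ?k1 + t *\<^sub>R ?k2) $ 2 = 0" using that by simp_all
    then show ?thesis by (simp add: axis_def)
  qed
  obtain k3 k4 where fr: "frame ?k1 ?k2 k3 k4" using frame_exists[of ?k1 ?k2] ind by blast
  let ?F = "\<lambda>x :: complex ^ 4. x $ 1 * x $ 2 * (x $ 1 - x $ 2)"
  have line: "(cvec ?k1 + z *s cvec ?k2) $ 1 = 1 - z" "(cvec ?k1 + z *s cvec ?k2) $ 2 = z" for z
    by (simp_all add: axis_def)
  have "?F (cvec ?k1 + 2 *s cvec ?k2) = 0"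
  proof (rule three_zeros_imp_plane_zero[OF fr deg, where l = "\<lambda>_. 1" and A = "{0, 1, 1/2}" and F = ?F])
    show "polynomial_fn ?F" by (intro polynomial_fn_intros)
    show "f x = 0" if "f \<in> vanishing (circle_planes Z)" for f x using no that by blast
    show "?F (cvec ?k1 + of_real t *s cvec ?k2) = 0" if t: "t \<in> {0, 1, 1/2}" for t
    proof -
      consider "t = 0" | "t = 1" | "t = 1/2" using t by blast
      then show ?thesis
      proof cases
        case 3
        have "of_real (1 / 2) = (1 / 2 :: complex)" by simp
        then show ?thesis unfolding line 3 by simp
      qed (unfold line, simp_all)
    qed
  qed (auto intro: polynomial_fn_const)
  then show False unfolding line by simp
qed

text \<open>
  \<open>f\<close> as a polynomial of degree at most \<open>n\<close> in one coordinate, with coefficients that are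
  constant in the direction \<open>v\<close>. The coefficients beyond the degree \<open>d\<close> are required to be
  zero because \<open>d - k\<close> is truncated there.
\<close>

definition direction_expansion ::
    "complex ^ 'n \<Rightarrow> 'n \<Rightarrow> nat \<Rightarrow> nat \<Rightarrow> (complex ^ 'n \<Rightarrow> complex) \<Rightarrow> (nat \<Rightarrow> complex ^ 'n \<Rightarrow> complex) \<Rightarrow> bool" where
  "direction_expansion v i n d f a \<longleftrightarrow>
     (\<forall>k. homogeneous_fn (d - k) (a k) \<and> invariant_along v (a k)) \<and>
     (\<forall>k. k > n \<or> k > d \<longrightarrow> a k = (\<lambda>x. 0)) \<and>
     (\<forall>x. f x = (\<Sum>k\<le>n. a k x * (x $ i) ^ k))"

text \<open>
  For \<open>v\<^sub>i \<noteq> 0\<close> each coordinate is \<open>(x\<^sub>j - x\<^sub>i v\<^sub>j / v\<^sub>i) + (v\<^sub>j / v\<^sub>i) x\<^sub>i\<close>, and the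
  first summand is constant along \<open>v\<close>.
\<close>

lemma direction_expansion_exists:
  fixes f :: "complex ^ 'n \<Rightarrow> complex"
  assumes "homogeneous_fn d f" and vi: "v $ i \<noteq> 0"
  shows "\<exists>a. direction_expansion v i d d f a"
  using assms(1)
proof (induction rule: homogeneous_fn_induct)
  case (zero d)
  show ?case by (rule exI[of _ "\<lambda>_ _. 0"])
    (simp add: direction_expansion_def homogeneous_fn_zero invariant_along_def)
next
  case (const c)
  show ?case by (rule exI[of _ "\<lambda>k x. if k = 0 then c else 0"])
    (auto simp: direction_expansion_def invariant_along_def intro: homogeneous_fn_const homogeneous_fn_zero)
next
  case (coord j)
  define a where "a = (\<lambda>(k :: nat) (x :: complex ^ 'n). if k = 0 then x $ j - x $ i * (v $ j / v $ i)
     else if k = 1 then v $ j / v $ i else 0)"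
  have "homogeneous_fn 1 (\<lambda>x :: complex ^ 'n. x $ j + (- (v $ j / v $ i)) * x $ i)"
    by (intro homogeneous_fn_add homogeneous_fn_cmult homogeneous_fn_coord)
  then have "homogeneous_fn (1 - k) (a k)" for k
    unfolding a_def
    by (cases "k = 0") (auto simp: algebra_simps intro: homogeneous_fn_const homogeneous_fn_zero)
  moreover have "invariant_along v (a k)" for k
    unfolding invariant_along_def a_def using vi by (auto simp: field_simps)
  moreover have "x $ j = (\<Sum>k\<le>1. a k x * (x $ i) ^ k)" for x by (simp add: a_def)
  ultimately show ?case unfolding direction_expansion_def
    by (intro exI[of _ a]) (auto simp: a_def)
next
  case (add d f g)
  then obtain a b where ab: "direction_expansion v i d d f a" "direction_expansion v i d d g b" by blast
  then show ?case unfolding direction_expansion_def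
    by (intro exI[of _ "\<lambda>k x. a k x + b k x"])
       (auto simp: invariant_along_def sum.distrib distrib_right intro!: homogeneous_fn_add)
next
  case (mult d e f g)
  then obtain a b where ab: "direction_expansion v i d d f a" "direction_expansion v i e e g b" by blast
  define c where "c = (\<lambda>r x. \<Sum>k\<le>r. a k x * b (r - k) x)"
  have hom: "homogeneous_fn (d + e - r) (\<lambda>x. a k x * b (r - k) x)" if "k \<le> r" for k r
  proof (cases "k \<le> d \<and> r - k \<le> e")
    case True
    then have "d + e - r = (d - k) + (e - (r - k))" using that by auto
    then show ?thesis using ab homogeneous_fn_mult unfolding direction_expansion_def by metis
  next
    case False
    then have "a k = (\<lambda>x. 0) \<or> b (r - k) = (\<lambda>x. 0)" using ab unfolding direction_expansion_def by auto
    then have "(\<lambda>x. a k x * b (r - k) x) = (\<lambda>x. 0)" by auto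
    then show ?thesis by (simp add: homogeneous_fn_zero)
  qed
  have "homogeneous_fn (d + e - r) (c r)" for r unfolding c_def by (rule homogeneous_fn_sum) (use hom in auto)
  moreover have "invariant_along v (c r)" for r
    using ab unfolding direction_expansion_def invariant_along_def c_def by simp
  moreover have "c r = (\<lambda>x. 0)" if "r > d + e" for r
  proof -
    have "a k x * b (r - k) x = 0" if "k \<le> r" for k x
    proof -
      have "k > d \<or> r - k > e" using \<open>r > d + e\<close> that by auto
      then show ?thesis using ab unfolding direction_expansion_def by auto
    qed
    then show ?thesis unfolding c_def by (intro ext sum.neutral) auto
  qed
  moreover have "f x * g x = (\<Sum>r\<le>d + e. c r x * (x $ i) ^ r)" for x
  proof -
    have "f x = (\<Sum>k\<le>d. a k x * (x $ i) ^ k)" "g x = (\<Sum>k\<le>e. b k x * (x $ i) ^ k)"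
      using ab unfolding direction_expansion_def by blast+
    moreover have "\<And>k. k > d \<Longrightarrow> a k x = 0" "\<And>k. k > e \<Longrightarrow> b k x = 0"
      using ab unfolding direction_expansion_def by auto
    ultimately show ?thesis unfolding c_def using polynomial_product[of d "\<lambda>k. a k x" e "\<lambda>k. b k x" "x $ i"] by simp
  qed
  ultimately show ?case unfolding direction_expansion_def by blast
qed

lemma direction_expansion_homogeneous:
  assumes "direction_expansion v i n d f a" shows "homogeneous_fn d f"
proof -
  have "homogeneous_fn d (\<lambda>x. a k x * (x $ i) ^ k)" for k
  proof (cases "k \<le> d")
    case True
    have "homogeneous_fn k (\<lambda>x. (x $ i) ^ k)" using homogeneous_fn_power[OF homogeneous_fn_coord, of k i] by simp
    then show ?thesis
      using assms homogeneous_fn_mult[of "d - k" "a k" k] True unfolding direction_expansion_def by auto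
  next
    case False
    then show ?thesis using assms unfolding direction_expansion_def by (auto simp: homogeneous_fn_zero)
  qed
  then have "homogeneous_fn d (\<lambda>x. \<Sum>k\<le>n. a k x * (x $ i) ^ k)" by (rule homogeneous_fn_sum)
  moreover have "f = (\<lambda>x. \<Sum>k\<le>n. a k x * (x $ i) ^ k)" using assms unfolding direction_expansion_def by auto
  ultimately show ?thesis by simp
qed

lemma direction_expansion_drop:
  assumes "direction_expansion v i n d f a" "a n = (\<lambda>x. 0)"
  shows "n = 0 \<and> f = (\<lambda>x. 0) \<or> n > 0 \<and> direction_expansion v i (n - 1) d f a"
proof (cases n)
  case 0 then show ?thesis using assms unfolding direction_expansion_def by auto
next
  case (Suc m)
  have "a k = (\<lambda>x. 0)" if "k > m" for k using assms that Suc unfolding direction_expansion_def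
    by (cases "k = n") auto
  then show ?thesis using assms Suc unfolding direction_expansion_def by auto
qed

text \<open>
  Pseudo-division by a vanishing form \<open>F\<close> of least degree in the direction \<open>v\<close>:
  multiplying by the leading coefficient of \<open>F\<close> and subtracting a multiple of \<open>F\<close> lowers
  the degree of \<open>f\<close> and keeps its zeros where \<open>F = 0\<close> and the leading coefficient is not
  zero.
\<close>

lemma pseudo_division_zero:
  assumes F: "direction_expansion v i n dF F a" "F \<in> vanishing D" "a n \<noteq> (\<lambda>x. 0)"
    and least: "\<And>m d f b. m < n \<Longrightarrow> direction_expansion v i m d f b \<Longrightarrow> f \<in> vanishing D \<Longrightarrow> f = (\<lambda>x. 0)"
    and f: "direction_expansion v i N d f b" "f \<in> vanishing D"
    and x: "F x = 0" "a n x \<noteq> 0"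
  shows "f x = 0"
  using f
proof (induction N arbitrary: d f b rule: less_induct)
  case (less N)
  show ?case
  proof (cases "N < n")
    case True
    then have "f = (\<lambda>x. 0)" using least[OF _ less.prems] by blast
    then show ?thesis by simp
  next
    case Nn: False
    show ?thesis
    proof (cases "b N = (\<lambda>x. 0)")
      case True
      then show ?thesis using direction_expansion_drop[OF less.prems(1)] less.IH[of "N - 1"] less.prems(2)
        by (metis diff_less zero_less_one)
    next
      case bN: False
      have nd: "n \<le> dF" using F(1,3) unfolding direction_expansion_def by (meson not_le)
      have Nd: "N \<le> d" using less.prems(1) bN unfolding direction_expansion_def by (meson not_le)
      define c where "c = (\<lambda>k x. a n x * b k x + (if k < N - n then 0 else (-1) * (b N x * a (k - (N - n)) x)))"
      \<comment> \<open>The pseudo-remainder: its coefficient \<open>c N\<close> cancels.\<close>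
      define f' where "f' = (\<lambda>x. a n x * f x + (-1) * (b N x * (x $ i) ^ (N - n) * F x))"
      have A: "\<And>k. homogeneous_fn (dF - k) (a k)" "\<And>k. invariant_along v (a k)"
        "\<And>k. k > n \<or> k > dF \<Longrightarrow> a k = (\<lambda>x. 0)" "\<And>x. F x = (\<Sum>k\<le>n. a k x * (x $ i) ^ k)"
        using F(1) unfolding direction_expansion_def by auto
      have B: "\<And>k. homogeneous_fn (d - k) (b k)" "\<And>k. invariant_along v (b k)"
        "\<And>k. k > N \<or> k > d \<Longrightarrow> b k = (\<lambda>x. 0)" "\<And>x. f x = (\<Sum>k\<le>N. b k x * (x $ i) ^ k)"
        using less.prems(1) unfolding direction_expansion_def by auto
      have h1: "homogeneous_fn (d + dF - n - k) (\<lambda>x. a n x * b k x)" for k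
      proof (cases "k \<le> d")
        case True
        then have "d + dF - n - k = (dF - n) + (d - k)" using nd by simp
        then show ?thesis using homogeneous_fn_mult[OF A(1) B(1)] by metis
      next
        case False then show ?thesis using B(3)[of k] by (simp add: homogeneous_fn_zero)
      qed
      have h2: "homogeneous_fn (d + dF - n - k) (\<lambda>x. b N x * a (k - (N - n)) x)" if "\<not> k < N - n" for k
      proof (cases "k - (N - n) \<le> dF")
        case True
        then have "d + dF - n - k = (d - N) + (dF - (k - (N - n)))" using nd Nd Nn that by simp
        then show ?thesis using homogeneous_fn_mult[OF B(1) A(1)] by metis
      next
        case False then show ?thesis using A(3)[of "k - (N - n)"] by (simp add: homogeneous_fn_zero)
      qed
      have hc: "homogeneous_fn (d + dF - n - k) (c k)" for k
      proof -
        have "homogeneous_fn (d + dF - n - k)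
            (\<lambda>x. if k < N - n then 0 else (-1) * (b N x * a (k - (N - n)) x))"
          using homogeneous_fn_cmult[OF h2[of k]] by (cases "k < N - n") (simp_all only: if_True if_False homogeneous_fn_zero simp_thms)
        then show ?thesis unfolding c_def by (rule homogeneous_fn_add[OF h1])
      qed
      have ic: "invariant_along v (c k)" for k
        using A(2) B(2) unfolding c_def invariant_along_def by simp
      have cN: "c N = (\<lambda>x. 0)" unfolding c_def using Nn by (auto simp: mult.commute)
      have c0: "c k = (\<lambda>x. 0)" if "k > N \<or> k > d + dF - n" for k
      proof -
        have "b k = (\<lambda>x. 0)" using that B(3) nd by (metis Nat.add_diff_assoc le_add1 le_less_trans)
        moreover have "a (k - (N - n)) = (\<lambda>x. 0)" if "\<not> k < N - n"
          using A(3)[of "k - (N - n)"] \<open>k > N \<or> k > d + dF - n\<close> Nn nd Nd that by force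
        ultimately show ?thesis unfolding c_def by auto
      qed
      have sum: "f' x = (\<Sum>k\<le>N. c k x * (x $ i) ^ k)" for x
      proof -
        have "(\<Sum>k\<le>N. (if k < N - n then 0 else b N x * a (k - (N - n)) x) * (x $ i) ^ k)
           = (\<Sum>k\<in>{N - n..N}. b N x * a (k - (N - n)) x * (x $ i) ^ k)"
          by (rule sum.mono_neutral_cong_right) auto
        also have "\<dots> = (\<Sum>k\<le>n. b N x * a k x * (x $ i) ^ (k + (N - n)))"
          by (rule sum.reindex_bij_witness[of _ "\<lambda>k. k + (N - n)" "\<lambda>k. k - (N - n)"]) (use Nn in auto)
        also have "\<dots> = b N x * (x $ i) ^ (N - n) * F x"
          unfolding A(4) sum_distrib_left by (rule sum.cong) (auto simp: power_add)
        finally have *: "(\<Sum>k\<le>N. (if k < N - n then 0 else b N x * a (k - (N - n)) x) * (x $ i) ^ k)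
           = b N x * (x $ i) ^ (N - n) * F x" .
        have "c k x * (x $ i) ^ k = a n x * (b k x * (x $ i) ^ k) -
            (if k < N - n then 0 else b N x * a (k - (N - n)) x) * (x $ i) ^ k" for k
          by (simp add: c_def algebra_simps)
        then have "(\<Sum>k\<le>N. c k x * (x $ i) ^ k) = a n x * f x - b N x * (x $ i) ^ (N - n) * F x"
          using * by (simp add: sum_subtractf B(4) sum_distrib_left)
        then show ?thesis by (simp add: f'_def)
      qed
      have ex: "direction_expansion v i N (d + dF - n) f' c"
        unfolding direction_expansion_def using hc ic c0 sum by blast
      have "f' \<in> vanishing D"
      proof -
        have "polynomial_fn f'" using direction_expansion_homogeneous[OF ex] by (rule homogeneous_imp_polynomial_fn)
        then show ?thesis using F(2) less.prems(2) unfolding vanishing_def f'_def by simp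
      qed
      then have "f' x = 0"
        using direction_expansion_drop[OF ex cN] less.IH[of "N - 1"]
        by (metis diff_less zero_less_one)
      then show ?thesis using x by (simp add: f'_def)
    qed
  qed
qed

text \<open>
  A vanishing form \<open>F\<close> of least degree in a suitable direction plays the role of the
  equation of the projected surface. Its leading coefficient \<open>l\<close> is constant in that
  direction and so does not vanish on the surface, and outside the zeros of \<open>l\<close> the zeros
  of \<open>F\<close> are zeros of every vanishing function. This replaces the statement that the
  projected surface is a hypersurface.
\<close>

lemma exists_hypersurface_equation:
  assumes deg: "proj_surface_degree (X_of Z) 4" and Z: "great Z"
  shows "\<exists>F l dF dl. F \<in> vanishing (circle_planes Z) \<and> homogeneous_fn dF F \<and> (\<exists>x. F x \<noteq> 0) \<and>
    homogeneous_fn dl l \<and> l \<notin> vanishing (circle_planes Z) \<and>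
    (\<forall>x. F x = 0 \<longrightarrow> l x \<noteq> 0 \<longrightarrow> (\<forall>f\<in>vanishing (circle_planes Z). f x = 0))"
proof -
  let ?I = "vanishing (circle_planes Z)"
  have sub: "\<And>P. P \<in> circle_planes Z \<Longrightarrow> subspace P" by (rule circle_planesD)
  obtain f0 x0 where f0: "f0 \<in> ?I" "f0 x0 \<noteq> 0" using exists_nonzero_vanishing[OF deg] by blast
  have hom_parts: "\<exists>d g. homogeneous_fn d g \<and> g \<in> ?I \<and> g x \<noteq> 0" if f: "f \<in> ?I" "f x \<noteq> 0" for f x
  proof -
    have pf: "polynomial_fn f" using f by (simp add: vanishing_def)
    obtain N h where "(\<forall>d. homogeneous_fn d (h d)) \<and> (\<forall>x. f x = (\<Sum>d\<le>(N::nat). h d x))"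
      using polynomial_fn_homogeneous_parts[OF pf] by auto
    then have h: "\<And>d. homogeneous_fn d (h d)" "\<And>x. f x = (\<Sum>d\<le>N. h d x)" by auto
    obtain d where d: "d \<le> N" "h d x \<noteq> 0"
      using f(2) unfolding h(2) using sum.neutral[of "{..N}" "\<lambda>d. h d x"] by (metis atMost_iff)
    then show ?thesis using h(1)[of d] vanishing_homogeneous_parts[OF h f(1) sub d(1)] by blast
  qed
  obtain d1 F1 where F1: "homogeneous_fn d1 F1" "F1 \<in> ?I" "F1 x0 \<noteq> 0" using hom_parts[OF f0] by blast
  obtain v where v: "v \<noteq> 0" "F1 (cvec v) \<noteq> 0"
    using homogeneous_fn_nonzero_at_nonzero_real[OF F1(1,3)] by blast
  obtain i where i: "cvec v $ i \<noteq> 0" using v(1) by (auto simp: vec_eq_iff)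
  define Q where "Q = (\<lambda>n. \<exists>d f a. direction_expansion (cvec v) i n d f a \<and> f \<in> ?I \<and> f \<noteq> (\<lambda>x. 0))"
  have "Q d1" using direction_expansion_exists[OF F1(1) i] F1 unfolding Q_def by force
  define n where "n = (LEAST n. Q n)"
  have L: "Q n" "\<And>m. m < n \<Longrightarrow> \<not> Q m"
    using LeastI[of Q, OF \<open>Q d1\<close>] not_less_Least[of _ Q] unfolding n_def by blast+
  obtain dF F a where F: "direction_expansion (cvec v) i n dF F a" "F \<in> ?I" "F \<noteq> (\<lambda>x. 0)"
    using L(1) unfolding Q_def by blast
  have least: "f = (\<lambda>x. 0)" if "m < n" "direction_expansion (cvec v) i m d f b" "f \<in> ?I" for m d f b
    using L(2)[of m] that unfolding Q_def by blast
  have an: "a n \<noteq> (\<lambda>x. 0)"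
  proof
    assume "a n = (\<lambda>x. 0)"
    then show False using direction_expansion_drop[OF F(1)] least[of "n - 1"] F(2,3) by force
  qed
  have A: "homogeneous_fn (dF - n) (a n)" "invariant_along (cvec v) (a n)"
    using F(1) unfolding direction_expansion_def by auto
  have "a n \<notin> ?I"
    using no_invariant_vanishing_form[OF deg Z F1(2,1) v(2) _ A] an by blast
  moreover have "f x = 0" if x: "F x = 0" "a n x \<noteq> 0" and f: "f \<in> ?I" for f x
  proof (rule ccontr)
    assume "f x \<noteq> 0"
    then obtain d g where g: "homogeneous_fn d g" "g \<in> ?I" "g x \<noteq> 0" using hom_parts[OF f] by blast
    obtain b where b: "direction_expansion (cvec v) i d d g b"
      using direction_expansion_exists[OF g(1) i] by blast
    have "g x = 0"
      by (rule pseudo_division_zero[OF F(1,2) an _ b g(2) x]) (rule least)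
    then show False using g(3) by simp
  qed
  moreover have "homogeneous_fn dF F" by (rule direction_expansion_homogeneous[OF F(1)])
  moreover have "\<exists>x. F x \<noteq> 0" using F(3) by auto
  ultimately show ?thesis using F(2) A(1) by blast
qed

section \<open>Pencils of lines: planes that meet in a vector\<close>

lemma plane_eq_span:
  fixes P :: "(real ^ 'n) set"
  assumes P: "subspace P" "dim P = 2" and xy: "x \<in> P" "y \<in> P" "x \<noteq> 0" "y \<notin> span {x}"
  shows "P = span {x, y}"
proof -
  have neq: "y \<noteq> x" using xy(4) span_base[of x "{x}"] by auto
  have "independent {y, x}" using xy by (intro independent_insertI) (auto simp: independent_empty)
  then have "dim (span {y, x}) = 2" using neq by (simp add: dim_eq_card_independent)
  moreover have "span {y, x} \<subseteq> P" using P(1) xy by (intro span_minimal) auto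
  ultimately have "span {y, x} = P" using P by (intro subspace_dim_equal) auto
  then show ?thesis by (simp add: insert_commute)
qed

definition skew :: "(real ^ 'n) set \<Rightarrow> (real ^ 'n) set \<Rightarrow> bool" where
  "skew P Q \<longleftrightarrow> P \<inter> Q \<subseteq> {0}"

lemma skew_commute: "skew P Q \<longleftrightarrow> skew Q P"
  by (auto simp: skew_def)

text \<open>
  In projective terms: a line that meets two intersecting lines passes through their
  common point or lies in their plane.
\<close>

lemma planes_meeting_two_planes:
  fixes P1 P2 :: "(real ^ 4) set"
  assumes P1: "subspace P1" "dim P1 = 2" and P2: "subspace P2" "dim P2 = 2"
    and ne: "P1 \<noteq> P2" "\<not> skew P1 P2"
  shows "\<exists>k w. k \<noteq> 0 \<and> w \<noteq> 0 \<and> (\<forall>P. subspace P \<longrightarrow> dim P = 2 \<longrightarrow> \<not> skew P P1 \<longrightarrow> \<not> skew P P2 \<longrightarrow>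
      k \<in> P \<or> (\<forall>y\<in>P. w \<bullet> y = 0))"
proof -
  obtain k where k: "k \<in> P1" "k \<in> P2" "k \<noteq> 0" using ne(2) by (auto simp: skew_def)
  let ?S = "{x + y | x y. x \<in> P1 \<and> y \<in> P2}"
  have "dim (P1 \<inter> P2) \<noteq> 0" using k by (auto simp: dim_eq_0)
  moreover have "dim ?S + dim (P1 \<inter> P2) = 4" using dim_sums_Int[OF P1(1) P2(1)] P1 P2 by simp
  ultimately have "dim ?S < 4" by linarith
  then have "dim ?S < DIM(real ^ 4)" by simp
  then obtain w where w: "w \<noteq> 0" "\<And>y. y \<in> span ?S \<Longrightarrow> orthogonal w y"
    using orthogonal_to_subspace_exists by blast
  have main: "k \<in> P \<or> (\<forall>y\<in>P. w \<bullet> y = 0)"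
    if P: "subspace P" "dim P = 2" "\<not> skew P P1" "\<not> skew P P2" for P
  proof -
    obtain x y where xy: "x \<in> P" "x \<in> P1" "x \<noteq> 0" "y \<in> P" "y \<in> P2" "y \<noteq> 0"
      using P(3,4) by (auto simp: skew_def)
    show ?thesis
    proof (cases "y \<in> span {x}")
      case True
      then have "y \<in> P1" using span_minimal[of "{x}" P1] xy P1(1) by auto
      have "k \<in> span {y}"
      proof (rule ccontr)
        assume "k \<notin> span {y}"
        then have "P1 = span {y, k}" "P2 = span {y, k}"
          using plane_eq_span[OF P1, of y k] plane_eq_span[OF P2, of y k] k xy \<open>y \<in> P1\<close> by auto
        then show False using ne(1) by simp
      qed
      then show ?thesis using span_minimal[of "{y}" P] xy P(1) by auto
    next
      case False
      then have "P = span {x, y}" using plane_eq_span[OF P(1,2)] xy by blast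
      moreover have "x \<in> ?S" using xy(2) subspace_0[OF P2(1)] by force
      moreover have "y \<in> ?S" using xy(5) subspace_0[OF P1(1)] by force
      ultimately have "P \<subseteq> span ?S" by (simp add: span_mono)
      then show ?thesis using w(2) unfolding orthogonal_def by blast
    qed
  qed
  show ?thesis
    by (rule exI[of _ k], rule exI[of _ w]) (use main k(3) w(1) in blast)
qed

text \<open>
  The properties that great ring cyclides and great Perseus cyclides have in common.
\<close>

locale great_cyclide =
  fixes Z :: "(real ^ 3) set"
  assumes great: "great Z" and irreducible: "zariski_irreducible Z"
    and degree: "proj_surface_degree (X_of Z) 4"
    and smooth: "without_real_singularities (X_of Z)"
begin

lemma dense_planesD:
  assumes "dense_planes Z D" "P \<in> D"
  shows "P \<in> circle_planes Z" "subspace P" "dim P = 2"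
  using assms circle_planesD unfolding dense_planes_def by blast+

text \<open>
  A dense family in a hyperplane would put the surface into it.
\<close>

lemma dense_planes_not_in_hyperplane:
  assumes D: "dense_planes Z D" and w: "w \<noteq> 0" "\<And>P y. P \<in> D \<Longrightarrow> y \<in> P \<Longrightarrow> w \<bullet> y = 0"
  shows False
proof -
  let ?f = "\<lambda>y :: complex ^ 4. \<Sum>i\<in>UNIV. cvec w $ i * y $ i"
  have fw: "?f (cvec y) = of_real (w \<bullet> y)" for y by (simp add: inner_vec_def)
  have "polynomial_fn ?f" by (intro polynomial_fn_intros)
  then have "?f \<in> vanishing D" using w(2) fw unfolding vanishing_def by (simp del: cvec_nth)
  then have "?f \<in> vanishing (circle_planes Z)" using D unfolding dense_planes_def by blast
  then have "?f (cvec y) = 0" if "y \<in> stereo_preimage Z" for y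
    using vanishing_on_preimage[OF great _ that] by blast
  then have "w \<bullet> y = 0" if "y \<in> stereo_preimage Z" for y
    using that fw[of y] by (metis of_real_eq_0_iff)
  then show False using preimage_not_in_hyperplane[OF degree w(1)] by blast
qed

lemma dense_planes_split:
  assumes "dense_planes Z D" "D \<subseteq> D1 \<union> D2"
  shows "dense_planes Z (D \<inter> D1) \<or> dense_planes Z (D \<inter> D2)"
  by (rule dense_planes_union[OF irreducible great assms])

text \<open>
  At a real point \<open>(1 : k)\<close>, each great circle through \<open>k\<close> on the surface contributes its
  tangent direction.
\<close>

lemma vertex_tangent_space:
  assumes k: "norm k = 1" and v: "v = hom_coords k"
  shows "vec.subspace (cone_tangent_space (X_of Z) v)"
    and "v \<in> X_of Z \<Longrightarrow> v \<in> cone_tangent_space (X_of Z) v"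
    and "P \<in> circle_planes Z \<Longrightarrow> k \<in> P \<Longrightarrow> w \<in> P \<Longrightarrow> k \<bullet> w = 0 \<Longrightarrow>
      hcons 0 (cvec w) \<in> cone_tangent_space (X_of Z) v"
proof -
  let ?T = "cone_tangent_space (X_of Z) v"
  have grad: "\<exists>G. curve_gradient f v G" if "homogeneous_fn d f" for d f
    by (rule polynomial_fn_has_curve_gradient[OF homogeneous_imp_polynomial_fn[OF that]])
  have line: "\<forall>i. ((\<lambda>t. (v + t *s w) $ i) has_field_derivative w $ i) (at 0)" for w
    by (auto intro!: derivative_eq_intros)
  have der: "deriv (\<lambda>t. f (v + t *s w)) 0 = (\<Sum>i\<in>UNIV. G $ i * w $ i)"
    if G: "curve_gradient f v G" for f G w
  proof -
    have "((\<lambda>t. f (v + t *s w)) has_field_derivative (\<Sum>i\<in>UNIV. G $ i * w $ i)) (at 0)"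
      using G[unfolded curve_gradient_def, rule_format, of "\<lambda>t. v + t *s w" w] line by simp
    then show ?thesis by (rule DERIV_imp_deriv)
  qed
  have zero: "0 \<in> ?T" unfolding cone_tangent_space_def by simp
  show "vec.subspace ?T"
    unfolding vec.subspace_def
  proof (intro conjI ballI allI zero)
    fix x y assume xy: "x \<in> ?T" "y \<in> ?T"
    show "x + y \<in> ?T"
      unfolding cone_tangent_space_def
    proof (intro CollectI allI impI)
      fix d f assume f: "homogeneous_fn d f" "\<forall>u\<in>X_of Z. f u = 0"
      obtain G where G: "curve_gradient f v G" using grad[OF f(1)] by blast
      have "(\<Sum>i\<in>UNIV. G $ i * x $ i) = 0" "(\<Sum>i\<in>UNIV. G $ i * y $ i) = 0"
        using xy f unfolding cone_tangent_space_def by (simp_all flip: der[OF G])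
      then show "deriv (\<lambda>t. f (v + t *s (x + y))) 0 = 0"
        unfolding der[OF G] by (simp add: distrib_left sum.distrib)
    qed
  next
    fix c x assume x: "x \<in> ?T"
    show "c *s x \<in> ?T"
      unfolding cone_tangent_space_def
    proof (intro CollectI allI impI)
      fix d f assume f: "homogeneous_fn d f" "\<forall>u\<in>X_of Z. f u = 0"
      obtain G where G: "curve_gradient f v G" using grad[OF f(1)] by blast
      have "(\<Sum>i\<in>UNIV. G $ i * x $ i) = 0"
        using x f unfolding cone_tangent_space_def by (simp flip: der[OF G])
      then have "c * (\<Sum>i\<in>UNIV. G $ i * x $ i) = 0" by simp
      then show "deriv (\<lambda>t. f (v + t *s (c *s x))) 0 = 0"
        unfolding der[OF G] by (simp add: sum_distrib_left mult_ac)
    qed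
  qed
  show "v \<in> ?T" if "v \<in> X_of Z"
    unfolding cone_tangent_space_def
  proof (intro CollectI allI impI)
    fix d f assume f: "homogeneous_fn d f" "\<forall>u\<in>X_of Z. f u = 0"
    have "v + t *s v = (1 + t) *s v" for t by (simp add: vec_eq_iff algebra_simps)
    then have "f (v + t *s v) = (1 + t) ^ d * f v" for t using homogeneous_fn_scale[OF f(1)] by metis
    then have "(\<lambda>t. f (v + t *s v)) = (\<lambda>t. 0)" using f(2) that by simp
    then show "deriv (\<lambda>t. f (v + t *s v)) 0 = 0" by simp
  qed
  show "hcons 0 (cvec w) \<in> ?T" if P: "P \<in> circle_planes Z" "k \<in> P" "w \<in> P" "k \<bullet> w = 0"
  proof (cases "w = 0")
    case True
    then have "hcons 0 (cvec w) = (0 :: complex ^ 4 option)" by (simp add: hcons_eq_0_iff)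
    then show ?thesis using zero by simp
  next
    case False
    define u where "u = (1 / norm w) *\<^sub>R w"
    have u: "norm u = 1" "k \<bullet> u = 0" "u \<in> P"
      using False P circle_planesD(1)[OF P(1)] by (auto simp: u_def subspace_scale)
    define \<gamma> where "\<gamma> = (\<lambda>t::complex. hcons 1 (cos t *s cvec k + sin t *s cvec u))"
    have gX: "\<gamma> t \<in> X_of Z" for t
      unfolding \<gamma>_def
    proof (rule X_of_memI)
      have in_c: "(\<Sum>i\<in>UNIV. cvec a $ i * cvec b $ i) = of_real (a \<bullet> b)" for a b :: "real ^ 4"
        by (simp add: inner_vec_def)
      show "1\<^sup>2 = (\<Sum>i\<in>UNIV. ((cos t *s cvec k + sin t *s cvec u) $ i)\<^sup>2)"
        using sum_squares_combination[of "cos t" "cvec k" "sin t" "cvec u" 0 0 0 0] k u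
        unfolding in_c by (simp add: norm_eq_1)
      show "hcons 1 (cos t *s cvec k + sin t *s cvec u) \<noteq> 0" by (simp add: hcons_eq_0_iff)
      fix f assume f: "f \<in> vanishing (circle_planes Z)"
      show "f (cos t *s cvec k + sin t *s cvec u) = 0"
      proof (rule polynomial_fn_zero_on_real_span)
        show "polynomial_fn f" using f by (simp add: vanishing_def)
        fix a b :: real
        have "a *\<^sub>R k + b *\<^sub>R u \<in> P" using P(2) u(3) circle_planesD(1)[OF P(1)] by (simp add: subspace_add subspace_scale)
        then show "f (cvec (a *\<^sub>R k + b *\<^sub>R u)) = 0" using f P(1) unfolding vanishing_def by blast
      qed
    qed
    have g0: "\<gamma> 0 = v" by (simp add: \<gamma>_def v hom_coords_eq_hcons)
    have gd: "\<forall>i. ((\<lambda>t. \<gamma> t $ i) has_field_derivative hcons 0 (cvec u) $ i) (at 0)"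
    proof
      fix i :: "4 option"
      show "((\<lambda>t. \<gamma> t $ i) has_field_derivative hcons 0 (cvec u) $ i) (at 0)"
        by (cases i) (auto simp: \<gamma>_def intro!: derivative_eq_intros)
    qed
    have "hcons 0 (cvec u) \<in> ?T"
      unfolding cone_tangent_space_def
    proof (intro CollectI allI impI)
      fix d f assume f: "homogeneous_fn d f" "\<forall>u\<in>X_of Z. f u = 0"
      obtain G where G: "curve_gradient f v G" using grad[OF f(1)] by blast
      have "(\<lambda>t. f (\<gamma> t)) = (\<lambda>t. 0)" using f(2) gX by auto
      moreover have "((\<lambda>t. f (\<gamma> t)) has_field_derivative (\<Sum>i\<in>UNIV. G $ i * hcons 0 (cvec u) $ i)) (at 0)"
        using G[unfolded curve_gradient_def] g0 gd by blast
      ultimately have "((\<lambda>t::complex. 0 :: complex) has_field_derivative (\<Sum>i\<in>UNIV. G $ i * hcons 0 (cvec u) $ i)) (at 0)"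
        by simp
      then have "(\<Sum>i\<in>UNIV. G $ i * hcons 0 (cvec u) $ i) = 0"
        using DERIV_unique DERIV_const by blast
      then show "deriv (\<lambda>t. f (v + t *s hcons 0 (cvec u))) 0 = 0" unfolding der[OF G] .
    qed
    then have "of_real (norm w) *s hcons 0 (cvec u) \<in> ?T"
      using \<open>vec.subspace ?T\<close> by (simp add: vec.subspace_def)
    moreover have "of_real (norm w) *s hcons 0 (cvec u) = hcons 0 (cvec w)"
      using False by (simp add: hcons_smult u_def cvec_scaleR)
    ultimately show ?thesis by simp
  qed
qed

text \<open>
  The vertex of a cone is singular: if all planes of a dense family contained \<open>k\<close>, the
  tangents of their circles at \<open>k\<close> would, with \<open>k\<close>, span the whole space, since the planes
  do not lie in a hyperplane. The tangent space at \<open>(1 : k)\<close> would then have dimension at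
  least 4.
\<close>

lemma dense_planes_no_common_vector:
  assumes D: "dense_planes Z D" and k0: "k0 \<noteq> 0" "\<And>P. P \<in> D \<Longrightarrow> k0 \<in> P"
  shows False
proof -
  define k where "k = (1 / norm k0) *\<^sub>R k0"
  have k: "norm k = 1" "\<And>P. P \<in> D \<Longrightarrow> k \<in> P"
    using k0 dense_planesD(2)[OF D] by (auto simp: k_def subspace_scale)
  define v where "v = hom_coords k"
  let ?T = "cone_tangent_space (X_of Z) v"
  have ax: "axis 1 1 \<noteq> (0 :: real ^ 4)" by (simp add: axis_eq_0_iff)
  have "D \<noteq> {}" using dense_planes_not_in_hyperplane[OF D ax] by auto
  then obtain P0 where P0: "P0 \<in> D" by blast
  have vX: "v \<in> X_of Z"
    unfolding v_def hom_coords_eq_hcons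
  proof (rule X_of_memI)
    show "1\<^sup>2 = (\<Sum>i\<in>UNIV. (cvec k $ i)\<^sup>2)" unfolding sum_squares_cvec k(1) by simp
    show "hcons 1 (cvec k) \<noteq> 0" by (simp add: hcons_eq_0_iff)
    show "f (cvec k) = 0" if "f \<in> vanishing (circle_planes Z)" for f
      using that k(2)[OF P0] dense_planesD(1)[OF D P0] unfolding vanishing_def by blast
  qed
  note T = vertex_tangent_space[OF k(1) v_def]
  define W where "W = {w. hcons 0 (cvec w) \<in> ?T}"
  have full: "span (insert k W) = UNIV"
  proof (rule ccontr)
    assume "span (insert k W) \<noteq> UNIV"
    then obtain m where l: "m \<noteq> 0" "\<forall>x\<in>span (insert k W). m \<bullet> x = 0"
      using span_not_UNIV_orthogonal by blast
    have "m \<bullet> y = 0" if P: "P \<in> D" "y \<in> P" for P y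
    proof -
      have sP: "subspace P" using dense_planesD(2)[OF D P(1)] .
      define z where "z = y - (k \<bullet> y) *\<^sub>R k"
      have "z \<in> P" unfolding z_def using sP P k(2) by (simp add: subspace_diff subspace_scale)
      moreover have "k \<bullet> z = 0" using k(1) by (simp add: z_def inner_diff_right norm_eq_1)
      ultimately have "z \<in> W" unfolding W_def using T(3)[OF dense_planesD(1)[OF D P(1)] k(2)[OF P(1)]] by blast
      then have "m \<bullet> z = 0" "m \<bullet> k = 0" using l(2) by (auto intro: span_base)
      then show ?thesis unfolding z_def by (simp add: inner_diff_right)
    qed
    then show False using dense_planes_not_in_hyperplane[OF D l(1)] by blast
  qed
  let ?S = "vec.span (insert (hcons 0 (cvec k)) ?T)"
  have real_in: "hcons 0 (cvec y) \<in> ?S" for y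
  proof -
    have "y \<in> span (insert k W)" using full by simp
    then show ?thesis
    proof (induction rule: span_induct_alt)
      case base
      have "hcons 0 (cvec 0) = (0 :: complex ^ 4 option)" by (simp add: hcons_eq_0_iff)
      then show ?case using vec.span_zero by metis
    next
      case (step c x y)
      have "hcons 0 (cvec x) \<in> ?S"
        using step(1) unfolding W_def by (auto intro: vec.span_base)
      then have "of_real c *s hcons 0 (cvec x) + hcons 0 (cvec y) \<in> ?S"
        using step(2) by (intro vec.span_add vec.span_scale)
      moreover have "of_real c *s hcons 0 (cvec x) + hcons 0 (cvec y) = hcons 0 (cvec (c *\<^sub>R x + y))"
        by (simp add: vec_option_eq_iff)
      ultimately show ?case by simp
    qed
  qed
  have "u \<in> ?S" for u
  proof -
    obtain y0 y where u: "u = hcons y0 y" using hcons_cases by blast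
    obtain a b where y: "y = cvec a + \<i> *s cvec b" using cvec_real_imag by blast
    have "hcons y0 y = y0 *s v + hcons 0 (cvec a) + \<i> *s hcons 0 (cvec b) + (- y0) *s hcons 0 (cvec k)"
      by (simp add: vec_option_eq_iff v_def hom_coords_eq_hcons y)
    moreover have "v \<in> ?S" using T(2)[OF vX] by (simp add: vec.span_base)
    ultimately show ?thesis unfolding u by (simp only:) (intro vec.span_add vec.span_scale real_in)
  qed
  then have "?S = UNIV" by blast
  then have "vec.dim (insert (hcons 0 (cvec k)) ?T) = CARD(4 option)"
    by (metis vec.dim_span vec_dim_card)
  then have "vec.dim ?T > 3" unfolding vec.dim_insert by (auto split: if_splits)
  then have "singular_point (X_of Z) v" using vX by (simp add: singular_point_def)
  moreover have "v $ i \<in> \<real>" for i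
    by (cases i) (auto simp: v_def hom_coords_eq_hcons)
  ultimately show False using smooth unfolding without_real_singularities_def by blast
qed

text \<open>
  Such planes would share a vector or lie in a hyperplane, by \<open>planes_meeting_two_planes\<close>.
\<close>

lemma dense_planes_no_intersecting_transversals:
  assumes D: "dense_planes Z D" and P: "P1 \<in> circle_planes Z" "P2 \<in> circle_planes Z" "P1 \<noteq> P2" "\<not> skew P1 P2"
    and all: "\<And>P. P \<in> D \<Longrightarrow> \<not> skew P P1 \<and> \<not> skew P P2"
  shows False
proof -
  obtain k w where kw: "k \<noteq> 0" "w \<noteq> 0" "\<And>P. subspace P \<Longrightarrow> dim P = 2 \<Longrightarrow> \<not> skew P P1 \<Longrightarrow> \<not> skew P P2 \<Longrightarrow>
      k \<in> P \<or> (\<forall>y\<in>P. w \<bullet> y = 0)"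
    using planes_meeting_two_planes[OF circle_planesD(1,2)[OF P(1)] circle_planesD(1,2)[OF P(2)] P(3,4)] by blast
  have "D \<subseteq> {P. k \<in> P} \<union> {P. \<forall>y\<in>P. w \<bullet> y = 0}"
    using kw(3) all dense_planesD[OF D] by blast
  from dense_planes_split[OF D this] show False
  proof
    assume "dense_planes Z (D \<inter> {P. k \<in> P})"
    then show False using dense_planes_no_common_vector kw(1) by blast
  next
    assume "dense_planes Z (D \<inter> {P. \<forall>y\<in>P. w \<bullet> y = 0})"
    then show False using dense_planes_not_in_hyperplane kw(2) by blast
  qed
qed

lemma dense_planes_skew_pair:
  assumes D: "dense_planes Z D"
  shows "\<exists>A\<in>D. \<exists>B\<in>D. skew A B"
proof (rule ccontr)
  assume no: "\<not> ?thesis"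
  have ax: "axis 1 1 \<noteq> (0 :: real ^ 4)" by (simp add: axis_eq_0_iff)
  obtain P1 where P1: "P1 \<in> D" using dense_planes_not_in_hyperplane[OF D ax] by blast
  have "dim P1 < DIM(real ^ 4)" using dense_planesD(3)[OF D P1] by simp
  then obtain w where w: "w \<noteq> 0" "\<And>y. y \<in> span P1 \<Longrightarrow> orthogonal w y"
    using orthogonal_to_subspace_exists by blast
  obtain P2 where P2: "P2 \<in> D" "P1 \<noteq> P2"
    using dense_planes_not_in_hyperplane[OF D w(1)] w(2) unfolding orthogonal_def by (metis span_base)
  show False
    using dense_planes_no_intersecting_transversals[OF D dense_planesD(1)[OF D P1] dense_planesD(1)[OF D P2(1)] P2(2)]
      no P1 P2 by blast
qed

text \<open>
  Otherwise each plane of \<open>D\<close> meets one of two skew planes \<open>A\<close> and \<open>B\<close> in \<open>D\<close>, so by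
  irreducibility a dense subfamily meets a single plane of \<open>D\<close>. Repeating the step within
  that subfamily yields a dense family that meets two planes, which intersect each other.
\<close>

lemma dense_planes_skew_triple:
  assumes D: "dense_planes Z D"
  shows "\<exists>A\<in>D. \<exists>B\<in>D. \<exists>C\<in>D. skew A B \<and> skew A C \<and> skew B C"
proof (rule ccontr)
  assume no: "\<not> ?thesis"
  have not_dense: False if E: "dense_planes Z E" "E \<subseteq> D" and P: "P \<in> D" and meet: "\<And>Q. Q \<in> E \<Longrightarrow> \<not> skew Q P" for E P
  proof -
    obtain A B where AB: "A \<in> E" "B \<in> E" "skew A B" using dense_planes_skew_pair[OF E(1)] by blast
    have "E \<subseteq> {Q. \<not> skew Q A} \<union> {Q. \<not> skew Q B}" using no AB E(2) skew_commute by blast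
    from dense_planes_split[OF E(1) this] obtain R S where R: "R \<in> {A, B}" "S \<in> {A, B}" "skew R S"
       "dense_planes Z (E \<inter> {Q. \<not> skew Q R})" using AB(3) skew_commute by blast
    have RE: "R \<in> E" "S \<in> E" using R AB by auto
    have "R \<noteq> P" using meet[OF RE(2)] R(3) by (auto simp: skew_commute)
    show False
    proof (rule dense_planes_no_intersecting_transversals[OF R(4), of P R])
      show "P \<in> circle_planes Z" "R \<in> circle_planes Z" using dense_planesD(1)[OF D] P RE(1) E(2) by blast+
      show "P \<noteq> R" using \<open>R \<noteq> P\<close> by simp
      show "\<not> skew P R" using meet[OF RE(1)] by (simp add: skew_commute)
      show "\<not> skew Q P \<and> \<not> skew Q R" if "Q \<in> E \<inter> {Q. \<not> skew Q R}" for Q using meet that by blast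
    qed
  qed
  obtain A B where AB: "A \<in> D" "B \<in> D" "skew A B" using dense_planes_skew_pair[OF D] by blast
  have "D \<subseteq> {Q. \<not> skew Q A} \<union> {Q. \<not> skew Q B}" using no AB skew_commute by blast
  from dense_planes_split[OF D this] show False
    using not_dense[of "D \<inter> {Q. \<not> skew Q A}" A] not_dense[of "D \<inter> {Q. \<not> skew Q B}" B] AB by blast
qed

end

section \<open>The quadric through three skew lines\<close>

text \<open>
  The quadric through three skew lines in its bilinear parametrization. For planes spanned
  by \<open>f1, f2\<close>, by \<open>g1, g2\<close> and by \<open>f1 + g1, f2 + g2\<close>, a fixed pair \<open>(\<alpha>, \<beta>)\<close> gives one
  common transversal, on which \<open>(x, y)\<close> varies.
\<close>

definition ruled_pt :: "real ^ 4 \<Rightarrow> real ^ 4 \<Rightarrow> real ^ 4 \<Rightarrow> real ^ 4 \<Rightarrow> real \<times> real \<times> real \<times> real \<Rightarrow> real ^ 4" where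
  "ruled_pt f1 f2 g1 g2 = (\<lambda>(\<alpha>, \<beta>, x, y).
     x *\<^sub>R (\<alpha> *\<^sub>R f1 + \<beta> *\<^sub>R f2) + y *\<^sub>R (\<alpha> *\<^sub>R g1 + \<beta> *\<^sub>R g2))"

lemma line_polynomial_ruled_pt:
  fixes h :: "complex ^ 4 \<Rightarrow> complex"
  assumes "polynomial_fn h" "linear N"
  shows "line_polynomial (\<lambda>p. h (cvec (N (ruled_pt f1 f2 g1 g2 p))))"
proof (rule line_polynomial_compose[OF assms(1)])
  fix i
  have l: "line_polynomial (\<lambda>p :: real \<times> real \<times> real \<times> real. complex_of_real (fst p))"
    "line_polynomial (\<lambda>p :: real \<times> real \<times> real \<times> real. complex_of_real (fst (snd p)))"
    "line_polynomial (\<lambda>p :: real \<times> real \<times> real \<times> real. complex_of_real (fst (snd (snd p))))"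
    "line_polynomial (\<lambda>p :: real \<times> real \<times> real \<times> real. complex_of_real (snd (snd (snd p))))"
    by (rule line_polynomial_linear, rule linearI; simp)+
  have "cvec (N (ruled_pt f1 f2 g1 g2 p)) $ i =
     of_real (fst (snd (snd p))) * (of_real (fst p) * of_real (N f1 $ i) + of_real (fst (snd p)) * of_real (N f2 $ i)) +
     of_real (snd (snd (snd p))) * (of_real (fst p) * of_real (N g1 $ i) + of_real (fst (snd p)) * of_real (N g2 $ i))" for p
    by (simp add: ruled_pt_def case_prod_unfold linear_add[OF assms(2)] linear_cmul[OF assms(2)])
  then show "line_polynomial (\<lambda>p. cvec (N (ruled_pt f1 f2 g1 g2 p)) $ i)"
    by (simp only:) (intro line_polynomial_add line_polynomial_mult line_polynomial_const l)
qed

lemma line_polynomial_linear_combination: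
  fixes h :: "complex ^ 4 \<Rightarrow> complex"
  assumes "polynomial_fn h"
  shows "line_polynomial (\<lambda>p :: real \<times> real. h (cvec (fst p *\<^sub>R a + snd p *\<^sub>R b)))"
proof (rule line_polynomial_compose[OF assms(1)])
  fix i
  have l: "line_polynomial (\<lambda>p :: real \<times> real. complex_of_real (fst p))"
    "line_polynomial (\<lambda>p :: real \<times> real. complex_of_real (snd p))"
    by (rule line_polynomial_linear, rule linearI; simp)+
  have "cvec (fst p *\<^sub>R a + snd p *\<^sub>R b) $ i =
     of_real (fst p) * of_real (a $ i) + of_real (snd p) * of_real (b $ i)" for p by simp
  then show "line_polynomial (\<lambda>p :: real \<times> real. cvec (fst p *\<^sub>R a + snd p *\<^sub>R b) $ i)"
    by (simp only:) (intro line_polynomial_add line_polynomial_mult line_polynomial_const l)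
qed

lemma skew_planes_span:
  fixes A B :: "(real ^ 4) set"
  assumes A: "subspace A" "dim A = 2" and B: "subspace B" "dim B = 2" and AB: "skew A B"
  shows "\<exists>a\<in>A. \<exists>b\<in>B. y = a + b"
proof -
  let ?S = "{x + y | x y. x \<in> A \<and> y \<in> B}"
  have "dim (A \<inter> B) = 0" using AB by (simp add: skew_def dim_eq_0)
  then have "dim ?S = 4" using dim_sums_Int[OF A(1) B(1)] A B by linarith
  moreover have "subspace ?S" by (rule subspace_sums[OF A(1) B(1)])
  ultimately have "?S = UNIV" using subspace_dim_equal[of ?S UNIV] by simp
  then have "y \<in> ?S" by simp
  then show ?thesis by blast
qed

lemma span_pair:
  assumes "y \<in> span {a, b}" shows "\<exists>s t. y = s *\<^sub>R a + t *\<^sub>R b"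
proof -
  obtain s where "y - s *\<^sub>R a \<in> span {b}" using assms span_breakdown_eq[of y a "{b}"] by blast
  then obtain t where "y - s *\<^sub>R a = t *\<^sub>R b" by (auto simp: span_singleton)
  then have "y = s *\<^sub>R a + t *\<^sub>R b" by (simp add: algebra_simps)
  then show ?thesis by blast
qed

context great_cyclide
begin

text \<open>
  The points \<open>p\<close>, \<open>m\<close> and \<open>\<alpha> p + \<beta> m\<close> of a projective line get the parameters 0, 1 and 1/2
  for the direction \<open>(\<beta> / \<alpha>) m - p\<close>, so that \<open>three_zeros_imp_plane_zero\<close> applies.
\<close>

lemma three_points_on_line:
  assumes F: "homogeneous_fn dF F" and l: "homogeneous_fn dl l"
    and V: "\<forall>x. F x = 0 \<longrightarrow> l x \<noteq> 0 \<longrightarrow> (\<forall>f\<in>vanishing (circle_planes Z). f x = 0)"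
    and ind: "\<And>s t. s *\<^sub>R p + t *\<^sub>R m = 0 \<Longrightarrow> s = 0 \<and> t = 0"
    and ab: "\<alpha> \<noteq> 0" "\<beta> \<noteq> 0"
    and F0: "F (cvec p) = 0" "F (cvec m) = 0" "F (cvec (\<alpha> *\<^sub>R p + \<beta> *\<^sub>R m)) = 0"
    and l0: "l (cvec p) \<noteq> 0" "l (cvec m) \<noteq> 0" "l (cvec (\<alpha> *\<^sub>R p + \<beta> *\<^sub>R m)) \<noteq> 0"
  shows "F (cvec (x *\<^sub>R p + y *\<^sub>R m)) = 0"
proof -
  define \<mu> where "\<mu> = \<beta> / \<alpha>"
  have \<mu>: "\<mu> \<noteq> 0" using ab by (simp add: \<mu>_def)
  let ?k2 = "\<mu> *\<^sub>R m - p"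
  have ind': "s = 0 \<and> t = 0" if "s *\<^sub>R p + t *\<^sub>R ?k2 = 0" for s t
  proof -
    have "(s - t) *\<^sub>R p + (t * \<mu>) *\<^sub>R m = 0" using that by (simp add: algebra_simps)
    then have "s - t = 0 \<and> t * \<mu> = 0" by (rule ind)
    then show ?thesis using \<mu> by simp
  qed
  obtain k3 k4 where fr: "frame p ?k2 k3 k4" using frame_exists[of p ?k2] ind' by blast
  have pt: "cvec p + of_real 0 *s cvec ?k2 = cvec p" "cvec p + of_real 1 *s cvec ?k2 = of_real \<mu> *s cvec m"
    "cvec p + of_real (1/2) *s cvec ?k2 = of_real (1 / (2 * \<alpha>)) *s cvec (\<alpha> *\<^sub>R p + \<beta> *\<^sub>R m)"
    using ab by (auto simp: vec_eq_iff \<mu>_def field_simps)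
  have zero: "F (cvec p + z *s cvec ?k2) = 0" for z
  proof (rule three_zeros_imp_plane_zero[OF fr degree, where l = l and A = "{0, 1, 1/2}"])
    show "polynomial_fn F" "polynomial_fn l" using F l homogeneous_imp_polynomial_fn by blast+
    show "f x = 0" if "F x = 0" "l x \<noteq> 0" "f \<in> vanishing (circle_planes Z)" for x f
      using V that by blast
    fix t :: real assume "t \<in> {0, 1, 1/2}"
    then consider "t = 0" | "t = 1" | "t = 1/2" by blast
    then have "F (cvec p + of_real t *s cvec ?k2) = 0 \<and> l (cvec p + of_real t *s cvec ?k2) \<noteq> 0"
    proof cases
      case 1 show ?thesis unfolding 1 pt using F0 l0 by blast
    next
      case 2 show ?thesis unfolding 2 pt homogeneous_fn_scale[OF F] homogeneous_fn_scale[OF l]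
        using F0 l0 \<mu> by simp
    next
      case 3 show ?thesis unfolding 3 pt homogeneous_fn_scale[OF F] homogeneous_fn_scale[OF l]
        using F0 l0 ab by simp
    qed
    then show "F (cvec p + of_real t *s cvec ?k2) = 0" "l (cvec p + of_real t *s cvec ?k2) \<noteq> 0" by blast+
  qed auto
  have "F (cvec (fst q *\<^sub>R p + snd q *\<^sub>R m)) * of_real (fst q + snd q / \<mu>) = 0" for q :: "real \<times> real"
  proof (cases "fst q + snd q / \<mu> = 0")
    case False
    let ?c = "fst q + snd q / \<mu>"
    have "cvec (fst q *\<^sub>R p + snd q *\<^sub>R m) = of_real ?c *s (cvec p + of_real (snd q / \<mu> / ?c) *s cvec ?k2)"
      using False \<mu> by (simp add: vec_eq_iff flip: of_real_mult of_real_add of_real_diff of_real_divide)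
        (simp add: field_simps)
    then have "F (cvec (fst q *\<^sub>R p + snd q *\<^sub>R m)) =
        of_real ?c ^ dF * F (cvec p + of_real (snd q / \<mu> / ?c) *s cvec ?k2)"
      using homogeneous_fn_scale[OF F] by metis
    then show ?thesis unfolding zero by simp
  qed simp
  moreover have "line_polynomial (\<lambda>q :: real \<times> real. of_real (fst q + snd q / \<mu>))"
    by (rule line_polynomial_linear) (rule linearI; simp add: add_divide_distrib algebra_simps)
  ultimately have "F (cvec (fst (x, y) *\<^sub>R p + snd (x, y) *\<^sub>R m)) = 0"
    using line_polynomial_no_zero_divisors[OF line_polynomial_linear_combination[OF homogeneous_imp_polynomial_fn[OF F], of p m],
        of _ "(1, 0)" "(x, y)"] by simp
  then show ?thesis by simp
qed

text \<open>
  The transversals of three skew lines in projective 3-space fill a quadric. Each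
  transversal has three points on the projected surface and so lies on it, by
  \<open>three_points_on_line\<close>; hence the quadric lies on the surface. Conversely, let \<open>p\<close> be a
  point of the surface off the quadric. A line through \<open>p\<close> that meets the quadric in two
  real points has three points on the surface and lies on it. These lines fill an open
  set, on which \<open>F\<close> would vanish. So the two surfaces agree. The map \<open>N\<close> consists of the
  coordinates with respect to \<open>f1, f2, g1, g2\<close>. The function \<open>l\<close> must be nonzero at the
  three points; as there are no zero divisors, multiplying by it takes care of the other
  lines.
\<close>

theorem preimage_is_quadric_section:
  "\<exists>N :: real ^ 4 \<Rightarrow> real ^ 4. linear N \<and> (\<forall>x. N x = 0 \<longrightarrow> x = 0) \<and>
     (\<forall>y. hom_coords y \<in> X_of Z \<longleftrightarrow> norm y = 1 \<and> N y $ 1 * N y $ 4 = N y $ 2 * N y $ 3)"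
proof -
  let ?I = "vanishing (circle_planes Z)"
  obtain F l dF dl where F: "F \<in> ?I" "homogeneous_fn dF F" "\<exists>x. F x \<noteq> 0"
    and l: "homogeneous_fn dl l" "l \<notin> ?I"
    and V0: "\<forall>x. F x = 0 \<longrightarrow> l x \<noteq> 0 \<longrightarrow> (\<forall>f\<in>?I. f x = 0)"
    using exists_hypersurface_equation[OF degree great] by blast
  have V: "\<And>x f. F x = 0 \<Longrightarrow> l x \<noteq> 0 \<Longrightarrow> f \<in> ?I \<Longrightarrow> f x = 0" using V0 by blast
  note pF = homogeneous_imp_polynomial_fn[OF F(2)] and pl = homogeneous_imp_polynomial_fn[OF l(1)]
  note three = three_points_on_line[OF F(2) l(1) V0]
  have F_plane: "F (cvec y) = 0" if "P \<in> circle_planes Z" "y \<in> P" for P y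
    using F(1) that unfolding vanishing_def by blast
  define D where "D = circle_planes Z \<inter> {P. \<exists>y\<in>P. l (cvec y) \<noteq> 0}"
  have D: "dense_planes Z D"
  proof -
    have "circle_planes Z \<subseteq> {P. \<exists>y\<in>P. l (cvec y) \<noteq> 0} \<union> {P. \<forall>y\<in>P. l (cvec y) = 0}" by blast
    from dense_planes_split[OF dense_planes_circle_planes this] show ?thesis
    proof
      assume "dense_planes Z (circle_planes Z \<inter> {P. \<forall>y\<in>P. l (cvec y) = 0})"
      moreover have "l \<in> vanishing (circle_planes Z \<inter> {P. \<forall>y\<in>P. l (cvec y) = 0})"
        using pl unfolding vanishing_def by blast
      ultimately show ?thesis using l(2) unfolding dense_planes_def by blast
    qed (simp add: D_def)
  qed
  obtain A B C where ABC: "A \<in> D" "B \<in> D" "C \<in> D" "skew A B" "skew A C" "skew B C"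
    using dense_planes_skew_triple[OF D] by blast
  note A = dense_planesD[OF D ABC(1)] and B = dense_planesD[OF D ABC(2)] and C = dense_planesD[OF D ABC(3)]
  obtain c1 c2 where c: "norm c1 = 1" "norm c2 = 1" "c1 \<bullet> c2 = 0" "C = {s *\<^sub>R c1 + t *\<^sub>R c2 | s t. True}"
    using plane_orthonormal_basis[OF C(2,3)] .
  have "1 *\<^sub>R c1 + 0 *\<^sub>R c2 \<in> C" "0 *\<^sub>R c1 + 1 *\<^sub>R c2 \<in> C" unfolding c(4) by blast+
  then have cC: "c1 \<in> C" "c2 \<in> C" by simp_all
  have cind: "s = 0 \<and> t = 0" if "s *\<^sub>R c1 + t *\<^sub>R c2 = 0" for s t
    using norm_combination_orthonormal[OF c(1-3), of s t] that by (simp add: sum_power2_eq_zero_iff)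
  obtain f1 g1 where fg1: "f1 \<in> A" "g1 \<in> B" "c1 = f1 + g1"
    using skew_planes_span[OF A(2,3) B(2,3) ABC(4)] by blast
  obtain f2 g2 where fg2: "f2 \<in> A" "g2 \<in> B" "c2 = f2 + g2"
    using skew_planes_span[OF A(2,3) B(2,3) ABC(4)] by blast
  have sub_mem: "s *\<^sub>R u + t *\<^sub>R w \<in> P" if "subspace P" "u \<in> P" "w \<in> P" for s t u w and P :: "(real ^ 4) set"
    using that by (simp add: subspace_add subspace_scale)
  have find: "s = 0 \<and> t = 0" if "s *\<^sub>R f1 + t *\<^sub>R f2 = 0" for s t
  proof -
    have "s *\<^sub>R c1 + t *\<^sub>R c2 = s *\<^sub>R g1 + t *\<^sub>R g2" using that fg1 fg2 by (simp add: algebra_simps)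
    then have "s *\<^sub>R c1 + t *\<^sub>R c2 \<in> B \<inter> C" using sub_mem[OF B(2) fg1(2) fg2(2)] sub_mem[OF C(2) cC] by (metis IntI)
    then show ?thesis using ABC(6) cind unfolding skew_def by blast
  qed
  have gind: "s = 0 \<and> t = 0" if "s *\<^sub>R g1 + t *\<^sub>R g2 = 0" for s t
  proof -
    have "s *\<^sub>R c1 + t *\<^sub>R c2 = s *\<^sub>R f1 + t *\<^sub>R f2" using that fg1 fg2 by (simp add: algebra_simps)
    then have "s *\<^sub>R c1 + t *\<^sub>R c2 \<in> A \<inter> C" using sub_mem[OF A(2) fg1(1) fg2(1)] sub_mem[OF C(2) cC] by (metis IntI)
    then show ?thesis using ABC(5) cind unfolding skew_def by blast
  qed
  have fnz: "f1 \<noteq> 0" and fns: "f2 \<notin> span {f1}" using find[of 1 0] find[of _ "-1"] by (auto simp: span_singleton)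
  have gnz: "g1 \<noteq> 0" and gns: "g2 \<notin> span {g1}" using gind[of 1 0] gind[of _ "-1"] by (auto simp: span_singleton)
  have A_par: "\<exists>s t. y = s *\<^sub>R f1 + t *\<^sub>R f2" if "y \<in> A" for y
    using that plane_eq_span[OF A(2,3) fg1(1) fg2(1) fnz fns] span_pair by metis
  have B_par: "\<exists>s t. y = s *\<^sub>R g1 + t *\<^sub>R g2" if "y \<in> B" for y
    using that plane_eq_span[OF B(2,3) fg1(2) fg2(2) gnz gns] span_pair by metis
  define L where "L = (\<lambda>x :: real ^ 4. x $ 1 *\<^sub>R f1 + x $ 2 *\<^sub>R f2 + x $ 3 *\<^sub>R g1 + x $ 4 *\<^sub>R g2)"
  have linL: "linear L" unfolding L_def by (rule linearI) (simp_all add: algebra_simps)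
  have "x = 0" if "L x = 0" for x
  proof -
    have "x $ 1 *\<^sub>R f1 + x $ 2 *\<^sub>R f2 = - (x $ 3 *\<^sub>R g1 + x $ 4 *\<^sub>R g2)"
      using that unfolding eq_neg_iff_add_eq_0 by (simp add: L_def add.assoc)
    moreover have "- (x $ 3 *\<^sub>R g1 + x $ 4 *\<^sub>R g2) \<in> B"
      using sub_mem[OF B(2) fg1(2) fg2(2)] subspace_neg[OF B(2)] by blast
    ultimately have "x $ 1 *\<^sub>R f1 + x $ 2 *\<^sub>R f2 \<in> A \<inter> B"
      using sub_mem[OF A(2) fg1(1) fg2(1)] by (metis IntI)
    then have *: "x $ 1 *\<^sub>R f1 + x $ 2 *\<^sub>R f2 = 0" using ABC(4) unfolding skew_def by blast
    then have "x $ 3 *\<^sub>R g1 + x $ 4 *\<^sub>R g2 = 0" using that by (simp add: L_def)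
    then have "x $ 3 = 0 \<and> x $ 4 = 0" by (rule gind)
    then show ?thesis using find[OF *] by (simp add: vec_eq_iff forall_4)
  qed
  then have "inj L" using linear_injective_0[OF linL] by blast
  then obtain N where N: "linear N" "\<And>x. N (L x) = x" "\<And>x. L (N x) = x"
    using linear_injective_isomorphism[OF linL] by blast
  have Nexp: "y = N y $ 1 *\<^sub>R f1 + N y $ 2 *\<^sub>R f2 + N y $ 3 *\<^sub>R g1 + N y $ 4 *\<^sub>R g2" for y
    using N(3)[of y] unfolding L_def by simp
  have Nval: "N (a *\<^sub>R f1 + b *\<^sub>R f2 + c *\<^sub>R g1 + d *\<^sub>R g2) = vector [a, b, c, d]" for a b c d
    using N(2)[of "vector [a, b, c, d]"] by (simp add: L_def)
  \<comment> \<open>The equation \<open>q\<close> of the quadric and its polar form.\<close>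
  define bf where "bf = (\<lambda>x y. N x $ 1 * N y $ 4 + N x $ 4 * N y $ 1 - N x $ 2 * N y $ 3 - N x $ 3 * N y $ 2)"
  define q where "q = (\<lambda>y. N y $ 1 * N y $ 4 - N y $ 2 * N y $ 3)"
  have q_comb: "q (s *\<^sub>R x + t *\<^sub>R y) = s\<^sup>2 * q x + s * t * bf x y + t\<^sup>2 * q y" for s t x y
    unfolding q_def bf_def linear_add[OF N(1)] linear_cmul[OF N(1)]
    by (simp add: power2_eq_square algebra_simps)
  have bf_comb: "bf p (s *\<^sub>R x + t *\<^sub>R y) = s * bf p x + t * bf p y" for p s t x y
    unfolding bf_def linear_add[OF N(1)] linear_cmul[OF N(1)] by (simp add: algebra_simps)
  have bf_self: "bf x x = 2 * q x" for x unfolding bf_def q_def by simp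
  let ?m = "ruled_pt f1 f2 g1 g2"
  have m_eq: "?m (\<alpha>, \<beta>, x, y) = (x * \<alpha>) *\<^sub>R f1 + (x * \<beta>) *\<^sub>R f2 + (y * \<alpha>) *\<^sub>R g1 + (y * \<beta>) *\<^sub>R g2" for \<alpha> \<beta> x y
    by (simp add: ruled_pt_def algebra_simps)
  have q_m: "q (?m p) = 0" for p
    by (cases p) (simp add: q_def m_eq Nval)
  have m_surj: "\<exists>p. y = ?m p" if "q y = 0" for y
  proof -
    have e: "N y $ 1 * N y $ 4 = N y $ 2 * N y $ 3" using that by (simp add: q_def)
    consider "N y $ 1 \<noteq> 0" | "N y $ 1 = 0" "N y $ 2 \<noteq> 0" | "N y $ 1 = 0" "N y $ 2 = 0" by blast
    then show ?thesis
    proof cases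
      case 1
      then have "y = ?m (N y $ 1, N y $ 2, 1, N y $ 3 / N y $ 1)"
        unfolding m_eq using e by (subst Nexp) (simp add: field_simps)
      then show ?thesis by blast
    next
      case 2
      then have "y = ?m (N y $ 1, N y $ 2, 1, N y $ 4 / N y $ 2)"
        unfolding m_eq using e by (subst Nexp) (simp add: field_simps)
      then show ?thesis by blast
    next
      case 3
      then have "y = ?m (N y $ 3, N y $ 4, 0, 1)" unfolding m_eq by (subst Nexp) simp
      then show ?thesis by blast
    qed
  qed
  have lin_id: "linear (\<lambda>x :: real ^ 4. x)" by (rule linearI) simp_all
  note lp_m = line_polynomial_ruled_pt[OF _ lin_id]
  \<comment> \<open>A transversal line of the three planes meets them in points where \<open>F\<close> vanishes.\<close>
  have F_m: "F (cvec (?m (\<alpha>, \<beta>, x, y))) = 0" for \<alpha> \<beta> x y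
  proof -
    let ?f = "\<lambda>p :: real \<times> real. fst p *\<^sub>R f1 + snd p *\<^sub>R f2"
    let ?g = "\<lambda>p :: real \<times> real. fst p *\<^sub>R g1 + snd p *\<^sub>R g2"
    let ?h = "\<lambda>p :: real \<times> real. fst p *\<^sub>R (f1 + g1) + snd p *\<^sub>R (f2 + g2)"
    have hfg: "?h p = 1 *\<^sub>R ?f p + 1 *\<^sub>R ?g p" for p by (simp add: algebra_simps)
    have memA: "?f p \<in> A" for p using sub_mem[OF A(2) fg1(1) fg2(1)] .
    have memB: "?g p \<in> B" for p using sub_mem[OF B(2) fg1(2) fg2(2)] .
    have memC: "?h p \<in> C" for p using sub_mem[OF C(2) cC] fg1(3) fg2(3) by simp
    let ?G = "\<lambda>p. F (cvec (x *\<^sub>R ?f p + y *\<^sub>R ?g p))"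
    have z: "?G p * l (cvec (?f p)) * l (cvec (?g p)) * l (cvec (?h p)) = 0" for p
    proof (rule ccontr)
      assume nz: "\<not> ?thesis"
      have ind: "s = 0 \<and> t = 0" if st: "s *\<^sub>R ?f p + t *\<^sub>R ?g p = 0" for s t
      proof -
        have p0: "p \<noteq> 0"
        proof
          assume p: "p = 0"
          then have "x *\<^sub>R ?f p + y *\<^sub>R ?g p = 0" by simp
          moreover have "F (cvec 0) = 0" using F_plane[OF A(1)] subspace_0[OF A(2)] by blast
          ultimately show False using nz by simp
        qed
        have "s *\<^sub>R ?f p = (- t) *\<^sub>R ?g p" using st by (simp add: eq_neg_iff_add_eq_0)
        then have "s *\<^sub>R ?f p \<in> A \<inter> B"
          using memA[of p] memB[of p] A(2) B(2) by (metis IntI subspace_scale)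
        then have "s *\<^sub>R ?f p = 0" using ABC(4) unfolding skew_def by blast
        moreover have "t *\<^sub>R ?g p = 0" using st unfolding \<open>s *\<^sub>R ?f p = 0\<close> by simp
        moreover have "?f p \<noteq> 0" "?g p \<noteq> 0" using find gind p0 by (auto simp: prod_eq_iff)
        ultimately show ?thesis by simp
      qed
      have "?G p = 0"
      proof (rule three[of "?f p" "?g p" 1 1])
        show "F (cvec (?f p)) = 0" by (rule F_plane[OF A(1) memA])
        show "F (cvec (?g p)) = 0" by (rule F_plane[OF B(1) memB])
        show "F (cvec (1 *\<^sub>R ?f p + 1 *\<^sub>R ?g p)) = 0" unfolding hfg[symmetric] by (rule F_plane[OF C(1) memC])
        show "l (cvec (?f p)) \<noteq> 0" "l (cvec (?g p)) \<noteq> 0" using nz by auto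
        show "l (cvec (1 *\<^sub>R ?f p + 1 *\<^sub>R ?g p)) \<noteq> 0" unfolding hfg[symmetric] using nz by auto
      qed (use ind in auto)
      then show False using nz by simp
    qed
    have lpl: "line_polynomial (\<lambda>p. l (cvec (?f p)))" "line_polynomial (\<lambda>p. l (cvec (?g p)))"
      "line_polynomial (\<lambda>p. l (cvec (?h p)))"
      by (rule line_polynomial_linear_combination[OF pl])+
    \<comment> \<open>The exceptional values of \<open>l\<close> are divided out one factor at a time.\<close>
    have G_eq: "?G p = F (cvec (fst p *\<^sub>R (x *\<^sub>R f1 + y *\<^sub>R g1) + snd p *\<^sub>R (x *\<^sub>R f2 + y *\<^sub>R g2)))" for p
      by (simp add: algebra_simps)
    have lpG: "line_polynomial ?G"
      unfolding G_eq by (rule line_polynomial_linear_combination[OF pF])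
    obtain a0 where "a0 \<in> A" "l (cvec a0) \<noteq> 0" using ABC(1) unfolding D_def by blast
    then obtain pa where pa: "l (cvec (?f pa)) \<noteq> 0" using A_par by (metis fst_conv snd_conv)
    obtain b0 where "b0 \<in> B" "l (cvec b0) \<noteq> 0" using ABC(2) unfolding D_def by blast
    then obtain pb where pb: "l (cvec (?g pb)) \<noteq> 0" using B_par by (metis fst_conv snd_conv)
    obtain s t where "l (cvec (s *\<^sub>R c1 + t *\<^sub>R c2)) \<noteq> 0" using ABC(3) unfolding D_def c(4) by blast
    then have pc: "l (cvec (?h (s, t))) \<noteq> 0" by (simp add: fg1(3) fg2(3))
    have "?G p * l (cvec (?f p)) * l (cvec (?g p)) = 0" for p
      by (rule line_polynomial_no_zero_divisors[OF _ lpl(3) z pc]) (intro line_polynomial_mult lpG lpl)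
    from line_polynomial_no_zero_divisors[OF line_polynomial_mult[OF lpG lpl(1)] lpl(2) this pb]
    have "?G p * l (cvec (?f p)) = 0" for p .
    from line_polynomial_no_zero_divisors[OF lpG lpl(1) this pa] have "?G p = 0" for p .
    from this[of "(\<alpha>, \<beta>)"] show ?thesis by (simp add: ruled_pt_def)
  qed
  obtain p1 where p1: "l (cvec (?m p1)) \<noteq> 0"
  proof -
    obtain a0 where a0: "a0 \<in> A" "l (cvec a0) \<noteq> 0" using ABC(1) unfolding D_def by blast
    then obtain s t where "a0 = s *\<^sub>R f1 + t *\<^sub>R f2" using A_par by blast
    then have "a0 = ?m (s, t, 1, 0)" by (simp add: m_eq)
    then show ?thesis using a0(2) that by blast
  qed
  have van_q: "f (cvec y) = 0" if f: "f \<in> ?I" and y: "q y = 0" for f y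
  proof -
    have "f (cvec (?m p)) * l (cvec (?m p)) = 0" for p
      using V[OF _ _ f] F_m by (cases p) auto
    then have "f (cvec (?m p)) = 0" for p
      using line_polynomial_no_zero_divisors[OF lp_m[of f] lp_m[OF pl] _ p1] f by (simp add: vanishing_def)
    then show ?thesis using m_surj[OF y] by blast
  qed
  define Nc where "Nc = (\<lambda>i (z :: complex ^ 4). \<Sum>j\<in>UNIV. of_real (N (axis j 1) $ i) * z $ j)"
  have Nc: "Nc i (cvec y) = of_real (N y $ i)" for i y
  proof -
    have "y = (\<Sum>j\<in>UNIV. y $ j *\<^sub>R axis j 1)" using basis_expansion[of y] unfolding scalar_mult_eq_scaleR by simp
    then have "N y = (\<Sum>j\<in>UNIV. y $ j *\<^sub>R N (axis j 1))"
      by (metis (no_types, lifting) linear_sum[OF N(1)] linear_cmul[OF N(1)] sum.cong)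
    then show ?thesis by (simp add: Nc_def sum_component mult.commute)
  qed
  define qc where "qc = (\<lambda>z. Nc 1 z * Nc 4 z - Nc 2 z * Nc 3 z)"
  have qc: "qc (cvec y) = of_real (q y)" for y by (simp add: qc_def Nc q_def)
  have pqc: "polynomial_fn qc" unfolding qc_def Nc_def by (intro polynomial_fn_intros)
  have "qc \<in> ?I"
  proof (rule ccontr)
    assume "qc \<notin> ?I"
    then have "qc \<notin> vanishing D" using D unfolding dense_planes_def by blast
    then obtain P y where P: "P \<in> D" "y \<in> P" "qc (cvec y) \<noteq> 0" using pqc unfolding vanishing_def by blast
    obtain y' where y': "y' \<in> P" "l (cvec y') \<noteq> 0" using P(1) unfolding D_def by blast
    note P' = dense_planesD[OF D P(1)]
    have "\<exists>p\<in>P. qc (cvec p) \<noteq> 0 \<and> l (cvec p) \<noteq> 0"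
    proof (rule ccontr)
      assume no: "\<not> ?thesis"
      have "qc (cvec (fst p *\<^sub>R y + snd p *\<^sub>R y')) * l (cvec (fst p *\<^sub>R y + snd p *\<^sub>R y')) = 0" for p
        using no sub_mem[OF P'(2) P(2) y'(1)] by auto
      from line_polynomial_no_zero_divisors[OF line_polynomial_linear_combination[OF pqc] line_polynomial_linear_combination[OF pl] this, of "(0, 1)" "(1, 0)"]
      show False using P(3) y'(2) by simp
    qed
    then obtain p where p: "p \<in> P" "qc (cvec p) \<noteq> 0" "l (cvec p) \<noteq> 0" by blast
    then have qp: "q p \<noteq> 0" by (simp add: qc)
    define \<rho> where "\<rho> = (\<lambda>m. bf p m / q p)"
    \<comment> \<open>The line through \<open>p\<close> and a point \<open>m\<close> of the quadric meets it again in \<open>M m\<close>.\<close>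
    define M where "M = (\<lambda>m. m - \<rho> m *\<^sub>R p)"
    have \<rho>_comb: "\<rho> (s *\<^sub>R x + t *\<^sub>R y) = s * \<rho> x + t * \<rho> y" for s t x y
      unfolding \<rho>_def bf_comb by (simp add: add_divide_distrib)
    have lin\<rho>: "linear \<rho>"
      using \<rho>_comb[of 1 _ 1] \<rho>_comb[of _ _ 0] by (intro linearI) simp_all
    have \<rho>p: "\<rho> p = 2" using qp by (simp add: \<rho>_def bf_self)
    have linM: "linear M" unfolding M_def
      by (rule linearI) (simp_all add: linear_add[OF lin\<rho>] linear_cmul[OF lin\<rho>] algebra_simps)
    have qM: "q (M m) = 0" if "q m = 0" for m
    proof -
      have "q (M m) = (- \<rho> m)\<^sup>2 * q p + (- \<rho> m) * 1 * bf p m + 1\<^sup>2 * q m"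
        using q_comb[of "- \<rho> m" p 1 m] by (simp add: M_def)
      then show ?thesis using that qp by (simp add: \<rho>_def power2_eq_square)
    qed
    have MM: "M (M m) = m" for m
    proof -
      have "\<rho> (M m) = - \<rho> m" using \<rho>_comb[of 1 m "- \<rho> m" p] \<rho>p by (simp add: M_def)
      then show ?thesis by (simp add: M_def)
    qed
    have lp_lM: "line_polynomial (\<lambda>t. l (cvec (M (?m t))))" by (rule line_polynomial_ruled_pt[OF pl linM])
    have lp_\<rho>: "line_polynomial (\<lambda>t. complex_of_real (\<rho> (?m t)))"
    proof -
      have "linear (\<lambda>m. \<rho> m *\<^sub>R axis 1 1 :: real ^ 4)"
        by (rule linearI) (simp_all add: linear_add[OF lin\<rho>] linear_cmul[OF lin\<rho>] algebra_simps)
      from line_polynomial_ruled_pt[OF polynomial_fn_coord[of 1] this] show ?thesis by (simp add: axis_def)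
    qed
    have "\<exists>t. l (cvec (M (?m t))) \<noteq> 0"
    proof -
      obtain t where "M (?m p1) = ?m t" using m_surj[OF qM[OF q_m]] by blast
      then have "M (?m t) = ?m p1" using MM by metis
      then show ?thesis using p1 by metis
    qed
    then obtain p2 where p2: "l (cvec (M (?m p2))) \<noteq> 0" by blast
    have "\<exists>t. \<rho> (?m t) \<noteq> 0"
    proof (rule ccontr)
      assume "\<not> ?thesis"
      then have z: "\<rho> (?m t) = 0" for t by blast
      have "\<rho> f1 = 0" "\<rho> f2 = 0" "\<rho> g1 = 0" "\<rho> g2 = 0"
        using z[of "(1, 0, 1, 0)"] z[of "(0, 1, 1, 0)"] z[of "(1, 0, 0, 1)"] z[of "(0, 1, 0, 1)"]
        by (simp_all add: m_eq)
      then have "\<rho> p = 0"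
        using Nexp[of p] by (metis linear_add[OF lin\<rho>] linear_cmul[OF lin\<rho>] add_0 scale_zero_right)
      then show False using \<rho>p by simp
    qed
    then obtain p3 where p3: "\<rho> (?m p3) \<noteq> 0" by blast
    have F_cone: "F (cvec (x *\<^sub>R p + y *\<^sub>R ?m t)) = 0" for x y t
    proof -
      let ?G = "\<lambda>t. F (cvec (x *\<^sub>R p + y *\<^sub>R ?m t))"
      have lpG: "line_polynomial ?G"
      proof -
        have "polynomial_fn (\<lambda>z. F (of_real x *s cvec p + of_real y *s z))"
          by (rule polynomial_fn_compose[OF pF]) (auto intro!: polynomial_fn_intros)
        from lp_m[OF this] show ?thesis by (simp add: cvec_add cvec_scaleR)
      qed
      have z: "?G t * l (cvec (?m t)) * l (cvec (M (?m t))) * of_real (\<rho> (?m t)) = 0" for t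
      proof (rule ccontr)
        assume nz: "\<not> ?thesis"
        let ?\<mu> = "?m t"
        have r: "\<rho> ?\<mu> \<noteq> 0" using nz by auto
        have M_eq: "M ?\<mu> = (- \<rho> ?\<mu>) *\<^sub>R p + 1 *\<^sub>R ?\<mu>" by (simp add: M_def)
        have ind: "s = 0 \<and> u = 0" if su: "s *\<^sub>R p + u *\<^sub>R ?\<mu> = 0" for s u
        proof -
          have "s *\<^sub>R p = (- u) *\<^sub>R ?\<mu>" using su by (simp add: eq_neg_iff_add_eq_0)
          then have "q (s *\<^sub>R p + 0 *\<^sub>R p) = q ((- u) *\<^sub>R ?\<mu> + 0 *\<^sub>R p)" by simp
          then have "s\<^sup>2 * q p = 0" unfolding q_comb q_m by simp
          then have s: "s = 0" using qp by simp
          moreover have "?\<mu> \<noteq> 0" using r linear_0[OF lin\<rho>] by metis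
          ultimately show ?thesis using su by simp
        qed
        have Fq: "F (cvec w) = 0" if "q w = 0" for w
          using m_surj[OF that] F_m by (metis prod_cases4)
        have "?G t = 0"
        proof (rule three[of p ?\<mu> "- \<rho> ?\<mu>" 1])
          show "F (cvec p) = 0" by (rule F_plane[OF P'(1) p(1)])
          show "F (cvec ?\<mu>) = 0" by (rule Fq[OF q_m])
          show "F (cvec ((- \<rho> ?\<mu>) *\<^sub>R p + 1 *\<^sub>R ?\<mu>)) = 0" unfolding M_eq[symmetric] by (rule Fq[OF qM[OF q_m]])
          show "l (cvec p) \<noteq> 0" by (rule p)
          show "l (cvec ?\<mu>) \<noteq> 0" using nz by auto
          show "l (cvec ((- \<rho> ?\<mu>) *\<^sub>R p + 1 *\<^sub>R ?\<mu>)) \<noteq> 0" unfolding M_eq[symmetric] using nz by auto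
        qed (use ind r in auto)
        then show False using nz by simp
      qed
      have "?G t * l (cvec (?m t)) * l (cvec (M (?m t))) = 0" for t
        by (rule line_polynomial_no_zero_divisors[OF _ lp_\<rho> z])
          (intro line_polynomial_mult lpG lp_lM lp_m pl, use p3 in simp)
      from line_polynomial_no_zero_divisors[OF line_polynomial_mult[OF lpG lp_m[OF pl]] lp_lM this p2]
      have "?G t * l (cvec (?m t)) = 0" for t .
      from line_polynomial_no_zero_divisors[OF lpG lp_m[OF pl] this p1] show ?thesis .
    qed
    \<comment> \<open>The points \<open>n\<close> whose line through \<open>p\<close> meets the quadric in two real points.\<close>
    define U where "U = {n. (bf p n)\<^sup>2 - 4 * q n * q p > 0}"
    have FU: "F (cvec n) = 0" if n: "n \<in> U" for n
    proof -
      define a where "a = (bf p n + sqrt ((bf p n)\<^sup>2 - 4 * q n * q p)) / (2 * q p)"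
      have "(2 * q p * a - bf p n)\<^sup>2 = (bf p n)\<^sup>2 - 4 * q n * q p" using n qp by (simp add: a_def U_def)
      then have "4 * q p * (q p * a\<^sup>2 - a * bf p n + q n) = 0" by (simp add: power2_eq_square algebra_simps)
      then have "q ((- a) *\<^sub>R p + 1 *\<^sub>R n) = 0" unfolding q_comb using qp by (simp add: mult.commute)
      then obtain t where t: "(- a) *\<^sub>R p + 1 *\<^sub>R n = ?m t" using m_surj by blast
      then have "n = a *\<^sub>R p + 1 *\<^sub>R ?m t" by (simp flip: t)
      then show ?thesis using F_cone by metis
    qed
    have contN: "continuous_on UNIV (\<lambda>n. N n $ i)" for i
      using linear_continuous_on[of N UNIV] N(1) by (intro continuous_intros) (simp add: linear_conv_bounded_linear)
    have "continuous_on UNIV (bf p)" "continuous_on UNIV q"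
      unfolding bf_def q_def by (intro continuous_intros contN)+
    then have "open U"
      unfolding U_def by (intro open_Collect_less continuous_on_diff continuous_on_mult
          continuous_on_power continuous_on_const)
    moreover have "?m p3 \<in> U" using p3 q_m[of p3] by (simp add: U_def \<rho>_def)
    ultimately have "F (cvec b) = 0" for b
      using line_polynomial_zero_near[OF line_polynomial_cvec[OF pF]] FU by blast
    then show False using polynomial_fn_zero_on_reals[OF pF] F(3) by blast
  qed
  have "hom_coords y \<in> X_of Z \<longleftrightarrow> norm y = 1 \<and> q y = 0" for y
  proof
    assume X: "hom_coords y \<in> X_of Z"
    then have X': "hcons 1 (cvec y) \<in> X_of Z" by (simp add: hom_coords_eq_hcons)
    have "of_real ((norm y)\<^sup>2) = (1 :: complex)" using X_ofD(2)[OF X'] unfolding sum_squares_cvec by simp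
    then have "(norm y)\<^sup>2 = 1" by (metis of_real_eq_1_iff)
    then have "norm y = 1" by (simp add: power2_eq_1_iff norm_ge_zero) (smt (verit) norm_ge_zero)
    moreover have "qc (cvec y) = 0" using X_of_vanishing[OF great X' \<open>qc \<in> ?I\<close>] .
    ultimately show "norm y = 1 \<and> q y = 0" by (simp add: qc)
  next
    assume y: "norm y = 1 \<and> q y = 0"
    show "hom_coords y \<in> X_of Z" unfolding hom_coords_eq_hcons
    proof (rule X_of_memI)
      show "1\<^sup>2 = (\<Sum>i\<in>UNIV. (cvec y $ i)\<^sup>2)" unfolding sum_squares_cvec using y by simp
      show "hcons 1 (cvec y) \<noteq> 0" by (simp add: hcons_eq_0_iff)
      show "f (cvec y) = 0" if "f \<in> ?I" for f using van_q[OF that] y by blast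
    qed
  qed
  moreover have "x = 0" if "N x = 0" for x using N(3)[of x] that linear_0[OF linL] by simp
  ultimately show ?thesis using N(1) unfolding q_def by (intro exI[of _ N]) auto
qed

end

section \<open>Principal axes\<close>

lemma quadratic_dominates_linear:
  fixes \<beta> c :: real
  assumes "\<And>t. 2 * t * \<beta> \<le> t\<^sup>2 * c" shows "\<beta> = 0"
proof (rule ccontr)
  assume b: "\<beta> \<noteq> 0"
  let ?t = "\<beta> / (\<bar>c\<bar> + 1)"
  have p: "\<bar>c\<bar> + 1 > 0" by simp
  have "2 * \<beta>\<^sup>2 / (\<bar>c\<bar> + 1) \<le> \<beta>\<^sup>2 * c / (\<bar>c\<bar> + 1)\<^sup>2"
    using assms[of ?t] by (simp add: power2_eq_square)
  also have "\<dots> = \<beta>\<^sup>2 / (\<bar>c\<bar> + 1) * (c / (\<bar>c\<bar> + 1))" by (simp add: power2_eq_square)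
  also have "\<dots> \<le> \<beta>\<^sup>2 / (\<bar>c\<bar> + 1) * 1" using p by (intro mult_left_mono) auto
  finally have "\<beta>\<^sup>2 / (\<bar>c\<bar> + 1) \<le> 0" by simp
  then show False using b p by (simp add: divide_le_0_iff)
qed

text \<open>
  A maximum of the form on the unit sphere of \<open>V\<close> is an eigenvector, by the first-order
  condition.
\<close>

lemma maximal_direction:
  fixes V :: "(real ^ 4) set"
  assumes b: "bilinear b" "\<And>x y. b x y = (b y x :: real)" and V: "subspace V" "v \<in> V" "v \<noteq> 0"
  shows "\<exists>e\<in>V. norm e = 1 \<and> (\<forall>x\<in>V. norm x = 1 \<longrightarrow> b x x \<le> b e e) \<and> (\<forall>y\<in>V. e \<bullet> y = 0 \<longrightarrow> b e y = 0)"
proof -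
  note bl = bilinear_ladd[OF b(1)] bilinear_radd[OF b(1)] bilinear_lmul[OF b(1)] bilinear_rmul[OF b(1)]
  have "compact (V \<inter> sphere 0 1)" using closed_subspace[OF V(1)] by (intro closed_Int_compact) auto
  moreover have "(1 / norm v) *\<^sub>R v \<in> V \<inter> sphere 0 1" using V by (simp add: subspace_scale)
  moreover have "continuous_on (V \<inter> sphere 0 1) (\<lambda>x. b x x)"
  proof -
    have bb: "bounded_bilinear b" using b(1) by (simp add: bilinear_conv_bounded_bilinear)
    show ?thesis by (intro bounded_bilinear.continuous_on[OF bb] continuous_on_id)
  qed
  ultimately have "\<exists>e\<in>V \<inter> sphere 0 1. \<forall>x\<in>V \<inter> sphere 0 1. b x x \<le> b e e"
    using continuous_attains_sup[of "V \<inter> sphere 0 1" "\<lambda>x. b x x"] by blast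
  then obtain e where e: "e \<in> V" "norm e = 1" "\<And>x. x \<in> V \<Longrightarrow> norm x = 1 \<Longrightarrow> b x x \<le> b e e"
    by auto
  have "b e y = 0" if y: "y \<in> V" "e \<bullet> y = 0" for y
  proof (rule quadratic_dominates_linear)
    fix t
    let ?x = "e + t *\<^sub>R y"
    have n2: "(norm ?x)\<^sup>2 = 1 + t\<^sup>2 * (y \<bullet> y)"
      using y(2) e(2) unfolding power2_norm_eq_inner
      by (simp add: inner_add_left inner_add_right inner_commute norm_eq_1 power2_eq_square)
    have pos: "norm ?x > 0"
    proof -
      have "(norm ?x)\<^sup>2 > 0" unfolding n2 by (simp add: add_pos_nonneg)
      then show ?thesis by (simp add: zero_less_power2)
    qed
    have "b ((1 / norm ?x) *\<^sub>R ?x) ((1 / norm ?x) *\<^sub>R ?x) \<le> b e e"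
      using e(1) y(1) V(1) pos by (intro e(3)) (auto simp: subspace_add subspace_scale)
    then have "b ?x ?x / (norm ?x)\<^sup>2 \<le> b e e"
      unfolding bilinear_lmul[OF b(1)] bilinear_rmul[OF b(1)] by (simp add: power2_eq_square)
    then have "b ?x ?x \<le> b e e * (1 + t\<^sup>2 * (y \<bullet> y))"
      using pos by (simp add: pos_divide_le_eq flip: n2)
    moreover have "b ?x ?x = b e e + 2 * t * b e y + t\<^sup>2 * b y y"
      using b(2)[of y e] by (simp add: bl power2_eq_square algebra_simps)
    ultimately show "2 * t * b e y \<le> t\<^sup>2 * (b e e * (y \<bullet> y) - b y y)"
      by (simp add: algebra_simps)
  qed
  then show ?thesis using e by blast
qed

lemma orthogonal_vector_exists_4:
  fixes S :: "(real ^ 4) set"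
  assumes "finite S" "card S < 4"
  shows "\<exists>v. v \<noteq> 0 \<and> (\<forall>x\<in>S. x \<bullet> v = 0)"
proof -
  have "dim S < DIM(real ^ 4)" using dim_le_card'[OF assms(1)] assms(2) by simp
  then obtain v where "v \<noteq> 0" "\<And>y. y \<in> span S \<Longrightarrow> orthogonal v y"
    using orthogonal_to_subspace_exists by blast
  then show ?thesis unfolding orthogonal_def by (metis inner_commute span_base)
qed

definition frame_map :: "real ^ 4 \<Rightarrow> real ^ 4 \<Rightarrow> real ^ 4 \<Rightarrow> real ^ 4 \<Rightarrow> real ^ 4 \<Rightarrow> real ^ 4" where
  "frame_map e1 e2 e3 e4 x = x $ 1 *\<^sub>R e1 + x $ 2 *\<^sub>R e2 + x $ 3 *\<^sub>R e3 + x $ 4 *\<^sub>R e4"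

lemma orthogonal_transformation_frame_map:
  assumes "norm e1 = 1" "norm e2 = 1" "norm e3 = 1" "norm e4 = 1"
    "e1 \<bullet> e2 = 0" "e1 \<bullet> e3 = 0" "e1 \<bullet> e4 = 0" "e2 \<bullet> e3 = 0" "e2 \<bullet> e4 = 0" "e3 \<bullet> e4 = 0"
  shows "orthogonal_transformation (frame_map e1 e2 e3 e4)"
  unfolding orthogonal_transformation_def
proof (intro conjI allI)
  show "linear (frame_map e1 e2 e3 e4)"
    unfolding frame_map_def by (rule linearI) (simp_all add: algebra_simps)
  fix v w
  have *: "e2 \<bullet> e1 = 0" "e3 \<bullet> e1 = 0" "e4 \<bullet> e1 = 0" "e3 \<bullet> e2 = 0" "e4 \<bullet> e2 = 0" "e4 \<bullet> e3 = 0"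
    using assms by (simp_all add: inner_commute)
  show "frame_map e1 e2 e3 e4 v \<bullet> frame_map e1 e2 e3 e4 w = v \<bullet> w"
    unfolding frame_map_def inner_add_left inner_add_right inner_scaleR_left inner_scaleR_right
    using assms * by (simp add: norm_eq_1 inner_vec_def[of v w] sum_4)
qed

definition diag_form :: "real ^ 4 \<Rightarrow> real ^ 4 \<Rightarrow> real" where
  "diag_form d x = d $ 1 * (x $ 1)\<^sup>2 + d $ 2 * (x $ 2)\<^sup>2 + d $ 3 * (x $ 3)\<^sup>2 + d $ 4 * (x $ 4)\<^sup>2"

text \<open>
  Successive maxima on orthogonal complements give the eigenvalues in decreasing order.
\<close>

lemma principal_axes:
  fixes b :: "real ^ 4 \<Rightarrow> real ^ 4 \<Rightarrow> real"
  assumes b: "bilinear b" "\<And>x y. b x y = b y x"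
  shows "\<exists>(T :: real ^ 4 \<Rightarrow> real ^ 4) d. orthogonal_transformation T \<and> (\<forall>x y. b (T x) (T y) =
      d $ 1 * x $ 1 * y $ 1 + d $ 2 * x $ 2 * y $ 2 + d $ 3 * x $ 3 * y $ 3 + d $ 4 * x $ 4 * y $ 4) \<and>
    d $ 1 \<ge> d $ 2 \<and> d $ 2 \<ge> d $ 3 \<and> d $ 3 \<ge> (d :: real ^ 4) $ 4"
proof -
  note bl = bilinear_ladd[OF b(1)] bilinear_radd[OF b(1)] bilinear_lmul[OF b(1)] bilinear_rmul[OF b(1)]
  define V where "V = (\<lambda>S :: (real ^ 4) set. {v. \<forall>x\<in>S. x \<bullet> v = 0})"
  have sV: "subspace (V S)" for S
    unfolding V_def by (auto simp: subspace_def inner_add_right)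
  have step: "\<exists>e\<in>V S. norm e = 1 \<and> (\<forall>x\<in>V S. norm x = 1 \<longrightarrow> b x x \<le> b e e) \<and> (\<forall>y\<in>V S. e \<bullet> y = 0 \<longrightarrow> b e y = 0)"
    if S: "finite S" "card S < 4" for S
  proof -
    obtain v where "v \<in> V S" "v \<noteq> 0" using orthogonal_vector_exists_4[OF S] unfolding V_def by blast
    then show ?thesis using maximal_direction[OF b sV] by blast
  qed
  obtain e1 where e1: "norm e1 = 1" "\<forall>x\<in>V {}. norm x = 1 \<longrightarrow> b x x \<le> b e1 e1" "\<forall>y\<in>V {}. e1 \<bullet> y = 0 \<longrightarrow> b e1 y = 0"
    using step[of "{}"] by auto
  obtain e2 where e2: "e2 \<in> V {e1}" "norm e2 = 1" "\<forall>x\<in>V {e1}. norm x = 1 \<longrightarrow> b x x \<le> b e2 e2"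
      "\<forall>y\<in>V {e1}. e2 \<bullet> y = 0 \<longrightarrow> b e2 y = 0"
    using step[of "{e1}"] by auto
  have c2: "card {e1, e2} < 4" by (simp add: card_insert_if)
  obtain e3 where e3: "e3 \<in> V {e1, e2}" "norm e3 = 1" "\<forall>x\<in>V {e1, e2}. norm x = 1 \<longrightarrow> b x x \<le> b e3 e3"
      "\<forall>y\<in>V {e1, e2}. e3 \<bullet> y = 0 \<longrightarrow> b e3 y = 0"
    using step[of "{e1, e2}"] c2 by auto
  have c3: "card {e1, e2, e3} < 4" by (simp add: card_insert_if)
  obtain e4 where e4: "e4 \<in> V {e1, e2, e3}" "norm e4 = 1"
    using step[of "{e1, e2, e3}"] c3 by auto
  have orth: "e1 \<bullet> e2 = 0" "e1 \<bullet> e3 = 0" "e1 \<bullet> e4 = 0" "e2 \<bullet> e3 = 0" "e2 \<bullet> e4 = 0" "e3 \<bullet> e4 = 0"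
    using e2(1) e3(1) e4(1) unfolding V_def by auto
  have bz: "b e1 e2 = 0" "b e1 e3 = 0" "b e1 e4 = 0" "b e2 e3 = 0" "b e2 e4 = 0" "b e3 e4 = 0"
    using e1(3) e2(4) e3(4) orth unfolding V_def by auto
  have bz': "b e2 e1 = 0" "b e3 e1 = 0" "b e4 e1 = 0" "b e3 e2 = 0" "b e4 e2 = 0" "b e4 e3 = 0"
    using bz b(2) by metis+
  have ord: "b e1 e1 \<ge> b e2 e2" "b e2 e2 \<ge> b e3 e3" "b e3 e3 \<ge> b e4 e4"
    using e1(2) e2(2,3) e3(2,3) e4(2) orth unfolding V_def by auto
  define d :: "real ^ 4" where "d = vector [b e1 e1, b e2 e2, b e3 e3, b e4 e4]"
  have "b (frame_map e1 e2 e3 e4 x) (frame_map e1 e2 e3 e4 y) =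
      d $ 1 * x $ 1 * y $ 1 + d $ 2 * x $ 2 * y $ 2 + d $ 3 * x $ 3 * y $ 3 + d $ 4 * x $ 4 * y $ 4" for x y
    unfolding frame_map_def bl bz bz' by (simp add: d_def)
  moreover have "orthogonal_transformation (frame_map e1 e2 e3 e4)"
    using orthogonal_transformation_frame_map e1 e2 e3 e4 orth by blast
  ultimately show ?thesis using ord by (intro exI[of _ "frame_map e1 e2 e3 e4"] exI[of _ d]) (auto simp: d_def)
qed

definition quadric_section :: "real ^ 4 \<Rightarrow> (real ^ 4) set" where
  "quadric_section d = {x. norm x = 1 \<and> diag_form d x = 0}"

text \<open>
  Signature (2, 2), with the eigenvalues in decreasing order.
\<close>

definition principal_signs :: "real ^ 4 \<Rightarrow> bool" where
  "principal_signs d \<longleftrightarrow> d $ 1 \<ge> d $ 2 \<and> d $ 2 > 0 \<and> 0 > d $ 3 \<and> d $ 3 \<ge> d $ 4"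

context great_cyclide
begin

text \<open>
  The quadric is nondegenerate and contains a real line, that is, a plane of isotropic
  vectors. This plane meets every coordinate hyperplane, so no three eigenvalues have the
  same sign.
\<close>

theorem real_points_principal_axes:
  "\<exists>T d. orthogonal_transformation T \<and> principal_signs d \<and> real_points (X_of Z) = T ` quadric_section d"
proof -
  obtain N :: "real ^ 4 \<Rightarrow> real ^ 4" where N: "linear N" "\<forall>x. N x = 0 \<longrightarrow> x = 0"
     "\<forall>y. hom_coords y \<in> X_of Z \<longleftrightarrow> norm y = 1 \<and> N y $ 1 * N y $ 4 = N y $ 2 * N y $ 3"
    using preimage_is_quadric_section by blast
  have "inj N" using N(1,2) linear_injective_0 by blast
  then obtain L where L: "linear L" "\<And>x. L (N x) = x" "\<And>x. N (L x) = x"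
    using linear_injective_isomorphism[OF N(1)] by blast
  define b where "b = (\<lambda>x y. N x $ 1 * N y $ 4 + N x $ 4 * N y $ 1 - N x $ 2 * N y $ 3 - N x $ 3 * N y $ 2)"
  have bil: "bilinear b"
    unfolding bilinear_def b_def
    by (intro conjI allI linearI)
       (simp_all add: linear_add[OF N(1)] linear_cmul[OF N(1)] algebra_simps)
  have sym: "b x y = b y x" for x y by (simp add: b_def)
  obtain T :: "real ^ 4 \<Rightarrow> real ^ 4" and d where T: "orthogonal_transformation T"
    "\<And>x y. b (T x) (T y) = d $ 1 * x $ 1 * y $ 1 + d $ 2 * x $ 2 * y $ 2 + d $ 3 * x $ 3 * y $ 3 + d $ 4 * x $ 4 * y $ 4"
    and ord: "d $ 1 \<ge> d $ 2" "d $ 2 \<ge> d $ 3" "d $ 3 \<ge> (d :: real ^ 4) $ 4"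
    using principal_axes[OF bil sym] by blast
  have surjT: "\<exists>x. y = T x" for y using orthogonal_transformation_surj[OF T(1)] by (metis surjD)
  have form: "diag_form d x = 2 * (N (T x) $ 1 * N (T x) $ 4 - N (T x) $ 2 * N (T x) $ 3)" for x
    using T(2)[of x x] by (simp add: b_def diag_form_def power2_eq_square mult.assoc)
  have nondeg: "x = 0" if "\<And>y. b x y = 0" for x
  proof -
    have "N x $ 4 = 0" "N x $ 3 = 0" "N x $ 2 = 0" "N x $ 1 = 0"
      using that[of "L (axis 1 1)"] that[of "L (axis 2 1)"] that[of "L (axis 3 1)"] that[of "L (axis 4 1)"]
      by (simp_all add: b_def L(3) axis_def)
    then have "N x = 0" by (simp add: vec_eq_iff forall_4)
    then show ?thesis using N(2) by blast
  qed
  have linT: "linear T" using T(1) by (rule orthogonal_transformation_linear)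
  have dnz: "d $ i \<noteq> 0" for i
  proof
    assume di: "d $ i = 0"
    have "b (T (axis i 1)) y = 0" for y
    proof -
      obtain x where y: "y = T x" using surjT by blast
      have "i = 1 \<or> i = 2 \<or> i = 3 \<or> i = 4" using exhaust_4 by blast
      then show ?thesis using di unfolding y T(2) by (elim disjE) (simp_all add: axis_def)
    qed
    then have "T (axis i 1) = 0" by (rule nondeg)
    then have "norm (axis i 1 :: real ^ 4) = 0" using orthogonal_transformation_norm[OF T(1), of "axis i 1"] by simp
    then show False by simp
  qed
  \<comment> \<open>A plane on which the form vanishes meets every hyperplane.\<close>
  have isotropic: "\<exists>x. x \<noteq> 0 \<and> diag_form d x = 0 \<and> x $ i = 0" for i
  proof -
    obtain u w where uw: "T u = L (axis 3 1)" "T w = L (axis 4 1)" using surjT by metis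
    define x where "x = (if u $ i = 0 then u else w $ i *\<^sub>R u - u $ i *\<^sub>R w)"
    have NTx: "N (T x) = (if u $ i = 0 then axis 3 1 else w $ i *\<^sub>R axis 3 1 - u $ i *\<^sub>R axis 4 1)"
      by (simp add: x_def linear_diff[OF linT] linear_cmul[OF linT] uw linear_diff[OF N(1)] linear_cmul[OF N(1)] L(3))
    have "diag_form d x = 0" unfolding form NTx by (simp add: axis_def)
    moreover have "x \<noteq> 0"
    proof
      assume "x = 0"
      then have z: "N (T x) = 0" using linear_0[OF linT] linear_0[OF N(1)] by simp
      show False
        using arg_cong[OF z, of "\<lambda>v. v $ 3"] arg_cong[OF z, of "\<lambda>v. v $ 4"] unfolding NTx
        by (simp add: axis_def split: if_splits)
    qed
    moreover have "x $ i = 0" by (simp add: x_def)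
    ultimately show ?thesis by blast
  qed
  have d2: "d $ 2 > 0"
  proof (rule ccontr)
    assume "\<not> ?thesis"
    then have neg: "d $ 2 < 0" "d $ 3 < 0" "d $ 4 < 0" using dnz[of 2] ord by linarith+
    obtain x where x: "x \<noteq> 0" "diag_form d x = 0" "x $ 1 = 0" using isotropic by blast
    have "d $ 2 * (x $ 2)\<^sup>2 \<le> 0" "d $ 3 * (x $ 3)\<^sup>2 \<le> 0" "d $ 4 * (x $ 4)\<^sup>2 \<le> 0"
      using neg by (simp_all add: mult_nonpos_nonneg)
    moreover have "d $ 2 * (x $ 2)\<^sup>2 + d $ 3 * (x $ 3)\<^sup>2 + d $ 4 * (x $ 4)\<^sup>2 = 0"
      using x(2,3) unfolding diag_form_def by simp
    ultimately have "d $ 2 * (x $ 2)\<^sup>2 = 0" "d $ 3 * (x $ 3)\<^sup>2 = 0" "d $ 4 * (x $ 4)\<^sup>2 = 0"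
      by linarith+
    then show False using x neg by (simp add: vec_eq_iff forall_4)
  qed
  have d3: "d $ 3 < 0"
  proof (rule ccontr)
    assume "\<not> ?thesis"
    then have pos: "d $ 1 > 0" "d $ 2 > 0" "d $ 3 > 0" using dnz[of 3] ord by linarith+
    obtain x where x: "x \<noteq> 0" "diag_form d x = 0" "x $ 4 = 0" using isotropic by blast
    have "d $ 1 * (x $ 1)\<^sup>2 \<ge> 0" "d $ 2 * (x $ 2)\<^sup>2 \<ge> 0" "d $ 3 * (x $ 3)\<^sup>2 \<ge> 0"
      using pos by simp_all
    moreover have "d $ 1 * (x $ 1)\<^sup>2 + d $ 2 * (x $ 2)\<^sup>2 + d $ 3 * (x $ 3)\<^sup>2 = 0"
      using x(2,3) unfolding diag_form_def by simp
    ultimately have "d $ 1 * (x $ 1)\<^sup>2 = 0" "d $ 2 * (x $ 2)\<^sup>2 = 0" "d $ 3 * (x $ 3)\<^sup>2 = 0"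
      by linarith+
    then show False using x pos by (simp add: vec_eq_iff forall_4)
  qed
  have "hom_coords (T x) \<in> X_of Z \<longleftrightarrow> x \<in> quadric_section d" for x
    using N(3) form[of x] orthogonal_transformation_norm[OF T(1)] by (auto simp: quadric_section_def)
  then have on: "\<And>x. hom_coords (T x) \<in> X_of Z \<longleftrightarrow> x \<in> quadric_section d" .
  have "real_points (X_of Z) = T ` quadric_section d"
  proof
    show "T ` quadric_section d \<subseteq> real_points (X_of Z)" using on by (auto simp: real_points_def)
    show "real_points (X_of Z) \<subseteq> T ` quadric_section d"
    proof
      fix p assume p: "p \<in> real_points (X_of Z)"
      obtain x where x: "p = T x" using surjT by blast
      then have "x \<in> quadric_section d" using p on by (simp add: real_points_def)
      then show "p \<in> T ` quadric_section d" using x by blast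
    qed
  qed
  moreover have "principal_signs d" using d2 d3 ord by (simp add: principal_signs_def)
  ultimately show ?thesis using T(1) by blast
qed

lemma real_points_minus_pole: "real_points (X_of Z) - {north_pole} = stereo_preimage Z"
proof -
  have cl: "zariski_closed Z" using irreducible by (simp add: zariski_irreducible_def)
  have "p \<in> stereo_preimage Z" if "hom_coords p \<in> X_of Z" "p \<noteq> north_pole" for p
  proof -
    have "norm p = 1" using preimage_is_quadric_section that(1) by blast
    then show ?thesis using X_of_real_point_in_preimage[OF cl that(1)] that(2) by blast
  qed
  moreover have "hom_coords p \<in> X_of Z \<and> p \<noteq> north_pole" if "p \<in> stereo_preimage Z" for p
    using that unfolding X_of_def proj_closure_def stereo_preimage_def by (auto simp: hom_coords_nonzero)
  ultimately show ?thesis unfolding real_points_def by blast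
qed

end

section \<open>Circles on the quadric section\<close>

text \<open>
  The circle through \<open>x\<close> in the affine plane with directions \<open>D\<close>. For orthogonal \<open>D\<close> and
  \<open>x\<close> the plane is tangent to the sphere and the circle shrinks to a point.
\<close>

definition circ :: "real ^ 4 \<Rightarrow> (real ^ 4) set \<Rightarrow> (real ^ 4) set" where
  "circ x D = {x + v | v. v \<in> D} \<inter> S3"

lemma circ_is_circle:
  assumes D: "subspace D" "dim D = 2" and x: "norm x = 1" and v0: "v0 \<in> D" "v0 \<bullet> x \<noteq> 0"
  shows "circle_in_S3 (circ x D)"
proof -
  obtain z c where zc: "z \<in> span D" "\<And>w. w \<in> span D \<Longrightarrow> orthogonal c w" "x = z + c"
    using orthogonal_subspace_decomp_exists[of D x] by metis
  have z: "z \<in> D" and c: "c \<bullet> w = 0" if "w \<in> D" for w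
    using zc D(1) that by (auto simp: orthogonal_def span_eq_iff[THEN iffD2])
  have zD: "z \<in> D" using zc(1) D(1) by (simp add: span_eq_iff[THEN iffD2])
  have "v0 \<bullet> z \<noteq> 0" using v0 c[OF v0(1)] unfolding zc(3) by (simp add: inner_add_right inner_commute)
  then have z0: "z \<noteq> 0" by auto
  let ?P = "(+) x ` D"
  have x2: "1 = (norm z)\<^sup>2 + (norm c)\<^sup>2"
  proof -
    have "1 = (z + c) \<bullet> (z + c)" using x unfolding zc(3) by (simp add: norm_eq_1)
    then show ?thesis using c[OF zD] by (simp add: power2_norm_eq_inner inner_add_left inner_add_right inner_commute)
  qed
  have cP: "c \<in> ?P"
    by (rule image_eqI[of _ _ "- z"]) (use zc(3) zD D(1) in \<open>auto simp: subspace_neg\<close>)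
  have eq: "circ x D = ?P \<inter> sphere c (norm z)"
  proof -
    have "norm (x + v) = 1 \<longleftrightarrow> dist c (x + v) = norm z" if v: "v \<in> D" for v
    proof -
      have zv: "z + v \<in> D" using zD v D(1) by (simp add: subspace_add)
      have "(norm (x + v))\<^sup>2 = (norm c)\<^sup>2 + (norm (z + v))\<^sup>2"
      proof -
        have "x + v = c + (z + v)" using zc(3) by simp
        then show ?thesis using c[OF zv] by (simp add: power2_norm_eq_inner inner_add_left[of c] inner_add_right inner_commute)
      qed
      moreover have "dist c (x + v) = norm (z + v)" using zc(3) by (simp add: dist_norm norm_minus_commute algebra_simps)
      moreover have "norm (x + v) = 1 \<longleftrightarrow> (norm (x + v))\<^sup>2 = 1" by (simp add: power2_eq_1_iff) (smt (verit) norm_ge_zero)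
      moreover have "norm (z + v) = norm z \<longleftrightarrow> (norm (z + v))\<^sup>2 = (norm z)\<^sup>2"
        by (metis norm_ge_zero power2_eq_imp_eq)
      ultimately show ?thesis using x2 by (metis add.commute add_left_cancel)
    qed
    then show ?thesis unfolding circ_def by auto
  qed
  show ?thesis
    unfolding circle_in_S3_def
  proof (intro conjI exI)
    show "circ x D \<subseteq> S3" by (auto simp: circ_def)
    show "affine ?P" using D(1) affine_translation subspace_imp_affine by blast
    show "aff_dim ?P = 2" using D by (simp add: aff_dim_translation_eq aff_dim_subspace)
  qed (use cP z0 eq in auto)
qed

text \<open>
  The centre is the foot of the perpendicular from the origin, as the circle lies on the
  unit sphere.
\<close>

lemma circle_in_S3_cases:
  assumes C: "circle_in_S3 C" "x \<in> C"
  obtains D c r where "subspace D" "dim D = 2" "C = circ x D" "r > 0"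
    "\<And>v. v \<in> D \<Longrightarrow> norm v = 1 \<Longrightarrow> c + r *\<^sub>R v \<in> C" "\<And>v. v \<in> D \<Longrightarrow> c \<bullet> v = 0" "x - c \<in> D" "norm (x - c) = r"
proof -
  obtain P c r where P: "affine P" "aff_dim P = 2" "c \<in> P" "r > 0" "C = P \<inter> sphere c r" and S: "C \<subseteq> S3"
    using C(1) unfolding circle_in_S3_def by blast
  define D where "D = (\<lambda>y. y - c) ` P"
  have D: "subspace D" unfolding D_def using affine_diffs_subspace_subtract[OF P(1,3)] .
  have "int (dim D) = aff_dim D" using aff_dim_subspace[OF D] by simp
  also have "aff_dim D = 2" unfolding D_def using P(2) by (simp add: aff_dim_translation_eq_subtract)
  finally have dD: "dim D = 2" by simp
  have memP: "y \<in> P \<longleftrightarrow> y - c \<in> D" for y unfolding D_def by (auto simp: image_iff)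
  have on: "c + r *\<^sub>R v \<in> C" if "v \<in> D" "norm v = 1" for v
    using that D P(4) unfolding P(5) by (auto simp: memP subspace_scale dist_norm)
  have xc: "x - c \<in> D" "norm (x - c) = r" using C(2) memP unfolding P(5) by (auto simp: dist_norm norm_minus_commute)
  have perp: "c \<bullet> v = 0" if v: "v \<in> D" for v
  proof (cases "v = 0")
    case False
    let ?u = "(1 / norm v) *\<^sub>R v"
    have u: "?u \<in> D" "norm ?u = 1" "- ?u \<in> D" "norm (- ?u) = 1"
      using v D False by (auto simp: subspace_scale subspace_neg)
    have "norm (c + r *\<^sub>R ?u) = 1" "norm (c + r *\<^sub>R (- ?u)) = 1"
      using on[OF u(1,2)] on[OF u(3,4)] S by (auto simp: subset_iff)
    then have "(c + r *\<^sub>R ?u) \<bullet> (c + r *\<^sub>R ?u) = (c + r *\<^sub>R (- ?u)) \<bullet> (c + r *\<^sub>R (- ?u))"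
      by (simp only: norm_eq_1)
    then have "4 * r * (c \<bullet> ?u) = 0" by (simp add: inner_add_left inner_add_right inner_diff_left inner_diff_right inner_commute algebra_simps)
    then show ?thesis using P(4) False by simp
  qed simp
  have "C = circ x D"
  proof
    show "C \<subseteq> circ x D"
    proof
      fix y assume y: "y \<in> C"
      then have "y - c \<in> D" unfolding P(5) by (auto simp: memP)
      then have "(y - c) - (x - c) \<in> D" using xc D subspace_diff by blast
      then have "y - x \<in> D" by simp
      then show "y \<in> circ x D" using y S unfolding circ_def by (auto intro!: exI[of _ "y - x"])
    qed
    show "circ x D \<subseteq> C"
    proof
      fix y assume "y \<in> circ x D"
      then obtain v where v: "y = x + v" "v \<in> D" "norm y = 1" by (auto simp: circ_def)
      have yc: "y - c \<in> D" using v xc D subspace_add[OF D xc(1) v(2)] by (simp add: algebra_simps)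
      have pyth: "(norm (c + w))\<^sup>2 = (norm c)\<^sup>2 + (norm w)\<^sup>2" if "w \<in> D" for w
        using perp[OF that] by (simp add: power2_norm_eq_inner inner_add_left inner_add_right inner_commute)
      have "norm x = 1" using C(2) S by auto
      then have "(norm c)\<^sup>2 + (norm (y - c))\<^sup>2 = (norm c)\<^sup>2 + (norm (x - c))\<^sup>2"
        using pyth[OF yc] pyth[OF xc(1)] v(3) by simp
      then have "norm (y - c) = r" using xc(2) by (metis add_left_cancel norm_ge_zero power2_eq_imp_eq)
      then show "y \<in> C" unfolding P(5) using yc by (auto simp: memP dist_norm norm_minus_commute)
    qed
  qed
  then show ?thesis using that[of D r c] D dD P(4) on perp xc by blast
qed

text \<open>
  In a direction that is not orthogonal to \<open>x\<close>, the line through \<open>x\<close> meets the sphere in a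
  second point; such directions span \<open>D\<close>.
\<close>

lemma circ_subset_imp_direction_subset:
  assumes D: "subspace D" "subspace D'" and x: "norm x = 1" and sub: "circ x D \<subseteq> circ x D'"
    and v0: "v0 \<in> D" "v0 \<bullet> x \<noteq> 0"
  shows "D \<subseteq> D'"
proof -
  have key: "v \<in> D'" if v: "v \<in> D" "v \<bullet> x \<noteq> 0" for v
  proof -
    have vv: "v \<bullet> v \<noteq> 0" using v(2) by auto
    let ?s = "- 2 * (v \<bullet> x) / (v \<bullet> v)"
    have "(x + ?s *\<^sub>R v) \<bullet> (x + ?s *\<^sub>R v) = x \<bullet> x + 2 * ?s * (v \<bullet> x) + ?s * ?s * (v \<bullet> v)"
      by (simp add: inner_add_left inner_add_right inner_commute algebra_simps)
    also have "\<dots> = x \<bullet> x" using vv by (simp add: field_simps)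
    finally have "norm (x + ?s *\<^sub>R v) = 1" using x by (simp add: norm_eq_1)
    then have "x + ?s *\<^sub>R v \<in> circ x D" using v(1) D(1) unfolding circ_def by (auto intro!: exI[of _ "?s *\<^sub>R v"] subspace_scale subspace_neg)
    then obtain w where w: "x + ?s *\<^sub>R v = x + w" "w \<in> D'" using sub unfolding circ_def by blast
    then have "(1 / ?s) *\<^sub>R (?s *\<^sub>R v) \<in> D'" using D(2) subspace_scale by (metis add_left_cancel)
    then show ?thesis using v(2) vv by simp
  qed
  show ?thesis
  proof
    fix v assume v: "v \<in> D"
    show "v \<in> D'"
    proof (cases "v \<bullet> x = 0")
      case True
      have "v + v0 \<in> D'" using v v0 True D(1) by (intro key) (auto simp: subspace_add inner_add_left)
      moreover have "v0 \<in> D'" using key v0 by blast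
      ultimately have "(v + v0) - v0 \<in> D'" using D(2) subspace_diff by blast
      then show ?thesis by simp
    qed (use key v in blast)
  qed
qed

definition direction_plane :: "real ^ 4 \<Rightarrow> real ^ 4 \<Rightarrow> (real ^ 4) set" where
  "direction_plane u w = {s *\<^sub>R u + t *\<^sub>R w | s t. True}"

lemma direction_plane_eq_span: "direction_plane u w = span {u, w}"
proof
  show "direction_plane u w \<subseteq> span {u, w}"
    using span_base[of u "{u, w}"] span_base[of w "{u, w}"]
    unfolding direction_plane_def by (auto intro!: span_add span_scale)
  show "span {u, w} \<subseteq> direction_plane u w" unfolding direction_plane_def using span_pair by blast
qed

lemma subspace_direction_plane: "subspace (direction_plane u w)"
  by (simp add: direction_plane_eq_span)

lemma dim_direction_plane:
  assumes "\<And>s t. s *\<^sub>R u + t *\<^sub>R w = 0 \<Longrightarrow> s = 0 \<and> t = 0"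
  shows "dim (direction_plane u w) = 2"
proof -
  have neq: "w \<noteq> u" using assms[of 1 "-1"] by auto
  have "u \<noteq> 0" using assms[of 1 0] by auto
  moreover have "w \<notin> span {u}" using assms[of _ "-1"] by (auto simp: span_singleton)
  ultimately have "independent {w, u}" by (intro independent_insertI) (auto simp: independent_empty)
  then show ?thesis unfolding direction_plane_eq_span using neq
    by (simp add: dim_eq_card_independent insert_commute)
qed

lemma direction_plane_mem: "u \<in> direction_plane u w" "w \<in> direction_plane u w"
proof -
  have "u = 1 *\<^sub>R u + 0 *\<^sub>R w" "w = 0 *\<^sub>R u + 1 *\<^sub>R w" by simp_all
  then show "u \<in> direction_plane u w" "w \<in> direction_plane u w"
    unfolding direction_plane_def by blast+
qed

text \<open>Two vectors of the same length in a plane are related by a rotation and by a reflection.\<close>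

lemma rotation_between:
  fixes p1 p2 q1 q2 \<sigma> :: real
  assumes eq: "p1\<^sup>2 + p2\<^sup>2 = q1\<^sup>2 + q2\<^sup>2" and nz: "p1\<^sup>2 + p2\<^sup>2 \<noteq> 0" and \<sigma>: "\<sigma>\<^sup>2 = 1"
  shows "\<exists>c s. c\<^sup>2 + s\<^sup>2 = 1 \<and> q1 = c * p1 - \<sigma> * s * p2 \<and> q2 = s * p1 + \<sigma> * c * p2"
proof -
  let ?n = "p1\<^sup>2 + p2\<^sup>2"
  define c where "c = (p1 * q1 + \<sigma> * p2 * q2) / ?n"
  define s where "s = (p1 * q2 - \<sigma> * p2 * q1) / ?n"
  have cn: "c * ?n = p1 * q1 + \<sigma> * p2 * q2" "s * ?n = p1 * q2 - \<sigma> * p2 * q1"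
    using nz by (simp_all add: c_def s_def)
  have \<sigma>': "\<sigma> * \<sigma> = 1" using \<sigma> by (simp add: power2_eq_square)
  have "(c * p1 - \<sigma> * s * p2) * ?n = (c * ?n) * p1 - \<sigma> * (s * ?n) * p2" by (simp add: algebra_simps)
  also have "\<dots> = q1 * p1\<^sup>2 + (\<sigma> * \<sigma>) * p2\<^sup>2 * q1" unfolding cn by (simp add: algebra_simps power2_eq_square)
  finally have 1: "(c * p1 - \<sigma> * s * p2) * ?n = q1 * ?n" unfolding \<sigma>' by (simp add: algebra_simps)
  have "(s * p1 + \<sigma> * c * p2) * ?n = (s * ?n) * p1 + \<sigma> * (c * ?n) * p2" by (simp add: algebra_simps)
  also have "\<dots> = q2 * p1\<^sup>2 + (\<sigma> * \<sigma>) * p2\<^sup>2 * q2" unfolding cn by (simp add: algebra_simps power2_eq_square)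
  finally have 2: "(s * p1 + \<sigma> * c * p2) * ?n = q2 * ?n" unfolding \<sigma>' by (simp add: algebra_simps)
  have "(c\<^sup>2 + s\<^sup>2) * ?n * ?n = (c * ?n)\<^sup>2 + (s * ?n)\<^sup>2" by (simp add: algebra_simps power2_eq_square)
  also have "\<dots> = (p1\<^sup>2 + (\<sigma> * \<sigma>) * p2\<^sup>2) * q1\<^sup>2 + (p1\<^sup>2 + (\<sigma> * \<sigma>) * p2\<^sup>2) * q2\<^sup>2" unfolding cn by (simp add: algebra_simps power2_eq_square)
  also have "\<dots> = ?n * (q1\<^sup>2 + q2\<^sup>2)" unfolding \<sigma>' by (simp add: algebra_simps)
  finally have "(c\<^sup>2 + s\<^sup>2) * ?n * ?n = 1 * ?n * ?n" unfolding eq[symmetric] by (simp add: algebra_simps)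
  then have 3: "c\<^sup>2 + s\<^sup>2 = 1" using mult_right_cancel[OF nz] by blast
  have "q1 = c * p1 - \<sigma> * s * p2" "q2 = s * p1 + \<sigma> * c * p2"
    using 1 2 mult_right_cancel[OF nz] by metis+
  then show ?thesis using 3 by blast
qed

text \<open>
  For \<open>\<sigma> = 1\<close> the map is a rotation, for \<open>\<sigma> = - 1\<close> a reflection.
\<close>

lemma rotated_same_length:
  fixes p1 p2 c s \<sigma> :: real
  assumes "c\<^sup>2 + s\<^sup>2 = 1" "\<sigma>\<^sup>2 = 1"
  shows "(c * p1 - \<sigma> * s * p2)\<^sup>2 + (s * p1 + \<sigma> * c * p2)\<^sup>2 = p1\<^sup>2 + p2\<^sup>2"
proof -
  have "(c * p1 - \<sigma> * s * p2)\<^sup>2 + (s * p1 + \<sigma> * c * p2)\<^sup>2 = (c\<^sup>2 + s\<^sup>2) * p1\<^sup>2 + \<sigma>\<^sup>2 * (c\<^sup>2 + s\<^sup>2) * p2\<^sup>2"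
    by (simp add: power2_eq_square algebra_simps)
  then show ?thesis using assms by simp
qed

text \<open>
  The directions of three families of circles through a point. On the sphere, adding the
  multiple \<open>0\<close>, \<open>- d\<^sub>2\<close> or \<open>- d\<^sub>3\<close> of \<open>|x|\<^sup>2 - 1\<close> turns the quadratic form into \<open>\<plusminus>(|p|\<^sup>2 -
  |q|\<^sup>2)\<close>, where \<open>p\<close> and \<open>q\<close> are affine functions of \<open>x\<close> with values in the plane. A
  rotation or reflection \<open>R\<close> with \<open>q = R p\<close> at the given point exists, and the equation \<open>q
  = R p\<close> defines an affine plane, on which the form vanishes. The parameters \<open>\<sigma>, c, s\<close>
  describe \<open>R\<close>.
\<close>

definition great_dirs :: "real ^ 4 \<Rightarrow> real \<Rightarrow> real \<Rightarrow> real \<Rightarrow> (real ^ 4) set" where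
  "great_dirs d \<sigma> c s = direction_plane
     (vector [1, 0, c * sqrt (d$1) / sqrt (- d$3), s * sqrt (d$1) / sqrt (- d$4)])
     (vector [0, 1, - \<sigma> * s * sqrt (d$2) / sqrt (- d$3), \<sigma> * c * sqrt (d$2) / sqrt (- d$4)])"

definition upper_dirs :: "real ^ 4 \<Rightarrow> real \<Rightarrow> real \<Rightarrow> (real ^ 4) set" where
  "upper_dirs d c s = direction_plane
     (vector [1, 0, c * sqrt (d$1 - d$2) / sqrt (d$2 - d$3), s * sqrt (d$1 - d$2) / sqrt (d$2 - d$4)])
     (axis 2 1)"

definition lower_dirs :: "real ^ 4 \<Rightarrow> real \<Rightarrow> real \<Rightarrow> (real ^ 4) set" where
  "lower_dirs d c s = direction_plane (axis 3 1)
     (vector [c * sqrt (d$3 - d$4) / sqrt (d$1 - d$3), s * sqrt (d$3 - d$4) / sqrt (d$2 - d$3), 0, 1])"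

lemma great_dirs_circle:
  assumes d: "principal_signs d" and x: "x \<in> quadric_section d" and cs: "c\<^sup>2 + s\<^sup>2 = 1" "\<sigma>\<^sup>2 = 1"
    and rot: "sqrt (- d$3) * x$3 = c * (sqrt (d$1) * x$1) - \<sigma> * s * (sqrt (d$2) * x$2)"
      "sqrt (- d$4) * x$4 = s * (sqrt (d$1) * x$1) + \<sigma> * c * (sqrt (d$2) * x$2)"
  shows "circ x (great_dirs d \<sigma> c s) \<subseteq> quadric_section d"
proof
  fix y assume "y \<in> circ x (great_dirs d \<sigma> c s)"
  then obtain a b where y: "norm y = 1" "y = x + (a *\<^sub>R vector [1, 0, c * sqrt (d$1) / sqrt (- d$3), s * sqrt (d$1) / sqrt (- d$4)] +
     b *\<^sub>R vector [0, 1, - \<sigma> * s * sqrt (d$2) / sqrt (- d$3), \<sigma> * c * sqrt (d$2) / sqrt (- d$4)])"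
    unfolding circ_def great_dirs_def direction_plane_def by auto
  have pos: "d$1 \<ge> 0" "d$2 \<ge> 0" "- d$3 > 0" "- d$4 > 0" using d by (auto simp: principal_signs_def)
  then have sq: "sqrt (- d$3) \<noteq> 0" "sqrt (- d$4) \<noteq> 0" by auto
  have comp: "y$1 = x$1 + a" "y$2 = x$2 + b"
    "y$3 = x$3 + (a * (c * sqrt (d$1) / sqrt (- d$3)) + b * (- \<sigma> * s * sqrt (d$2) / sqrt (- d$3)))"
    "y$4 = x$4 + (a * (s * sqrt (d$1) / sqrt (- d$4)) + b * (\<sigma> * c * sqrt (d$2) / sqrt (- d$4)))"
    unfolding y(2) by simp_all
  have "sqrt (- d$3) * y$3 = c * (sqrt (d$1) * y$1) - \<sigma> * s * (sqrt (d$2) * y$2)"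
    unfolding comp distrib_left rot using sq by (simp add: field_simps)
  moreover have "sqrt (- d$4) * y$4 = s * (sqrt (d$1) * y$1) + \<sigma> * c * (sqrt (d$2) * y$2)"
    unfolding comp distrib_left rot using sq by (simp add: field_simps)
  ultimately have "(sqrt (- d$3) * y$3)\<^sup>2 + (sqrt (- d$4) * y$4)\<^sup>2 = (sqrt (d$1) * y$1)\<^sup>2 + (sqrt (d$2) * y$2)\<^sup>2"
    using rotated_same_length[OF cs] by simp
  then have "- d$3 * (y$3)\<^sup>2 + - d$4 * (y$4)\<^sup>2 = d$1 * (y$1)\<^sup>2 + d$2 * (y$2)\<^sup>2"
    using pos by (simp add: power_mult_distrib)
  then show "y \<in> quadric_section d" using y(1) by (simp add: quadric_section_def diag_form_def)
qed

lemma upper_dirs_circle: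
  assumes d: "principal_signs d" and x: "x \<in> quadric_section d" and cs: "c\<^sup>2 + s\<^sup>2 = 1" "\<sigma>\<^sup>2 = 1"
    and rot: "sqrt (d$2 - d$3) * x$3 = c * (sqrt (d$1 - d$2) * x$1) - \<sigma> * s * sqrt (d$2)"
      "sqrt (d$2 - d$4) * x$4 = s * (sqrt (d$1 - d$2) * x$1) + \<sigma> * c * sqrt (d$2)"
  shows "circ x (upper_dirs d c s) \<subseteq> quadric_section d"
proof
  fix y assume "y \<in> circ x (upper_dirs d c s)"
  then obtain a b where y: "norm y = 1" "y = x + (a *\<^sub>R vector [1, 0, c * sqrt (d$1 - d$2) / sqrt (d$2 - d$3),
      s * sqrt (d$1 - d$2) / sqrt (d$2 - d$4)] + b *\<^sub>R axis 2 1)"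
    unfolding circ_def upper_dirs_def direction_plane_def by auto
  have pos: "d$1 - d$2 \<ge> 0" "d$2 \<ge> 0" "d$2 - d$3 > 0" "d$2 - d$4 > 0" using d by (auto simp: principal_signs_def)
  then have sq: "sqrt (d$2 - d$3) \<noteq> 0" "sqrt (d$2 - d$4) \<noteq> 0" by auto
  have comp: "y$1 = x$1 + a" "y$3 = x$3 + a * (c * sqrt (d$1 - d$2) / sqrt (d$2 - d$3))"
    "y$4 = x$4 + a * (s * sqrt (d$1 - d$2) / sqrt (d$2 - d$4))"
    unfolding y(2) by (simp_all add: axis_def)
  have "sqrt (d$2 - d$3) * y$3 = c * (sqrt (d$1 - d$2) * y$1) - \<sigma> * s * sqrt (d$2)"
    unfolding comp distrib_left rot using sq by (simp add: field_simps)
  moreover have "sqrt (d$2 - d$4) * y$4 = s * (sqrt (d$1 - d$2) * y$1) + \<sigma> * c * sqrt (d$2)"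
    unfolding comp distrib_left rot using sq by (simp add: field_simps)
  ultimately have "(sqrt (d$2 - d$3) * y$3)\<^sup>2 + (sqrt (d$2 - d$4) * y$4)\<^sup>2 = (sqrt (d$1 - d$2) * y$1)\<^sup>2 + (sqrt (d$2))\<^sup>2"
    using rotated_same_length[OF cs] by simp
  then have "(d$2 - d$3) * (y$3)\<^sup>2 + (d$2 - d$4) * (y$4)\<^sup>2 = (d$1 - d$2) * (y$1)\<^sup>2 + d$2"
    using pos by (simp add: power_mult_distrib)
  moreover have "d$2 = d$2 * ((y$1)\<^sup>2 + (y$2)\<^sup>2 + (y$3)\<^sup>2 + (y$4)\<^sup>2)" using sphere_4_eq[OF y(1)] by simp
  ultimately have "diag_form d y = 0" unfolding diag_form_def by (simp add: algebra_simps)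
  then show "y \<in> quadric_section d" using y(1) by (simp add: quadric_section_def)
qed

lemma lower_dirs_circle:
  assumes d: "principal_signs d" and x: "x \<in> quadric_section d" and cs: "c\<^sup>2 + s\<^sup>2 = 1" "\<sigma>\<^sup>2 = 1"
    and rot: "sqrt (d$1 - d$3) * x$1 = c * (sqrt (d$3 - d$4) * x$4) - \<sigma> * s * sqrt (- d$3)"
      "sqrt (d$2 - d$3) * x$2 = s * (sqrt (d$3 - d$4) * x$4) + \<sigma> * c * sqrt (- d$3)"
  shows "circ x (lower_dirs d c s) \<subseteq> quadric_section d"
proof
  fix y assume "y \<in> circ x (lower_dirs d c s)"
  then obtain a b where y: "norm y = 1" "y = x + (b *\<^sub>R axis 3 1 + a *\<^sub>R vector [c * sqrt (d$3 - d$4) / sqrt (d$1 - d$3),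
      s * sqrt (d$3 - d$4) / sqrt (d$2 - d$3), 0, 1])"
    unfolding circ_def lower_dirs_def direction_plane_def by auto
  have pos: "d$3 - d$4 \<ge> 0" "- d$3 \<ge> 0" "d$1 - d$3 > 0" "d$2 - d$3 > 0" using d by (auto simp: principal_signs_def)
  then have sq: "sqrt (d$1 - d$3) \<noteq> 0" "sqrt (d$2 - d$3) \<noteq> 0" by auto
  have comp: "y$4 = x$4 + a" "y$1 = x$1 + a * (c * sqrt (d$3 - d$4) / sqrt (d$1 - d$3))"
    "y$2 = x$2 + a * (s * sqrt (d$3 - d$4) / sqrt (d$2 - d$3))"
    unfolding y(2) by (simp_all add: axis_def)
  have "sqrt (d$1 - d$3) * y$1 = c * (sqrt (d$3 - d$4) * y$4) - \<sigma> * s * sqrt (- d$3)"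
    unfolding comp distrib_left rot using sq by (simp add: field_simps)
  moreover have "sqrt (d$2 - d$3) * y$2 = s * (sqrt (d$3 - d$4) * y$4) + \<sigma> * c * sqrt (- d$3)"
    unfolding comp distrib_left rot using sq by (simp add: field_simps)
  ultimately have "(sqrt (d$1 - d$3) * y$1)\<^sup>2 + (sqrt (d$2 - d$3) * y$2)\<^sup>2 = (sqrt (d$3 - d$4) * y$4)\<^sup>2 + (sqrt (- d$3))\<^sup>2"
    using rotated_same_length[OF cs] by simp
  then have "(d$1 - d$3) * (y$1)\<^sup>2 + (d$2 - d$3) * (y$2)\<^sup>2 = (d$3 - d$4) * (y$4)\<^sup>2 + - d$3"
    using pos by (simp add: power_mult_distrib)
  moreover have "d$3 = d$3 * ((y$1)\<^sup>2 + (y$2)\<^sup>2 + (y$3)\<^sup>2 + (y$4)\<^sup>2)" using sphere_4_eq[OF y(1)] by simp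
  ultimately have "diag_form d y = 0" unfolding diag_form_def by (simp add: algebra_simps)
  then show "y \<in> quadric_section d" using y(1) by (simp add: quadric_section_def)
qed

lemma directions_are_planes:
  "subspace (great_dirs d \<sigma> c s)" "dim (great_dirs d \<sigma> c s) = 2"
  "subspace (upper_dirs d c s)" "dim (upper_dirs d c s) = 2"
  "subspace (lower_dirs d c s)" "dim (lower_dirs d c s) = 2"
  unfolding great_dirs_def upper_dirs_def lower_dirs_def
  by (intro subspace_direction_plane dim_direction_plane; simp add: vector_eq_4 axis_def)+

lemma great_dirs_contains_point:
  assumes d: "principal_signs d"
    and rot: "sqrt (- d$3) * x$3 = c * (sqrt (d$1) * x$1) - \<sigma> * s * (sqrt (d$2) * x$2)"
      "sqrt (- d$4) * x$4 = s * (sqrt (d$1) * x$1) + \<sigma> * c * (sqrt (d$2) * x$2)"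
  shows "x \<in> great_dirs d \<sigma> c s"
proof -
  have "sqrt (- d$3) \<noteq> 0" "sqrt (- d$4) \<noteq> 0" using d by (auto simp: principal_signs_def)
  then have "x$3 = (c * (sqrt (d$1) * x$1) - \<sigma> * s * (sqrt (d$2) * x$2)) / sqrt (- d$3)"
    "x$4 = (s * (sqrt (d$1) * x$1) + \<sigma> * c * (sqrt (d$2) * x$2)) / sqrt (- d$4)"
    using rot by (simp_all add: field_simps)
  then show ?thesis
    unfolding great_dirs_def direction_plane_def
    by (intro CollectI exI[of _ "x$1"] exI[of _ "x$2"])
       (simp add: vector_eq_4 add_divide_distrib diff_divide_distrib algebra_simps)
qed

text \<open>
  In each of the three families a rotation and a reflection match the data at \<open>x\<close>. The two
  resulting planes are equal only in the second family with \<open>d\<^sub>1 = d\<^sub>2\<close> and in the third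
  with \<open>d\<^sub>3 = d\<^sub>4\<close>; the families are told apart by the second and third coordinate
  vectors.
\<close>

lemma many_circles:
  assumes d: "principal_signs d" and x: "x \<in> quadric_section d" and g: "x $ 2 \<noteq> 0" "x $ 3 \<noteq> 0"
  shows "\<exists>S. finite S \<and> card S = 4 + (if d$1 > d$2 then 1 else 0) + (if d$3 > d$4 then 1 else 0) \<and>
    inj_on (circ x) S \<and> (\<forall>D\<in>S. circle_in_S3 (circ x D) \<and> x \<in> circ x D \<and> circ x D \<subseteq> quadric_section d)"
proof -
  have pos: "d$1 > 0" "d$2 > 0" "- d$3 > 0" "- d$4 > 0" "d$1 - d$2 \<ge> 0" "d$3 - d$4 \<ge> 0"
    "d$2 - d$3 > 0" "d$2 - d$4 > 0" "d$1 - d$3 > 0"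
    using d by (auto simp: principal_signs_def)
  have n: "norm x = 1" and q0: "d$1 * (x$1)\<^sup>2 + d$2 * (x$2)\<^sup>2 + d$3 * (x$3)\<^sup>2 + d$4 * (x$4)\<^sup>2 = 0"
    using x by (auto simp: quadric_section_def diag_form_def)
  note sph = sphere_4_eq[OF n]
  define G where "G = (\<lambda>\<sigma> c s. c\<^sup>2 + s\<^sup>2 = 1 \<and> sqrt (- d$3) * x$3 = c * (sqrt (d$1) * x$1) - \<sigma> * s * (sqrt (d$2) * x$2) \<and>
      sqrt (- d$4) * x$4 = s * (sqrt (d$1) * x$1) + \<sigma> * c * (sqrt (d$2) * x$2))"
  define U where "U = (\<lambda>\<sigma> c s. c\<^sup>2 + s\<^sup>2 = 1 \<and> sqrt (d$2 - d$3) * x$3 = c * (sqrt (d$1 - d$2) * x$1) - \<sigma> * s * sqrt (d$2) \<and>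
      sqrt (d$2 - d$4) * x$4 = s * (sqrt (d$1 - d$2) * x$1) + \<sigma> * c * sqrt (d$2))"
  define L where "L = (\<lambda>\<sigma> c s. c\<^sup>2 + s\<^sup>2 = 1 \<and> sqrt (d$1 - d$3) * x$1 = c * (sqrt (d$3 - d$4) * x$4) - \<sigma> * s * sqrt (- d$3) \<and>
      sqrt (d$2 - d$3) * x$2 = s * (sqrt (d$3 - d$4) * x$4) + \<sigma> * c * sqrt (- d$3))"
  have ex: "\<exists>c s. G \<sigma> c s" "\<exists>c s. U \<sigma> c s" "\<exists>c s. L \<sigma> c s" if "\<sigma>\<^sup>2 = 1" for \<sigma> :: real
  proof -
    show "\<exists>c s. G \<sigma> c s" unfolding G_def
    proof (rule rotation_between[OF _ _ that])
      show "(sqrt (d$1) * x$1)\<^sup>2 + (sqrt (d$2) * x$2)\<^sup>2 = (sqrt (- d$3) * x$3)\<^sup>2 + (sqrt (- d$4) * x$4)\<^sup>2"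
        using q0 pos by (simp add: power_mult_distrib)
      show "(sqrt (d$1) * x$1)\<^sup>2 + (sqrt (d$2) * x$2)\<^sup>2 \<noteq> 0"
        using g(1) pos by (simp add: sum_power2_eq_zero_iff)
    qed
    have "d$2 * ((x$1)\<^sup>2 + (x$2)\<^sup>2 + (x$3)\<^sup>2 + (x$4)\<^sup>2) = d$2" using sph by simp
    then have u: "(d$1 - d$2) * (x$1)\<^sup>2 + d$2 = (d$2 - d$3) * (x$3)\<^sup>2 + (d$2 - d$4) * (x$4)\<^sup>2"
      using q0 by (simp add: algebra_simps)
    show "\<exists>c s. U \<sigma> c s" unfolding U_def
    proof (rule rotation_between[OF _ _ that])
      show "(sqrt (d$1 - d$2) * x$1)\<^sup>2 + (sqrt (d$2))\<^sup>2 = (sqrt (d$2 - d$3) * x$3)\<^sup>2 + (sqrt (d$2 - d$4) * x$4)\<^sup>2"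
        using u pos by (simp add: power_mult_distrib)
      have "0 < (sqrt (d$1 - d$2) * x$1)\<^sup>2 + (sqrt (d$2))\<^sup>2"
        by (rule add_nonneg_pos) (use pos in simp_all)
      then show "(sqrt (d$1 - d$2) * x$1)\<^sup>2 + (sqrt (d$2))\<^sup>2 \<noteq> 0" by (metis less_irrefl)
    qed
    have "d$3 * ((x$1)\<^sup>2 + (x$2)\<^sup>2 + (x$3)\<^sup>2 + (x$4)\<^sup>2) = d$3" using sph by simp
    then have l: "(d$3 - d$4) * (x$4)\<^sup>2 + - d$3 = (d$1 - d$3) * (x$1)\<^sup>2 + (d$2 - d$3) * (x$2)\<^sup>2"
      using q0 by (simp add: algebra_simps)
    show "\<exists>c s. L \<sigma> c s" unfolding L_def
    proof (rule rotation_between[OF _ _ that])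
      show "(sqrt (d$3 - d$4) * x$4)\<^sup>2 + (sqrt (- d$3))\<^sup>2 = (sqrt (d$1 - d$3) * x$1)\<^sup>2 + (sqrt (d$2 - d$3) * x$2)\<^sup>2"
        using l pos by (simp add: power_mult_distrib)
      have "0 < (sqrt (d$3 - d$4) * x$4)\<^sup>2 + (sqrt (- d$3))\<^sup>2"
        by (rule add_nonneg_pos) (use pos in simp_all)
      then show "(sqrt (d$3 - d$4) * x$4)\<^sup>2 + (sqrt (- d$3))\<^sup>2 \<noteq> 0" by (metis less_irrefl)
    qed
  qed
  obtain gc gs gc' gs' where G: "G 1 gc gs" "G (- 1) gc' gs'" using ex(1)[of 1] ex(1)[of "- 1"] by auto
  obtain uc us uc' us' where U: "U 1 uc us" "U (- 1) uc' us'" using ex(2)[of 1] ex(2)[of "- 1"] by auto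
  obtain lc ls lc' ls' where L: "L 1 lc ls" "L (- 1) lc' ls'" using ex(3)[of 1] ex(3)[of "- 1"] by auto
  have sq: "sqrt (d$1) \<noteq> 0" "sqrt (d$2) \<noteq> 0" "sqrt (- d$3) \<noteq> 0" "sqrt (- d$4) \<noteq> 0" "sqrt (d$2 - d$3) \<noteq> 0"
    "sqrt (d$2 - d$4) \<noteq> 0" "sqrt (d$1 - d$3) \<noteq> 0" using pos by auto
  have Gne: "great_dirs d 1 gc gs \<noteq> great_dirs d (- 1) gc' gs'"
  proof
    assume eq: "great_dirs d 1 gc gs = great_dirs d (- 1) gc' gs'"
    have "vector [1, 0, gc * sqrt (d$1) / sqrt (- d$3), gs * sqrt (d$1) / sqrt (- d$4)] \<in> great_dirs d 1 gc gs"
      "vector [0, 1, - 1 * gs * sqrt (d$2) / sqrt (- d$3), 1 * gc * sqrt (d$2) / sqrt (- d$4)] \<in> great_dirs d 1 gc gs"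
      unfolding great_dirs_def by (rule direction_plane_mem)+
    then have "gc = gc'" "gs = gs'" "- gs = gs'" "gc = - gc'"
      unfolding eq unfolding great_dirs_def direction_plane_def using sq by (auto simp: vector_eq_4)
    then show False using G unfolding G_def by simp
  qed
  have axis_great: "axis i 1 \<notin> great_dirs d \<sigma> c s" if "G \<sigma> c s" "\<sigma> \<noteq> 0" "i = 2 \<or> i = 3" for i \<sigma> c s
  proof
    assume "axis i 1 \<in> great_dirs d \<sigma> c s"
    then have "i = 2 \<and> s = 0 \<and> c = 0"
      unfolding great_dirs_def direction_plane_def using sq that(2,3) by (auto simp: vector_eq_4 axis_def)
    then show False using that(1) unfolding G_def by simp
  qed
  have axis_upper: "axis 3 1 \<notin> upper_dirs d c s" for c s
    unfolding upper_dirs_def direction_plane_def by (auto simp: vector_eq_4 axis_def)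
  have Une: "upper_dirs d uc us \<noteq> upper_dirs d uc' us'" if "d$1 > d$2"
  proof
    assume eq: "upper_dirs d uc us = upper_dirs d uc' us'"
    have "vector [1, 0, uc * sqrt (d$1 - d$2) / sqrt (d$2 - d$3), us * sqrt (d$1 - d$2) / sqrt (d$2 - d$4)] \<in> upper_dirs d uc us"
      unfolding upper_dirs_def by (rule direction_plane_mem)
    then have "uc = uc'" "us = us'"
      unfolding eq unfolding upper_dirs_def direction_plane_def using sq that by (auto simp: vector_eq_4 axis_def)
    then have "us * sqrt (d$2) = 0" "uc * sqrt (d$2) = 0" using U unfolding U_def by auto
    then show False using U sq unfolding U_def by simp
  qed
  have Lne: "lower_dirs d lc ls \<noteq> lower_dirs d lc' ls'" if "d$3 > d$4"
  proof
    assume eq: "lower_dirs d lc ls = lower_dirs d lc' ls'"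
    have "vector [lc * sqrt (d$3 - d$4) / sqrt (d$1 - d$3), ls * sqrt (d$3 - d$4) / sqrt (d$2 - d$3), 0, 1] \<in> lower_dirs d lc ls"
      unfolding lower_dirs_def by (rule direction_plane_mem)
    then have "lc = lc'" "ls = ls'"
      unfolding eq unfolding lower_dirs_def direction_plane_def using sq that by (auto simp: vector_eq_4 axis_def)
    then have "ls * sqrt (- d$3) = 0" "lc * sqrt (- d$3) = 0" using L unfolding L_def by auto
    then show False using L sq unfolding L_def by simp
  qed
  define A where "A = {great_dirs d 1 gc gs, great_dirs d (- 1) gc' gs'}"
  define B where "B = (if d$1 > d$2 then {upper_dirs d uc us, upper_dirs d uc' us'} else {upper_dirs d uc us})"
  define C where "C = (if d$3 > d$4 then {lower_dirs d lc ls, lower_dirs d lc' ls'} else {lower_dirs d lc ls})"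
  have in2: "axis 2 1 \<in> upper_dirs d c s" "axis 3 1 \<in> lower_dirs d c s" for c s
    unfolding upper_dirs_def lower_dirs_def by (rule direction_plane_mem)+
  have Ax: "axis i 1 \<notin> D" if "D \<in> A" "i = 2 \<or> i = 3" for D i
    using that axis_great[OF G(1)] axis_great[OF G(2)] unfolding A_def by auto
  have Bx: "axis 2 1 \<in> D" "axis 3 1 \<notin> D" if "D \<in> B" for D
    using that in2 axis_upper unfolding B_def by (auto split: if_splits)
  have Cx: "axis 3 1 \<in> D" if "D \<in> C" for D
    using that in2 unfolding C_def by (auto split: if_splits)
  have disj: "A \<inter> B = {}" "A \<inter> C = {}" "B \<inter> C = {}" using Ax Bx Cx by blast+
  have fin: "finite A" "finite B" "finite C" by (auto simp: A_def B_def C_def)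
  have cards: "card A = 2" "card B = 1 + (if d$1 > d$2 then 1 else 0)" "card C = 1 + (if d$3 > d$4 then 1 else 0)"
    using Gne Une Lne by (auto simp: A_def B_def C_def)
  have "card (A \<union> B \<union> C) = card A + card B + card C"
    using fin disj by (simp add: card_Un_disjoint Int_Un_distrib2)
  then have card: "card (A \<union> B \<union> C) = 4 + (if d$1 > d$2 then 1 else 0) + (if d$3 > d$4 then 1 else 0)"
    using cards by simp
  have v0: "\<exists>v\<in>D. v \<bullet> x \<noteq> 0" if "D \<in> A \<union> B \<union> C" for D
  proof -
    have "x \<bullet> x \<noteq> 0" using n by (simp add: norm_eq_1)
    moreover have "x \<in> D" if "D \<in> A"
      using that great_dirs_contains_point[OF d] G unfolding A_def G_def by auto
    moreover have "axis 2 1 \<bullet> x \<noteq> 0" "axis 3 1 \<bullet> x \<noteq> 0" using g by (simp_all add: inner_axis')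
    ultimately show ?thesis using that Bx Cx by blast
  qed
  have pl: "subspace D \<and> dim D = 2" if "D \<in> A \<union> B \<union> C" for D
    using that directions_are_planes unfolding A_def B_def C_def by (auto split: if_splits)
  have inQ: "circ x D \<subseteq> quadric_section d" if "D \<in> A \<union> B \<union> C" for D
  proof -
    have s: "(1 :: real)\<^sup>2 = 1" "(- 1 :: real)\<^sup>2 = 1" by simp_all
    have "circ x (great_dirs d 1 gc gs) \<subseteq> quadric_section d" "circ x (great_dirs d (- 1) gc' gs') \<subseteq> quadric_section d"
      using G great_dirs_circle[OF d x _ s(1)] great_dirs_circle[OF d x _ s(2)] unfolding G_def by blast+
    moreover have "circ x (upper_dirs d uc us) \<subseteq> quadric_section d" "circ x (upper_dirs d uc' us') \<subseteq> quadric_section d"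
      using U upper_dirs_circle[OF d x _ s(1)] upper_dirs_circle[OF d x _ s(2)] unfolding U_def by blast+
    moreover have "circ x (lower_dirs d lc ls) \<subseteq> quadric_section d" "circ x (lower_dirs d lc' ls') \<subseteq> quadric_section d"
      using L lower_dirs_circle[OF d x _ s(1)] lower_dirs_circle[OF d x _ s(2)] unfolding L_def by blast+
    ultimately show ?thesis using that unfolding A_def B_def C_def by (auto split: if_splits)
  qed
  have "inj_on (circ x) (A \<union> B \<union> C)"
  proof (rule inj_onI)
    fix D E assume DE: "D \<in> A \<union> B \<union> C" "E \<in> A \<union> B \<union> C" "circ x D = circ x E"
    have "D \<subseteq> E" using circ_subset_imp_direction_subset[of D E x] pl DE v0[OF DE(1)] n by blast
    moreover have "E \<subseteq> D" using circ_subset_imp_direction_subset[of E D x] pl DE v0[OF DE(2)] n by blast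
    ultimately show "D = E" by blast
  qed
  moreover have "circle_in_S3 (circ x D)" "x \<in> circ x D" if "D \<in> A \<union> B \<union> C" for D
  proof -
    show "circle_in_S3 (circ x D)" using v0[OF that] pl[OF that] circ_is_circle n by blast
    show "x \<in> circ x D" using pl[OF that] n unfolding circ_def by (auto intro!: exI[of _ 0] simp: subspace_0)
  qed
  ultimately show ?thesis using card fin inQ by (intro exI[of _ "A \<union> B \<union> C"]) auto
qed

lemma circle_in_S3_orthogonal_image:
  assumes T: "orthogonal_transformation T" and C: "circle_in_S3 C"
  shows "circle_in_S3 (T ` C)"
proof -
  obtain P c r where P: "affine P" "aff_dim P = 2" "c \<in> P" "r > 0" "C = P \<inter> sphere c r" and S: "C \<subseteq> S3"
    using C unfolding circle_in_S3_def by blast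
  have lin: "linear T" using T by (rule orthogonal_transformation_linear)
  have inj: "inj T" using T by (rule orthogonal_transformation_inj)
  have nrm: "norm (T y) = norm y" for y using T by (rule orthogonal_transformation_norm)
  have dst: "dist (T y) (T z) = dist y z" for y z
    unfolding dist_norm linear_diff[OF lin, symmetric] by (rule nrm)
  show ?thesis unfolding circle_in_S3_def
  proof (intro conjI exI)
    show "T ` C \<subseteq> S3" using S nrm by auto
    show "affine (T ` P)"
      using P(1) by (metis affine_hull_eq affine_hull_linear_image lin linear_conv_bounded_linear)
    show "aff_dim (T ` P) = 2" using P(2) lin inj by simp
    show "T c \<in> T ` P" using P(3) by blast
    show "T ` C = T ` P \<inter> sphere (T c) r" unfolding P(5) using dst by auto
  qed (rule P(4))
qed

lemma general_position_point:
  assumes "principal_signs d"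
  shows "\<exists>x\<in>quadric_section d. x $ 2 \<noteq> 0 \<and> x $ 3 \<noteq> 0"
proof -
  have pos: "d$2 > 0" "- d$3 > 0" "d$2 - d$3 > 0" using assms by (auto simp: principal_signs_def)
  \<comment> \<open>The point of the section in the plane of the second and third axes.\<close>
  define x :: "real ^ 4" where "x = vector [0, sqrt (- d$3 / (d$2 - d$3)), sqrt (d$2 / (d$2 - d$3)), 0]"
  have xs: "x$2 = sqrt (- d$3 / (d$2 - d$3))" "x$3 = sqrt (d$2 / (d$2 - d$3))" by (simp_all add: x_def)
  have sq: "(x$2)\<^sup>2 = - d$3 / (d$2 - d$3)" "(x$3)\<^sup>2 = d$2 / (d$2 - d$3)"
    unfolding xs by (rule real_sqrt_pow2, rule divide_nonneg_pos, use pos in linarith, use pos in linarith)+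
  have "(x$2)\<^sup>2 + (x$3)\<^sup>2 = 1" unfolding sq add_divide_distrib[symmetric] using pos by simp
  then have "norm x = 1" unfolding norm_eq_1 inner_vec_def sum_4 by (simp add: x_def power2_eq_square)
  moreover have "diag_form d x = 0"
  proof -
    have "diag_form d x = d$2 * (x$2)\<^sup>2 + d$3 * (x$3)\<^sup>2" by (simp add: diag_form_def x_def)
    then show ?thesis unfolding sq by simp
  qed
  moreover have "x $ 2 \<noteq> 0" "x $ 3 \<noteq> 0" using pos by (auto simp: x_def)
  ultimately show ?thesis unfolding quadric_section_def by blast
qed

text \<open>
  The points where the second or the third principal coordinate vanishes are not general.
\<close>

lemma circles_through_general_point_lower:
  assumes T: "orthogonal_transformation T" and d: "principal_signs d"
    and R: "real_points (X_of Z) = T ` quadric_section d"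
    and n: "n \<le> 4 + (if d$1 > d$2 then 1 else 0) + (if d$3 > d$4 then 1 else 0)"
  shows "circles_through_general_point (enat n) Z"
proof -
  have lin: "linear T" using T by (rule orthogonal_transformation_linear)
  have injT: "inj T" using T by (rule orthogonal_transformation_inj)
  define W where "W = {p. (\<Sum>i\<in>UNIV. T (axis 2 1) $ i * p $ i) * (\<Sum>i\<in>UNIV. T (axis 3 1) $ i * p $ i) = 0}"
  have comp: "(\<Sum>i\<in>UNIV. T (axis k 1) $ i * T x $ i) = x $ k" for k x
  proof -
    have "(\<Sum>i\<in>UNIV. T (axis k 1) $ i * T x $ i) = T (axis k 1) \<bullet> T x" by (simp add: inner_vec_def)
    also have "\<dots> = axis k 1 \<bullet> x" using T by (simp add: orthogonal_transformation_def)
    finally show ?thesis by (simp add: inner_axis')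
  qed
  have W: "T x \<in> W \<longleftrightarrow> x $ 2 = 0 \<or> x $ 3 = 0" for x by (simp add: W_def comp)
  have "zariski_closed W"
    unfolding zariski_closed_def W_def
    by (rule exI[of _ "{\<lambda>p. (\<Sum>i\<in>UNIV. T (axis 2 1) $ i * p $ i) * (\<Sum>i\<in>UNIV. T (axis 3 1) $ i * p $ i)}"])
       (auto intro!: polynomial_fn_intros)
  moreover have "\<not> real_points (X_of Z) \<subseteq> W"
    using general_position_point[OF d] W unfolding R by blast
  moreover have "has_at_least (enat n) {C. circle_in_S3 C \<and> p \<in> C \<and> C \<subseteq> real_points (X_of Z)}"
    if p: "p \<in> real_points (X_of Z) - W" for p
  proof -
    obtain x where x: "p = T x" "x \<in> quadric_section d" using p unfolding R by blast
    have g: "x $ 2 \<noteq> 0" "x $ 3 \<noteq> 0" using p W x(1) by auto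
    obtain S where S: "finite S" "card S = 4 + (if d$1 > d$2 then 1 else 0) + (if d$3 > d$4 then 1 else 0)"
      "inj_on (circ x) S" "\<forall>D\<in>S. circle_in_S3 (circ x D) \<and> x \<in> circ x D \<and> circ x D \<subseteq> quadric_section d"
      using many_circles[OF d x(2) g] by blast
    let ?F = "(\<lambda>D. T ` circ x D)"
    have inj: "inj_on ?F S"
      using S(3) injT by (auto simp: inj_on_def inj_image_eq_iff)
    have sub: "?F ` S \<subseteq> {C. circle_in_S3 C \<and> p \<in> C \<and> C \<subseteq> real_points (X_of Z)}"
      using S(4) circle_in_S3_orthogonal_image[OF T] unfolding R x(1) by blast
    show ?thesis unfolding has_at_least_def
    proof (intro allI impI)
      fix k assume "enat k \<le> enat n"
      then have "k \<le> card (?F ` S)" using n S(2) card_image[OF inj] by simp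
      then obtain U where "U \<subseteq> ?F ` S" "card U = k" "finite U" using obtain_subset_with_card_n by metis
      then show "\<exists>U\<subseteq>{C. circle_in_S3 C \<and> p \<in> C \<and> C \<subseteq> real_points (X_of Z)}. finite U \<and> card U = k"
        using sub by (intro exI[of _ U]) auto
    qed
  qed
  ultimately show ?thesis unfolding circles_through_general_point_def by blast
qed

text \<open>
  Two perpendicular vectors of equal length in a plane differ by a quarter turn.
\<close>

lemma perpendicular_same_length:
  fixes u1 u2 w1 w2 :: real
  assumes "u1 * w1 + u2 * w2 = 0" "u1\<^sup>2 + u2\<^sup>2 = w1\<^sup>2 + w2\<^sup>2"
  shows "\<exists>e. (e = 1 \<or> e = -1) \<and> w1 = - e * u2 \<and> w2 = e * u1"
proof (cases "u1\<^sup>2 + u2\<^sup>2 = 0")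
  case True
  then have "u1 = 0" "u2 = 0" "w1 = 0" "w2 = 0" using assms(2) by (auto simp: sum_power2_eq_zero_iff)
  then show ?thesis by auto
next
  case False
  let ?n = "u1\<^sup>2 + u2\<^sup>2"
  define e where "e = (u1 * w2 - u2 * w1) / ?n"
  have en: "e * ?n = u1 * w2 - u2 * w1" using False by (simp add: e_def)
  have "w1 * ?n = - (e * ?n) * u2 + u1 * (u1 * w1 + u2 * w2)" unfolding en by (simp add: algebra_simps power2_eq_square)
  then have "w1 * ?n = (- e * u2) * ?n" using assms(1) by (simp add: algebra_simps)
  then have w1: "w1 = - e * u2" using False by (metis mult_right_cancel)
  have "w2 * ?n = (e * ?n) * u1 + u2 * (u1 * w1 + u2 * w2)" unfolding en by (simp add: algebra_simps power2_eq_square)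
  then have "w2 * ?n = (e * u1) * ?n" using assms(1) by (simp add: algebra_simps)
  then have w2: "w2 = e * u1" using False by (metis mult_right_cancel)
  have "w1\<^sup>2 + w2\<^sup>2 = e\<^sup>2 * ?n" unfolding w1 w2 by (simp add: algebra_simps power2_eq_square)
  then have "e\<^sup>2 * ?n = 1 * ?n" using assms(2) by simp
  then have "e\<^sup>2 = 1" using False by (metis mult_right_cancel)
  then show ?thesis using w1 w2 by (auto simp: power2_eq_1_iff)
qed

lemma planes_equal_if_subset:
  fixes D E :: "(real ^ 4) set"
  assumes "subspace D" "dim D = 2" "subspace E" "dim E = 2" "D \<subseteq> E" shows "D = E"
  using assms by (intro subspace_dim_equal) auto

text \<open>
  On \<open>x\<^sub>1\<^sup>2 + x\<^sub>2\<^sup>2 = \<kappa>\<close>, comparing antipodal points of a circle with centre \<open>c\<close> shows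
  that the projection of the unit directions of the circle to the first two coordinates
  has constant length \<open>sqrt \<mu>\<close>. For \<open>\<mu> = 0\<close> or \<open>1\<close> the plane of directions is a coordinate
  plane. Otherwise both coordinate projections of it are similarities, which forces \<open>c =
  0\<close>: the circle is great and belongs to one of the two families of Clifford parallels.
\<close>

lemma torus_circle_directions:
  assumes d: "principal_signs d" "d$1 = d$2" "d$3 = d$4" and x: "x \<in> quadric_section d"
    and C: "circle_in_S3 C" "x \<in> C" "C \<subseteq> quadric_section d"
  shows "C \<in> circ x ` {direction_plane (axis 1 1) (axis 2 1), direction_plane (axis 3 1) (axis 4 1),
     direction_plane x (vector [- x$2, x$1, - x$4, x$3]), direction_plane x (vector [- x$2, x$1, x$4, - x$3])}"
proof -
  obtain D c r where D: "subspace D" "dim D = 2" "C = circ x D" "r > 0"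
    "\<And>v. v \<in> D \<Longrightarrow> norm v = 1 \<Longrightarrow> c + r *\<^sub>R v \<in> C" "\<And>v. v \<in> D \<Longrightarrow> c \<bullet> v = 0" "x - c \<in> D" "norm (x - c) = r"
    using circle_in_S3_cases[OF C(1,2)] by metis
  have nz: "d$1 - d$3 \<noteq> 0" using d by (auto simp: principal_signs_def)
  define \<kappa> where "\<kappa> = - d$3 / (d$1 - d$3)"
  have on: "(y$1)\<^sup>2 + (y$2)\<^sup>2 = \<kappa>" if "y \<in> quadric_section d" for y
  proof -
    have n: "(y$1)\<^sup>2 + (y$2)\<^sup>2 + (y$3)\<^sup>2 + (y$4)\<^sup>2 = 1" using that by (intro sphere_4_eq) (simp add: quadric_section_def)
    have "d$1 * ((y$1)\<^sup>2 + (y$2)\<^sup>2) + d$3 * ((y$3)\<^sup>2 + (y$4)\<^sup>2) = 0"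
      using that d by (simp add: quadric_section_def diag_form_def algebra_simps)
    moreover have "(y$3)\<^sup>2 + (y$4)\<^sup>2 = 1 - ((y$1)\<^sup>2 + (y$2)\<^sup>2)" using n by simp
    ultimately have "((y$1)\<^sup>2 + (y$2)\<^sup>2) * (d$1 - d$3) = - d$3" by (simp add: algebra_simps)
    then show ?thesis using nz by (simp add: \<kappa>_def field_simps)
  qed
  \<comment> \<open>By Pythagoras in the first two coordinates.\<close>
  define \<mu> where "\<mu> = (\<kappa> - (c$1)\<^sup>2 - (c$2)\<^sup>2) / r\<^sup>2"
  have unit: "c$1 * v$1 + c$2 * v$2 = 0 \<and> (v$1)\<^sup>2 + (v$2)\<^sup>2 = \<mu>" if v: "v \<in> D" "norm v = 1" for v
  proof -
    have "- v \<in> D" "norm (- v) = 1" using v D(1) by (simp_all add: subspace_neg)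
    then have "c + r *\<^sub>R v \<in> quadric_section d" "c + r *\<^sub>R (- v) \<in> quadric_section d" using D(5) v C(3) by blast+
    from on[OF this(1)] on[OF this(2)]
    have e: "(c$1 + r * v$1)\<^sup>2 + (c$2 + r * v$2)\<^sup>2 = \<kappa>" "(c$1 - r * v$1)\<^sup>2 + (c$2 - r * v$2)\<^sup>2 = \<kappa>" by simp_all
    have "4 * r * (c$1 * v$1 + c$2 * v$2) = 0"
      using e by (simp add: power2_eq_square algebra_simps)
    then have 1: "c$1 * v$1 + c$2 * v$2 = 0" using D(4) by simp
    have "(c$1 + r * v$1)\<^sup>2 + (c$2 + r * v$2)\<^sup>2 = (c$1)\<^sup>2 + (c$2)\<^sup>2 + 2 * r * (c$1 * v$1 + c$2 * v$2) + r\<^sup>2 * ((v$1)\<^sup>2 + (v$2)\<^sup>2)"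
      by (simp add: power2_eq_square algebra_simps)
    then have "r\<^sup>2 * ((v$1)\<^sup>2 + (v$2)\<^sup>2) = \<kappa> - (c$1)\<^sup>2 - (c$2)\<^sup>2" using e(1) 1 by simp
    then show ?thesis using 1 D(4) by (simp add: \<mu>_def field_simps)
  qed
  obtain u w where uw: "norm u = 1" "norm w = 1" "u \<bullet> w = 0" "D = {s *\<^sub>R u + t *\<^sub>R w | s t. True}"
    using plane_orthonormal_basis[OF D(1,2)] .
  have "1 *\<^sub>R u + 0 *\<^sub>R w \<in> D" "0 *\<^sub>R u + 1 *\<^sub>R w \<in> D" unfolding uw(4) by blast+
  then have uD: "u \<in> D" "w \<in> D" by simp_all
  have n4: "(u$1)\<^sup>2 + (u$2)\<^sup>2 + (u$3)\<^sup>2 + (u$4)\<^sup>2 = 1" "(w$1)\<^sup>2 + (w$2)\<^sup>2 + (w$3)\<^sup>2 + (w$4)\<^sup>2 = 1"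
    using sphere_4_eq uw by blast+
  have u12: "(u$1)\<^sup>2 + (u$2)\<^sup>2 = \<mu>" "(w$1)\<^sup>2 + (w$2)\<^sup>2 = \<mu>" using unit uD uw by blast+
  have i4: "u$1 * w$1 + u$2 * w$2 + u$3 * w$3 + u$4 * w$4 = 0" using uw(3) by (simp add: inner_vec_def sum_4)
  have "(3/5) *\<^sub>R u + (4/5) *\<^sub>R w \<in> D" unfolding uw(4) by blast
  moreover have "norm ((3/5) *\<^sub>R u + (4/5) *\<^sub>R w) = 1"
  proof -
    have "(norm ((3/5) *\<^sub>R u + (4/5) *\<^sub>R w))\<^sup>2 = 1"
      unfolding norm_combination_orthonormal[OF uw(1-3)] by (simp add: power2_eq_square)
    then show ?thesis by (simp add: power2_eq_1_iff) (smt (verit) norm_ge_zero)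
  qed
  ultimately have "((3/5) * u$1 + (4/5) * w$1)\<^sup>2 + ((3/5) * u$2 + (4/5) * w$2)\<^sup>2 = \<mu>"
    using unit by fastforce
  then have "9/25 * ((u$1)\<^sup>2 + (u$2)\<^sup>2) + 16/25 * ((w$1)\<^sup>2 + (w$2)\<^sup>2) + 24/25 * (u$1 * w$1 + u$2 * w$2) = \<mu>"
    by (simp add: power2_eq_square algebra_simps)
  then have uw12: "u$1 * w$1 + u$2 * w$2 = 0" unfolding u12 by simp
  have uw34: "u$3 * w$3 + u$4 * w$4 = 0" using i4 uw12 by simp
  have u34: "(u$3)\<^sup>2 + (u$4)\<^sup>2 = 1 - \<mu>" "(w$3)\<^sup>2 + (w$4)\<^sup>2 = 1 - \<mu>" using n4 u12 by simp_all
  have E: "dim (direction_plane (axis i 1) (axis j 1) :: (real ^ 4) set) = 2" if "i \<noteq> j" for i j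
  proof (rule dim_direction_plane)
    fix s t :: real assume z: "s *\<^sub>R axis i 1 + t *\<^sub>R axis j 1 = (0 :: real ^ 4)"
    show "s = 0 \<and> t = 0" using arg_cong[OF z, of "\<lambda>v. v $ i"] arg_cong[OF z, of "\<lambda>v. v $ j"] that by (simp add: axis_def)
  qed
  consider "\<mu> = 0" | "\<mu> = 1" | "\<mu> \<noteq> 0" "\<mu> \<noteq> 1" by blast
  then show ?thesis
  proof cases
    case 1
    then have z: "u$1 = 0" "u$2 = 0" "w$1 = 0" "w$2 = 0" using u12 by (simp_all add: sum_power2_eq_zero_iff)
    have "D \<subseteq> direction_plane (axis 3 1) (axis 4 1)"
    proof
      fix v assume "v \<in> D"
      then have "v$1 = 0" "v$2 = 0" unfolding uw(4) using z by auto
      then have "v = v$3 *\<^sub>R axis 3 1 + v$4 *\<^sub>R axis 4 1" by (simp add: vector_eq_4 axis_def)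
      then show "v \<in> direction_plane (axis 3 1) (axis 4 1)" unfolding direction_plane_def by blast
    qed
    then have "D = direction_plane (axis 3 1) (axis 4 1)"
      using planes_equal_if_subset[OF D(1,2) subspace_direction_plane E] by simp
    then show ?thesis using D(3) by blast
  next
    case 2
    then have z: "u$3 = 0" "u$4 = 0" "w$3 = 0" "w$4 = 0" using u34 by (simp_all add: sum_power2_eq_zero_iff)
    have "D \<subseteq> direction_plane (axis 1 1) (axis 2 1)"
    proof
      fix v assume "v \<in> D"
      then have "v$3 = 0" "v$4 = 0" unfolding uw(4) using z by auto
      then have "v = v$1 *\<^sub>R axis 1 1 + v$2 *\<^sub>R axis 2 1" by (simp add: vector_eq_4 axis_def)
      then show "v \<in> direction_plane (axis 1 1) (axis 2 1)" unfolding direction_plane_def by blast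
    qed
    then have "D = direction_plane (axis 1 1) (axis 2 1)"
      using planes_equal_if_subset[OF D(1,2) subspace_direction_plane E] by simp
    then show ?thesis using D(3) by blast
  next
    case 3
    obtain e where e: "e = 1 \<or> e = -1" "w$1 = - e * u$2" "w$2 = e * u$1"
      using perpendicular_same_length[OF uw12] u12 by auto
    obtain f where f: "f = 1 \<or> f = -1" "w$3 = - f * u$4" "w$4 = f * u$3"
      using perpendicular_same_length[OF uw34] u34 by auto
    have cu: "c$1 * u$1 + c$2 * u$2 = 0" "c$1 * w$1 + c$2 * w$2 = 0" using unit uD uw by blast+
    have "c \<bullet> u = 0" "c \<bullet> w = 0" using D(6) uD by blast+
    then have cu': "c$3 * u$3 + c$4 * u$4 = 0" "c$3 * w$3 + c$4 * w$4 = 0"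
      using cu by (simp_all add: inner_vec_def sum_4)
    have zero: "a = 0 \<and> b = 0" if "a * p + b * q = 0" "a * (- e * q) + b * (e * p) = 0" "p\<^sup>2 + q\<^sup>2 \<noteq> 0" "e = 1 \<or> e = -1" for a b p q e :: real
    proof -
      have s: "a * q = b * p" using that(2,4) by auto
      have "a * (p\<^sup>2 + q\<^sup>2) = p * (a * p + b * q) + q * (a * q - b * p)" "b * (p\<^sup>2 + q\<^sup>2) = q * (a * p + b * q) - p * (a * q - b * p)"
        by (simp_all add: power2_eq_square algebra_simps)
      then have "a * (p\<^sup>2 + q\<^sup>2) = 0" "b * (p\<^sup>2 + q\<^sup>2) = 0" unfolding that(1) s by simp_all
      then show ?thesis using that(3) by (metis mult_eq_0_iff)
    qed
    have "c$1 = 0 \<and> c$2 = 0" by (rule zero[OF cu(1) _ _ e(1)]) (use cu(2) e u12 3 in auto)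
    moreover have "c$3 = 0 \<and> c$4 = 0" by (rule zero[OF cu'(1) _ _ f(1)]) (use cu'(2) f u34 3 in auto)
    ultimately have "c = 0" by (simp add: vector_eq_4)
    then have xD: "x \<in> D" using D(7) by simp
    then obtain s t where st: "x = s *\<^sub>R u + t *\<^sub>R w" unfolding uw(4) by blast
    define y where "y = e *\<^sub>R ((- t) *\<^sub>R u + s *\<^sub>R w)"
    have yD: "y \<in> D" unfolding y_def using uD D(1) by (intro subspace_scale subspace_add)
    have ee': "e * (e * a) = a" "f * (f * a) = a" "e * (f * (f * a)) = e * a" for a using e(1) f(1) by auto
    have y: "y$1 = - x$2" "y$2 = x$1" "y$3 = - (e * f) * x$4" "y$4 = (e * f) * x$3"
      unfolding y_def st by (simp_all add: e(2,3) f(2,3) algebra_simps ee')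
    have "dim (direction_plane x y) = 2"
    proof (rule dim_direction_plane)
      fix a b assume z: "a *\<^sub>R x + b *\<^sub>R y = 0"
      have xy: "x \<bullet> y = 0" using y by (simp add: inner_vec_def sum_4 algebra_simps)
      have "norm x = 1" using x by (simp add: quadric_section_def)
      then have "a = 0" using arg_cong[OF z, of "\<lambda>v. x \<bullet> v"] xy by (simp add: inner_add_right norm_eq_1)
      have "y \<bullet> y = x \<bullet> x" using e(1) f(1) y by (auto simp: inner_vec_def sum_4)
      then have "y \<bullet> y = 1" using \<open>norm x = 1\<close> by (simp add: norm_eq_1)
      moreover have "y \<bullet> (a *\<^sub>R x + b *\<^sub>R y) = b * (y \<bullet> y)" using xy by (simp add: inner_add_right inner_commute)
      ultimately have "b = 0" unfolding z by simp
      then show "a = 0 \<and> b = 0" using \<open>a = 0\<close> by simp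
    qed
    moreover have "direction_plane x y \<subseteq> D"
      unfolding direction_plane_def using xD yD D(1) by (auto intro!: subspace_add subspace_scale)
    ultimately have Dxy: "D = direction_plane x y"
      using planes_equal_if_subset[OF subspace_direction_plane _ D(1,2)] by blast
    have "y = vector [- x$2, x$1, - x$4, x$3] \<or> y = vector [- x$2, x$1, x$4, - x$3]"
      using e(1) f(1) y by (auto simp: vector_eq_4)
    then show ?thesis using D(3) unfolding Dxy by blast
  qed
qed

text \<open>
  Through every point there are at most four planes of directions.
\<close>

lemma circles_through_general_point_upper:
  assumes T: "orthogonal_transformation T" and d: "principal_signs d" "d$1 = d$2" "d$3 = d$4"
    and R: "real_points (X_of Z) = T ` quadric_section d"
  shows "\<not> circles_through_general_point (enat 5) Z"
proof
  assume "circles_through_general_point (enat 5) Z"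
  then obtain W where W: "\<not> real_points (X_of Z) \<subseteq> W" "\<forall>p \<in> real_points (X_of Z) - W.
          has_at_least (enat 5) {C. circle_in_S3 C \<and> p \<in> C \<and> C \<subseteq> real_points (X_of Z)}"
    unfolding circles_through_general_point_def by blast
  then obtain p where p: "p \<in> real_points (X_of Z)" "has_at_least (enat 5) {C. circle_in_S3 C \<and> p \<in> C \<and> C \<subseteq> real_points (X_of Z)}"
    by blast
  then obtain S where S: "S \<subseteq> {C. circle_in_S3 C \<and> p \<in> C \<and> C \<subseteq> real_points (X_of Z)}" "card S = 5"
    unfolding has_at_least_def by blast
  obtain x where x: "p = T x" "x \<in> quadric_section d" using p(1) unfolding R by blast
  let ?D = "{direction_plane (axis 1 1) (axis 2 1), direction_plane (axis 3 1) (axis 4 1),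
     direction_plane x (vector [- x$2, x$1, - x$4, x$3]), direction_plane x (vector [- x$2, x$1, x$4, - x$3])}"
  obtain T' where T': "orthogonal_transformation T'" "\<And>y. T' (T y) = y" "\<And>y. T (T' y) = y"
    using T by (metis bij_inv_eq_iff orthogonal_transformation_bij orthogonal_transformation_inv)
  have "S \<subseteq> (\<lambda>D. T ` circ x D) ` ?D"
  proof
    fix C assume "C \<in> S"
    then have C: "circle_in_S3 C" "p \<in> C" "C \<subseteq> T ` quadric_section d" using S(1) unfolding R by auto
    have TT: "T ` T' ` C = C" using T'(3) by (simp add: image_image)
    have "T' ` C \<in> circ x ` ?D"
    proof (rule torus_circle_directions[OF d x(2)])
      show "circle_in_S3 (T' ` C)" by (rule circle_in_S3_orthogonal_image[OF T'(1) C(1)])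
      show "x \<in> T' ` C" using C(2) T'(2) x(1) by (metis image_eqI)
      show "T' ` C \<subseteq> quadric_section d" using C(3) T'(2) by auto
    qed
    then obtain D where "D \<in> ?D" "T' ` C = circ x D" by blast
    moreover from this TT have "C = T ` circ x D" by metis
    ultimately show "C \<in> (\<lambda>D. T ` circ x D) ` ?D" by blast
  qed
  moreover have "card ((\<lambda>D. T ` circ x D) ` ?D) \<le> 4"
    by (rule le_trans[OF card_image_le]) (auto simp: card_insert_if)
  moreover have "finite ((\<lambda>D. T ` circ x D) ` ?D)" by simp
  ultimately show False using card_mono[of "(\<lambda>D. T ` circ x D) ` ?D" S] S(2) by linarith
qed

section \<open>Products of circles\<close>

text \<open>
  The properties of quaternion multiplication that matter for products of circles. Unlike
  associativity, they survive exchanging the factors and applying an orthogonal map to the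
  product.
\<close>

definition composition_product :: "(real ^ 4 \<Rightarrow> real ^ 4 \<Rightarrow> real ^ 4) \<Rightarrow> bool" where
  "composition_product m \<longleftrightarrow> bilinear m \<and>
     (\<forall>a b b'. m a b \<bullet> m a b' = (a \<bullet> a) * (b \<bullet> b')) \<and> (\<forall>a a' b. m a b \<bullet> m a' b = (a \<bullet> a') * (b \<bullet> b))"

lemma composition_product_quat_mult: "composition_product (\<star>)"
  unfolding composition_product_def
proof (intro conjI allI)
  show "bilinear (\<star>)"
    unfolding bilinear_def
    by (intro conjI allI linearI) (simp_all add: quat_mult_def vector_eq_4 algebra_simps)
  show "(a \<star> b) \<bullet> (a \<star> b') = (a \<bullet> a) * (b \<bullet> b')" for a b b'
    by (simp add: quat_mult_def inner_vec_def sum_4 algebra_simps)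
  show "(a \<star> b) \<bullet> (a' \<star> b) = (a \<bullet> a') * (b \<bullet> b)" for a a' b
    by (simp add: quat_mult_def inner_vec_def sum_4 algebra_simps)
qed

lemma composition_product_flip: "composition_product m \<Longrightarrow> composition_product (\<lambda>a b. m b a)"
  unfolding composition_product_def bilinear_def by (auto simp: mult.commute)

lemma composition_product_orthogonal:
  assumes "composition_product m" "orthogonal_transformation T"
  shows "composition_product (\<lambda>a b. T (m a b))"
proof -
  have "linear T" using assms(2) by (rule orthogonal_transformation_linear)
  then have "bilinear (\<lambda>a b. T (m a b))"
    using assms(1) unfolding composition_product_def bilinear_def
    by (auto intro: linear_compose[unfolded o_def])
  then show ?thesis
    using assms unfolding composition_product_def orthogonal_transformation_def by simp
qed

lemma composition_product_polarized:
  assumes "composition_product m"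
  shows "m a b \<bullet> m a' b' + m a b' \<bullet> m a' b = 2 * (a \<bullet> a') * (b \<bullet> b')"
proof -
  have bl: "bilinear m" and c: "\<And>a b b'. m a b \<bullet> m a b' = (a \<bullet> a) * (b \<bullet> b')"
    using assms by (auto simp: composition_product_def)
  have "m (a + a') b \<bullet> m (a + a') b' = ((a + a') \<bullet> (a + a')) * (b \<bullet> b')" by (rule c)
  then have "m a b \<bullet> m a b' + m a b \<bullet> m a' b' + (m a' b \<bullet> m a b' + m a' b \<bullet> m a' b') =
      (a \<bullet> a + 2 * (a \<bullet> a') + a' \<bullet> a') * (b \<bullet> b')"
    by (simp add: bilinear_ladd[OF bl] inner_add_left inner_add_right inner_commute[of a' a] algebra_simps)
  then show ?thesis by (simp add: c inner_commute[of "m a' b"] algebra_simps)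
qed

lemma circle_parametrization:
  assumes C: "circle_in_S3 C"
  obtains c u w r where "r > 0" "norm u = 1" "norm w = 1" "u \<bullet> w = 0" "c \<bullet> u = 0" "c \<bullet> w = 0" "c \<bullet> c + r\<^sup>2 = 1"
    "C = {c + r *\<^sub>R (p *\<^sub>R u + s *\<^sub>R w) | p s. p\<^sup>2 + s\<^sup>2 = 1}"
proof -
  obtain P c0 r0 where "affine P" "aff_dim P = 2" "c0 \<in> P" "r0 > 0" "C = P \<inter> sphere c0 r0"
    using C unfolding circle_in_S3_def by blast
  have "C \<noteq> {}"
  proof
    assume "C = {}"
    have "aff_dim P > 0" using \<open>aff_dim P = 2\<close> by simp
    then have "P \<noteq> {c0}" by auto
    then obtain y where y: "y \<in> P" "y \<noteq> c0" using \<open>c0 \<in> P\<close> by blast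
    let ?z = "c0 + (r0 / norm (y - c0)) *\<^sub>R (y - c0)"
    have "(1 - r0 / norm (y - c0)) *\<^sub>R c0 + (r0 / norm (y - c0)) *\<^sub>R y \<in> P"
      using \<open>affine P\<close> \<open>c0 \<in> P\<close> y(1) unfolding affine_def by auto
    moreover have "(1 - r0 / norm (y - c0)) *\<^sub>R c0 + (r0 / norm (y - c0)) *\<^sub>R y = ?z" by (simp add: algebra_simps)
    moreover have "?z \<in> sphere c0 r0" using y(2) \<open>r0 > 0\<close> by (simp add: dist_norm)
    ultimately show False using \<open>C = {}\<close> \<open>C = P \<inter> sphere c0 r0\<close> by auto
  qed
  then obtain x where x: "x \<in> C" by blast
  obtain D c r where D: "subspace D" "dim D = 2" "C = circ x D" "r > 0"
    "\<And>v. v \<in> D \<Longrightarrow> norm v = 1 \<Longrightarrow> c + r *\<^sub>R v \<in> C" "\<And>v. v \<in> D \<Longrightarrow> c \<bullet> v = 0" "x - c \<in> D" "norm (x - c) = r"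
    using circle_in_S3_cases[OF C x] by metis
  obtain u w where uw: "norm u = 1" "norm w = 1" "u \<bullet> w = 0" "D = {s *\<^sub>R u + t *\<^sub>R w | s t. True}"
    using plane_orthonormal_basis[OF D(1,2)] .
  have "1 *\<^sub>R u + 0 *\<^sub>R w \<in> D" "0 *\<^sub>R u + 1 *\<^sub>R w \<in> D" unfolding uw(4) by blast+
  then have uD: "u \<in> D" "w \<in> D" by simp_all
  have pyth: "(norm (c + v))\<^sup>2 = c \<bullet> c + (norm v)\<^sup>2" if "v \<in> D" for v
    using D(6)[OF that] by (simp add: power2_norm_eq_inner inner_add_left inner_add_right inner_commute)
  have S: "norm y = 1" if "y \<in> C" for y using that unfolding D(3) circ_def by auto
  have cr: "c \<bullet> c + r\<^sup>2 = 1" using pyth[OF D(7)] S[OF x] D(8) by simp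
  have "C = {c + r *\<^sub>R (p *\<^sub>R u + s *\<^sub>R w) | p s. p\<^sup>2 + s\<^sup>2 = 1}"
  proof
    show "{c + r *\<^sub>R (p *\<^sub>R u + s *\<^sub>R w) | p s. p\<^sup>2 + s\<^sup>2 = 1} \<subseteq> C"
    proof
      fix y assume "y \<in> {c + r *\<^sub>R (p *\<^sub>R u + s *\<^sub>R w) | p s. p\<^sup>2 + s\<^sup>2 = 1}"
      then obtain p s where y: "y = c + r *\<^sub>R (p *\<^sub>R u + s *\<^sub>R w)" "p\<^sup>2 + s\<^sup>2 = 1" by blast
      have "(norm (p *\<^sub>R u + s *\<^sub>R w))\<^sup>2 = 1" unfolding norm_combination_orthonormal[OF uw(1-3)] by (rule y(2))
      then have "norm (p *\<^sub>R u + s *\<^sub>R w) = 1" by (simp add: power2_eq_1_iff) (smt (verit) norm_ge_zero)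
      moreover have "p *\<^sub>R u + s *\<^sub>R w \<in> D" unfolding uw(4) by blast
      ultimately show "y \<in> C" using D(5) y(1) by blast
    qed
    show "C \<subseteq> {c + r *\<^sub>R (p *\<^sub>R u + s *\<^sub>R w) | p s. p\<^sup>2 + s\<^sup>2 = 1}"
    proof
      fix y assume y: "y \<in> C"
      then obtain v where v: "y = x + v" "v \<in> D" unfolding D(3) circ_def by blast
      have "(x - c) + v \<in> D" using D(1,7) v(2) by (simp add: subspace_add)
      then have yc: "y - c \<in> D" using v(1) by (simp add: algebra_simps)
      have "(norm (y - c))\<^sup>2 = r\<^sup>2" using pyth[OF yc] S[OF y] cr by simp
      moreover obtain s t where st: "y - c = s *\<^sub>R u + t *\<^sub>R w" using yc unfolding uw(4) by blast
      ultimately have n: "s\<^sup>2 + t\<^sup>2 = r\<^sup>2" using norm_combination_orthonormal[OF uw(1-3), of s t] by simp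
      have "(s / r)\<^sup>2 + (t / r)\<^sup>2 = 1" using n D(4) by (simp add: power_divide add_divide_distrib[symmetric])
      moreover have "y = c + r *\<^sub>R ((s / r) *\<^sub>R u + (t / r) *\<^sub>R w)" using st D(4) by (simp add: algebra_simps)
      ultimately show "y \<in> {c + r *\<^sub>R (p *\<^sub>R u + s *\<^sub>R w) | p s. p\<^sup>2 + s\<^sup>2 = 1}" by blast
    qed
  qed
  from that[OF D(4) uw(1-3) D(6)[OF uD(1)] D(6)[OF uD(2)] cr this] show ?thesis .
qed

text \<open>
  The identity theorem; it turns statements about infinitely many points of a circle into
  statements about all of them.
\<close>

lemma trig_quadratic_zero:
  fixes k :: "nat \<Rightarrow> real"
  assumes S: "infinite S" "S \<subseteq> {0..2*pi}"
    and z: "\<And>t. t \<in> S \<Longrightarrow> k 0 + k 1 * cos t + k 2 * sin t + k 3 * (cos t)\<^sup>2 + k 4 * cos t * sin t + k 5 * (sin t)\<^sup>2 = 0"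
    and ps: "p\<^sup>2 + s\<^sup>2 = 1"
  shows "k 0 + k 1 * p + k 2 * s + k 3 * p\<^sup>2 + k 4 * p * s + k 5 * s\<^sup>2 = 0"
proof -
  define h where "h = (\<lambda>t::complex. of_real (k 0) + of_real (k 1) * cos t + of_real (k 2) * sin t +
     of_real (k 3) * (cos t)\<^sup>2 + of_real (k 4) * cos t * sin t + of_real (k 5) * (sin t)\<^sup>2)"
  have hol: "h holomorphic_on UNIV" unfolding h_def by (intro holomorphic_intros)
  have hr: "h (of_real t) = of_real (k 0 + k 1 * cos t + k 2 * sin t + k 3 * (cos t)\<^sup>2 + k 4 * cos t * sin t + k 5 * (sin t)\<^sup>2)" for t
    by (simp add: h_def cos_of_real sin_of_real)
  have zero: "h (of_real t) = 0" if "t \<in> S" for t unfolding hr z[OF that] by simp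
  obtain t where t: "p = cos t" "s = sin t" using sincos_total_2pi[OF ps] by metis
  have "h (of_real t) = 0" using entire_zero_from_infinite_real_zeros[OF hol S zero] .
  then show ?thesis unfolding hr t of_real_eq_0_iff .
qed

lemma orthonormal_complete:
  fixes z :: "real ^ 4"
  assumes "norm e1 = 1" "norm e2 = 1" "norm e3 = 1" "norm e4 = 1"
    "e1 \<bullet> e2 = 0" "e1 \<bullet> e3 = 0" "e1 \<bullet> e4 = 0" "e2 \<bullet> e3 = 0" "e2 \<bullet> e4 = 0" "e3 \<bullet> e4 = 0"
  shows "z = (z \<bullet> e1) *\<^sub>R e1 + (z \<bullet> e2) *\<^sub>R e2 + (z \<bullet> e3) *\<^sub>R e3 + (z \<bullet> e4) *\<^sub>R e4"
proof -
  have T: "orthogonal_transformation (frame_map e1 e2 e3 e4)"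
    by (rule orthogonal_transformation_frame_map[OF assms])
  obtain x where x: "z = frame_map e1 e2 e3 e4 x" using orthogonal_transformation_surj[OF T] by (metis surjD)
  have *: "e2 \<bullet> e1 = 0" "e3 \<bullet> e1 = 0" "e4 \<bullet> e1 = 0" "e3 \<bullet> e2 = 0" "e4 \<bullet> e2 = 0" "e4 \<bullet> e3 = 0"
    using assms by (simp_all add: inner_commute)
  have "z \<bullet> e1 = x $ 1" "z \<bullet> e2 = x $ 2" "z \<bullet> e3 = x $ 3" "z \<bullet> e4 = x $ 4"
    unfolding x frame_map_def inner_add_left inner_scaleR_left using assms * by (simp_all add: norm_eq_1)
  then show ?thesis by (simp add: x frame_map_def)
qed

definition diag_apply :: "real ^ 4 \<Rightarrow> real ^ 4 \<Rightarrow> real ^ 4" where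
  "diag_apply d x = (\<chi> i. d $ i * x $ i)"

lemma diag_apply_nth [simp]: "diag_apply d x $ i = d $ i * x $ i"
  by (simp add: diag_apply_def)

lemma diag_apply_linear:
  "diag_apply d (x + y) = diag_apply d x + diag_apply d y" "diag_apply d (c *\<^sub>R x) = c *\<^sub>R diag_apply d x"
  by (simp_all add: vector_eq_4 algebra_simps)

lemma diag_apply_symmetric: "diag_apply d x \<bullet> y = diag_apply d y \<bullet> x"
  by (simp add: inner_vec_def sum_4 algebra_simps)

lemma diag_form_inner: "diag_form d x = diag_apply d x \<bullet> x"
  by (simp add: diag_form_def inner_vec_def sum_4 power2_eq_square)

lemma diag_form_combination:
  "diag_form d (a *\<^sub>R x + b *\<^sub>R y + c *\<^sub>R z) = a\<^sup>2 * diag_form d x + b\<^sup>2 * diag_form d y + c\<^sup>2 * diag_form d z +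
    2 * a * b * (diag_apply d x \<bullet> y) + 2 * a * c * (diag_apply d x \<bullet> z) + 2 * b * c * (diag_apply d y \<bullet> z)"
  unfolding diag_form_inner diag_apply_linear inner_add_left inner_add_right inner_scaleR_left inner_scaleR_right
    diag_apply_symmetric[of d y x] diag_apply_symmetric[of d z x] diag_apply_symmetric[of d z y]
  by (simp add: power2_eq_square algebra_simps)

text \<open>
  The coefficients are read off at the points \<open>(\<plusminus>1, 0)\<close>, \<open>(0, \<plusminus>1)\<close> and \<open>(3/5, 4/5)\<close>.
\<close>

lemma quadratic_on_circle_zero:
  fixes k0 k1 k2 k3 k4 k5 :: real
  assumes "\<And>p s :: real. p\<^sup>2 + s\<^sup>2 = 1 \<Longrightarrow> k0 + k1 * p + k2 * s + k3 * p\<^sup>2 + k4 * p * s + k5 * s\<^sup>2 = 0"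
  shows "k1 = 0" "k2 = 0" "k4 = 0" "k3 = k5" "k0 + k3 = 0"
proof -
  have e: "k0 + k1 + k3 = 0" "k0 - k1 + k3 = 0" "k0 + k2 + k5 = 0" "k0 - k2 + k5 = 0"
    using assms[of 1 0] assms[of "- 1" 0] assms[of 0 1] assms[of 0 "- 1"] by simp_all
  then show "k1 = 0" "k2 = 0" "k3 = k5" "k0 + k3 = 0" by linarith+
  have "k0 + k1 * (3/5) + k2 * (4/5) + k3 * (3/5)\<^sup>2 + k4 * (3/5) * (4/5) + k5 * (4/5)\<^sup>2 = 0"
    by (rule assms) (simp add: power2_eq_square)
  then have "k0 + k1 * (3/5) + k2 * (4/5) + k3 * (9/25) + k4 * (12/25) + k5 * (16/25) = 0"
    by (simp add: power2_eq_square)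
  then show "k4 = 0" using e by linarith
qed

definition double_upper :: "real ^ 4 \<Rightarrow> bool" where
  "double_upper d \<longleftrightarrow> d$1 = d$2 \<and> d$2 > 0 \<and> 0 > d$3 \<and> d$3 > d$4"

text \<open>
  The circle has centre \<open>h N\<close>, radius \<open>r\<close> and directions \<open>U, W\<close>, and \<open>V\<close> is normal to its
  hyperplane. Since the form vanishes on the circle, it is \<open>\<tau>\<close> times the inner product on
  the span of \<open>U, W\<close>, and \<open>N\<close> is orthogonal to this span for the form. Some unit vector
  \<open>E\<close> of the span is also orthogonal to \<open>V\<close> for the form, so \<open>E\<close> is an eigenvector with
  eigenvalue \<open>\<tau>\<close>. The double eigenvalue \<open>\<tau> = d\<^sub>1\<close> gives the first alternative and \<open>\<tau> =
  d\<^sub>3\<close> the second; the extreme eigenvalue \<open>d\<^sub>4\<close> is impossible.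
\<close>

lemma small_circle_normal_form:
  assumes d: "double_upper d" and h: "h \<noteq> 0" and r: "r > 0"
    and on: "norm N = 1" "norm U = 1" "norm W = 1" "norm V = 1"
      "N \<bullet> U = 0" "N \<bullet> W = 0" "U \<bullet> W = 0" "V \<bullet> N = 0" "V \<bullet> U = 0" "V \<bullet> W = 0"
    and q: "\<And>p s. p\<^sup>2 + s\<^sup>2 = 1 \<Longrightarrow> diag_form d (h *\<^sub>R N + r *\<^sub>R (p *\<^sub>R U + s *\<^sub>R W)) = 0"
  shows "N$1 = 0 \<and> N$2 = 0 \<and> (N$4)\<^sup>2 = (- r\<^sup>2 * d$1 / h\<^sup>2 - d$3) / (d$4 - d$3) \<or>
    N$3 = 0 \<and> N$4 = 0 \<and> (V$4)\<^sup>2 = (d$3 - d$4) / (d$1 - d$4)"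
proof -
  let ?B = "\<lambda>x y. diag_apply d x \<bullet> y"
  have ex: "h\<^sup>2 * diag_form d N + (2 * h * r * ?B N U) * p + (2 * h * r * ?B N W) * s + (r\<^sup>2 * diag_form d U) * p\<^sup>2 +
      (2 * r\<^sup>2 * ?B U W) * p * s + (r\<^sup>2 * diag_form d W) * s\<^sup>2 = 0" if "p\<^sup>2 + s\<^sup>2 = 1" for p s
    using q[OF that] diag_form_combination[of d h N "r * p" U "r * s" W]
    by (simp add: scaleR_add_right power2_eq_square algebra_simps)
  note c = quadratic_on_circle_zero[OF ex]
  have NU: "?B N U = 0" and NW: "?B N W = 0" and UW: "?B U W = 0" and UU: "diag_form d U = diag_form d W"
    and NN: "h\<^sup>2 * diag_form d N + r\<^sup>2 * diag_form d U = 0"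
    using c h r by auto
  define \<tau> where "\<tau> = diag_form d U"
  define L where "L = (\<lambda>x. diag_apply d x - \<tau> *\<^sub>R x)"
  have Lsym: "L x \<bullet> y = L y \<bullet> x" for x y
    by (simp add: L_def inner_diff_left diag_apply_symmetric[of d x y] inner_commute[of x y])
  have Lcomb: "L (a *\<^sub>R x + b *\<^sub>R y) = a *\<^sub>R L x + b *\<^sub>R L y" for a b x y
    by (simp add: L_def diag_apply_linear algebra_simps)
  have L0: "L U \<bullet> U = 0" "L W \<bullet> W = 0" "L U \<bullet> W = 0" "L U \<bullet> N = 0" "L W \<bullet> N = 0"
    using on(2,3,5,6,7) UU UW NU NW
    unfolding L_def inner_diff_left \<tau>_def diag_form_inner norm_eq_1
       diag_apply_symmetric[of d U N] diag_apply_symmetric[of d W N] inner_commute[of N U] inner_commute[of N W]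
    by simp_all
  \<comment> \<open>The direction in the span of \<open>U, W\<close> that \<open>L\<close> maps to a vector orthogonal to \<open>V\<close>.\<close>
  obtain p s where ps: "p\<^sup>2 + s\<^sup>2 = 1" "p * (L U \<bullet> V) + s * (L W \<bullet> V) = 0"
  proof (cases "(L U \<bullet> V)\<^sup>2 + (L W \<bullet> V)\<^sup>2 = 0")
    case True
    then show ?thesis using that[of 1 0] by (simp add: sum_power2_eq_zero_iff)
  next
    case False
    let ?n = "(L U \<bullet> V)\<^sup>2 + (L W \<bullet> V)\<^sup>2"
    have pos: "?n > 0" using False by (simp add: sum_power2_gt_zero_iff sum_power2_eq_zero_iff)
    show ?thesis
    proof (rule that[of "- (L W \<bullet> V) / sqrt ?n" "(L U \<bullet> V) / sqrt ?n"])
      show "(- (L W \<bullet> V) / sqrt ?n)\<^sup>2 + ((L U \<bullet> V) / sqrt ?n)\<^sup>2 = 1"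
        using pos False by (simp add: power_divide add_divide_distrib[symmetric] add.commute)
    qed simp
  qed
  define E where "E = p *\<^sub>R U + s *\<^sub>R W"
  define X where "X = (- s) *\<^sub>R U + p *\<^sub>R W"
  have E: "norm E = 1" "norm X = 1" "E \<bullet> X = 0" "N \<bullet> E = 0" "N \<bullet> X = 0" "V \<bullet> E = 0" "V \<bullet> X = 0"
    using ps(1) on norm_combination_orthonormal[OF on(2,3,7)]
    by (simp_all add: E_def X_def norm_eq_1 inner_add_left inner_add_right inner_diff_left inner_diff_right
         inner_commute[of W U] power2_eq_square algebra_simps)
  have LE: "L E \<bullet> N = 0" "L E \<bullet> E = 0" "L E \<bullet> X = 0" "L E \<bullet> V = 0" "L X \<bullet> X = 0" "L X \<bullet> N = 0"
    using L0 ps(2) Lsym[of W U] unfolding E_def X_def Lcomb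
    by (simp_all add: inner_add_left inner_add_right algebra_simps)
  have VN: "N \<bullet> V = 0" "E \<bullet> V = 0" "X \<bullet> V = 0" using on E by (simp_all add: inner_commute)
  note expand = orthonormal_complete[OF on(1) E(1,2) on(4) E(4,5) VN(1) E(3) VN(2,3)]
  have "L E = 0" using expand[of "L E"] LE by simp
  then have Ei: "(d$i - \<tau>) * E$i = 0" for i
  proof -
    have "L E $ i = 0" by (simp add: \<open>L E = 0\<close>)
    then show ?thesis unfolding L_def by (simp add: left_diff_distrib)
  qed
  have Xq: "(d$1 - \<tau>) * (X$1)\<^sup>2 + (d$2 - \<tau>) * (X$2)\<^sup>2 + (d$3 - \<tau>) * (X$3)\<^sup>2 + (d$4 - \<tau>) * (X$4)\<^sup>2 = 0"
    using LE(5) by (simp add: L_def inner_vec_def sum_4 power2_eq_square algebra_simps)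
  have XN: "(d$1 - \<tau>) * X$1 * N$1 + (d$2 - \<tau>) * X$2 * N$2 + (d$3 - \<tau>) * X$3 * N$3 + (d$4 - \<tau>) * X$4 * N$4 = 0"
    using LE(6) by (simp add: L_def inner_vec_def sum_4 algebra_simps)
  have D: "d$2 = d$1" "d$1 > 0" "d$3 < 0" "d$4 < d$3" using d by (auto simp: double_upper_def)
  have n4: "(E$1)\<^sup>2 + (E$2)\<^sup>2 + (E$3)\<^sup>2 + (E$4)\<^sup>2 = 1" "(X$1)\<^sup>2 + (X$2)\<^sup>2 + (X$3)\<^sup>2 + (X$4)\<^sup>2 = 1"
    "(N$1)\<^sup>2 + (N$2)\<^sup>2 + (N$3)\<^sup>2 + (N$4)\<^sup>2 = 1"
    using sphere_4_eq E on by blast+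
  have i4: "E$1 * X$1 + E$2 * X$2 + E$3 * X$3 + E$4 * X$4 = 0" "N$1 * E$1 + N$2 * E$2 + N$3 * E$3 + N$4 * E$4 = 0"
    "N$1 * X$1 + N$2 * X$2 + N$3 * X$3 + N$4 * X$4 = 0"
    using E by (simp_all add: inner_vec_def sum_4)
  have "\<tau> = d$1 \<or> \<tau> = d$3 \<or> \<tau> = d$4"
  proof (rule ccontr)
    assume *: "\<not> ?thesis"
    then have "E$i = 0" for i using Ei[of i] D(1) exhaust_4[of i] by auto
    then show False using n4(1) by simp
  qed
  then consider "\<tau> = d$1" | "\<tau> = d$3" | "\<tau> = d$4" by blast
  then show ?thesis
  proof cases
    case 1
    have "(d$1 - d$3) * (X$3)\<^sup>2 + (d$1 - d$4) * (X$4)\<^sup>2 = 0" using Xq unfolding 1 D(1) by (simp add: algebra_simps)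
    moreover have "(d$1 - d$3) * (X$3)\<^sup>2 \<ge> 0" "(d$1 - d$4) * (X$4)\<^sup>2 \<ge> 0" using D by simp_all
    ultimately have "(d$1 - d$3) * (X$3)\<^sup>2 = 0" "(d$1 - d$4) * (X$4)\<^sup>2 = 0" by linarith+
    then have X34: "X$3 = 0" "X$4 = 0" using D by auto
    have E34: "E$3 = 0" "E$4 = 0" using Ei[of 3] Ei[of 4] D 1 by auto
    have t: "E$1 * X$1 + E$2 * X$2 = 0" "(E$1)\<^sup>2 + (E$2)\<^sup>2 = (X$1)\<^sup>2 + (X$2)\<^sup>2" using i4 n4 X34 E34 by simp_all
    obtain e where e: "e = 1 \<or> e = -1" "X$1 = - e * E$2" "X$2 = e * E$1" using perpendicular_same_length[OF t] by blast
    have "N$1 * E$1 + N$2 * E$2 = 0" "N$2 * E$1 = N$1 * E$2" using i4(2,3) e X34 E34 by auto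
    moreover have "N$1 = E$1 * (N$1 * E$1 + N$2 * E$2) + E$2 * (N$1 * E$2 - N$2 * E$1)"
      "N$2 = E$2 * (N$1 * E$1 + N$2 * E$2) - E$1 * (N$1 * E$2 - N$2 * E$1)"
    proof -
      have n: "(E$1)\<^sup>2 + (E$2)\<^sup>2 = 1" using n4(1) E34 by simp
      have "N$1 * ((E$1)\<^sup>2 + (E$2)\<^sup>2) = E$1 * (N$1 * E$1 + N$2 * E$2) + E$2 * (N$1 * E$2 - N$2 * E$1)"
        "N$2 * ((E$1)\<^sup>2 + (E$2)\<^sup>2) = E$2 * (N$1 * E$1 + N$2 * E$2) - E$1 * (N$1 * E$2 - N$2 * E$1)"
        by (simp_all add: power2_eq_square algebra_simps)
      then show "N$1 = E$1 * (N$1 * E$1 + N$2 * E$2) + E$2 * (N$1 * E$2 - N$2 * E$1)"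
        "N$2 = E$2 * (N$1 * E$1 + N$2 * E$2) - E$1 * (N$1 * E$2 - N$2 * E$1)" unfolding n by simp_all
    qed
    ultimately have N12: "N$1 = 0" "N$2 = 0" by (metis diff_self mult_zero_right add_0)+
    have "h\<^sup>2 * (d$3 * (N$3)\<^sup>2 + d$4 * (N$4)\<^sup>2) = - r\<^sup>2 * d$1"
      using NN 1 N12 unfolding \<tau>_def by (simp add: diag_form_def[of d N] algebra_simps)
    then have k: "d$3 * (N$3)\<^sup>2 + d$4 * (N$4)\<^sup>2 = - r\<^sup>2 * d$1 / h\<^sup>2" using h by (simp add: field_simps)
    have "(N$3)\<^sup>2 = 1 - (N$4)\<^sup>2" using n4(3) N12 by simp
    then have "d$3 * (1 - (N$4)\<^sup>2) + d$4 * (N$4)\<^sup>2 = - r\<^sup>2 * d$1 / h\<^sup>2" using k by (simp only:)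
    moreover have "(N$4)\<^sup>2 * (d$4 - d$3) = d$3 * (1 - (N$4)\<^sup>2) + d$4 * (N$4)\<^sup>2 - d$3" by (simp add: algebra_simps)
    ultimately have "(N$4)\<^sup>2 * (d$4 - d$3) = - r\<^sup>2 * d$1 / h\<^sup>2 - d$3" by (simp only:)
    moreover have "d$4 - d$3 \<noteq> 0" using D by simp
    ultimately have "(N$4)\<^sup>2 = (- r\<^sup>2 * d$1 / h\<^sup>2 - d$3) / (d$4 - d$3)" by (metis nonzero_mult_div_cancel_right)
    then show ?thesis using N12 by blast
  next
    case 2
    have E0: "E$1 = 0" "E$2 = 0" "E$4 = 0" using Ei[of 1] Ei[of 2] Ei[of 4] D 2 by auto
    then have "E$3 \<noteq> 0" using n4(1) by auto
    then have z3: "X$3 = 0" "N$3 = 0" using i4(1,2) E0 by simp_all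
    have "(V \<bullet> E) = V$3 * E$3" using E0 by (simp add: inner_vec_def sum_4)
    then have V3: "V$3 = 0" using E(6) \<open>E$3 \<noteq> 0\<close> by simp
    have "(d$1 - d$3) * ((X$1)\<^sup>2 + (X$2)\<^sup>2) + (d$4 - d$3) * (X$4)\<^sup>2 = 0"
      using Xq unfolding 2 D(1) by (simp add: z3 algebra_simps)
    moreover have "(X$1)\<^sup>2 + (X$2)\<^sup>2 = 1 - (X$4)\<^sup>2" using n4(2) z3 by simp
    ultimately have X4: "(X$4)\<^sup>2 * (d$1 - d$4) = d$1 - d$3" by (simp add: algebra_simps)
    have X4n: "X$4 \<noteq> 0" using X4 D by auto
    have "(d$1 - d$3) * (N$1 * X$1 + N$2 * X$2) + (d$4 - d$3) * (N$4 * X$4) = 0"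
      using XN unfolding 2 D(1) by (simp add: z3 algebra_simps)
    moreover have "N$1 * X$1 + N$2 * X$2 = - (N$4 * X$4)" using i4(3) z3 by simp
    ultimately have "(d$4 - d$1) * (N$4 * X$4) = 0" by (simp add: algebra_simps)
    then have N4: "N$4 = 0" using X4n D by simp
    have c4: "axis 4 1 \<bullet> v = v $ 4" for v :: "real ^ 4" by (simp add: inner_axis')
    have a4: "(axis 4 1 :: real ^ 4) = N$4 *\<^sub>R N + E$4 *\<^sub>R E + X$4 *\<^sub>R X + V$4 *\<^sub>R V"
      using expand[of "axis 4 1"] unfolding c4 .
    have "(1::real) = (axis 4 1 :: real ^ 4) $ 4" by (simp add: axis_def)
    also have "\<dots> = (X$4)\<^sup>2 + (V$4)\<^sup>2" unfolding a4 by (simp add: N4 E0 power2_eq_square)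
    finally have "(V$4)\<^sup>2 = 1 - (X$4)\<^sup>2" by simp
    then have "(V$4)\<^sup>2 * (d$1 - d$4) = (d$1 - d$4) - (X$4)\<^sup>2 * (d$1 - d$4)" by (simp add: left_diff_distrib)
    then have "(V$4)\<^sup>2 * (d$1 - d$4) = d$3 - d$4" unfolding X4 by simp
    moreover have "d$1 - d$4 \<noteq> 0" using D by simp
    ultimately have "(V$4)\<^sup>2 = (d$3 - d$4) / (d$1 - d$4)" by (metis nonzero_mult_div_cancel_right)
    then show ?thesis using z3 N4 by blast
  next
    case 3
    have p: "(d$1 - d$4) * (X$1)\<^sup>2 \<ge> 0" "(d$1 - d$4) * (X$2)\<^sup>2 \<ge> 0" "(d$3 - d$4) * (X$3)\<^sup>2 \<ge> 0" using D by simp_all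
    have "(d$1 - d$4) * (X$1)\<^sup>2 + (d$1 - d$4) * (X$2)\<^sup>2 + (d$3 - d$4) * (X$3)\<^sup>2 = 0" using Xq unfolding 3 D(1) by simp
    then have "(d$1 - d$4) * (X$1)\<^sup>2 = 0" "(d$1 - d$4) * (X$2)\<^sup>2 = 0" "(d$3 - d$4) * (X$3)\<^sup>2 = 0" using p by linarith+
    then have X0: "X$1 = 0" "X$2 = 0" "X$3 = 0" using D by auto
    have "E$1 = 0" "E$2 = 0" "E$3 = 0" using Ei[of 1] Ei[of 2] Ei[of 3] D 3 by auto
    then have "E$4 * X$4 = 0" "(E$4)\<^sup>2 = 1" "(X$4)\<^sup>2 = 1" using i4(1) n4 X0 by simp_all
    then show ?thesis by auto
  qed
qed

lemma affine_trig_zero: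
  fixes \<alpha> \<beta> \<gamma> :: real
  assumes S: "infinite S" "S \<subseteq> {0..2*pi}" and z: "\<And>t. t \<in> S \<Longrightarrow> \<alpha> + \<beta> * cos t + \<gamma> * sin t = 0"
  shows "\<alpha> = 0" "\<beta> = 0" "\<gamma> = 0"
proof -
  define k :: "nat \<Rightarrow> real" where "k = (\<lambda>_. 0)(0 := \<alpha>, 1 := \<beta>, 2 := \<gamma>)"
  have "k 0 + k 1 * p + k 2 * s + k 3 * p\<^sup>2 + k 4 * p * s + k 5 * s\<^sup>2 = 0" if "p\<^sup>2 + s\<^sup>2 = 1" for p s
    by (rule trig_quadratic_zero[OF S _ that]) (simp add: k_def z)
  then have "\<alpha> + \<beta> * p + \<gamma> * s + 0 * p\<^sup>2 + 0 * p * s + 0 * s\<^sup>2 = 0" if "p\<^sup>2 + s\<^sup>2 = 1" for p s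
    using that by (simp add: k_def)
  note c = quadratic_on_circle_zero[OF this]
  show "\<beta> = 0" "\<gamma> = 0" "\<alpha> = 0" using c by simp_all
qed

text \<open>
  The square has \<open>2 \<beta> \<gamma>\<close> as the coefficient of \<open>cos t sin t\<close> and equal coefficients \<open>\<beta>\<^sup>2 =
  \<gamma>\<^sup>2\<close>.
\<close>

lemma affine_trig_square_constant:
  fixes \<alpha> \<beta> \<gamma> :: real
  assumes S: "infinite S" "S \<subseteq> {0..2*pi}" and z: "\<And>t. t \<in> S \<Longrightarrow> (\<alpha> + \<beta> * cos t + \<gamma> * sin t)\<^sup>2 = K"
  shows "\<beta> = 0" "\<gamma> = 0"
proof -
  define k :: "nat \<Rightarrow> real" where
    "k = (\<lambda>_. 0)(0 := \<alpha>\<^sup>2 - K, 1 := 2 * \<alpha> * \<beta>, 2 := 2 * \<alpha> * \<gamma>, 3 := \<beta>\<^sup>2, 4 := 2 * \<beta> * \<gamma>, 5 := \<gamma>\<^sup>2)"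
  have k: "k 0 = \<alpha>\<^sup>2 - K" "k 1 = 2 * \<alpha> * \<beta>" "k 2 = 2 * \<alpha> * \<gamma>" "k 3 = \<beta>\<^sup>2" "k 4 = 2 * \<beta> * \<gamma>" "k 5 = \<gamma>\<^sup>2"
    by (simp_all add: k_def)
  have "k 0 + k 1 * p + k 2 * s + k 3 * p\<^sup>2 + k 4 * p * s + k 5 * s\<^sup>2 = 0" if "p\<^sup>2 + s\<^sup>2 = 1" for p s
  proof (rule trig_quadratic_zero[OF S _ that])
    fix t assume "t \<in> S"
    from z[OF this] show "k 0 + k 1 * cos t + k 2 * sin t + k 3 * (cos t)\<^sup>2 + k 4 * cos t * sin t + k 5 * (sin t)\<^sup>2 = 0"
      unfolding k by (simp add: power2_eq_square algebra_simps)
  qed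
  note c = quadratic_on_circle_zero[OF this]
  show "\<beta> = 0" "\<gamma> = 0" using c(3,4) unfolding k by auto
qed

lemma no_third_orthogonal_in_plane:
  fixes x y v :: "real ^ 4"
  assumes z: "x$3 = 0" "x$4 = 0" "y$3 = 0" "y$4 = 0" "v$3 = 0" "v$4 = 0"
    and o: "x \<bullet> y = 0" "v \<bullet> x = 0" "v \<bullet> y = 0" and n: "x \<noteq> 0" "y \<noteq> 0"
  shows "v = 0"
proof -
  let ?D = "x$1 * y$2 - x$2 * y$1"
  have i: "x$1 * y$1 + x$2 * y$2 = 0" "v$1 * x$1 + v$2 * x$2 = 0" "v$1 * y$1 + v$2 * y$2 = 0"
    using o z by (simp_all add: inner_vec_def sum_4)
  have "x \<bullet> x > 0" "y \<bullet> y > 0" using n by simp_all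
  then have "((x$1)\<^sup>2 + (x$2)\<^sup>2) * ((y$1)\<^sup>2 + (y$2)\<^sup>2) > 0"
    using z by (simp add: inner_vec_def sum_4 power2_eq_square)
  moreover have "((x$1)\<^sup>2 + (x$2)\<^sup>2) * ((y$1)\<^sup>2 + (y$2)\<^sup>2) = ?D\<^sup>2 + (x$1 * y$1 + x$2 * y$2)\<^sup>2"
    by (simp add: power2_eq_square algebra_simps)
  ultimately have D: "?D \<noteq> 0" using i(1) by auto
  have "v$1 * ?D = y$2 * (v$1 * x$1 + v$2 * x$2) - x$2 * (v$1 * y$1 + v$2 * y$2)"
    "v$2 * ?D = x$1 * (v$1 * y$1 + v$2 * y$2) - y$1 * (v$1 * x$1 + v$2 * x$2)" by (simp_all add: algebra_simps)
  then have "v$1 * ?D = 0" "v$2 * ?D = 0" using i by simp_all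
  then show ?thesis using D z by (simp add: vector_eq_4)
qed

lemma composition_product_norm:
  assumes m: "composition_product m" and a: "norm a = 1"
  shows "norm (m a b) = norm b" "m a b \<bullet> m a b' = b \<bullet> b'"
proof -
  show i: "m a b \<bullet> m a b' = b \<bullet> b'" for b b' using m a by (simp add: composition_product_def norm_eq_1)
  show "norm (m a b) = norm b" by (simp add: norm_eq_sqrt_inner i)
qed

text \<open>
  Multiplication by \<open>a \<in> A\<close> preserves the radius and the distance of the centre from the
  origin, so with the same constants the normal form holds for each product circle \<open>m a
  B\<close>. One of its two alternatives then holds for infinitely many \<open>a\<close>, hence identically on
  \<open>A\<close>. The first makes \<open>m a n\<close> constant along \<open>A\<close>, although \<open>m\<close> preserves lengths. The
  second puts three orthogonal vectors into a plane, so the centre of \<open>A\<close> is the origin,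
  and a coordinate with the constant square \<open>\<kappa> > 0\<close> is linear on the great circle \<open>A\<close>.
\<close>

lemma small_right_circle_centre:
  assumes m: "composition_product m" and d: "double_upper d" and A: "circle_in_S3 A"
    and r: "r > 0" and on: "norm u = 1" "norm w = 1" "u \<bullet> w = 0" "c \<bullet> u = 0" "c \<bullet> w = 0"
    and z: "\<And>a p s. a \<in> A \<Longrightarrow> p\<^sup>2 + s\<^sup>2 = 1 \<Longrightarrow> diag_form d (m a (c + r *\<^sub>R (p *\<^sub>R u + s *\<^sub>R w))) = 0"
  shows "c = 0"
proof (rule ccontr)
  assume c: "c \<noteq> 0"
  have bl: "bilinear m" using m by (simp add: composition_product_def)
  note bls = bilinear_ladd[OF bl] bilinear_radd[OF bl] bilinear_lmul[OF bl] bilinear_rmul[OF bl]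
  obtain cA uA wA rA where Ar: "rA > 0" and Ao: "norm uA = 1" "norm wA = 1" "uA \<bullet> wA = 0" "cA \<bullet> uA = 0" "cA \<bullet> wA = 0"
    and Ac: "cA \<bullet> cA + rA\<^sup>2 = 1" and Aeq: "A = {cA + rA *\<^sub>R (p *\<^sub>R uA + s *\<^sub>R wA) | p s. p\<^sup>2 + s\<^sup>2 = 1}"
    by (rule circle_parametrization[OF A])
  \<comment> \<open>The centre is \<open>h n\<close>, and \<open>n'\<close> completes \<open>n, u, w\<close> to an orthonormal basis.\<close>
  define h n where "h = norm c" and "n = (1 / h) *\<^sub>R c"
  have h: "h > 0" using c by (simp add: h_def)
  have n: "norm n = 1" "n \<bullet> u = 0" "n \<bullet> w = 0" "c = h *\<^sub>R n" using h on by (simp_all add: n_def h_def)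
  have "\<exists>v. v \<noteq> 0 \<and> (\<forall>x\<in>{n, u, w}. x \<bullet> v = 0)"
    by (rule orthogonal_vector_exists_4) (simp_all add: card_insert_if)
  then obtain v where v: "v \<noteq> 0" "n \<bullet> v = 0" "u \<bullet> v = 0" "w \<bullet> v = 0" by auto
  define n' where "n' = (1 / norm v) *\<^sub>R v"
  have n': "norm n' = 1" "n' \<bullet> n = 0" "n' \<bullet> u = 0" "n' \<bullet> w = 0"
    using v by (simp_all add: n'_def inner_commute)
  define K where "K = (- r\<^sup>2 * d$1 / h\<^sup>2 - d$3) / (d$4 - d$3)"
  define \<kappa> where "\<kappa> = (d$3 - d$4) / (d$1 - d$4)"
  have "\<kappa> > 0" using d by (simp add: \<kappa>_def double_upper_def)
  define a where "a = (\<lambda>t. cA + rA *\<^sub>R (cos t *\<^sub>R uA + sin t *\<^sub>R wA))"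
  have aA: "a t \<in> A" for t unfolding Aeq a_def using sin_cos_squared_add2[of t] by blast
  have A1: "norm (a t) = 1" for t using aA[of t] A unfolding circle_in_S3_def by auto
  have comp: "m (a t) x $ i = m cA x $ i + (rA * m uA x $ i) * cos t + (rA * m wA x $ i) * sin t" for t x i
    unfolding a_def bls by (simp add: algebra_simps)
  define S1 where "S1 = {t\<in>{0..2*pi}. m (a t) n $ 1 = 0 \<and> m (a t) n $ 2 = 0 \<and> (m (a t) n $ 4)\<^sup>2 = K}"
  define S2 where "S2 = {t\<in>{0..2*pi}. m (a t) n $ 3 = 0 \<and> m (a t) n $ 4 = 0 \<and> (m (a t) n' $ 4)\<^sup>2 = \<kappa>}"
  have "t \<in> S1 \<union> S2" if t: "t \<in> {0..2*pi}" for t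
  proof -
    note cn = composition_product_norm[OF m A1]
    have q: "diag_form d (h *\<^sub>R m (a t) n + r *\<^sub>R (p *\<^sub>R m (a t) u + s *\<^sub>R m (a t) w)) = 0" if "p\<^sup>2 + s\<^sup>2 = 1" for p s
      using z[OF aA that] unfolding n(4) bls .
    have "m (a t) n $ 1 = 0 \<and> m (a t) n $ 2 = 0 \<and> (m (a t) n $ 4)\<^sup>2 = K \<or>
        m (a t) n $ 3 = 0 \<and> m (a t) n $ 4 = 0 \<and> (m (a t) n' $ 4)\<^sup>2 = \<kappa>"
      unfolding K_def \<kappa>_def
      by (rule small_circle_normal_form[OF d _ r _ _ _ _ _ _ _ _ _ _ q]) (use h n(1-3) n' on(1-3) in \<open>simp_all add: cn\<close>)
    then show ?thesis using t by (auto simp: S1_def S2_def)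
  qed
  then have "{0..2*pi} \<subseteq> S1 \<union> S2" by blast
  moreover have "infinite {0..2*pi}" by (simp add: infinite_Icc)
  ultimately have inf: "infinite S1 \<or> infinite S2" using finite_subset by (metis finite_UnI)
  have sub: "S1 \<subseteq> {0..2*pi}" "S2 \<subseteq> {0..2*pi}" by (auto simp: S1_def S2_def)
  show False
  proof (cases "infinite S1")
    case True
    have z1: "m cA n $ 1 + (rA * m uA n $ 1) * cos t + (rA * m wA n $ 1) * sin t = 0" if "t \<in> S1" for t
      using that comp[of t n 1] by (simp add: S1_def)
    have z2: "m cA n $ 2 + (rA * m uA n $ 2) * cos t + (rA * m wA n $ 2) * sin t = 0" if "t \<in> S1" for t
      using that comp[of t n 2] by (simp add: S1_def)
    have z4: "(m cA n $ 4 + (rA * m uA n $ 4) * cos t + (rA * m wA n $ 4) * sin t)\<^sup>2 = K" if "t \<in> S1" for t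
      using that comp[of t n 4] by (simp add: S1_def)
    have z3: "(m cA n $ 3 + (rA * m uA n $ 3) * cos t + (rA * m wA n $ 3) * sin t)\<^sup>2 = 1 - K" if t: "t \<in> S1" for t
    proof -
      have "norm (m (a t) n) = 1" using composition_product_norm(1)[OF m A1] n(1) by simp
      then have "(m (a t) n $ 1)\<^sup>2 + (m (a t) n $ 2)\<^sup>2 + (m (a t) n $ 3)\<^sup>2 + (m (a t) n $ 4)\<^sup>2 = 1"
        using sphere_4_eq by blast
      then have "(m (a t) n $ 3)\<^sup>2 = 1 - K" using t by (simp add: S1_def)
      then show ?thesis unfolding comp .
    qed
    have "m uA n = 0"
      using affine_trig_zero(2)[OF True sub(1) z1] affine_trig_zero(2)[OF True sub(1) z2]
        affine_trig_square_constant(1)[OF True sub(1) z3] affine_trig_square_constant(1)[OF True sub(1) z4] Ar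
      by (simp add: vector_eq_4)
    then show False using composition_product_norm(1)[OF m Ao(1), of n] n(1) by simp
  next
    case False
    then have S2: "infinite S2" using inf by blast
    have z3: "m cA n $ 3 + (rA * m uA n $ 3) * cos t + (rA * m wA n $ 3) * sin t = 0" if "t \<in> S2" for t
      using that comp[of t n 3] by (simp add: S2_def)
    have z4: "m cA n $ 4 + (rA * m uA n $ 4) * cos t + (rA * m wA n $ 4) * sin t = 0" if "t \<in> S2" for t
      using that comp[of t n 4] by (simp add: S2_def)
    have k: "(m cA n' $ 4 + (rA * m uA n' $ 4) * cos t + (rA * m wA n' $ 4) * sin t)\<^sup>2 = \<kappa>" if "t \<in> S2" for t
      using that comp[of t n' 4] by (simp add: S2_def)
    have rn: "m x n \<bullet> m y n = x \<bullet> y" for x y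
      using m n(1) by (simp add: composition_product_def norm_eq_1)
    have "m uA n \<bullet> m uA n \<noteq> 0" "m wA n \<bullet> m wA n \<noteq> 0" unfolding rn using Ao(1,2) by auto
    then have nz: "m uA n \<noteq> 0" "m wA n \<noteq> 0" by auto
    have "m cA n = 0"
      using affine_trig_zero[OF S2 sub(2) z3] affine_trig_zero[OF S2 sub(2) z4] Ar Ao nz
      by (intro no_third_orthogonal_in_plane[of "m uA n" "m wA n"]) (simp_all add: rn)
    then have "m cA n \<bullet> m cA n = 0" by simp
    then have "cA = 0" unfolding rn by simp
    then have c0: "m cA n' $ 4 = 0" by (simp add: bilinear_lzero[OF bl])
    obtain t where "t \<in> S2" using S2 by (metis ex_in_conv finite.emptyI)
    then have "\<kappa> = 0"
      using k affine_trig_square_constant[OF S2 sub(2) k] c0 by simp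
    then show False using \<open>\<kappa> > 0\<close> by simp
  qed
qed

lemma orthogonal_to_four_zero:
  fixes z :: "real ^ 4"
  assumes n: "x1 \<noteq> 0" "x2 \<noteq> 0" "x3 \<noteq> 0" "x4 \<noteq> 0"
    and o: "x1 \<bullet> x2 = 0" "x1 \<bullet> x3 = 0" "x1 \<bullet> x4 = 0" "x2 \<bullet> x3 = 0" "x2 \<bullet> x4 = 0" "x3 \<bullet> x4 = 0"
    and z: "z \<bullet> x1 = 0" "z \<bullet> x2 = 0" "z \<bullet> x3 = 0" "z \<bullet> x4 = 0"
  shows "z = 0"
proof -
  have "z = (z \<bullet> ((1 / norm x1) *\<^sub>R x1)) *\<^sub>R ((1 / norm x1) *\<^sub>R x1) + (z \<bullet> ((1 / norm x2) *\<^sub>R x2)) *\<^sub>R ((1 / norm x2) *\<^sub>R x2) +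
      (z \<bullet> ((1 / norm x3) *\<^sub>R x3)) *\<^sub>R ((1 / norm x3) *\<^sub>R x3) + (z \<bullet> ((1 / norm x4) *\<^sub>R x4)) *\<^sub>R ((1 / norm x4) *\<^sub>R x4)"
    by (rule orthonormal_complete) (use n o in simp_all)
  then show ?thesis unfolding inner_scaleR_right z by simp
qed

text \<open>
  Two independent eigenvectors belong to the double eigenvalue \<open>d\<^sub>1 = d\<^sub>2\<close>.
\<close>

lemma double_eigenvector:
  assumes d: "double_upper d" and x: "diag_apply d x = \<kappa> *\<^sub>R x" "x \<noteq> 0" and y: "diag_apply d y = \<kappa> *\<^sub>R y" "y \<noteq> 0" and o: "x \<bullet> y = 0"
  shows "x$3 = 0 \<and> x$4 = 0 \<and> y$3 = 0 \<and> y$4 = 0"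
proof -
  have D: "d$2 = d$1" "d$1 > 0" "d$3 < 0" "d$4 < d$3" using d by (auto simp: double_upper_def)
  have e: "x$i = 0" "y$i = 0" if "\<kappa> \<noteq> d$i" for i
    using arg_cong[OF x(1), of "\<lambda>v. v$i"] arg_cong[OF y(1), of "\<lambda>v. v$i"] that by auto
  have i: "x$1 * y$1 + x$2 * y$2 + x$3 * y$3 + x$4 * y$4 = 0" using o by (simp add: inner_vec_def sum_4)
  have "\<kappa> \<noteq> d$3"
  proof
    assume k: "\<kappa> = d$3"
    have "x$1 = 0" "x$2 = 0" "x$4 = 0" "y$1 = 0" "y$2 = 0" "y$4 = 0" using e[of 1] e[of 2] e[of 4] D k by auto
    then show False using i x(2) y(2) by (auto simp: vector_eq_4)
  qed
  moreover have "\<kappa> \<noteq> d$4"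
  proof
    assume k: "\<kappa> = d$4"
    have "x$1 = 0" "x$2 = 0" "x$3 = 0" "y$1 = 0" "y$2 = 0" "y$3 = 0" using e[of 1] e[of 2] e[of 3] D k by auto
    then show False using i x(2) y(2) by (auto simp: vector_eq_4)
  qed
  ultimately show ?thesis using e[of 3] e[of 4] by blast
qed

text \<open>
  The sum and difference formulas turn the product at angles \<open>\<theta>\<close> and \<open>\<phi>\<close> into half of \<open>cos
  (\<theta> - \<phi>) x + sin (\<theta> - \<phi>) y + cos (\<theta> + \<phi>) w + sin (\<theta> + \<phi>) z\<close> with pairwise orthogonal
  vectors, where \<open>x, y\<close> have equal lengths and so have \<open>w, z\<close>. If these are nonzero, the
  form is diagonal in this basis with two eigenvalues, each for two basis vectors. A form
  with two simple eigenvalues does not admit this.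
\<close>

lemma great_circle_product_not_spanning:
  assumes m: "composition_product m" and d: "double_upper d"
    and a: "norm a0 = 1" "norm a1 = 1" "a0 \<bullet> a1 = 0" and b: "norm b0 = 1" "norm b1 = 1" "b0 \<bullet> b1 = 0"
    and z: "\<And>p s q t. p\<^sup>2 + s\<^sup>2 = 1 \<Longrightarrow> q\<^sup>2 + t\<^sup>2 = 1 \<Longrightarrow>
      diag_form d (m (p *\<^sub>R a0 + s *\<^sub>R a1) (q *\<^sub>R b0 + t *\<^sub>R b1)) = 0"
  shows "\<exists>l. l \<noteq> 0 \<and> (\<forall>p s q t. l \<bullet> m (p *\<^sub>R a0 + s *\<^sub>R a1) (q *\<^sub>R b0 + t *\<^sub>R b1) = 0)"
proof -
  have bl: "bilinear m" using m by (simp add: composition_product_def)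
  note bls = bilinear_ladd[OF bl] bilinear_radd[OF bl] bilinear_lmul[OF bl] bilinear_rmul[OF bl]
  \<comment> \<open>The products of the basis vectors.\<close>
  define P F G S where "P = m a0 b0" and "F = m a1 b0" and "G = m a0 b1" and "S = m a1 b1"
  have prod: "m (p *\<^sub>R a0 + s *\<^sub>R a1) (q *\<^sub>R b0 + t *\<^sub>R b1) = (p*q) *\<^sub>R P + (s*q) *\<^sub>R F + (p*t) *\<^sub>R G + (s*t) *\<^sub>R S" for p s q t
    by (simp add: bls P_def F_def G_def S_def algebra_simps)
  have c: "m x y \<bullet> m x y' = (x \<bullet> x) * (y \<bullet> y')" "m x y \<bullet> m x' y = (x \<bullet> x') * (y \<bullet> y)" for x x' y y'
    using m by (auto simp: composition_product_def)
  have o: "P \<bullet> P = 1" "F \<bullet> F = 1" "G \<bullet> G = 1" "S \<bullet> S = 1" "P \<bullet> F = 0" "P \<bullet> G = 0" "F \<bullet> S = 0" "G \<bullet> S = 0"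
    using a b unfolding P_def F_def G_def S_def c by (simp_all add: norm_eq_1)
  have "P \<bullet> S + G \<bullet> F = 0"
    using composition_product_polarized[OF m, of a0 b0 a1 b1] a b by (simp add: P_def F_def G_def S_def)
  then have GF: "F \<bullet> G = - (P \<bullet> S)" by (simp add: inner_commute[of G F])
  have os: "F \<bullet> P = 0" "G \<bullet> P = 0" "S \<bullet> F = 0" "S \<bullet> G = 0" "G \<bullet> F = - (P \<bullet> S)" "S \<bullet> P = P \<bullet> S"
    using o GF by (simp_all add: inner_commute)
  let ?B = "\<lambda>x y. diag_apply d x \<bullet> y"
  have Bc: "?B x y = ?B y x" for x y by (rule diag_apply_symmetric)
  have Bl: "?B (x + y) z = ?B x z + ?B y z" "?B (x - y) z = ?B x z - ?B y z" "?B z (x + y) = ?B z x + ?B z y"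
    "?B z (x - y) = ?B z x - ?B z y" "?B (e *\<^sub>R x) z = e * ?B x z" "?B z (e *\<^sub>R x) = e * ?B z x" for x y z e
    by (simp_all add: inner_vec_def sum_4 algebra_simps)
  have q: "?B ((p*q) *\<^sub>R P + (s*q) *\<^sub>R F + (p*t) *\<^sub>R G + (s*t) *\<^sub>R S) ((p*q) *\<^sub>R P + (s*q) *\<^sub>R F + (p*t) *\<^sub>R G + (s*t) *\<^sub>R S) = 0"
    if "p\<^sup>2 + s\<^sup>2 = 1" "q\<^sup>2 + t\<^sup>2 = 1" for p s q t
    using z[OF that] unfolding prod diag_form_inner .
  have B1: "?B P P = 0" "?B F F = 0" "?B G G = 0" "?B S S = 0"
    using q[of 1 0 1 0] q[of 0 1 1 0] q[of 1 0 0 1] q[of 0 1 0 1] by simp_all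
  have e: "(3/5::real)\<^sup>2 + (4/5)\<^sup>2 = 1" by (simp add: power2_eq_square)
  have B2: "?B P F = 0" "?B P G = 0" "?B F S = 0" "?B G S = 0"
    using q[of "3/5" "4/5" 1 0] q[of 1 0 "3/5" "4/5"] q[of 0 1 "3/5" "4/5"] q[of "3/5" "4/5" 0 1] B1 e
    by (simp_all add: Bl Bc[of F P] Bc[of G P] Bc[of S F] Bc[of S G])
  have B3: "?B F G = - ?B P S"
    using q[OF e e] B1 B2 by (simp add: Bl Bc[of F P] Bc[of G P] Bc[of S F] Bc[of S G] Bc[of G F] Bc[of S P])
  have Bs: "?B F P = 0" "?B G P = 0" "?B S F = 0" "?B S G = 0" "?B G F = - ?B P S" "?B S P = ?B P S"
    using B2 B3 by (simp_all add: Bc[of F P] Bc[of G P] Bc[of S F] Bc[of S G] Bc[of G F] Bc[of S P])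
  \<comment> \<open>In the notation above, \<open>x'\<close> is \<open>y\<close> and \<open>w'\<close> is \<open>z\<close>.\<close>
  define x x' w w' where "x = P + S" and "x' = F - G" and "w = P - S" and "w' = F + G"
  note xw = x_def x'_def w_def w'_def
  have ort: "x \<bullet> x' = 0" "x \<bullet> w = 0" "x \<bullet> w' = 0" "x' \<bullet> w = 0" "x' \<bullet> w' = 0" "w \<bullet> w' = 0"
    "w \<bullet> x = 0" "w' \<bullet> x = 0" "w \<bullet> x' = 0" "w' \<bullet> x' = 0" "w' \<bullet> w = 0" "x' \<bullet> x = 0"
    unfolding xw inner_add_left inner_add_right inner_diff_left inner_diff_right o os GF by simp_all
  have len: "x' \<bullet> x' = x \<bullet> x" "w' \<bullet> w' = w \<bullet> w"
    unfolding xw inner_add_left inner_add_right inner_diff_left inner_diff_right o os GF by simp_all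
  have Bo: "?B x x' = 0" "?B x w = 0" "?B x w' = 0" "?B x' w = 0" "?B x' w' = 0" "?B w w' = 0"
    "?B w x = 0" "?B w' x = 0" "?B w x' = 0" "?B w' x' = 0" "?B w' w = 0" "?B x' x = 0"
    unfolding xw Bl B1 B2 B3 Bs by simp_all
  have Be: "?B x' x' = ?B x x" "?B w' w' = ?B w w" unfolding xw Bl B1 B2 B3 Bs by simp_all
  show ?thesis
  proof (cases "x = 0 \<or> w = 0")
    case True
    then have "S = - P \<and> G = F \<or> S = P \<and> G = - F"
    proof
      assume "x = 0"
      then have "x' = 0" using len(1) by simp
      then show ?thesis using \<open>x = 0\<close> by (simp add: xw add_eq_0_iff2)
    next
      assume "w = 0"
      then have "w' = 0" using len(2) by simp
      then show ?thesis using \<open>w = 0\<close> by (simp add: xw add_eq_0_iff)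
    qed
    moreover have "\<exists>l. l \<noteq> 0 \<and> (\<forall>y\<in>{P, F}. y \<bullet> l = 0)"
      by (rule orthogonal_vector_exists_4) (simp_all add: card_insert_if)
    then obtain l where l: "l \<noteq> 0" "l \<bullet> P = 0" "l \<bullet> F = 0" by (auto simp: inner_commute)
    ultimately have "l \<bullet> G = 0" "l \<bullet> S = 0" by auto
    then show ?thesis using l unfolding prod by (intro exI[of _ l]) (simp add: inner_add_right)
  next
    case False
    then have nz: "x \<noteq> 0" "w \<noteq> 0" by auto
    then have nz': "x' \<noteq> 0" "w' \<noteq> 0" using len by auto
    define \<kappa>1 \<kappa>2 where "\<kappa>1 = ?B x x / (x \<bullet> x)" and "\<kappa>2 = ?B w w / (w \<bullet> w)"
    have k: "?B x x = \<kappa>1 * (x \<bullet> x)" "?B w w = \<kappa>2 * (w \<bullet> w)" using nz by (simp_all add: \<kappa>1_def \<kappa>2_def)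
    have "diag_apply d x - \<kappa>1 *\<^sub>R x = 0" "diag_apply d x' - \<kappa>1 *\<^sub>R x' = 0"
      "diag_apply d w - \<kappa>2 *\<^sub>R w = 0" "diag_apply d w' - \<kappa>2 *\<^sub>R w' = 0"
      by (rule orthogonal_to_four_zero[OF nz(1) nz'(1) nz(2) nz'(2) ort(1-6)];
          simp add: inner_diff_left Bo ort Be k len)+
    then have ev: "diag_apply d x = \<kappa>1 *\<^sub>R x" "diag_apply d x' = \<kappa>1 *\<^sub>R x'" "diag_apply d w = \<kappa>2 *\<^sub>R w" "diag_apply d w' = \<kappa>2 *\<^sub>R w'"
      by simp_all
    have "x$3 = 0 \<and> x$4 = 0 \<and> x'$3 = 0 \<and> x'$4 = 0" by (rule double_eigenvector[OF d ev(1) nz(1) ev(2) nz'(1) ort(1)])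
    moreover have "w$3 = 0 \<and> w$4 = 0 \<and> w'$3 = 0 \<and> w'$4 = 0" by (rule double_eigenvector[OF d ev(3) nz(2) ev(4) nz'(2) ort(6)])
    ultimately have "w = 0" using no_third_orthogonal_in_plane[of x x' w] ort nz nz' by simp
    then show ?thesis using nz by simp
  qed
qed

text \<open>
  Both circles are great, by the previous results for the product and for the product with
  exchanged factors. The conclusion is that the products lie in a hyperplane.
\<close>

lemma circle_product_not_spanning:
  assumes m: "composition_product m" and d: "double_upper d" and A: "circle_in_S3 A" and B: "circle_in_S3 B"
    and z: "\<And>a b. a \<in> A \<Longrightarrow> b \<in> B \<Longrightarrow> diag_form d (m a b) = 0"
  shows "\<exists>l. l \<noteq> 0 \<and> (\<forall>a\<in>A. \<forall>b\<in>B. l \<bullet> m a b = 0)"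
proof -
  obtain c u w r where r: "r > 0" and o: "norm u = 1" "norm w = 1" "u \<bullet> w = 0" "c \<bullet> u = 0" "c \<bullet> w = 0"
    and cr: "c \<bullet> c + r\<^sup>2 = 1" and Beq: "B = {c + r *\<^sub>R (p *\<^sub>R u + s *\<^sub>R w) | p s. p\<^sup>2 + s\<^sup>2 = 1}"
    by (rule circle_parametrization[OF B])
  obtain c' u' w' r' where r': "r' > 0" and o': "norm u' = 1" "norm w' = 1" "u' \<bullet> w' = 0" "c' \<bullet> u' = 0" "c' \<bullet> w' = 0"
    and cr': "c' \<bullet> c' + r'\<^sup>2 = 1" and Aeq: "A = {c' + r' *\<^sub>R (p *\<^sub>R u' + s *\<^sub>R w') | p s. p\<^sup>2 + s\<^sup>2 = 1}"
    by (rule circle_parametrization[OF A])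
  have "c = 0"
    by (rule small_right_circle_centre[OF m d A r o]) (use z Beq in blast)
  moreover have "c' = 0"
    by (rule small_right_circle_centre[OF composition_product_flip[OF m] d B r' o']) (use z Aeq in blast)
  ultimately have c0: "c = 0" "c' = 0" by auto
  have "r = 1" "r' = 1" using cr cr' c0 r r' by (simp_all add: power2_eq_1_iff)
  then have eq: "A = {p *\<^sub>R u' + s *\<^sub>R w' | p s. p\<^sup>2 + s\<^sup>2 = 1}" "B = {p *\<^sub>R u + s *\<^sub>R w | p s. p\<^sup>2 + s\<^sup>2 = 1}"
    using Aeq Beq c0 by simp_all
  have "\<exists>l. l \<noteq> 0 \<and> (\<forall>p s q t. l \<bullet> m (p *\<^sub>R u' + s *\<^sub>R w') (q *\<^sub>R u + t *\<^sub>R w) = 0)"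
    by (rule great_circle_product_not_spanning[OF m d o'(1-3) o(1-3)]) (use z eq in blast)
  then show ?thesis unfolding eq by blast
qed

text \<open>
  Reversing the order of the coordinates and the sign of the form exchanges the roles of
  the two pairs of eigenvalues.
\<close>

lemma circle_product_not_spanning_lower:
  assumes m: "composition_product m" and d: "d$1 > d$2" "d$2 > 0" "0 > d$3" "d$3 = d$4" and A: "circle_in_S3 A" and B: "circle_in_S3 B"
    and z: "\<And>a b. a \<in> A \<Longrightarrow> b \<in> B \<Longrightarrow> diag_form d (m a b) = 0"
  shows "\<exists>l. l \<noteq> 0 \<and> (\<forall>a\<in>A. \<forall>b\<in>B. l \<bullet> m a b = 0)"
proof -
  define J :: "real ^ 4 \<Rightarrow> real ^ 4" where "J = (\<lambda>x. vector [x$4, x$3, x$2, x$1])"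
  define d' :: "real ^ 4" where "d' = vector [- d$4, - d$3, - d$2, - d$1]"
  have J: "orthogonal_transformation J"
    unfolding orthogonal_transformation_def
  proof (intro conjI allI linearI)
    show "J (x + y) = J x + J y" "J (e *\<^sub>R x) = e *\<^sub>R J x" "J x \<bullet> J y = x \<bullet> y" for x y e
      by (simp_all add: J_def vector_eq_4 inner_vec_def sum_4)
  qed
  have JJ: "J x \<bullet> y = x \<bullet> J y" for x y by (simp add: J_def inner_vec_def sum_4)
  have f: "diag_form d' (J x) = - diag_form d x" for x by (simp add: J_def d'_def diag_form_def)
  have "double_upper d'" using d by (simp add: double_upper_def d'_def)
  then have "\<exists>l. l \<noteq> 0 \<and> (\<forall>a\<in>A. \<forall>b\<in>B. l \<bullet> J (m a b) = 0)"
    by (rule circle_product_not_spanning[OF composition_product_orthogonal[OF m J] _ A B]) (simp add: f z)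
  then obtain l where l: "l \<noteq> 0" "\<forall>a\<in>A. \<forall>b\<in>B. l \<bullet> J (m a b) = 0" by blast
  have "J l \<noteq> 0" using l(1) J by (metis orthogonal_transformation_norm norm_eq_zero)
  then show ?thesis using l(2) JJ by metis
qed

section \<open>Perseus cyclides are not Cliffordian\<close>

lemma diag_form_zero_on_circle:
  assumes S: "infinite S" "S \<subseteq> {0..2*pi}"
    and z: "\<And>t. t \<in> S \<Longrightarrow> diag_form d (c + r *\<^sub>R (cos t *\<^sub>R u + sin t *\<^sub>R w)) = 0" and ps: "p\<^sup>2 + s\<^sup>2 = 1"
  shows "diag_form d (c + r *\<^sub>R (p *\<^sub>R u + s *\<^sub>R w)) = 0"
proof -
  define k :: "nat \<Rightarrow> real" where "k = (\<lambda>_. 0)(0 := diag_form d c, 1 := 2 * r * (diag_apply d c \<bullet> u),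
     2 := 2 * r * (diag_apply d c \<bullet> w), 3 := r\<^sup>2 * diag_form d u, 4 := 2 * r\<^sup>2 * (diag_apply d u \<bullet> w), 5 := r\<^sup>2 * diag_form d w)"
  have k: "k 0 = diag_form d c" "k 1 = 2 * r * (diag_apply d c \<bullet> u)" "k 2 = 2 * r * (diag_apply d c \<bullet> w)"
    "k 3 = r\<^sup>2 * diag_form d u" "k 4 = 2 * r\<^sup>2 * (diag_apply d u \<bullet> w)" "k 5 = r\<^sup>2 * diag_form d w"
    by (simp_all add: k_def)
  have e: "diag_form d (c + r *\<^sub>R (p *\<^sub>R u + s *\<^sub>R w)) = k 0 + k 1 * p + k 2 * s + k 3 * p\<^sup>2 + k 4 * p * s + k 5 * s\<^sup>2" for p s
    unfolding k using diag_form_combination[of d 1 c "r * p" u "r * s" w]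
    by (simp add: scaleR_add_right power2_eq_square algebra_simps)
  show ?thesis unfolding e by (rule trig_quadratic_zero[OF S _ ps]) (use z e in simp)
qed

lemma norm_quat_mult: "norm (a \<star> b) = norm a * norm b"
proof -
  have "(a \<star> b) \<bullet> (a \<star> b) = (a \<bullet> a) * (b \<bullet> b)"
    using composition_product_quat_mult by (simp add: composition_product_def)
  then show ?thesis by (simp add: norm_eq_sqrt_inner real_sqrt_mult)
qed

text \<open>
  Multiplication by \<open>a\<close> is injective, and on the half circle \<open>0 \<le> t \<le> pi\<close> so is the
  parametrization.
\<close>

lemma infinite_parameters_off_pole:
  assumes a: "norm a = 1" and r: "r > 0" and o: "norm u = 1" "u \<bullet> w = 0"
  shows "infinite {t\<in>{0..2*pi}. a \<star> (c + r *\<^sub>R (cos t *\<^sub>R u + sin t *\<^sub>R w)) \<noteq> N}"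
proof -
  let ?b = "\<lambda>t. c + r *\<^sub>R (cos t *\<^sub>R u + sin t *\<^sub>R w)"
  let ?F = "{t\<in>{0..pi}. a \<star> ?b t = N}"
  have inj: "t = t'" if "t \<in> ?F" "t' \<in> ?F" for t t'
  proof -
    have bl: "bilinear (\<star>)" using composition_product_quat_mult by (simp add: composition_product_def)
    have "a \<star> (?b t - ?b t') = a \<star> ?b t - a \<star> ?b t'" by (rule bilinear_rsub[OF bl])
    also have "\<dots> = 0" using that by simp
    finally have "a \<star> (?b t - ?b t') = 0" .
    then have "?b t - ?b t' = 0" using norm_quat_mult[of a "?b t - ?b t'"] a by simp
    then have "r *\<^sub>R (cos t *\<^sub>R u + sin t *\<^sub>R w) = r *\<^sub>R (cos t' *\<^sub>R u + sin t' *\<^sub>R w)" by simp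
    then have "cos t *\<^sub>R u + sin t *\<^sub>R w = cos t' *\<^sub>R u + sin t' *\<^sub>R w" using r by (metis scaleR_left_imp_eq less_irrefl)
    then have "u \<bullet> (cos t *\<^sub>R u + sin t *\<^sub>R w) = u \<bullet> (cos t' *\<^sub>R u + sin t' *\<^sub>R w)" by simp
    then have "cos t = cos t'" using o unfolding norm_eq_1 inner_add_right inner_scaleR_right by simp
    then show ?thesis using that cos_inj_pi by auto
  qed
  have "finite ?F"
  proof (cases "?F = {}")
    case False
    then obtain t0 where "t0 \<in> ?F" by blast
    then have "?F \<subseteq> {t0}" using inj by blast
    then show ?thesis using finite_subset by blast
  next
    case True
    show ?thesis unfolding True by simp
  qed
  moreover have "infinite {0..pi}" by (simp add: infinite_Icc)
  ultimately have "infinite ({0..pi} - ?F)" by (rule Diff_infinite_finite)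
  moreover have "{0..pi} - ?F \<subseteq> {t\<in>{0..2*pi}. a \<star> ?b t \<noteq> N}" by auto
  ultimately show ?thesis using finite_subset by blast
qed

context great_cyclide
begin

text \<open>
  A linear equation for the products is polynomial after stereographic projection and
  extends to the Zariski closure.
\<close>

lemma product_surface_in_hyperplane:
  assumes Z: "Z = zariski_closure (stereo_image (A \<star>\<star> B))" and A: "A \<subseteq> S3" and B: "B \<subseteq> S3"
    and w: "w \<noteq> 0" "\<And>a b. a \<in> A \<Longrightarrow> b \<in> B \<Longrightarrow> w \<bullet> (a \<star> b) = 0"
  shows False
proof -
  have "zariski_closed {x. w \<bullet> stereo_lift x = 0}"
    unfolding zariski_closed_def
  proof (intro exI[of _ "{\<lambda>x. w \<bullet> stereo_lift x}"] conjI ballI)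
    fix f assume "f \<in> {\<lambda>x. w \<bullet> stereo_lift x}"
    then have "f = (\<lambda>x. \<Sum>i\<in>UNIV. w $ i * stereo_lift x $ i)" by (simp add: inner_vec_def)
    then show "polynomial_fn f"
      by (simp only:) (intro polynomial_fn_sum polynomial_fn_mult polynomial_fn_const stereo_lift_polynomial_fn)
  qed simp
  moreover have "stereo_image (A \<star>\<star> B) \<subseteq> {x. w \<bullet> stereo_lift x = 0}"
  proof
    fix x assume "x \<in> stereo_image (A \<star>\<star> B)"
    then obtain a b where ab: "a \<in> A" "b \<in> B" "a \<star> b \<noteq> north_pole" "x = stereo (a \<star> b)"
      unfolding stereo_image_def quat_set_mult_def by blast
    have "norm (a \<star> b) = 1" using ab(1,2) A B by (auto simp: norm_quat_mult subset_iff)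
    then show "x \<in> {x. w \<bullet> stereo_lift x = 0}" using ab w(2) by (simp add: stereo_lift_stereo)
  qed
  ultimately have Zw: "Z \<subseteq> {x. w \<bullet> stereo_lift x = 0}" unfolding Z by (rule hull_minimal[rotated])
  show False
  proof (rule preimage_not_in_hyperplane[OF degree w(1)])
    fix y assume "y \<in> stereo_preimage Z"
    then have y: "norm y = 1" "y \<noteq> north_pole" "stereo y \<in> Z" by (auto simp: stereo_preimage_def)
    then have "w \<bullet> stereo_lift (stereo y) = 0" using Zw by blast
    then show "w \<bullet> y = 0" using y north_pole_iff[OF y(1)] by (simp add: stereo_lift_stereo)
  qed
qed

text \<open>
  A product \<open>a \<star> b\<close> different from the pole satisfies the equation of the surface, and by
  the identity theorem so does every product. By the results on products of circles all
  products then lie in a hyperplane.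
\<close>

lemma not_cliffordian:
  assumes T: "orthogonal_transformation T" and R: "real_points (X_of Z) = T ` quadric_section d"
    and d: "principal_signs d" "d$1 = d$2 \<and> d$3 > d$4 \<or> d$1 > d$2 \<and> d$3 = d$4"
  shows "\<not> cliffordian Z"
proof
  assume "cliffordian Z"
  then obtain A B where A: "circle_in_S3 A" and B: "circle_in_S3 B" and Z: "Z = zariski_closure (stereo_image (A \<star>\<star> B))"
    unfolding cliffordian_def by blast
  have AS: "A \<subseteq> S3" "B \<subseteq> S3" using A B by (auto simp: circle_in_S3_def)
  define T' where "T' = inv T"
  have bT: "bij T" by (rule orthogonal_transformation_bij[OF T])
  have T': "orthogonal_transformation T'" unfolding T'_def by (rule orthogonal_transformation_inv[OF T])
  have TT': "T (T' x) = x" and T'T: "T' (T x) = x" for x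
    using bT by (simp_all add: T'_def bij_is_inj bij_is_surj surj_f_inv_f inv_f_f)
  define m where "m = (\<lambda>a b. T' (a \<star> b))"
  have m: "composition_product m"
    unfolding m_def by (rule composition_product_orthogonal[OF composition_product_quat_mult T'])
  have bl: "bilinear m" using m by (simp add: composition_product_def)
  have off: "diag_form d (m a b) = 0" if "a \<in> A" "b \<in> B" "a \<star> b \<noteq> north_pole" for a b
  proof -
    have "norm (a \<star> b) = 1" using that(1,2) AS by (auto simp: norm_quat_mult subset_iff)
    moreover have "stereo (a \<star> b) \<in> Z"
      using that hull_subset[of "stereo_image (A \<star>\<star> B)" zariski_closed]
      unfolding Z stereo_image_def quat_set_mult_def by blast
    ultimately have "a \<star> b \<in> stereo_preimage Z" using that(3) by (simp add: stereo_preimage_def)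
    then have "a \<star> b \<in> T ` quadric_section d" using real_points_minus_pole R by blast
    then show ?thesis unfolding m_def by (auto simp: T'T quadric_section_def)
  qed
  obtain c u w r where r: "r > 0" and o: "norm u = 1" "norm w = 1" "u \<bullet> w = 0" "c \<bullet> u = 0" "c \<bullet> w = 0"
    and cr: "c \<bullet> c + r\<^sup>2 = 1" and Beq: "B = {c + r *\<^sub>R (p *\<^sub>R u + s *\<^sub>R w) | p s. p\<^sup>2 + s\<^sup>2 = 1}"
    by (rule circle_parametrization[OF B])
  have z: "diag_form d (m a b) = 0" if a: "a \<in> A" and b: "b \<in> B" for a b
  proof -
    obtain p s where ps: "b = c + r *\<^sub>R (p *\<^sub>R u + s *\<^sub>R w)" "p\<^sup>2 + s\<^sup>2 = 1" using b unfolding Beq by blast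
    let ?S = "{t\<in>{0..2*pi}. a \<star> (c + r *\<^sub>R (cos t *\<^sub>R u + sin t *\<^sub>R w)) \<noteq> north_pole}"
    have "norm a = 1" using a AS by auto
    then have inf: "infinite ?S" by (rule infinite_parameters_off_pole[OF _ r o(1,3)])
    have e: "m a (c + r *\<^sub>R (p *\<^sub>R u + s *\<^sub>R w)) = m a c + r *\<^sub>R (p *\<^sub>R m a u + s *\<^sub>R m a w)" for p s
      by (simp add: bilinear_radd[OF bl] bilinear_rmul[OF bl])
    have "diag_form d (m a c + r *\<^sub>R (p *\<^sub>R m a u + s *\<^sub>R m a w)) = 0"
    proof (rule diag_form_zero_on_circle[OF inf _ _ ps(2)])
      fix t assume t: "t \<in> ?S"
      have "c + r *\<^sub>R (cos t *\<^sub>R u + sin t *\<^sub>R w) \<in> B" unfolding Beq using sin_cos_squared_add2[of t] by blast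
      then have "diag_form d (m a (c + r *\<^sub>R (cos t *\<^sub>R u + sin t *\<^sub>R w))) = 0" using off[OF a] t by blast
      then show "diag_form d (m a c + r *\<^sub>R (cos t *\<^sub>R m a u + sin t *\<^sub>R m a w)) = 0" unfolding e .
    qed auto
    then show ?thesis unfolding ps(1) e .
  qed
  have "\<exists>l. l \<noteq> 0 \<and> (\<forall>a\<in>A. \<forall>b\<in>B. l \<bullet> m a b = 0)"
    using d(2)
  proof
    assume "d$1 = d$2 \<and> d$3 > d$4"
    then have "double_upper d" using d(1) by (auto simp: double_upper_def principal_signs_def)
    then show ?thesis by (rule circle_product_not_spanning[OF m _ A B z])
  next
    assume "d$1 > d$2 \<and> d$3 = d$4"
    then show ?thesis using d(1) unfolding principal_signs_def
      by (intro circle_product_not_spanning_lower[OF m _ _ _ _ A B z]) auto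
  qed
  then obtain l where l: "l \<noteq> 0" "\<forall>a\<in>A. \<forall>b\<in>B. l \<bullet> m a b = 0" by blast
  have "T l \<bullet> (a \<star> b) = l \<bullet> m a b" for a b
    using T TT' unfolding orthogonal_transformation_def m_def by metis
  moreover have "T l \<noteq> 0" using l(1) T by (metis orthogonal_transformation_norm norm_eq_zero)
  ultimately show False using product_surface_in_hyperplane[OF Z AS, of "T l"] l(2) by auto
qed

end

section \<open>Clifford tori\<close>

definition quat_conj :: "real ^ 4 \<Rightarrow> real ^ 4" where
  "quat_conj a = vector [a$1, - a$2, - a$3, - a$4]"

definition quat_one :: "real ^ 4" where
  "quat_one = vector [1, 0, 0, 0]"

lemma quat_mult_assoc: "a \<star> b \<star> c = a \<star> (b \<star> c)"
  by (simp add: quat_mult_def vector_eq_4 algebra_simps)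

lemma quat_one_mult: "quat_one \<star> a = a" "a \<star> quat_one = a"
  by (simp_all add: quat_mult_def quat_one_def vector_eq_4)

lemma quat_conj_mult: "quat_conj a \<star> a = (a \<bullet> a) *\<^sub>R quat_one" "a \<star> quat_conj a = (a \<bullet> a) *\<^sub>R quat_one"
  by (simp_all add: quat_mult_def quat_one_def quat_conj_def vector_eq_4 inner_vec_def sum_4 algebra_simps)

text \<open>
  For mutually orthogonal \<open>a, b, c\<close> the right-hand side is zero, so that left
  multiplication of \<open>c\<close> by \<open>a \<star> conj b\<close> and right multiplication by \<open>conj b \<star> a\<close> are
  opposite.
\<close>

lemma quat_triple_symmetrized:
  "a \<star> quat_conj b \<star> c + c \<star> quat_conj b \<star> a = (2 * (a \<bullet> b)) *\<^sub>R c + (2 * (b \<bullet> c)) *\<^sub>R a - (2 * (a \<bullet> c)) *\<^sub>R b"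
  by (simp add: quat_mult_def quat_conj_def vector_eq_4 inner_vec_def sum_4 algebra_simps)

lemma quat_bilinear: "bilinear (\<star>)"
  using composition_product_quat_mult by (simp add: composition_product_def)

lemma quat_inner: "(a \<star> b) \<bullet> (a \<star> b') = (a \<bullet> a) * (b \<bullet> b')" "(a \<star> b) \<bullet> (a' \<star> b) = (a \<bullet> a') * (b \<bullet> b)"
  using composition_product_quat_mult by (simp_all add: composition_product_def)

lemma great_circle_orthonormal_pair:
  assumes o: "norm u = 1" "norm w = 1" "u \<bullet> w = 0"
  shows "great_circle {p *\<^sub>R u + s *\<^sub>R w | p s. p\<^sup>2 + s\<^sup>2 = 1}"
  unfolding great_circle_def
proof (intro exI conjI)
  show "subspace (span {u, w})" by simp
  have "u \<noteq> w" using o by (auto simp: norm_eq_1)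
  have "pairwise orthogonal {u, w}" using o(3) by (auto simp: pairwise_def orthogonal_def inner_commute)
  moreover have "0 \<notin> {u, w}" using o by auto
  ultimately have "independent {u, w}" by (rule pairwise_orthogonal_independent)
  then show "dim (span {u, w}) = 2" using \<open>u \<noteq> w\<close> by (simp add: dim_eq_card_independent)
  have n: "norm (p *\<^sub>R u + s *\<^sub>R w) = 1 \<longleftrightarrow> p\<^sup>2 + s\<^sup>2 = 1" for p s
    using norm_combination_orthonormal[OF o, of p s] by (metis norm_ge_zero one_power2 power2_eq_imp_eq zero_le_one)
  have "p *\<^sub>R u + s *\<^sub>R w \<in> span {u, w}" for p s by (simp add: span_add span_base span_scale)
  then show "{p *\<^sub>R u + s *\<^sub>R w | p s. p\<^sup>2 + s\<^sup>2 = 1} = span {u, w} \<inter> S3"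
    using span_pair[of _ u w] n by fastforce
qed

lemma circle_angle:
  assumes "(x::real)\<^sup>2 + y\<^sup>2 = \<rho>" "\<rho> > 0"
  obtains t where "x = sqrt \<rho> * cos t" "y = sqrt \<rho> * sin t"
proof -
  have "(x / sqrt \<rho>)\<^sup>2 + (y / sqrt \<rho>)\<^sup>2 = 1"
    using assms by (simp add: power_divide add_divide_distrib[symmetric])
  then obtain t where "x / sqrt \<rho> = cos t" "y / sqrt \<rho> = sin t" using sincos_total_2pi by metis
  then show ?thesis using that[of t] assms(2) by (simp add: field_simps)
qed

text \<open>
  Left multiplication by \<open>u = e\<^sub>2 \<star> conj e\<^sub>1\<close> and right multiplication by \<open>v = conj e\<^sub>1 \<star>
  e\<^sub>2\<close> are quarter turns that agree on the plane of \<open>e\<^sub>1, e\<^sub>2\<close> and are opposite on the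
  plane of \<open>e\<^sub>3, e\<^sub>4\<close>. So the unit circles in the spans of \<open>1, u\<close> and of \<open>1, v\<close> act on a
  point \<open>P0\<close> of the torus by independent rotations of the two planes, and the orbit of
  \<open>P0\<close> is the torus.
\<close>

lemma clifford_torus_product:
  assumes T: "orthogonal_transformation T" and d: "principal_signs d" "d$1 = d$2" "d$3 = d$4"
  shows "\<exists>A B. great_circle A \<and> great_circle B \<and> A \<star>\<star> B = T ` quadric_section d"
proof -
  note bl = bilinear_ladd[OF quat_bilinear] bilinear_radd[OF quat_bilinear] bilinear_lmul[OF quat_bilinear]
    bilinear_rmul[OF quat_bilinear] bilinear_lneg[OF quat_bilinear] bilinear_rneg[OF quat_bilinear]
  define e where "e = (\<lambda>i. T (axis i 1))"
  have ee: "e i \<bullet> e j = (if i = j then 1 else 0)" for i j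
    using T unfolding e_def orthogonal_transformation_def by (simp add: inner_axis_axis)
  have e1: "norm (e i) = 1" for i by (simp add: norm_eq_1 ee)
  have Tx: "T x = x$1 *\<^sub>R e 1 + x$2 *\<^sub>R e 2 + x$3 *\<^sub>R e 3 + x$4 *\<^sub>R e 4" for x
  proof -
    have "x = x$1 *\<^sub>R axis 1 1 + x$2 *\<^sub>R axis 2 1 + x$3 *\<^sub>R axis 3 1 + x$4 *\<^sub>R axis 4 1"
      by (simp add: vector_eq_4 axis_def)
    then have "T x = T (x$1 *\<^sub>R axis 1 1 + x$2 *\<^sub>R axis 2 1 + x$3 *\<^sub>R axis 3 1 + x$4 *\<^sub>R axis 4 1)" by simp
    then show ?thesis using orthogonal_transformation_linear[OF T] by (simp add: linear_add linear_scale e_def)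
  qed
  define u v where "u = e 2 \<star> quat_conj (e 1)" and "v = quat_conj (e 1) \<star> e 2"
  have ue1: "u \<star> e 1 = e 2" by (simp add: u_def quat_mult_assoc quat_conj_mult ee bl quat_one_mult)
  have e1v: "e 1 \<star> v = e 2" by (simp add: v_def quat_mult_assoc[symmetric] quat_conj_mult ee bl quat_one_mult)
  have u1: "u \<bullet> u = 1" using quat_inner(2)[of u "e 1" u] by (simp add: ue1 ee)
  have v1: "v \<bullet> v = 1" using quat_inner(1)[of "e 1" v v] by (simp add: e1v ee)
  have uo: "quat_one \<bullet> u = 0" using quat_inner(2)[of quat_one "e 1" u] by (simp add: ue1 ee quat_one_mult)
  have vo: "quat_one \<bullet> v = 0" using quat_inner(1)[of "e 1" quat_one v] by (simp add: e1v ee quat_one_mult)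
  have sq: "x \<star> x = - quat_one" if "x \<bullet> x = 1" "quat_one \<bullet> x = 0" for x
  proof -
    have "quat_conj x = - x" using that(2) by (simp add: quat_one_def quat_conj_def inner_vec_def sum_4 vector_eq_4)
    then show ?thesis using quat_conj_mult(2)[of x] that(1) by (simp add: bl) (metis minus_minus)
  qed
  have uu: "u \<star> (u \<star> x) = - x" for x by (simp add: quat_mult_assoc[symmetric] sq[OF u1 uo] bl quat_one_mult)
  have ue2: "u \<star> e 2 = - e 1" using uu[of "e 1"] ue1 by simp
  \<comment> \<open>The two quarter turns are opposite on the second plane.\<close>
  have ve: "e 3 \<star> v = - (u \<star> e 3)"
    using quat_triple_symmetrized[of "e 2" "e 1" "e 3"] by (simp add: u_def v_def quat_mult_assoc ee eq_neg_iff_add_eq_0 add.commute)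
  have o3: "(u \<star> e 3) \<bullet> e 1 = 0" "(u \<star> e 3) \<bullet> e 2 = 0" "(u \<star> e 3) \<bullet> e 3 = 0" "(u \<star> e 3) \<bullet> (u \<star> e 3) = 1"
    using quat_inner(1)[of u "e 3" "e 2"] quat_inner(1)[of u "e 3" "e 1"] quat_inner(2)[of u "e 3" quat_one] quat_inner(1)[of u "e 3" "e 3"]
    by (simp_all add: ue1 ue2 ee u1 uo quat_one_mult inner_commute[of u quat_one])
  define \<epsilon> where "\<epsilon> = (u \<star> e 3) \<bullet> e 4"
  have "u \<star> e 3 = ((u \<star> e 3) \<bullet> e 1) *\<^sub>R e 1 + ((u \<star> e 3) \<bullet> e 2) *\<^sub>R e 2 + ((u \<star> e 3) \<bullet> e 3) *\<^sub>R e 3 + ((u \<star> e 3) \<bullet> e 4) *\<^sub>R e 4"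
    using orthonormal_complete[of "e 1" "e 2" "e 3" "e 4" "u \<star> e 3"] by (simp add: e1 ee)
  then have ue3: "u \<star> e 3 = \<epsilon> *\<^sub>R e 4" by (simp add: o3 \<epsilon>_def)
  have eps: "\<epsilon> * \<epsilon> = 1" using o3(4) by (simp add: ue3 ee)
  have e4: "e 4 = \<epsilon> *\<^sub>R (u \<star> e 3)" by (simp add: ue3 eps)
  have ue4: "u \<star> e 4 = - (\<epsilon> *\<^sub>R e 3)" by (simp add: e4 bl uu)
  \<comment> \<open>The torus is \<open>x\<^sub>1\<^sup>2 + x\<^sub>2\<^sup>2 = \<kappa>\<close>, \<open>x\<^sub>3\<^sup>2 + x\<^sub>4\<^sup>2 = 1 - \<kappa>\<close>.\<close>
  define \<kappa> where "\<kappa> = - d$3 / (d$1 - d$3)"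
  have D: "d$1 > 0" "d$3 < 0" using d by (auto simp: principal_signs_def)
  have k: "\<kappa> > 0" "1 - \<kappa> > 0" "1 - \<kappa> = d$1 / (d$1 - d$3)" using D by (simp_all add: \<kappa>_def field_simps)
  have kd: "\<kappa> * (d$1 - d$3) = - d$3" using D by (simp add: \<kappa>_def)
  have sec: "x \<in> quadric_section d \<longleftrightarrow> (x$1)\<^sup>2 + (x$2)\<^sup>2 = \<kappa> \<and> (x$3)\<^sup>2 + (x$4)\<^sup>2 = 1 - \<kappa>" for x
  proof -
    let ?a = "(x$1)\<^sup>2 + (x$2)\<^sup>2" and ?b = "(x$3)\<^sup>2 + (x$4)\<^sup>2"
    have "x \<in> quadric_section d \<longleftrightarrow> ?a + ?b = 1 \<and> d$1 * ?a + d$3 * ?b = 0"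
      using d(2,3) by (simp add: quadric_section_def diag_form_def norm_eq_1 inner_vec_def sum_4 power2_eq_square algebra_simps)
    also have "\<dots> \<longleftrightarrow> ?a = \<kappa> \<and> ?b = 1 - \<kappa>"
    proof (intro iffI)
      assume h: "?a + ?b = 1 \<and> d$1 * ?a + d$3 * ?b = 0"
      then have "?b = 1 - ?a" by linarith
      then have "d$1 * ?a + d$3 * (1 - ?a) = 0" using h by metis
      then have "(?a - \<kappa>) * (d$1 - d$3) = 0" unfolding left_diff_distrib kd by (simp add: algebra_simps)
      then have "?a = \<kappa>" using D by auto
      then show "?a = \<kappa> \<and> ?b = 1 - \<kappa>" using \<open>?b = 1 - ?a\<close> by blast
    next
      assume h: "?a = \<kappa> \<and> ?b = 1 - \<kappa>"
      have "d$1 * \<kappa> + d$3 * (1 - \<kappa>) = 0" using kd by (simp add: algebra_simps)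
      then show "?a + ?b = 1 \<and> d$1 * ?a + d$3 * ?b = 0" unfolding conjunct1[OF h] conjunct2[OF h] by simp
    qed
    finally show ?thesis .
  qed
  define a b where "a = sqrt \<kappa>" and "b = sqrt (1 - \<kappa>)"
  have ab: "a\<^sup>2 = \<kappa>" "b\<^sup>2 = 1 - \<kappa>" using k by (simp_all add: a_def b_def)
  define P0 where "P0 = a *\<^sub>R e 1 + b *\<^sub>R e 3"
  have P0: "P0 \<bullet> P0 = 1"
    using ab by (simp add: P0_def inner_add_left inner_add_right ee power2_eq_square)
  have P0v: "P0 \<star> v = a *\<^sub>R e 2 - (b * \<epsilon>) *\<^sub>R e 4" by (simp add: P0_def bl e1v ve ue3)
  have prod: "(p *\<^sub>R quat_one + s *\<^sub>R u) \<star> (q *\<^sub>R P0 + t *\<^sub>R (P0 \<star> v)) =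
      (a * (p*q - s*t)) *\<^sub>R e 1 + (a * (p*t + s*q)) *\<^sub>R e 2 + (b * (p*q + s*t)) *\<^sub>R e 3 + (\<epsilon> * (b * (s*q - p*t))) *\<^sub>R e 4" for p s q t
  proof -
    have uP: "u \<star> P0 = a *\<^sub>R e 2 + (b * \<epsilon>) *\<^sub>R e 4" by (simp add: P0_def bl ue1 ue3)
    have uPv: "u \<star> (a *\<^sub>R e 2 - (b * \<epsilon>) *\<^sub>R e 4) = - (a *\<^sub>R e 1) + b *\<^sub>R e 3"
      by (simp add: bl bilinear_rsub[OF quat_bilinear] ue2 ue4 eps mult.assoc)
    have "(p *\<^sub>R quat_one + s *\<^sub>R u) \<star> (q *\<^sub>R P0 + t *\<^sub>R (P0 \<star> v)) =
        p *\<^sub>R (q *\<^sub>R P0 + t *\<^sub>R (P0 \<star> v)) + s *\<^sub>R (q *\<^sub>R (u \<star> P0) + t *\<^sub>R (u \<star> (P0 \<star> v)))"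
      by (simp add: bl quat_one_mult algebra_simps)
    then show ?thesis unfolding P0v uP uPv unfolding P0_def by (simp add: algebra_simps)
  qed
  let ?A = "{p *\<^sub>R quat_one + s *\<^sub>R u | p s. p\<^sup>2 + s\<^sup>2 = 1}"
  let ?B = "{q *\<^sub>R P0 + t *\<^sub>R (P0 \<star> v) | q t. q\<^sup>2 + t\<^sup>2 = 1}"
  have "great_circle ?A"
    by (rule great_circle_orthonormal_pair) (simp_all add: norm_eq_1 u1 uo, simp add: quat_one_def inner_vec_def sum_4)
  moreover have "great_circle ?B"
  proof (rule great_circle_orthonormal_pair)
    show "norm P0 = 1" "norm (P0 \<star> v) = 1" unfolding norm_eq_sqrt_inner quat_inner P0 v1 by simp_all
    have "(P0 \<star> quat_one) \<bullet> (P0 \<star> v) = 0" unfolding quat_inner vo by simp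
    then show "P0 \<bullet> (P0 \<star> v) = 0" by (simp add: quat_one_mult)
  qed
  moreover have "?A \<star>\<star> ?B = T ` quadric_section d"
  proof
    show "?A \<star>\<star> ?B \<subseteq> T ` quadric_section d"
    proof
      fix y assume "y \<in> ?A \<star>\<star> ?B"
      then obtain p s q t where y: "y = (p *\<^sub>R quat_one + s *\<^sub>R u) \<star> (q *\<^sub>R P0 + t *\<^sub>R (P0 \<star> v))"
        and c: "p\<^sup>2 + s\<^sup>2 = 1" "q\<^sup>2 + t\<^sup>2 = 1" unfolding quat_set_mult_def by blast
      define x :: "real ^ 4" where "x = vector [a * (p*q - s*t), a * (p*t + s*q), b * (p*q + s*t), \<epsilon> * (b * (s*q - p*t))]"
      have "y = T x" unfolding y prod Tx x_def by simp
      have "(p*q - s*t)\<^sup>2 + (p*t + s*q)\<^sup>2 = (p\<^sup>2 + s\<^sup>2) * (q\<^sup>2 + t\<^sup>2)"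
        "(p*q + s*t)\<^sup>2 + (s*q - p*t)\<^sup>2 = (p\<^sup>2 + s\<^sup>2) * (q\<^sup>2 + t\<^sup>2)" by (simp_all add: power2_eq_square algebra_simps)
      then have "a\<^sup>2 * ((p*q - s*t)\<^sup>2 + (p*t + s*q)\<^sup>2) = \<kappa>" "b\<^sup>2 * ((p*q + s*t)\<^sup>2 + (s*q - p*t)\<^sup>2) = 1 - \<kappa>"
        using c ab by simp_all
      then have "(a * (p*q - s*t))\<^sup>2 + (a * (p*t + s*q))\<^sup>2 = \<kappa>"
        "(b * (p*q + s*t))\<^sup>2 + (b * (s*q - p*t))\<^sup>2 = 1 - \<kappa>" by (simp_all only: power_mult_distrib distrib_left[of "a\<^sup>2"] distrib_left[of "b\<^sup>2"])
      moreover have "(\<epsilon> * (b * (s*q - p*t)))\<^sup>2 = (b * (s*q - p*t))\<^sup>2"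
        using eps by (simp add: power_mult_distrib power2_eq_square)
      ultimately have "x \<in> quadric_section d"
        unfolding sec x_def vector_4 by (simp only: simp_thms)
      then show "y \<in> T ` quadric_section d" using \<open>y = T x\<close> by blast
    qed
    show "T ` quadric_section d \<subseteq> ?A \<star>\<star> ?B"
    proof
      fix y assume "y \<in> T ` quadric_section d"
      then obtain x where x: "y = T x" "(x$1)\<^sup>2 + (x$2)\<^sup>2 = \<kappa>" "(x$3)\<^sup>2 + (x$4)\<^sup>2 = 1 - \<kappa>" using sec by blast
      obtain \<beta> where be: "x$1 = a * cos \<beta>" "x$2 = a * sin \<beta>" using circle_angle[OF x(2) k(1)] unfolding a_def by metis
      have "(x$3)\<^sup>2 + (\<epsilon> * x$4)\<^sup>2 = 1 - \<kappa>" using x(3) eps unfolding power_mult_distrib by (simp add: power2_eq_square[of \<epsilon>])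
      then obtain \<gamma> where ga: "x$3 = b * cos \<gamma>" "\<epsilon> * x$4 = b * sin \<gamma>" using circle_angle k(2) unfolding b_def by metis
      have x4: "x$4 = \<epsilon> * (b * sin \<gamma>)" unfolding ga(2)[symmetric] by (simp add: mult.assoc[symmetric] eps)
      let ?t = "(\<beta> + \<gamma>) / 2" and ?f = "(\<beta> - \<gamma>) / 2"
      have ang: "\<beta> = ?t + ?f" "\<gamma> = ?t - ?f" by (simp_all add: field_simps)
      have tr: "cos \<beta> = cos ?t * cos ?f - sin ?t * sin ?f" "sin \<beta> = cos ?t * sin ?f + sin ?t * cos ?f"
        "cos \<gamma> = cos ?t * cos ?f + sin ?t * sin ?f" "sin \<gamma> = sin ?t * cos ?f - cos ?t * sin ?f"
        using cos_add[of ?t ?f] sin_add[of ?t ?f] cos_diff[of ?t ?f] sin_diff[of ?t ?f] by (simp_all add: ang[symmetric])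
      have "y = (cos ?t *\<^sub>R quat_one + sin ?t *\<^sub>R u) \<star> (cos ?f *\<^sub>R P0 + sin ?f *\<^sub>R (P0 \<star> v))"
        unfolding prod x(1) Tx be ga(1) x4 tr by simp
      moreover have "cos ?t *\<^sub>R quat_one + sin ?t *\<^sub>R u \<in> ?A" using sin_cos_squared_add2[of ?t] by blast
      moreover have "cos ?f *\<^sub>R P0 + sin ?f *\<^sub>R (P0 \<star> v) \<in> ?B" using sin_cos_squared_add2[of ?f] by blast
      ultimately show "y \<in> ?A \<star>\<star> ?B" unfolding quat_set_mult_def by blast
    qed
  qed
  ultimately show ?thesis by blast
qed

section \<open>Great ring and Perseus cyclides\<close>

lemma great_cyclideI:
  assumes "great Z" "darboux_cyclide Z" "without_real_singularities (X_of Z)"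
  shows "great_cyclide Z"
  using assms unfolding great_cyclide_def darboux_cyclide_def surface_def by blast

theorem corollary4:
  "(\<forall>Z. great Z \<and> ring_cyclide Z \<longrightarrow>
      (\<exists>A B. great_circle A \<and> great_circle B \<and> Z = stereo_image (A \<star>\<star> B))) \<and>
   (\<forall>Z. great Z \<and> perseus_cyclide Z \<longrightarrow> \<not> cliffordian Z)"
proof (intro conjI allI impI)
  fix Z assume Z: "great Z \<and> ring_cyclide Z"
  then interpret great_cyclide Z by (intro great_cyclideI) (auto simp: ring_cyclide_def)
  obtain T d where T: "orthogonal_transformation T" and d: "principal_signs d"
    and R: "real_points (X_of Z) = T ` quadric_section d"
    using real_points_principal_axes by blast
  have "(4::enat) + 1 = enat 5" "(4::enat) < \<infinity>" by (simp_all add: numeral_eq_enat one_enat_def)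
  then have not5: "\<not> circles_through_general_point (enat 5) Z"
    using Z unfolding ring_cyclide_def circled_def by metis
  then have "\<not> 5 \<le> 4 + (if d$1 > d$2 then 1 else 0) + (if d$3 > d$4 then 1 else (0::nat))"
    using circles_through_general_point_lower[OF T d R, of 5] by blast
  then have "d$1 = d$2" "d$3 = d$4" using d unfolding principal_signs_def by (auto split: if_splits)
  then obtain A B where AB: "great_circle A" "great_circle B" "A \<star>\<star> B = T ` quadric_section d"
    using clifford_torus_product[OF T d] by blast
  have "stereo_image (A \<star>\<star> B) = stereo ` stereo_preimage Z"
    unfolding stereo_image_def AB(3) R[symmetric] real_points_minus_pole ..
  then show "\<exists>A B. great_circle A \<and> great_circle B \<and> Z = stereo_image (A \<star>\<star> B)"
    using AB(1,2) stereo_image_preimage by metis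
next
  fix Z assume Z: "great Z \<and> perseus_cyclide Z"
  then interpret great_cyclide Z by (intro great_cyclideI) (auto simp: perseus_cyclide_def)
  obtain T d where T: "orthogonal_transformation T" and d: "principal_signs d"
    and R: "real_points (X_of Z) = T ` quadric_section d"
    using real_points_principal_axes by blast
  have "(5::enat) + 1 = enat 6" "(5::enat) < \<infinity>" "(5::enat) = enat 5" by (simp_all add: numeral_eq_enat one_enat_def)
  then have five: "circles_through_general_point (enat 5) Z" and not6: "\<not> circles_through_general_point (enat 6) Z"
    using Z unfolding perseus_cyclide_def circled_def by metis+
  have "\<not> (d$1 = d$2 \<and> d$3 = d$4)"
    using circles_through_general_point_upper[OF T d _ _ R] five by blast
  moreover have "\<not> 6 \<le> 4 + (if d$1 > d$2 then 1 else 0) + (if d$3 > d$4 then 1 else (0::nat))"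
    using circles_through_general_point_lower[OF T d R, of 6] not6 by blast
  ultimately have "d$1 = d$2 \<and> d$3 > d$4 \<or> d$1 > d$2 \<and> d$3 = d$4"
    using d unfolding principal_signs_def by (auto split: if_splits)
  then show "\<not> cliffordian Z" by (rule not_cliffordian[OF T R d])
qed

end
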